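(* Let $L$ satisfy assumptions i)–viii) of the context, let $c\in\mathbb{R}^d$, and let $U$ and $\bar H(c)$ be the limits defined in the context. Then $U$ is a viscosity solution of the equation $$H_c(M,\nabla U)=\bar H(c).$$ Additionally, for every (Fréchet) differentiability point $M\in L^2(I;\mathbb{R}^d)$ of $U$, there exists a unique trajectory $\mathbf{x}^*\in C^1([0,\infty);L^2(I;\mathbb{R}^d))$ whose restriction to the interval $[0,T]$ is, for any $T>0$, a minimizer of $$U(M)=\inf\Big\{\int_0^T\big(L_c(\mathbf{x}(s),\dot{\mathbf{x}}(s))+\bar H(c)\big)\,ds+U(\mathbf{x}(T))\;;\;\mathbf{x}(0)=M\Big\},$$ where the infimum is taken over the curves in $AC^2((0,T);L^2(I;\mathbb{R}^d))$. Moreover, $\mathbf{x}^*$ satisfies the Euler–Lagrange equation $$\frac{d}{ds}D_vL_c(\mathbf{x}^*,\dot{\mathbf{x}}^* )=D_xL_c(\mathbf{x}^*,\dot{\mathbf{x}}^* ),$$ with $\mathbf{x}^*(0)=M$ and $\dot{\mathbf{x}}^*(0)=-D_pH_c(M,\nabla U(M))$.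
   Context: Let $d\ge 1$, $I=[0,1]^d$, and let $\lambda_0$ be Lebesgue measure on $I$. $L^2(I;\mathbb{R}^d)$ is taken with respect to $\lambda_0$, with its inner product $\langle\cdot,\cdot\rangle$ and norm $\|\cdot\|$. $L^2(I;\mathbb{Z}^d)$ is the set of $M\in L^2(I;\mathbb{R}^d)$ with $M(z)\in\mathbb{Z}^d$ for $\lambda_0$-a.e. $z$. $\mathcal{G}$ is the group of bijections $G:I\to I$ such that $G$ and $G^{-1}$ are Borel measurable and push $\lambda_0$ forward to itself. The Lagrangian $L:L^2(I;\mathbb{R}^d)\times L^2(I;\mathbb{R}^d)\to\mathbb{R}$ satisfies, for some constants $C,K_L,\gamma>0$ and all $M,N,H_1,H_2\in L^2(I;\mathbb{R}^d)$, $G\in\mathcal{G}$, $Z\in L^2(I;\mathbb{Z}^d)$: i) $L(M+Z,N)=L(M,N)$; ii) $L(M\circ G,N\circ G)=L(M,N)$; iii) $L\ge 0$; iv) $L$ is $C^1$ in the Fréchet sense and $L,DL$ are locally uniformly continuous ($DL$ is the full Fréchet derivative); v) $L(M,N)\le C(1+\|M\|^2+\|N\|^2)$ and $|L(M,0)|\le C$; vi) $\|DL\|\le C+CL$; vii) $L(M+H_1,N+H_2)-L(M,N)-\langle D_xL(M,N),H_1\rangle-\langle D_vL(M,N),H_2\rangle\ge\gamma\|H_2\|^2-K_L\|H_1\|^2$; viii) $L(M+H_1,N+H_2)-L(M,N)-\langle D_xL(M,N),H_1\rangle-\langle D_vL(M,N),H_2\rangle\le K_L\|H_2\|^2+K_L\|H_1\|^2$.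 Here $D_x,D_v$ are the partial Fréchet derivatives in the first and second variable. For $c\in\mathbb{R}^d$ (also viewed as a constant function on $I$), $L_c(M,N)=L(M,N)+\int_I c\cdot N\,d\lambda_0$. The Hamiltonian is $H(M,P)=\sup_{N\in L^2(I;\mathbb{R}^d)}\{-\langle P,N\rangle-L(M,N)\}$ and $H_c(M,P)=H(M,P+c)$; under the assumptions $H$ is $C^1$, and $D_p$ denotes its derivative in the second variable. A curve $\sigma:(0,T)\to L^2(I;\mathbb{R}^d)$ is in $AC^2((0,T);L^2(I;\mathbb{R}^d))$ if there is $\beta\in L^2(0,T)$ with $\|\sigma_t-\sigma_s\|\le\int_s^t\beta(u)\,du$ for all $s<t$ in $(0,T)$; $AC^2_{loc}((0,\infty);L^2(I;\mathbb{R}^d))$ is the set of curves on $(0,\infty)$ whose restriction to $(0,T)$ is in $AC^2((0,T);L^2(I;\mathbb{R}^d))$ for all $T>0$. $\dot{\mathbf{x}}$ is the a.e. derivative, and endpoint values are understood through the continuous extension. For $\varepsilon>0$, $V_{\varepsilon}(M)=\inf\{\int_0^\infty e^{-\varepsilon t}L_c(\mathbf{x},\dot{\mathbf{x}})\,dt:\mathbf{x}\in AC^2_{loc}((0,\infty);L^2(I;\mathbb{R}^d)),\ \mathbf{x}(0)=M\}$ and $U_\varepsilon=V_\varepsilon-\inf V_\varepsilon$. There is a sequence $\varepsilon_j\to0^+$ along which $\varepsilon_jV_{\varepsilon_j}$ converges uniformly to a constant, denoted $-\bar H(c)$, and $U_{\varepsilon_j}$ converges uniformly to a Lipschitz function,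 denoted $U:L^2(I;\mathbb{R}^d)\to\mathbb{R}$; $U$ and $\bar H(c)$ denote the limits along any such fixed sequence. Viscosity solutions: for $V:L^2(I;\mathbb{R}^d)\to\mathbb{R}$, $D^-V(M)$ (resp. $D^+V(M)$) is the set of $\xi\in L^2(I;\mathbb{R}^d)$ with $V(M+X)\ge V(M)+\langle\xi,X\rangle+o(\|X\|)$ (resp. $\le$). A continuous $V$ is a viscosity solution of $F(M,V,\nabla V)=0$ if $F(M,V(M),\zeta)\le0$ for all $M$ and $\zeta\in D^+V(M)$ and $F(M,V(M),\zeta)\ge0$ for all $M$ and $\zeta\in D^-V(M)$; for the equation above take $F(M,r,\zeta)=H_c(M,\zeta)-\bar H(c)$. *)

theory Defs
  imports "HOL-Analysis.Analysis"
begin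

section \<open>The unit cube and the Hilbert space \<open>L\<^sup>2(I;\<real>\<^sup>d)\<close>\<close>

text \<open>The dimension \<open>d \<ge> 1\<close> is \<open>CARD('d)\<close> for a finite index type \<open>'d\<close>.\<close>

definition unit_cube :: "(real ^ 'd) set" where
  "unit_cube = {z. \<forall>i. 0 \<le> z $ i \<and> z $ i \<le> 1}"

definition cube_measure :: "(real ^ 'd) measure" where
  "cube_measure = restrict_space lborel unit_cube"

definition square_integrable :: "(real ^ 'd \<Rightarrow> real ^ 'd) \<Rightarrow> bool" where
  "square_integrable f \<longleftrightarrow>
     f \<in> borel_measurable cube_measure \<and> integrable cube_measure (\<lambda>z. (norm (f z))\<^sup>2)"

definition L2_eq :: "(real ^ 'd \<Rightarrow> real ^ 'd) \<Rightarrow> (real ^ 'd \<Rightarrow> real ^ 'd) \<Rightarrow> bool" where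
  "L2_eq f g \<longleftrightarrow> square_integrable f \<and> square_integrable g \<and> (AE z in cube_measure. f z = g z)"

lemma emeasure_unit_cube_finite: "emeasure lborel (unit_cube :: (real ^ 'd) set) < \<infinity>"
  and unit_cube_sets [measurable]: "(unit_cube :: (real ^ 'd) set) \<in> sets borel"
proof -
  have *: "(unit_cube :: (real ^ 'd) set) = cbox (\<chi> i. 0) (\<chi> i. 1)"
    by (auto simp: unit_cube_def mem_box_cart)
  show "emeasure lborel (unit_cube :: (real ^ 'd) set) < \<infinity>"
    unfolding * by (rule emeasure_lborel_cbox_finite)
  show "(unit_cube :: (real ^ 'd) set) \<in> sets borel"
    unfolding * by simp
qed

lemma finite_measure_cube_measure: "finite_measure (cube_measure :: (real ^ 'd) measure)"
  by (rule finite_measureI)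
     (use emeasure_unit_cube_finite[where 'd = 'd] in
       \<open>auto simp: cube_measure_def space_restrict_space emeasure_restrict_space\<close>)

lemma square_integrable_const: "square_integrable (\<lambda>_. c)"
proof -
  interpret finite_measure "cube_measure :: (real ^ 'd) measure"
    by (rule finite_measure_cube_measure)
  show ?thesis
    by (simp add: square_integrable_def)
qed

lemma square_integrable_scaleR:
  "square_integrable f \<Longrightarrow> square_integrable (\<lambda>z. r *\<^sub>R f z)"
  by (auto simp: square_integrable_def power_mult_distrib)

lemma square_integrable_uminus:
  "square_integrable f \<Longrightarrow> square_integrable (\<lambda>z. - f z)"
  by (auto simp: square_integrable_def)

lemma square_integrable_add:
  assumes "square_integrable f" "square_integrable g"
  shows "square_integrable (\<lambda>z. f z + g z)"
proof -
  have [measurable]: "f \<in> borel_measurable cube_measure" "g \<in> borel_measurable cube_measure"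
    and i: "integrable cube_measure (\<lambda>z. (norm (f z))\<^sup>2)" "integrable cube_measure (\<lambda>z. (norm (g z))\<^sup>2)"
    using assms by (auto simp: square_integrable_def)
  have le: "(norm (f z + g z))\<^sup>2 \<le> 2 * (norm (f z))\<^sup>2 + 2 * (norm (g z))\<^sup>2" for z
  proof -
    have "(norm (f z + g z))\<^sup>2 \<le> (norm (f z) + norm (g z))\<^sup>2"
      by (intro power_mono norm_triangle_ineq) auto
    also have "\<dots> \<le> 2 * (norm (f z))\<^sup>2 + 2 * (norm (g z))\<^sup>2"
      using sum_squares_bound[of "norm (f z)" "norm (g z)"] by (simp add: power2_sum)
    finally show ?thesis .
  qed
  have "integrable cube_measure (\<lambda>z. (norm (f z + g z))\<^sup>2)"
    by (rule Bochner_Integration.integrable_bound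
          [where f = "\<lambda>z. 2 * (norm (f z))\<^sup>2 + 2 * (norm (g z))\<^sup>2"])
       (use i le in auto)
  then show ?thesis
    by (simp add: square_integrable_def)
qed

lemma square_integrable_inner:
  assumes "square_integrable f" "square_integrable g"
  shows "integrable cube_measure (\<lambda>z. f z \<bullet> g z)"
proof -
  have [measurable]: "f \<in> borel_measurable cube_measure" "g \<in> borel_measurable cube_measure"
    and i: "integrable cube_measure (\<lambda>z. (norm (f z))\<^sup>2)" "integrable cube_measure (\<lambda>z. (norm (g z))\<^sup>2)"
    using assms by (auto simp: square_integrable_def)
  have le: "\<bar>f z \<bullet> g z\<bar> \<le> (norm (f z))\<^sup>2 + (norm (g z))\<^sup>2" for z
  proof -
    have "\<bar>f z \<bullet> g z\<bar> \<le> norm (f z) * norm (g z)"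
      by (rule Cauchy_Schwarz_ineq2)
    also have "\<dots> \<le> 2 * norm (f z) * norm (g z)"
      by simp
    also have "\<dots> \<le> (norm (f z))\<^sup>2 + (norm (g z))\<^sup>2"
      by (rule sum_squares_bound)
    finally show ?thesis .
  qed
  show ?thesis
    by (rule Bochner_Integration.integrable_bound
          [where f = "\<lambda>z. (norm (f z))\<^sup>2 + (norm (g z))\<^sup>2"])
       (use i le in auto)
qed

quotient_type 'd L2 = "real ^ 'd::finite \<Rightarrow> real ^ 'd" / partial: L2_eq
proof (rule part_equivpI)
  show "\<exists>f. L2_eq f f"
    by (rule exI[of _ "\<lambda>_. 0"]) (simp add: L2_eq_def square_integrable_const)
  show "symp L2_eq"
    by (rule sympI) (auto simp: L2_eq_def elim!: eventually_mono)
  show "transp L2_eq"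
    by (rule transpI) (auto simp: L2_eq_def elim: eventually_elim2)
qed

lemma L2_eq_refl: "square_integrable f \<Longrightarrow> L2_eq f f"
  by (simp add: L2_eq_def)

instantiation L2 :: (finite) real_vector
begin

lift_definition zero_L2 :: "'a L2" is "\<lambda>_. 0"
  by (simp add: L2_eq_def square_integrable_const)

lift_definition plus_L2 :: "'a L2 \<Rightarrow> 'a L2 \<Rightarrow> 'a L2" is "\<lambda>f g z. f z + g z"
  by (auto simp: L2_eq_def square_integrable_add elim: eventually_elim2)

lift_definition uminus_L2 :: "'a L2 \<Rightarrow> 'a L2" is "\<lambda>f z. - f z"
  by (auto simp: L2_eq_def square_integrable_uminus elim: eventually_mono)

lift_definition scaleR_L2 :: "real \<Rightarrow> 'a L2 \<Rightarrow> 'a L2" is "\<lambda>r f z. r *\<^sub>R f z"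
  by (auto simp: L2_eq_def square_integrable_scaleR elim: eventually_mono)

definition minus_L2 :: "'a L2 \<Rightarrow> 'a L2 \<Rightarrow> 'a L2" where
  "minus_L2 M N = M + (- N)"

instance
proof
  fix M N P :: "'a L2" and r s :: real
  show "M + N + P = M + (N + P)"
    by transfer (simp add: L2_eq_def square_integrable_add add.assoc)
  show "M + N = N + M"
    by transfer (simp add: L2_eq_def square_integrable_add add.commute)
  show "0 + M = M"
    by transfer (simp add: L2_eq_def)
  show "- M + M = 0"
    by transfer (simp add: L2_eq_def square_integrable_const)
  show "M - N = M + - N"
    by (simp add: minus_L2_def)
  show "r *\<^sub>R (M + N) = r *\<^sub>R M + r *\<^sub>R N"
    by transfer (simp add: L2_eq_def square_integrable_add square_integrable_scaleR scaleR_add_right)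
  show "(r + s) *\<^sub>R M = r *\<^sub>R M + s *\<^sub>R M"
    by transfer (simp add: L2_eq_def square_integrable_add square_integrable_scaleR scaleR_add_left)
  show "r *\<^sub>R s *\<^sub>R M = (r * s) *\<^sub>R M"
    by transfer (simp add: L2_eq_def square_integrable_scaleR)
  show "1 *\<^sub>R M = M"
    by transfer (simp add: L2_eq_def)
qed

end

instantiation L2 :: (finite) real_inner
begin

lift_definition inner_L2 :: "'a L2 \<Rightarrow> 'a L2 \<Rightarrow> real" is
  "\<lambda>f g. LINT z|cube_measure. f z \<bullet> g z"
  by (rule integral_cong_AE)
     (auto simp: L2_eq_def square_integrable_def elim: eventually_elim2)

definition norm_L2 :: "'a L2 \<Rightarrow> real" where
  "norm_L2 M = sqrt (M \<bullet> M)"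

definition sgn_L2 :: "'a L2 \<Rightarrow> 'a L2" where
  "sgn_L2 M = M /\<^sub>R norm M"

definition dist_L2 :: "'a L2 \<Rightarrow> 'a L2 \<Rightarrow> real" where
  "dist_L2 M N = norm (M - N)"

definition uniformity_L2 :: "('a L2 \<times> 'a L2) filter" where
  "uniformity_L2 = (INF e\<in>{0<..}. principal {(M, N). dist M N < e})"

definition open_L2 :: "'a L2 set \<Rightarrow> bool" where
  "open_L2 S \<longleftrightarrow> (\<forall>M\<in>S. \<forall>\<^sub>F (M', N) in uniformity. M' = M \<longrightarrow> N \<in> S)"

instance
proof
  fix M N P :: "'a L2" and r :: real and S :: "'a L2 set"
  show "sgn M = M /\<^sub>R norm M"
    by (rule sgn_L2_def)
  show "dist M N = norm (M - N)"
    by (rule dist_L2_def)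
  show "(uniformity :: ('a L2 \<times> 'a L2) filter) = (INF e\<in>{0<..}. principal {(x, y). dist x y < e})"
    by (rule uniformity_L2_def)
  show "open S \<longleftrightarrow> (\<forall>x\<in>S. \<forall>\<^sub>F (x', y) in uniformity. x' = x \<longrightarrow> y \<in> S)"
    by (rule open_L2_def)
  show "M \<bullet> N = N \<bullet> M"
    by transfer (simp add: inner_commute)
  show "(M + N) \<bullet> P = M \<bullet> P + N \<bullet> P"
    by transfer (simp add: L2_eq_def inner_add_left square_integrable_inner)
  show "(r *\<^sub>R M) \<bullet> N = r * (M \<bullet> N)"
    by transfer simp
  show "0 \<le> M \<bullet> M"
    by transfer simp
  show "M \<bullet> M = 0 \<longleftrightarrow> M = 0"
  proof transfer
    fix f :: "real ^ 'a \<Rightarrow> real ^ 'a"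
    assume "L2_eq f f"
    then have f: "square_integrable f"
      by (simp add: L2_eq_def)
    have "(LINT z|cube_measure. f z \<bullet> f z) = 0 \<longleftrightarrow> (AE z in cube_measure. f z \<bullet> f z = 0)"
      by (rule integral_nonneg_eq_0_iff_AE) (use f in \<open>auto intro: square_integrable_inner\<close>)
    then show "(LINT z|cube_measure. f z \<bullet> f z) = 0 \<longleftrightarrow> L2_eq f (\<lambda>_. 0)"
      using f by (simp add: L2_eq_def square_integrable_const)
  qed
  show "norm M = sqrt (M \<bullet> M)"
    by (rule norm_L2_def)
qed

end

lift_definition const_L2 :: "real ^ 'd \<Rightarrow> 'd::finite L2" is "\<lambda>c z. c"
  by (simp add: L2_eq_def square_integrable_const)

text \<open>\<open>rep_L2 M\<close> is a chosen representative of the class \<open>M\<close>; all uses below are independent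
  of the choice.\<close>

definition integer_valued :: "'d::finite L2 \<Rightarrow> bool" where
  "integer_valued Z \<longleftrightarrow> (AE z in cube_measure. \<forall>i. rep_L2 Z z $ i \<in> \<int>)"

definition mp_bijections :: "(real ^ 'd \<Rightarrow> real ^ 'd) set" where
  "mp_bijections = {G. bij_betw G unit_cube unit_cube
     \<and> G \<in> cube_measure \<rightarrow>\<^sub>M cube_measure
     \<and> inv_into unit_cube G \<in> cube_measure \<rightarrow>\<^sub>M cube_measure
     \<and> distr cube_measure cube_measure G = cube_measure
     \<and> distr cube_measure cube_measure (inv_into unit_cube G) = cube_measure}"

definition comp_L2 :: "'d::finite L2 \<Rightarrow> (real ^ 'd \<Rightarrow> real ^ 'd) \<Rightarrow> 'd L2" where
  "comp_L2 M G = abs_L2 (rep_L2 M \<circ> G)"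


section \<open>Gradients and viscosity solutions\<close>

text \<open>The Riesz representative of the Frechet derivative; it is only meaningful
  where the latter exists.\<close>

definition grad :: "('a::real_inner \<Rightarrow> real) \<Rightarrow> 'a \<Rightarrow> 'a" where
  "grad f x = (THE D. GDERIV f x :> D)"

definition Dx :: "('a::real_inner \<Rightarrow> 'b::real_inner \<Rightarrow> real) \<Rightarrow> 'a \<Rightarrow> 'b \<Rightarrow> 'a" where
  "Dx F M N = grad (\<lambda>M'. F M' N) M"

definition Dv :: "('a::real_inner \<Rightarrow> 'b::real_inner \<Rightarrow> real) \<Rightarrow> 'a \<Rightarrow> 'b \<Rightarrow> 'b" where
  "Dv F M N = grad (\<lambda>N'. F M N') N"

definition locally_uniformly_continuous :: "('a::metric_space \<Rightarrow> 'b::metric_space) \<Rightarrow> bool" where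
  "locally_uniformly_continuous f \<longleftrightarrow> (\<forall>x. \<exists>r>0. uniformly_continuous_on (ball x r) f)"

definition subdifferential :: "('a::real_inner \<Rightarrow> real) \<Rightarrow> 'a \<Rightarrow> 'a set" where
  "subdifferential V M =
     {\<xi>. \<exists>r \<in> o[at 0](norm). \<forall>X. V (M + X) \<ge> V M + \<xi> \<bullet> X + r X}"

definition superdifferential :: "('a::real_inner \<Rightarrow> real) \<Rightarrow> 'a \<Rightarrow> 'a set" where
  "superdifferential V M =
     {\<xi>. \<exists>r \<in> o[at 0](norm). \<forall>X. V (M + X) \<le> V M + \<xi> \<bullet> X + r X}"

definition viscosity_solution ::
  "('a::real_inner \<Rightarrow> real \<Rightarrow> 'a \<Rightarrow> real) \<Rightarrow> ('a \<Rightarrow> real) \<Rightarrow> bool" where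
  "viscosity_solution F V \<longleftrightarrow> continuous_on UNIV V
     \<and> (\<forall>M. \<forall>\<zeta> \<in> superdifferential V M. F M (V M) \<zeta> \<le> 0)
     \<and> (\<forall>M. \<forall>\<zeta> \<in> subdifferential V M. F M (V M) \<zeta> \<ge> 0)"


section \<open>Lagrangian and Hamiltonian\<close>

text \<open>The full derivative \<open>DL\<close> is the gradient of \<open>case_prod L\<close> on the Hilbert product, whose
  norm is the operator norm of the Frechet derivative.\<close>

definition admissible_lagrangian :: "('d::finite L2 \<Rightarrow> 'd L2 \<Rightarrow> real) \<Rightarrow> bool" where
  "admissible_lagrangian L \<longleftrightarrow>
    (\<exists>C>0. \<exists>K>0. \<exists>\<gamma>>0.
      (\<forall>M N Z. integer_valued Z \<longrightarrow> L (M + Z) N = L M N)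
    \<and> (\<forall>M N. \<forall>G \<in> mp_bijections. L (comp_L2 M G) (comp_L2 N G) = L M N)
    \<and> (\<forall>M N. L M N \<ge> 0)
    \<and> ((\<forall>w. case_prod L differentiable (at w))
        \<and> continuous_on UNIV (grad (case_prod L))
        \<and> locally_uniformly_continuous (case_prod L)
        \<and> locally_uniformly_continuous (grad (case_prod L)))
    \<and> (\<forall>M N. L M N \<le> C * (1 + (norm M)\<^sup>2 + (norm N)\<^sup>2) \<and> \<bar>L M 0\<bar> \<le> C)
    \<and> (\<forall>M N. norm (grad (case_prod L) (M, N)) \<le> C + C * L M N)
    \<and> (\<forall>M N H1 H2.
          L (M + H1) (N + H2) - L M N - Dx L M N \<bullet> H1 - Dv L M N \<bullet> H2
            \<ge> \<gamma> * (norm H2)\<^sup>2 - K * (norm H1)\<^sup>2)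
    \<and> (\<forall>M N H1 H2.
          L (M + H1) (N + H2) - L M N - Dx L M N \<bullet> H1 - Dv L M N \<bullet> H2
            \<le> K * (norm H2)\<^sup>2 + K * (norm H1)\<^sup>2))"

definition shifted_lagrangian ::
  "('d::finite L2 \<Rightarrow> 'd L2 \<Rightarrow> real) \<Rightarrow> real ^ 'd \<Rightarrow> 'd L2 \<Rightarrow> 'd L2 \<Rightarrow> real" where
  "shifted_lagrangian L c M N = L M N + (LINT z|cube_measure. c \<bullet> rep_L2 N z)"

text \<open>Under the assumptions on \<open>L\<close> the set below is bounded above (by strong convexity in the
  velocity), so the real supremum is the usual one.\<close>

definition hamiltonian ::
  "('d::finite L2 \<Rightarrow> 'd L2 \<Rightarrow> real) \<Rightarrow> 'd L2 \<Rightarrow> 'd L2 \<Rightarrow> real" where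
  "hamiltonian L M P = (SUP N. - (P \<bullet> N) - L M N)"

definition shifted_hamiltonian ::
  "('d::finite L2 \<Rightarrow> 'd L2 \<Rightarrow> real) \<Rightarrow> real ^ 'd \<Rightarrow> 'd L2 \<Rightarrow> 'd L2 \<Rightarrow> real" where
  "shifted_hamiltonian L c M P = hamiltonian L M (P + const_L2 c)"


section \<open>Curves and variational problems\<close>

text \<open>Curves are total functions on \<open>real\<close>, of which only the values on the relevant open time
  interval matter. Endpoint values are one-sided limits.\<close>

definition AC2 :: "real \<Rightarrow> (real \<Rightarrow> 'a::real_normed_vector) set" where
  "AC2 T = {x. \<exists>\<beta> :: real \<Rightarrow> real.
      \<beta> \<in> borel_measurable (lebesgue_on {0<..<T})
    \<and> integrable (lebesgue_on {0<..<T}) (\<lambda>u. (\<beta> u)\<^sup>2)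
    \<and> (\<forall>s t. 0 < s \<longrightarrow> s < t \<longrightarrow> t < T \<longrightarrow> norm (x t - x s) \<le> (LINT u|lebesgue_on {s..t}. \<beta> u))}"

definition AC2_loc :: "(real \<Rightarrow> 'a::real_normed_vector) set" where
  "AC2_loc = {x. \<forall>T>0. x \<in> AC2 T}"

text \<open>The extended-valued Lebesgue integral (positive part minus negative part). The running costs
  below are bounded below, so the integral over the half-line may be \<open>\<infinity>\<close>, but the
  indeterminate case does not arise.\<close>

definition ext_integral :: "real set \<Rightarrow> (real \<Rightarrow> real) \<Rightarrow> ereal" where
  "ext_integral S f = enn2ereal (\<integral>\<^sup>+ t\<in>S. ennreal (f t) \<partial>lebesgue)
                    - enn2ereal (\<integral>\<^sup>+ t\<in>S. ennreal (- f t) \<partial>lebesgue)"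

definition discounted_value ::
  "('d::finite L2 \<Rightarrow> 'd L2 \<Rightarrow> real) \<Rightarrow> real \<Rightarrow> 'd L2 \<Rightarrow> real" where
  "discounted_value \<Lambda> \<epsilon> M = real_of_ereal
     (INF x \<in> {x \<in> AC2_loc. (x \<longlongrightarrow> M) (at_right 0)}.
        ext_integral {0<..} (\<lambda>t. exp (- \<epsilon> * t) * \<Lambda> (x t) (vector_derivative x (at t))))"

definition admissible_curves :: "real \<Rightarrow> 'd::finite L2 \<Rightarrow> (real \<Rightarrow> 'd L2) set" where
  "admissible_curves T M = {x \<in> AC2 T. (x \<longlongrightarrow> M) (at_right 0)}"

definition bolza_cost ::
  "('d::finite L2 \<Rightarrow> 'd L2 \<Rightarrow> real) \<Rightarrow> real \<Rightarrow> ('d L2 \<Rightarrow> real) \<Rightarrow> real \<Rightarrow> (real \<Rightarrow> 'd L2) \<Rightarrow> ereal" where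
  "bolza_cost \<Lambda> h U T x =
     ext_integral {0<..<T} (\<lambda>s. \<Lambda> (x s) (vector_derivative x (at s)) + h)
     + ereal (U (Lim (at_left T) x))"

text \<open>The derivative of a curve on \<open>[0,\<infinity>)\<close>; one-sided at \<open>0\<close>.\<close>

definition velocity :: "(real \<Rightarrow> 'a::real_normed_vector) \<Rightarrow> real \<Rightarrow> 'a" where
  "velocity x t = vector_derivative x (at t within {0..})"

definition C1_half_line :: "(real \<Rightarrow> 'a::real_normed_vector) set" where
  "C1_half_line = {x. (\<forall>t\<ge>0. x differentiable (at t within {0..})) \<and> continuous_on {0..} (velocity x)}"

text \<open>A \<open>C\<^sup>1\<close> trajectory whose restriction to every \<open>[0,T]\<close> minimizes the cost among the
  admissible curves.\<close>

definition calibrated_trajectory ::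
  "('d::finite L2 \<Rightarrow> 'd L2 \<Rightarrow> real) \<Rightarrow> real \<Rightarrow> ('d L2 \<Rightarrow> real) \<Rightarrow> 'd L2 \<Rightarrow> (real \<Rightarrow> 'd L2) \<Rightarrow> bool" where
  "calibrated_trajectory \<Lambda> h U M x \<longleftrightarrow> x \<in> C1_half_line
     \<and> (\<forall>T>0. x \<in> admissible_curves T M
           \<and> ereal (U M) = (INF y \<in> admissible_curves T M. bolza_cost \<Lambda> h U T y)
           \<and> bolza_cost \<Lambda> h U T x = ereal (U M))"

end

theory Submission
  imports Defs
begin

text \<open>Write \<open>\<Lambda>\<close> for the shifted Lagrangian and \<open>h\<close> for the limit \<open>Hbar\<close>. All of the theorem follows from
  the dynamic programming principle for \<open>U\<close>: for every \<open>T > 0\<close>,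
  \<open>U M = inf (\<integral>\<^sub>0\<^sup>T \<Lambda> (x, v) + T h + U (x T))\<close>, the infimum being over the square integrable velocity
  fields \<open>v\<close>, with \<open>x t = M + \<integral>\<^sub>0\<^sup>t v\<close>. This principle is an exact identity for the discounted value
  functions (\<open>disc_dpp_le\<close>, \<open>disc_dpp_near\<close>); subtracting their infima \<open>m\<^sub>j\<close> produces the extra term
  \<open>(1 - exp (- \<epsilon>\<^sub>j T)) m\<^sub>j\<close>, which converges to \<open>- T h\<close>, and so the principle survives the limit
  (\<open>vanishing_discount\<close>). The viscosity inequalities follow in the usual way, by inserting a straight
  line and a near minimizer over a short time.

  The existence of a minimizing trajectory cannot be obtained from compactness, since a
  bounded sequence of velocity fields need not have a strongly convergent subsequence, and the action need
  not be weakly lower semicontinuous: \<open>\<Lambda>\<close> need not be convex in the position, and weak convergence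
  of velocities gives no strong convergence of positions in infinite dimension. It comes instead from the
  differentiability of \<open>U\<close> at \<open>M\<close>. Let \<open>P = \<nabla>U(M)\<close>. To a velocity field \<open>v\<close> attach the residual
  \<open>g = D\<^sub>v\<Lambda>(x, v) - \<integral> D\<^sub>x\<Lambda>(x, v) + P\<close>, which vanishes exactly on the solution of the Euler--Lagrange equation
  with initial momentum \<open>-P\<close>. Change the velocity to \<open>v - \<kappa> g\<close> and keep the \<^emph>\<open>end point\<close> of the curve fixed,
  so that its initial point moves from \<open>M\<close> to \<open>M + k\<close> with \<open>k = \<kappa> \<integral> g\<close>. The first variation of the
  action is then \<open>P \<bullet> k - \<kappa> \<parallel>g\<parallel>\<^sup>2\<close>, up to \<open>O(\<kappa>\<^sup>2 \<parallel>g\<parallel>\<^sup>2)\<close> (\<open>residual_variation\<close>), while the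
  terminal cost does not change and \<open>U (M + k) \<ge> U M + P \<bullet> k - o(\<parallel>k\<parallel>)\<close>. Hence a velocity field that is
  almost optimal from \<open>M\<close> has a small residual (\<open>near_minimizer_residual\<close>). By strong convexity in
  the velocity and Gronwall's inequality, a small residual forces \<open>v\<close> to be close to the
  Euler--Lagrange solution (\<open>velocity_gap\<close>). So all minimizing sequences converge strongly to this one
  solution, which exists for all times because momentum and position solve a Lipschitz differential
  equation (\<open>Euler_Lagrange_solution\<close>). It is therefore a minimizer (\<open>Euler_Lagrange_minimizes\<close>), and the
  only one (\<open>minimizer_unique\<close>). Its initial velocity \<open>\<Psi> M (- P)\<close> is the value that attains the supremum in
  the Hamiltonian, which identifies it with \<open>- D\<^sub>pH(M, P)\<close> (\<open>grad_Legendre\<close>).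

  Two analytic facts connect curves with velocity fields. The space \<open>L\<^sup>2(I;\<real>\<^sup>d)\<close> is complete and
  separable, as the Bochner integral demands. In a Hilbert space, a curve with a square integrable
  modulus is the primitive of its a.e. derivative (\<open>AC2_imp_primitive\<close>, \<open>AE_primitive_derivative\<close>).\<close>

section \<open>Completeness of \<open>L\<^sup>2(I;\<real>\<^sup>d)\<close>\<close>

lemma nn_integral_le_of_norm_sq:
  fixes f :: "'x \<Rightarrow> 'b::{banach, second_countable_topology}"
  assumes "integrable M (\<lambda>x. (norm (f x))\<^sup>2)" "(LINT x|M. (norm (f x))\<^sup>2) \<le> e"
  shows "(\<integral>\<^sup>+x. ennreal ((norm (f x))\<^sup>2) \<partial>M) \<le> ennreal e"
  using assms by (subst nn_integral_eq_integral) (auto intro: ennreal_leI)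

lemma norm_diff_sq_le: "(norm (x - y))\<^sup>2 \<le> 2 * (norm x)\<^sup>2 + 2 * (norm y)\<^sup>2" for x y :: "'b::real_inner"
proof -
  have "(norm (x - y))\<^sup>2 + (norm (x + y))\<^sup>2 = 2 * (norm x)\<^sup>2 + 2 * (norm y)\<^sup>2"
    by (simp add: power2_norm_eq_inner algebra_simps inner_commute)
  moreover have "0 \<le> (norm (x + y))\<^sup>2"
    by simp
  ultimately show ?thesis
    by linarith
qed

lemma square_integrable_diff_general:
  fixes f g :: "'x \<Rightarrow> 'b::{real_inner, second_countable_topology}"
  assumes [measurable]: "f \<in> borel_measurable M" "g \<in> borel_measurable M"
    and i: "integrable M (\<lambda>x. (norm (f x))\<^sup>2)" "integrable M (\<lambda>x. (norm (g x))\<^sup>2)"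
  shows "integrable M (\<lambda>x. (norm (f x - g x))\<^sup>2)"
proof (rule Bochner_Integration.integrable_bound[where f = "\<lambda>x. 2 * (norm (f x))\<^sup>2 + 2 * (norm (g x))\<^sup>2"])
  show "AE x in M. norm ((norm (f x - g x))\<^sup>2) \<le> norm (2 * (norm (f x))\<^sup>2 + 2 * (norm (g x))\<^sup>2)"
  proof (rule AE_I2)
    fix x
    show "norm ((norm (f x - g x))\<^sup>2) \<le> norm (2 * (norm (f x))\<^sup>2 + 2 * (norm (g x))\<^sup>2)"
      using norm_diff_sq_le[of "f x" "g x"] by simp
  qed
qed (use i in auto)

text \<open>The argument of Riesz and Fischer. Along a subsequence whose successive distances are at most
  \<open>2 powr (- k)\<close> the increments are summable almost everywhere, so the subsequence converges a.e.;
  Fatou's lemma turns this into convergence of the whole sequence in mean square.\<close>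

lemma L2_Cauchy_converges:
  fixes f :: "nat \<Rightarrow> 'x \<Rightarrow> 'b::{real_inner, banach, second_countable_topology}"
  assumes fin: "finite_measure M"
    and meas [measurable]: "\<And>n. f n \<in> borel_measurable M"
    and int: "\<And>n. integrable M (\<lambda>x. (norm (f n x))\<^sup>2)"
    and Cauchy: "\<And>e. e > 0 \<Longrightarrow> \<exists>N. \<forall>m\<ge>N. \<forall>n\<ge>N. (LINT x|M. (norm (f m x - f n x))\<^sup>2) < e"
  obtains g where "g \<in> borel_measurable M" "integrable M (\<lambda>x. (norm (g x))\<^sup>2)"
    "(\<lambda>n. LINT x|M. (norm (f n x - g x))\<^sup>2) \<longlonglongrightarrow> 0"
proof -
  interpret finite_measure M by (rule fin)
  note intd = square_integrable_diff_general[OF meas meas int int]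
  have "\<forall>k. \<exists>N. \<forall>m\<ge>N. \<forall>n\<ge>N. (LINT x|M. (norm (f m x - f n x))\<^sup>2) < (1/4)^k"
    by (intro allI Cauchy) simp
  then obtain R where R: "\<And>k m n. m \<ge> R k \<Longrightarrow> n \<ge> R k \<Longrightarrow> (LINT x|M. (norm (f m x - f n x))\<^sup>2) < (1/4)^k"
    by metis
  \<comment> \<open>The summands make \<open>r\<close> monotone and at least \<open>R\<close>; the term \<open>k\<close> makes it unbounded.\<close>
  define r where "r k = (\<Sum>i\<le>k. R i) + k" for k
  have rR: "r k \<ge> R k" and rk: "r k \<ge> k" and rSuc: "r (Suc k) \<ge> r k" for k
    by (auto simp: r_def intro: trans_le_add1 member_le_sum)
  define h where "h k x = norm (f (r (Suc k)) x - f (r k) x)" for k x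
  have [measurable]: "h k \<in> borel_measurable M" for k
    unfolding h_def by measurable
  have h_le: "(\<integral>\<^sup>+x. ennreal (h k x) \<partial>M) \<le> ennreal ((1/2)^k * (measure M (space M) + 1))" for k
  proof -
    have "(LINT x|M. (h k x)\<^sup>2) \<le> (1/4)^k"
      unfolding h_def using R[of k "r (Suc k)" "r k"] rR[of k] rSuc[of k] by force
    then have "(\<integral>\<^sup>+x. ennreal ((1/2)^k) + ennreal (2^k) * ennreal ((h k x)\<^sup>2) \<partial>M)
       \<le> ennreal ((1/2)^k * measure M (space M)) + ennreal (2^k) * ennreal ((1/4)^k)"
      using intd[of "r (Suc k)" "r k"]
      by (subst nn_integral_add; (subst nn_integral_cmult)?)
         (auto simp: h_def ennreal_mult emeasure_eq_measure
            intro!: add_mono mult_left_mono nn_integral_le_of_norm_sq)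
    also have "ennreal (2^k) * ennreal ((1/4)^k) = ennreal ((1/2)^k)"
      by (simp flip: ennreal_mult power_mult_distrib)
    also have "ennreal ((1/2)^k * measure M (space M)) + ennreal ((1/2)^k)
        = ennreal ((1/2)^k * (measure M (space M) + 1))"
      by (simp add: ring_distribs flip: ennreal_plus)
    finally have *: "(\<integral>\<^sup>+x. ennreal ((1/2)^k) + ennreal (2^k) * ennreal ((h k x)\<^sup>2) \<partial>M)
       \<le> ennreal ((1/2)^k * (measure M (space M) + 1))" .
    \<comment> \<open>Young's inequality with the weight that balances \<open>\<integral> h\<^sup>2 \<le> (1/4)^k\<close> against the finite total mass.\<close>
    have pt: "h k x \<le> (1/2)^k + 2^k * (h k x)\<^sup>2" for x
    proof -
      have "0 \<le> (1/2)^k * (1 - 2^k * h k x)\<^sup>2" by simp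
      also have "\<dots> = (1/2)^k - 2 * ((1/2)^k * 2^k) * h k x + ((1/2)^k*2^k) * 2^k * (h k x)\<^sup>2"
        by (simp add: power2_eq_square algebra_simps)
      also have "(1/2)^k * (2::real)^k = 1"
        by (simp flip: power_mult_distrib)
      finally have "2 * h k x \<le> (1/2)^k + 2^k * (h k x)\<^sup>2" by simp
      moreover have "h k x \<ge> 0" by (simp add: h_def)
      ultimately show ?thesis by simp
    qed
    have "(\<integral>\<^sup>+x. ennreal (h k x) \<partial>M) \<le> (\<integral>\<^sup>+x. ennreal ((1/2)^k) + ennreal (2^k) * ennreal ((h k x)\<^sup>2) \<partial>M)"
      by (intro nn_integral_mono) (use pt in \<open>simp add: ennreal_leI flip: ennreal_mult ennreal_plus\<close>)
    with * show ?thesis by simp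
  qed
  have "(\<integral>\<^sup>+x. (\<Sum>k. ennreal (h k x)) \<partial>M) = (\<Sum>k. \<integral>\<^sup>+x. ennreal (h k x) \<partial>M)"
    by (rule nn_integral_suminf) simp
  also have "\<dots> \<le> (\<Sum>k. ennreal ((1/2)^k * (measure M (space M) + 1)))"
    by (intro suminf_le h_le) auto
  also have "\<dots> < \<infinity>"
  proof -
    have "summable (\<lambda>k. (1/2)^k * (measure M (space M) + 1) :: real)"
      by (intro summable_mult2 summable_geometric) simp
    then have "(\<Sum>k. ennreal ((1/2)^k * (measure M (space M) + 1))) \<noteq> top"
      by (subst suminf_ennreal_eq[OF _ summable_sums]) (auto)
    then show ?thesis by (simp add: less_top)
  qed
  finally have "AE x in M. (\<Sum>k. ennreal (h k x)) \<noteq> \<infinity>"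
    by (intro nn_integral_PInf_AE) auto
  then have AEc: "AE x in M. (\<lambda>k. f (r k) x) \<longlonglongrightarrow> lim (\<lambda>k. f (r k) x)"
  proof eventually_elim
    fix x assume "(\<Sum>k. ennreal (h k x)) \<noteq> \<infinity>"
    then have "summable (\<lambda>k. norm (f (r (Suc k)) x - f (r k) x))"
      by (intro summable_suminf_not_top) (auto simp: h_def)
    then have "summable (\<lambda>k. f (r (Suc k)) x - f (r k) x)"
      by (rule summable_norm_cancel)
    then have "convergent (\<lambda>n. \<Sum>k<n. f (r (Suc k)) x - f (r k) x)"
      by (simp add: summable_iff_convergent)
    then have "convergent (\<lambda>n. f (r n) x - f (r 0) x)"
      by (subst (asm) sum_lessThan_telescope)
    then have "convergent (\<lambda>n. (f (r n) x - f (r 0) x) + f (r 0) x)"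
      by (intro convergent_add convergent_const)
    then show "(\<lambda>k. f (r k) x) \<longlonglongrightarrow> lim (\<lambda>k. f (r k) x)"
      by (simp add: convergent_LIMSEQ_iff)
  qed
  define g where "g x = lim (\<lambda>k. f (r k) x)" for x
  have g[measurable]: "g \<in> borel_measurable M"
    unfolding g_def by measurable
  have est: "(\<integral>\<^sup>+x. ennreal ((norm (f n x - g x))\<^sup>2) \<partial>M) \<le> ennreal e"
    if N: "\<forall>m\<ge>N. \<forall>n\<ge>N. (LINT x|M. (norm (f m x - f n x))\<^sup>2) < e" and "n \<ge> N" for N n e
  proof -
    have "(\<integral>\<^sup>+x. ennreal ((norm (f n x - g x))\<^sup>2) \<partial>M)
       = (\<integral>\<^sup>+x. liminf (\<lambda>k. ennreal ((norm (f n x - f (r k) x))\<^sup>2)) \<partial>M)"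
    proof (rule nn_integral_cong_AE)
      show "AE x in M. ennreal ((norm (f n x - g x))\<^sup>2) = liminf (\<lambda>k. ennreal ((norm (f n x - f (r k) x))\<^sup>2))"
        using AEc
      proof eventually_elim
        fix x assume "(\<lambda>k. f (r k) x) \<longlonglongrightarrow> lim (\<lambda>k. f (r k) x)"
        then have "(\<lambda>k. ennreal ((norm (f n x - f (r k) x))\<^sup>2)) \<longlonglongrightarrow> ennreal ((norm (f n x - g x))\<^sup>2)"
          unfolding g_def by (intro tendsto_intros)
        then show "ennreal ((norm (f n x - g x))\<^sup>2) = liminf (\<lambda>k. ennreal ((norm (f n x - f (r k) x))\<^sup>2))"
          by (intro lim_imp_Liminf[symmetric] trivial_limit_sequentially)
      qed
    qed
    also have "\<dots> \<le> liminf (\<lambda>k. \<integral>\<^sup>+x. ennreal ((norm (f n x - f (r k) x))\<^sup>2) \<partial>M)"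
      by (rule nn_integral_liminf) simp
    also have "\<dots> \<le> limsup (\<lambda>k. \<integral>\<^sup>+x. ennreal ((norm (f n x - f (r k) x))\<^sup>2) \<partial>M)"
      by (rule Liminf_le_Limsup) simp
    also have "\<dots> \<le> ennreal e"
    proof (rule Limsup_bounded)
      show "\<forall>\<^sub>F k in sequentially. (\<integral>\<^sup>+x. ennreal ((norm (f n x - f (r k) x))\<^sup>2) \<partial>M) \<le> ennreal e"
        using eventually_ge_at_top[of N]
      proof eventually_elim
        fix k assume "N \<le> k"
        then have "r k \<ge> N" using rk[of k] by simp
        then show "(\<integral>\<^sup>+x. ennreal ((norm (f n x - f (r k) x))\<^sup>2) \<partial>M) \<le> ennreal e"
          using N \<open>n \<ge> N\<close> intd by (intro nn_integral_le_of_norm_sq) (auto intro: less_imp_le)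
      qed
    qed
    finally show ?thesis .
  qed
  have ifg: "integrable M (\<lambda>x. (norm (f n x - g x))\<^sup>2)" 
    and efg: "(LINT x|M. (norm (f n x - g x))\<^sup>2) \<le> e"
    if N: "\<forall>m\<ge>N. \<forall>n\<ge>N. (LINT x|M. (norm (f m x - f n x))\<^sup>2) < e" and "n \<ge> N" "e > 0" for N n e
  proof -
    show "integrable M (\<lambda>x. (norm (f n x - g x))\<^sup>2)"
      using est[OF N \<open>n \<ge> N\<close>]  by (intro integrableI_bounded) (auto simp: le_less_trans[OF _ ennreal_less_top])
    show "(LINT x|M. (norm (f n x - g x))\<^sup>2) \<le> e"
      using est[OF N \<open>n \<ge> N\<close>] \<open>e > 0\<close>
      by (subst integral_eq_nn_integral) (auto simp: enn2real_leI)
  qed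
  show thesis
  proof (rule that[OF g])
    obtain N where N: "\<forall>m\<ge>N. \<forall>n\<ge>N. (LINT x|M. (norm (f m x - f n x))\<^sup>2) < 1"
      using Cauchy[of 1] by auto
    have "integrable M (\<lambda>x. (norm (f N x - (f N x - g x)))\<^sup>2)"
      by (rule square_integrable_diff_general) (use int ifg[OF N] in auto)
    then show "integrable M (\<lambda>x. (norm (g x))\<^sup>2)" by simp
    show "(\<lambda>n. LINT x|M. (norm (f n x - g x))\<^sup>2) \<longlonglongrightarrow> 0"
    proof (rule LIMSEQ_I)
      fix e :: real assume "e > 0"
      then obtain N where N: "\<forall>m\<ge>N. \<forall>n\<ge>N. (LINT x|M. (norm (f m x - f n x))\<^sup>2) < e/2"
        using Cauchy[of "e/2"] by auto
      show "\<exists>N. \<forall>n\<ge>N. norm ((LINT x|M. (norm (f n x - g x))\<^sup>2) - 0) < e"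
        using efg[OF N] \<open>e > 0\<close> by (intro exI[of _ N]) (force simp: abs_of_nonneg)
    qed
  qed
qed

lemma square_integrable_diff:
  "square_integrable f \<Longrightarrow> square_integrable g \<Longrightarrow> square_integrable (\<lambda>z. f z - g z)"
  using square_integrable_add[of f "\<lambda>z. - g z"] square_integrable_uminus[of g] by simp

lemma square_integrable_rep_L2: "square_integrable (rep_L2 M)"
  using Quotient_rep_reflp[OF Quotient_L2, of M] by (simp add: L2_eq_def)

lemma abs_rep_L2: "abs_L2 (rep_L2 M) = M"
  by (rule Quotient_abs_rep[OF Quotient_L2])

lemma abs_L2_diff:
  assumes "square_integrable f" "square_integrable g"
  shows "abs_L2 f - abs_L2 g = abs_L2 (\<lambda>z. f z - g z)"
proof -
  have "abs_L2 f - abs_L2 g = abs_L2 f + abs_L2 (\<lambda>z. - g z)"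
    unfolding minus_L2_def using assms by (simp add: uminus_L2.abs_eq L2_eq_refl)
  also have "\<dots> = abs_L2 (\<lambda>z. f z + - g z)"
    using assms by (intro plus_L2.abs_eq) (auto intro: L2_eq_refl square_integrable_uminus)
  finally show ?thesis by simp
qed

lemma norm_abs_L2:
  assumes "square_integrable f"
  shows "(norm (abs_L2 f))\<^sup>2 = (LINT z|cube_measure. (norm (f z))\<^sup>2)"
  unfolding power2_norm_eq_inner
  by (rule inner_L2.abs_eq) (auto intro: L2_eq_refl assms)

lemma norm_L2_diff:
  "(norm (X - Y))\<^sup>2 = (LINT z|cube_measure. (norm (rep_L2 X z - rep_L2 Y z))\<^sup>2)"
proof -
  have "X - Y = abs_L2 (\<lambda>z. rep_L2 X z - rep_L2 Y z)"
    by (subst abs_L2_diff[symmetric]) (auto simp: square_integrable_rep_L2 abs_rep_L2)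
  then show ?thesis
    by (simp add: norm_abs_L2 square_integrable_diff square_integrable_rep_L2)
qed

instance L2 :: (finite) complete_space
proof
  fix X :: "nat \<Rightarrow> 'a L2" assume X: "Cauchy X"
  have rep: "rep_L2 Y \<in> borel_measurable cube_measure"
     "integrable cube_measure (\<lambda>z. (norm (rep_L2 Y z))\<^sup>2)" for Y :: "'a L2"
    using square_integrable_rep_L2[of Y] by (auto simp: square_integrable_def)
  obtain g where g: "g \<in> borel_measurable cube_measure"
    "integrable cube_measure (\<lambda>z. (norm (g z))\<^sup>2)"
    "(\<lambda>n. LINT z|cube_measure. (norm (rep_L2 (X n) z - g z))\<^sup>2) \<longlonglongrightarrow> 0"
  proof (rule L2_Cauchy_converges[OF finite_measure_cube_measure rep])
    fix e :: real assume "e > 0"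
    then obtain N where N: "\<And>m n. m \<ge> N \<Longrightarrow> n \<ge> N \<Longrightarrow> norm (X m - X n) < sqrt e"
      using X[THEN CauchyD, of "sqrt e"] by auto
    have "(LINT z|cube_measure. (norm (rep_L2 (X m) z - rep_L2 (X n) z))\<^sup>2) < e" if "m \<ge> N" "n \<ge> N" for m n
      unfolding norm_L2_diff[symmetric]
      using N[OF that] power_strict_mono[of "norm (X m - X n)" "sqrt e" 2] \<open>e > 0\<close> by simp
    then show "\<exists>N. \<forall>m\<ge>N. \<forall>n\<ge>N. (LINT z|cube_measure. (norm (rep_L2 (X m) z - rep_L2 (X n) z))\<^sup>2) < e"
      by auto
  qed
  then have sq: "square_integrable g"
    by (simp add: square_integrable_def)
  have "(\<lambda>n. (norm (X n - abs_L2 g))\<^sup>2) \<longlonglongrightarrow> 0"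
  proof -
    have "(norm (X n - abs_L2 g))\<^sup>2 = (LINT z|cube_measure. (norm (rep_L2 (X n) z - g z))\<^sup>2)" for n
      by (subst abs_rep_L2[symmetric, of "X n"])
         (simp add: abs_L2_diff norm_abs_L2 sq square_integrable_rep_L2 square_integrable_diff)
    then show ?thesis using g(3) by simp
  qed
  then have "(\<lambda>n. sqrt ((norm (X n - abs_L2 g))\<^sup>2)) \<longlonglongrightarrow> sqrt 0"
    by (rule tendsto_real_sqrt)
  then have "(\<lambda>n. norm (X n - abs_L2 g)) \<longlonglongrightarrow> 0"
    by simp
  then have "X \<longlonglongrightarrow> abs_L2 g"
    by (simp add: LIM_zero_iff tendsto_norm_zero_iff)
  then show "convergent X"
    by (auto simp: convergent_def)
qed

instance L2 :: (finite) banach ..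

section \<open>Separability of \<open>L\<^sup>2(I;\<real>\<^sup>d)\<close>\<close>

definition step_L2 :: "(real ^ 'd) set \<Rightarrow> real ^ 'd \<Rightarrow> 'd::finite L2" where
  "step_L2 A y = abs_L2 (\<lambda>z. indicator A z *\<^sub>R y)"

lemma square_integrable_bounded:
  assumes "f \<in> borel_measurable cube_measure" "\<And>z. norm (f z) \<le> B"
  shows "square_integrable f"
proof -
  interpret finite_measure "cube_measure :: (real ^ 'a) measure"
    by (rule finite_measure_cube_measure)
  have "integrable cube_measure (\<lambda>z. (norm (f z))\<^sup>2)"
    by (rule integrable_const_bound[where B = "B\<^sup>2"]) (use assms in \<open>auto intro!: power_mono\<close>)
  with assms show ?thesis by (simp add: square_integrable_def)
qed

lemma borel_measurable_cube [measurable (raw)]: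
  "f \<in> borel_measurable borel \<Longrightarrow> f \<in> borel_measurable cube_measure"
  unfolding cube_measure_def by (intro measurable_restrict_space1) simp

lemma square_integrable_step:
  assumes "A \<in> sets borel"
  shows "square_integrable (\<lambda>z. indicator A z *\<^sub>R y)"
  by (rule square_integrable_bounded[where B = "norm y"])
     (use assms in \<open>auto simp: indicator_def\<close>)

lemma step_L2_add:
  assumes "A \<in> sets borel"
  shows "step_L2 A (x + y) = step_L2 A x + step_L2 A y"
  unfolding step_L2_def using assms
  by (subst plus_L2.abs_eq) (auto intro!: L2_eq_refl square_integrable_step simp: scaleR_add_right)

lemma step_L2_scaleR:
  assumes "A \<in> sets borel"
  shows "step_L2 A (r *\<^sub>R x) = r *\<^sub>R step_L2 A x"
  unfolding step_L2_def using assms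
  by (subst scaleR_L2.abs_eq) (auto intro!: L2_eq_refl square_integrable_step simp: mult.commute)

text \<open>Dominated convergence for classes of functions. The bound has the form that comes with both the
  truncated unions of indicators and the standard approximation by simple functions.\<close>

lemma abs_L2_dominated:
  assumes f: "\<And>n. f n \<in> borel_measurable cube_measure" and g: "square_integrable g"
    and le: "\<And>n z. z \<in> unit_cube \<Longrightarrow> norm (f n z) \<le> B + 2 * norm (g z)" and B: "B \<ge> 0"
    and lim: "\<And>z. z \<in> unit_cube \<Longrightarrow> (\<lambda>n. f n z) \<longlonglongrightarrow> g z"
  shows "(\<lambda>n. abs_L2 (f n)) \<longlonglongrightarrow> abs_L2 g" and "square_integrable (f n)"
proof -
  interpret finite_measure "cube_measure :: (real ^ 'a) measure"
    by (rule finite_measure_cube_measure)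
  have [measurable]: "f n \<in> borel_measurable cube_measure" "g \<in> borel_measurable cube_measure" for n
    using f g by (auto simp: square_integrable_def)
  have sp: "space cube_measure = (unit_cube :: (real ^ 'a) set)"
    by (simp add: cube_measure_def space_restrict_space)
  have gi: "integrable cube_measure (\<lambda>z. (norm (g z))\<^sup>2)"
    using g by (auto simp: square_integrable_def)
  have sq_le: "(norm (f n z))\<^sup>2 \<le> 2 * B\<^sup>2 + 8 * (norm (g z))\<^sup>2" if "z \<in> unit_cube" for n z
  proof -
    have "(norm (f n z))\<^sup>2 \<le> (B + 2 * norm (g z))\<^sup>2"
      using le[OF that] by (intro power_mono) auto
    also have "\<dots> \<le> 2 * B\<^sup>2 + 8 * (norm (g z))\<^sup>2"
      using zero_le_power2[of "B - 2 * norm (g z)"] by (simp add: power2_eq_square algebra_simps)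
    finally show ?thesis .
  qed
  show sqf: "square_integrable (f n)" for n
    unfolding square_integrable_def
  proof
    show "integrable cube_measure (\<lambda>z. (norm (f n z))\<^sup>2)"
      by (rule Bochner_Integration.integrable_bound[where f = "\<lambda>z. 2 * B\<^sup>2 + 8 * (norm (g z))\<^sup>2"])
         (use sq_le gi sp in \<open>auto simp: AE_space intro!: AE_I2\<close>)
  qed simp
  have "(\<lambda>n. LINT z|cube_measure. (norm (f n z - g z))\<^sup>2) \<longlonglongrightarrow> (LINT z|(cube_measure :: (real ^ 'a) measure). 0)"
  proof (rule integral_dominated_convergence[where w = "\<lambda>z. 4 * B\<^sup>2 + 18 * (norm (g z))\<^sup>2"])
    show "AE z in cube_measure. (\<lambda>n. (norm (f n z - g z))\<^sup>2) \<longlonglongrightarrow> 0"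
    proof (rule AE_I2)
      fix z :: "real ^ 'a" assume "z \<in> space cube_measure"
      then have "(\<lambda>n. (norm (f n z - g z))\<^sup>2) \<longlonglongrightarrow> (norm (g z - g z))\<^sup>2"
        using lim sp by (intro tendsto_intros) auto
      then show "(\<lambda>n. (norm (f n z - g z))\<^sup>2) \<longlonglongrightarrow> 0" by simp
    qed
    show "AE z in cube_measure. norm ((norm (f n z - g z))\<^sup>2) \<le> 4 * B\<^sup>2 + 18 * (norm (g z))\<^sup>2" for n
    proof (rule AE_I2)
      fix z :: "real ^ 'a" assume z: "z \<in> space cube_measure"
      have "(norm (f n z - g z))\<^sup>2 \<le> 2 * (norm (f n z))\<^sup>2 + 2 * (norm (g z))\<^sup>2"
        by (rule norm_diff_sq_le)
      moreover have "(norm (f n z))\<^sup>2 \<le> 2 * B\<^sup>2 + 8 * (norm (g z))\<^sup>2"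
        using sq_le[of z n] z sp by simp
      ultimately have "(norm (f n z - g z))\<^sup>2 \<le> 4 * B\<^sup>2 + 18 * (norm (g z))\<^sup>2"
        by linarith
      then show "norm ((norm (f n z - g z))\<^sup>2) \<le> 4 * B\<^sup>2 + 18 * (norm (g z))\<^sup>2" by simp
    qed
  qed (use gi in auto)
  then have "(\<lambda>n. (norm (abs_L2 (f n) - abs_L2 g))\<^sup>2) \<longlonglongrightarrow> 0"
    using sqf g by (simp add: abs_L2_diff norm_abs_L2 square_integrable_diff)
  then have "(\<lambda>n. sqrt ((norm (abs_L2 (f n) - abs_L2 g))\<^sup>2)) \<longlonglongrightarrow> sqrt 0"
    by (rule tendsto_real_sqrt)
  then have "(\<lambda>n. norm (abs_L2 (f n) - abs_L2 g)) \<longlonglongrightarrow> 0"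
    by simp
  then show "(\<lambda>n. abs_L2 (f n)) \<longlonglongrightarrow> abs_L2 g"
    by (simp add: LIM_zero_iff tendsto_norm_zero_iff)
qed

text \<open>Finite intersections of the members of a countable basis; the empty intersection contributes
  \<open>UNIV\<close>.\<close>

lemma countable_Int_stable_generator:
  obtains G :: "(real ^ 'd) set set" where
    "countable G" "Int_stable G" "sets borel = sigma_sets UNIV G" "UNIV \<in> G"
proof -
  obtain B :: "(real ^ 'd) set set" where B: "countable B" "topological_basis B"
    using ex_countable_basis by auto
  define G where "G = Inter ` {F. finite F \<and> F \<subseteq> B}"
  have "countable G"
    unfolding G_def using B(1) by (intro countable_image countable_Collect_finite_subset)
  moreover have "Int_stable G"
  proof (rule Int_stableI)
    fix a b assume "a \<in> G" "b \<in> G"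
    then obtain F1 F2 where "finite F1" "F1 \<subseteq> B" "a = \<Inter>F1" "finite F2" "F2 \<subseteq> B" "b = \<Inter>F2"
      by (auto simp: G_def)
    then have "a \<inter> b = \<Inter>(F1 \<union> F2)" "finite (F1 \<union> F2)" "F1 \<union> F2 \<subseteq> B" by auto
    then show "a \<inter> b \<in> G" unfolding G_def by blast
  qed
  moreover have "sets borel = sigma_sets UNIV G"
  proof -
    have "sets (borel :: (real ^ 'd) measure) = sigma_sets UNIV B"
      by (simp add: borel_eq_countable_basis[OF B])
    also have "\<dots> = sigma_sets UNIV G"
    proof (rule sigma_sets_eqI)
      fix b assume "b \<in> B"
      then have "b = \<Inter>{b}" "{b} \<in> {F. finite F \<and> F \<subseteq> B}" by auto
      then have "b \<in> G" unfolding G_def by blast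
      then show "b \<in> sigma_sets UNIV G" by auto
    next
      fix a assume "a \<in> G"
      then obtain F where F: "finite F" "F \<subseteq> B" "a = \<Inter>F" by (auto simp: G_def)
      interpret sigma_algebra "UNIV :: (real ^ 'd) set" "sigma_sets UNIV B"
        by (rule sigma_algebra_sigma_sets) simp
      from F show "a \<in> sigma_sets UNIV B"
      proof (cases "F = {}")
        case False
        have "(\<Inter>i\<in>F. i) \<in> sigma_sets UNIV B"
          using F False by (intro finite_INT) auto
        then show ?thesis using F by simp
      qed (use F in auto)
    qed
    finally show ?thesis .
  qed
  moreover have "UNIV \<in> G"
    unfolding G_def by (rule image_eqI[of _ _ "{}"]) auto
  ultimately show thesis by (rule that)
qed

lemma closure_subspace:
  fixes S :: "'a::real_normed_vector set"
  assumes "subspace S"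
  shows "subspace (closure S)"
proof (rule subspaceI)
  show "0 \<in> closure S"
    using subspace_0[OF assms] closure_subset by blast
next
  fix x y assume "x \<in> closure S" "y \<in> closure S"
  then obtain f g where "\<forall>n. f n \<in> S" "f \<longlonglongrightarrow> x" "\<forall>n. g n \<in> S" "g \<longlonglongrightarrow> y"
    by (auto simp: closure_sequential)
  then show "x + y \<in> closure S"
    unfolding closure_sequential
    by (intro exI[of _ "\<lambda>n. f n + g n"]) (auto intro: tendsto_add subspace_add[OF assms])
next
  fix x and c :: real assume "x \<in> closure S"
  then obtain f where "\<forall>n. f n \<in> S" "f \<longlonglongrightarrow> x"
    by (auto simp: closure_sequential)
  then show "c *\<^sub>R x \<in> closure S"
    unfolding closure_sequential
    by (intro exI[of _ "\<lambda>n. c *\<^sub>R f n"]) (auto intro: tendsto_scaleR subspace_scale[OF assms])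
qed

text \<open>The sets \<open>A\<close> all of whose step functions lie in the closed span form a \<open>\<lambda>\<close>-system, so they
  exhaust the Borel sets as soon as they contain an intersection-stable generator. Simple functions
  then lie in the closed span, and they are dense.\<close>

lemma closure_span_steps:
  fixes G :: "(real ^ 'd::finite) set set"
  assumes G: "Int_stable G" "sets borel = sigma_sets UNIV G" "UNIV \<in> G"
  shows "closure (span ((\<lambda>(A, b). step_L2 A b) ` (G \<times> Basis))) = UNIV"
proof -
  define S where "S = closure (span ((\<lambda>(A, b). step_L2 A b) ` (G \<times> Basis)))"
  have subS: "subspace S"
    unfolding S_def by (intro closure_subspace subspace_span)
  have clS: "closed S" by (simp add: S_def)
  have GB: "A \<in> sets borel" if "A \<in> G" for A using that G by auto
  have lin: "step_L2 A y \<in> S" if "\<And>b. b \<in> Basis \<Longrightarrow> step_L2 A b \<in> S" "A \<in> sets borel" for A y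
  proof -
    have "step_L2 A (\<Sum>b\<in>F. (y \<bullet> b) *\<^sub>R b) \<in> S" if "finite F" "F \<subseteq> Basis" for F
      using that
    proof (induction F)
      case empty
      have "step_L2 A 0 = 0" using step_L2_scaleR[OF \<open>A \<in> sets borel\<close>, of 0 0] by simp
      then show ?case using subspace_0[OF subS] by simp
    next
      case (insert b F)
      then show ?case
        using \<open>\<And>b. b \<in> Basis \<Longrightarrow> step_L2 A b \<in> S\<close> \<open>A \<in> sets borel\<close>
        by (auto simp: step_L2_add step_L2_scaleR intro!: subspace_add[OF subS] subspace_scale[OF subS])
    qed
    from this[of Basis] show ?thesis by (simp add: euclidean_representation)
  qed
  have "G \<subseteq> Pow UNIV" by simp
  have ind: "\<forall>y. step_L2 A y \<in> S" if "A \<in> sigma_sets UNIV G" for A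
    using \<open>Int_stable G\<close> \<open>G \<subseteq> Pow UNIV\<close> that
  proof (induction rule: sigma_sets_induct_disjoint)
    case (basic A)
    then have "step_L2 A b \<in> S" if "b \<in> Basis" for b
      unfolding S_def using that by (intro closure_subset[THEN subsetD] span_base) auto
    then show ?case using lin GB basic by blast
  next
    case empty
    have "step_L2 {} y = 0" for y :: "real ^ 'd"
      by (simp add: step_L2_def zero_L2_def)
    then show ?case using subspace_0[OF subS] by simp
  next
    case (compl A)
    have A: "A \<in> sets borel" using compl(1) G(2) by simp
    have "step_L2 (UNIV - A) y = step_L2 UNIV y - step_L2 A y" for y
    proof -
      have eq: "(\<lambda>z. indicator (UNIV - A) z *\<^sub>R y) = (\<lambda>z. indicator UNIV z *\<^sub>R y - indicator A z *\<^sub>R y)"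
        by (auto simp: indicator_def)
      show ?thesis
        unfolding step_L2_def eq
        by (rule abs_L2_diff[symmetric]; rule square_integrable_step) (simp_all add: A)
    qed
    moreover have "step_L2 UNIV y \<in> S" for y
    proof (rule lin)
      show "step_L2 UNIV b \<in> S" if "b \<in> Basis" for b
        unfolding S_def using that G by (intro closure_subset[THEN subsetD] span_base) auto
    qed simp
    ultimately show ?case
      using compl subspace_diff[OF subS] by simp
  next
    case (union A)
    have A: "A i \<in> sets borel" for i using union(2) G(2) by blast
    have part: "step_L2 (\<Union>i<n. A i) y \<in> S" for n y
    proof (induction n)
      case 0
      then show ?case using subspace_0[OF subS] by (simp add: step_L2_def zero_L2_def)
    next
      case (Suc n)
      have disj: "A n \<inter> (\<Union>i<n. A i) = {}"
      proof -
        have "A n \<inter> A i = {}" if "i < n" for i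
          by (rule disjoint_family_onD[OF union(1)]) (use that in auto)
        then show ?thesis by blast
      qed
      have split: "step_L2 (\<Union>i<Suc n. A i) y = step_L2 (A n) y + step_L2 (\<Union>i<n. A i) y"
      proof -
        have eq: "(\<lambda>z. indicator (\<Union>i<Suc n. A i) z *\<^sub>R y)
            = (\<lambda>z. indicator (A n) z *\<^sub>R y + indicator (\<Union>i<n. A i) z *\<^sub>R y)"
        proof
          fix z
          have "(indicator (\<Union>i<Suc n. A i) z :: real) = indicator (A n \<union> (\<Union>i<n. A i)) z"
            by (simp add: lessThan_Suc)
          also have "\<dots> = indicator (A n) z + indicator (\<Union>i<n. A i) z"
            using disj by (rule indicator_disj_union)
          finally show "indicator (\<Union>i<Suc n. A i) z *\<^sub>R y
              = indicator (A n) z *\<^sub>R y + indicator (\<Union>i<n. A i) z *\<^sub>R y"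
            by (simp add: scaleR_add_left)
        qed
        show ?thesis
          unfolding step_L2_def eq
          by (rule plus_L2.abs_eq[symmetric]; rule L2_eq_refl; rule square_integrable_step) (use A in auto)
      qed
      have "step_L2 (A n) y \<in> S" using union(3) by blast
      then show ?case unfolding split using Suc.IH by (rule subspace_add[OF subS])
    qed
    have U: "(\<Union>i. A i) \<in> sets borel" and Un: "(\<Union>i<n. A i) \<in> sets borel" for n
      using A by auto
    show ?case
    proof
      fix y :: "real ^ 'd"
      have meas: "(\<lambda>z. indicator (\<Union>i<n. A i) z *\<^sub>R y) \<in> borel_measurable cube_measure" for n
        using square_integrable_step[OF Un] unfolding square_integrable_def by (rule conjunct1)
      have bound: "norm (indicator (\<Union>i<n. A i) z *\<^sub>R y)
          \<le> norm y + 2 * norm (indicator (\<Union>i. A i) z *\<^sub>R y)" for n z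
      proof -
        have "norm (indicator (\<Union>i<n. A i) z *\<^sub>R y) \<le> 1 * norm y"
          unfolding norm_scaleR by (intro mult_right_mono) (auto split: split_indicator)
        moreover have "0 \<le> norm (indicator (\<Union>i. A i) z *\<^sub>R y)"
          by (rule norm_ge_zero)
        ultimately show ?thesis by linarith
      qed
      have conv: "(\<lambda>n. indicator (\<Union>i<n. A i) z *\<^sub>R y) \<longlonglongrightarrow> indicator (\<Union>i. A i) z *\<^sub>R y" for z
        by (intro tendsto_scaleR tendsto_const LIMSEQ_indicator_UN)
      have "(\<lambda>n. step_L2 (\<Union>i<n. A i) y) \<longlonglongrightarrow> step_L2 (\<Union>i. A i) y"
        unfolding step_L2_def
        by (rule abs_L2_dominated(1)[OF meas square_integrable_step[OF U] bound norm_ge_zero conv])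
      then show "step_L2 (\<Union>i. A i) y \<in> S"
        by (rule closed_sequentially[OF clS part])
    qed
  qed
  have simpS: "abs_L2 F \<in> S" if F: "simple_function borel F" for F :: "real ^ 'd \<Rightarrow> real ^ 'd"
  proof -
    have fin: "finite (range F)" using simple_functionD(1)[OF F] by simp
    have vim: "F -` {y} \<in> sets borel" for y
      using simple_functionD(2)[OF F, of "{y}"] by simp
    have *: "square_integrable (\<lambda>z. \<Sum>y\<in>Y. indicator (F -` {y}) z *\<^sub>R y) \<and>
          abs_L2 (\<lambda>z. \<Sum>y\<in>Y. indicator (F -` {y}) z *\<^sub>R y) \<in> S" if "finite Y" for Y
      using that
    proof (induction Y)
      case empty
      then show ?case using subspace_0[OF subS] square_integrable_const by (simp add: zero_L2_def)
    next
      case (insert y Y)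
      have eq: "(\<lambda>z. \<Sum>y\<in>insert y Y. indicator (F -` {y}) z *\<^sub>R y)
         = (\<lambda>z. indicator (F -` {y}) z *\<^sub>R y + (\<Sum>y\<in>Y. indicator (F -` {y}) z *\<^sub>R y))"
        by (simp only: sum.insert[OF insert(1,2)])
      have abs_eq: "abs_L2 (\<lambda>z. indicator (F -` {y}) z *\<^sub>R y + (\<Sum>y\<in>Y. indicator (F -` {y}) z *\<^sub>R y))
         = step_L2 (F -` {y}) y + abs_L2 (\<lambda>z. \<Sum>y\<in>Y. indicator (F -` {y}) z *\<^sub>R y)"
        unfolding step_L2_def
        by (rule plus_L2.abs_eq[symmetric]; rule L2_eq_refl)
           (rule square_integrable_step[OF vim] insert.IH[THEN conjunct1])+
      have "step_L2 (F -` {y}) y \<in> S" using ind vim[of y] G(2) by blast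
      then show ?case
        unfolding eq abs_eq
        using insert.IH
        by (intro conjI subspace_add[OF subS] square_integrable_add square_integrable_step[OF vim]) auto
    qed
    have "F z = (\<Sum>y\<in>range F. indicator (F -` {y}) z *\<^sub>R y)" for z
    proof -
      have "(\<Sum>y\<in>range F. indicator (F -` {y}) z *\<^sub>R y) = (\<Sum>y\<in>range F. if y = F z then y else 0)"
        by (intro sum.cong) (auto simp: indicator_def)
      then show ?thesis using fin by simp
    qed
    then have "F = (\<lambda>z. \<Sum>y\<in>range F. indicator (F -` {y}) z *\<^sub>R y)" by (rule ext)
    then show ?thesis using *[OF fin] by simp
  qed
  have "X \<in> S" for X
  proof -
    \<comment> \<open>A representative that is Borel measurable on the whole space.\<close>
    define f where "f z = (if z \<in> unit_cube then rep_L2 X z else 0)" for z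
    have sq: "square_integrable (rep_L2 X)" by (rule square_integrable_rep_L2)
    have sp: "space cube_measure = (unit_cube :: (real ^ 'd) set)"
      by (simp add: cube_measure_def space_restrict_space)
    have fb[measurable]: "f \<in> borel_measurable borel"
    proof -
      have "borel_measurable (restrict_space borel unit_cube)
          = (borel_measurable cube_measure :: (real ^ 'd \<Rightarrow> real ^ 'd) set)"
        by (rule measurable_cong_sets) (simp_all add: cube_measure_def sets_restrict_space)
      then have "rep_L2 X \<in> borel_measurable (restrict_space borel unit_cube)"
        using sq unfolding square_integrable_def by blast
      then show ?thesis unfolding f_def
        using measurable_restrict_space_iff[of unit_cube borel 0 borel "rep_L2 X"] by simp
    qed
    have AEf: "AE z in cube_measure. f z = rep_L2 X z"
      using sp by (intro AE_I2) (auto simp: f_def)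
    have sqf: "square_integrable f"
      unfolding square_integrable_def
    proof
      show "integrable cube_measure (\<lambda>z. (norm (f z))\<^sup>2)"
      proof (subst Bochner_Integration.integrable_cong[OF refl])
        show "(norm (f z))\<^sup>2 = (norm (rep_L2 X z))\<^sup>2" if "z \<in> space cube_measure" for z
          using that sp by (simp add: f_def)
        show "integrable cube_measure (\<lambda>z. (norm (rep_L2 X z))\<^sup>2)"
          using sq unfolding square_integrable_def by blast
      qed
    qed (rule borel_measurable_cube[OF fb])
    have X: "X = abs_L2 f"
    proof -
      have "abs_L2 (rep_L2 X) = abs_L2 f"
      proof (rule Quotient_rel_abs[OF Quotient_L2])
        have "AE z in cube_measure. rep_L2 X z = f z"
          using AEf by (auto elim: eventually_mono)
        then show "L2_eq (rep_L2 X) f"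
          using sq sqf by (simp add: L2_eq_def)
      qed
      then show ?thesis by (simp add: abs_rep_L2)
    qed
    obtain F where F: "\<And>i. simple_function borel (F i)" "\<And>x. (\<lambda>i. F i x) \<longlonglongrightarrow> f x"
      "\<And>i x. dist (F i x) 0 \<le> 2 * dist (f x) 0"
      using borel_measurable_implies_sequence_metric[OF fb, of 0] unfolding space_borel by blast
    have Fm: "F i \<in> borel_measurable cube_measure" for i
      by (rule borel_measurable_cube[OF borel_measurable_simple_function[OF F(1)]])
    have "(\<lambda>i. abs_L2 (F i)) \<longlonglongrightarrow> abs_L2 f"
      by (rule abs_L2_dominated(1)[where B = 0])
         (use F Fm sqf in auto)
    then show ?thesis unfolding X
      by (rule closed_sequentially[OF clS simpS[OF F(1)]])
  qed
  then show ?thesis unfolding S_def by auto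
qed

lemma countable_dense_of_span:
  fixes B :: "'a::real_normed_vector set"
  assumes "countable B" and cl: "closure (span B) = UNIV"
  obtains D :: "'a set" where "countable D" "closure D = UNIV"
proof -
  define D where "D = (\<lambda>l. sum_list (map (\<lambda>(q, b). q *\<^sub>R b) l)) ` lists (\<rat> \<times> B)"
  have cD: "countable D"
    unfolding D_def using assms countable_rat by (intro countable_image countable_lists) auto
  have zero: "0 \<in> D"
    unfolding D_def by (rule image_eqI[of _ _ "[]"]) auto
  have approx: "\<exists>d\<in>D. dist d x < e" if "x \<in> span B" "e > 0" for x e
    using that
  proof (induction arbitrary: e rule: span_induct_alt)
    case base
    then show ?case using zero by (intro bexI[of _ 0]) auto
  next
    case (step c x y e)
    obtain d where d: "d \<in> D" "dist d y < e/2" using step.IH[of "e/2"] step.prems by auto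
    obtain q where q: "q \<in> \<rat>" "\<bar>q - c\<bar> < e / (2 * (norm x + 1))"
    proof -
      have "c < c + e / (2 * (norm x + 1))" using step.prems by (simp add: add_nonneg_pos)
      from Rats_dense_in_real[OF this] show thesis using that by (auto simp: abs_if)
    qed
    have "norm (q *\<^sub>R x - c *\<^sub>R x) < e/2"
    proof -
      have "norm (q *\<^sub>R x - c *\<^sub>R x) = \<bar>q - c\<bar> * norm x"
        by (simp flip: scaleR_diff_left)
      also have "\<dots> \<le> \<bar>q - c\<bar> * (norm x + 1)" by (intro mult_left_mono) auto
      also have "\<dots> < e / (2 * (norm x + 1)) * (norm x + 1)"
        using q by (intro mult_strict_right_mono) (auto simp: add_nonneg_pos)
      also have "\<dots> = e/2"
      proof -
        have "e / (2 * n) * n = e/2" if "n > 0" for n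
          using that by (simp add: field_simps)
        moreover have "norm x + 1 > 0" by (simp add: add_nonneg_pos)
        ultimately show ?thesis by blast
      qed
      finally show ?thesis .
    qed
    then have "dist (q *\<^sub>R x + d) (c *\<^sub>R x + y) < e"
      using d(2) norm_triangle_ineq[of "q *\<^sub>R x - c *\<^sub>R x" "d - y"]
      by (simp add: dist_norm algebra_simps)
    moreover have "q *\<^sub>R x + d \<in> D"
    proof -
      obtain l where l: "l \<in> lists (\<rat> \<times> B)" "d = sum_list (map (\<lambda>(q, b). q *\<^sub>R b) l)"
        using d(1) by (auto simp: D_def)
      then show ?thesis unfolding D_def using q(1) step.hyps
        by (intro image_eqI[of _ _ "(q, x) # l"]) auto
    qed
    ultimately show ?case by blast
  qed
  have "closure D = UNIV"
  proof -
    have "span B \<subseteq> closure D"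
      using approx by (auto simp: closure_approachable)
    then have "closure (span B) \<subseteq> closure D"
      by (simp add: closure_minimal)
    then show ?thesis using cl by auto
  qed
  with cD show thesis by (rule that)
qed

lemma countable_basis_of_dense:
  fixes D :: "'a::metric_space set"
  assumes "countable D" and cl: "closure D = UNIV"
  obtains \<B> :: "'a set set" where "countable \<B>" "topological_basis \<B>"
proof -
  define \<B> where "\<B> = (\<lambda>(x, n). ball x (inverse (real (Suc n)))) ` (D \<times> UNIV)"
  have "countable \<B>" unfolding \<B>_def using assms(1) by auto
  moreover have "topological_basis \<B>"
  proof (rule topological_basisI)
    fix O' :: "'a set" and x assume "open O'" "x \<in> O'"
    then obtain e where e: "e > 0" "ball x e \<subseteq> O'" using openE by blast
    obtain n where n: "inverse (real (Suc n)) < e/2"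
      using reals_Archimedean[of "e/2"] e by auto
    obtain d where d: "d \<in> D" "dist d x < inverse (real (Suc n))"
      using cl closure_approachable[of x D] by (metis UNIV_I inverse_positive_iff_positive of_nat_0_less_iff zero_less_Suc)
    have "ball d (inverse (real (Suc n))) \<subseteq> ball x e"
    proof
      fix y assume "y \<in> ball d (inverse (real (Suc n)))"
      then show "y \<in> ball x e"
        using dist_triangle[of x y d] d(2) n by (simp add: dist_commute)
    qed
    then show "\<exists>B'\<in>\<B>. x \<in> B' \<and> B' \<subseteq> O'"
      using d e unfolding \<B>_def by (intro bexI[of _ "ball d (inverse (real (Suc n)))"]) auto
  qed (auto simp: \<B>_def)
  ultimately show thesis by (rule that)
qed

instance L2 :: (finite) second_countable_topology
proof
  obtain G :: "(real ^ 'a) set set" where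
    G: "countable G" "Int_stable G" "sets borel = sigma_sets UNIV G" "UNIV \<in> G"
    by (rule countable_Int_stable_generator)
  define B :: "'a L2 set" where "B = (\<lambda>(A, b). step_L2 A b) ` (G \<times> Basis)"
  have B: "countable B"
    unfolding B_def using G(1) by (intro countable_image countable_SIGMA) (auto simp: countable_finite)
  have "closure (span B) = UNIV"
    unfolding B_def by (rule closure_span_steps[OF G(2-4)])
  with B obtain D :: "'a L2 set" where "countable D" "closure D = UNIV"
    by (rule countable_dense_of_span)
  then obtain \<B> :: "'a L2 set set" where "countable \<B>" "topological_basis \<B>"
    by (rule countable_basis_of_dense)
  then show "\<exists>\<B> :: 'a L2 set set. countable \<B> \<and> open = generate_topology \<B>"
    using topological_basis_imp_subbasis by blast
qed

section \<open>Riesz representation and gradients\<close>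

text \<open>The functional \<open>\<phi> x = \<parallel>x\<parallel>\<^sup>2 / 2 - f x\<close> is bounded below, and by the parallelogram identity its
  minimizing sequences are Cauchy. Its minimum point represents \<open>f\<close>.\<close>

theorem riesz_representation:
  fixes f :: "'a::{real_inner, banach} \<Rightarrow> real"
  assumes f: "bounded_linear f"
  obtains D where "\<And>h. f h = h \<bullet> D"
proof -
  interpret f: bounded_linear f by (rule f)
  define \<phi> where "\<phi> x = (norm x)\<^sup>2 / 2 - f x" for x
  obtain B where B: "\<And>x. norm (f x) \<le> norm x * B" "B > 0"
    using f.pos_bounded by blast
  have bdd: "- B\<^sup>2 / 2 \<le> \<phi> x" for x
  proof -
    have "f x \<le> norm x * B" using B(1)[of x] by simp
    moreover have "0 \<le> (norm x - B)\<^sup>2" by simp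
    then have "2 * (norm x * B) \<le> (norm x)\<^sup>2 + B\<^sup>2" by (simp add: power2_diff)
    ultimately show ?thesis unfolding \<phi>_def by (simp add: field_simps)
  qed
  define m where "m = (INF x. \<phi> x)"
  have bb: "bdd_below (range \<phi>)" using bdd by (intro bdd_belowI2) auto
  have m_le: "m \<le> \<phi> x" for x
    unfolding m_def by (rule cINF_lower[OF bb]) simp
  have "\<exists>x. \<phi> x < m + inverse (real (Suc n))" for n
  proof -
    have "(INF x. \<phi> x) < m + inverse (real (Suc n))" unfolding m_def by simp
    then show ?thesis using bb by (subst (asm) cINF_less_iff) auto
  qed
  then obtain x where x: "\<And>n. \<phi> (x n) < m + inverse (real (Suc n))" by metis
  have par: "(norm (y - z))\<^sup>2 \<le> 4 * (\<phi> y - m) + 4 * (\<phi> z - m)" for y z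
  proof -
    have "(norm (y - z))\<^sup>2 = 4 * \<phi> y + 4 * \<phi> z - 8 * \<phi> ((1/2) *\<^sub>R (y + z))"
      unfolding \<phi>_def by (simp add: f.add f.scaleR power2_norm_eq_inner algebra_simps inner_commute)
    with m_le[of "(1/2) *\<^sub>R (y + z)"] show ?thesis by simp
  qed
  have "Cauchy x"
  proof (rule CauchyI)
    fix e :: real assume "e > 0"
    obtain N where N: "inverse (real (Suc N)) < e\<^sup>2 / 8"
      using reals_Archimedean[of "e\<^sup>2 / 8"] \<open>e > 0\<close> by auto
    have sm: "\<phi> (x n) - m < e\<^sup>2 / 8" if "n \<ge> N" for n
    proof -
      have "inverse (real (Suc n)) \<le> inverse (real (Suc N))"
        using that by (intro le_imp_inverse_le) auto
      then show ?thesis using x[of n] N by linarith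
    qed
    show "\<exists>M. \<forall>m\<ge>M. \<forall>n\<ge>M. norm (x m - x n) < e"
    proof (intro exI allI impI)
      fix k n assume "k \<ge> N" "n \<ge> N"
      have "(norm (x k - x n))\<^sup>2 \<le> 4 * (\<phi> (x k) - m) + 4 * (\<phi> (x n) - m)"
        by (rule par)
      also have "\<dots> < 4 * (e\<^sup>2 / 8) + 4 * (e\<^sup>2 / 8)"
        using sm[OF \<open>k \<ge> N\<close>] sm[OF \<open>n \<ge> N\<close>]
        by (intro add_strict_mono mult_strict_left_mono) auto
      finally have "(norm (x k - x n))\<^sup>2 < e\<^sup>2"
        by simp
      then show "norm (x k - x n) < e"
        using \<open>e > 0\<close> by (simp add: power2_less_imp_less)
    qed
  qed
  then obtain D where D: "x \<longlonglongrightarrow> D"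
    using Cauchy_convergent convergent_def by blast
  have "(\<lambda>n. \<phi> (x n)) \<longlonglongrightarrow> \<phi> D"
    unfolding \<phi>_def by (intro tendsto_intros D f.tendsto) simp
  moreover have "(\<lambda>n. m + inverse (real (Suc n))) \<longlonglongrightarrow> m + 0"
    by (intro tendsto_intros LIMSEQ_inverse_real_of_nat)
  ultimately have "\<phi> D \<le> m + 0"
    by (rule LIMSEQ_le) (use x less_imp_le in blast)
  then have min: "\<phi> D \<le> \<phi> y" for y using m_le[of y] by simp
  have "f h = h \<bullet> D" for h
  proof -
    define a where "a = f h - h \<bullet> D"
    \<comment> \<open>The step \<open>a s\<close> in direction \<open>h\<close> is short enough for the linear term of \<open>\<phi>\<close> to dominate.\<close>
    define s where "s = 1 / ((norm h)\<^sup>2 + 1)"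
    have s: "s > 0" "s * (norm h)\<^sup>2 \<le> 1"
    proof -
      have "0 < (norm h)\<^sup>2 + 1" by (rule add_nonneg_pos) auto
      then show "s > 0" "s * (norm h)\<^sup>2 \<le> 1"
        unfolding s_def by (auto simp: divide_le_eq)
    qed
    have "0 \<le> \<phi> (D + (a * s) *\<^sub>R h) - \<phi> D" using min by simp
    also have "\<dots> = - (a\<^sup>2 * s) + (a\<^sup>2 * s) * (s * (norm h)\<^sup>2) / 2"
    proof -
      have "\<phi> (D + t *\<^sub>R h) - \<phi> D = - (t * a) + t * t * (norm h)\<^sup>2 / 2" for t
        unfolding \<phi>_def a_def
        by (simp add: f.add f.scaleR power2_norm_eq_inner inner_add_left inner_add_right
              inner_commute[of D h] algebra_simps add_divide_distrib)
      from this[of "a * s"] show ?thesis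
        by (simp add: power2_eq_square algebra_simps)
    qed
    also have "\<dots> \<le> - (a\<^sup>2 * s) + (a\<^sup>2 * s) * 1 / 2"
      using s by (intro add_left_mono divide_right_mono mult_left_mono) auto
    finally have "a\<^sup>2 * s \<le> 0" by (simp add: mult.commute)
    then have "a = 0" using s by (simp add: mult_le_0_iff)
    then show ?thesis by (simp add: a_def)
  qed
  then show thesis by (rule that)
qed

lemma GDERIV_imp_grad:
  assumes "GDERIV f x :> D"
  shows "grad f x = D"
  unfolding grad_def
proof (rule the_equality)
  show "GDERIV f x :> D" by (rule assms)
  fix E assume "GDERIV f x :> E"
  then have "(\<lambda>h. h \<bullet> E) = (\<lambda>h. h \<bullet> D)"
    using assms unfolding gderiv_def by (rule has_derivative_unique)
  then have "(E - D) \<bullet> E = (E - D) \<bullet> D" by metis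
  then have "(E - D) \<bullet> (E - D) = 0" by (simp add: inner_diff_right)
  then show "E = D" by simp
qed

text \<open>Completeness enters here: only by Riesz representation is a Frechet derivative given by a
  gradient, so that \<open>grad\<close> is meaningful at points of differentiability.\<close>

lemma differentiable_imp_GDERIV:
  fixes f :: "'a::{real_inner, banach} \<Rightarrow> real"
  assumes "f differentiable (at x)"
  shows "GDERIV f x :> grad f x"
proof -
  obtain f' where f': "(f has_derivative f') (at x)"
    using assms by (auto simp: differentiable_def)
  obtain D where "\<And>h. f' h = h \<bullet> D"
    using riesz_representation[OF has_derivative_bounded_linear[OF f']] by blast
  then have "f' = (\<lambda>h. h \<bullet> D)" by auto
  with f' have D: "GDERIV f x :> D" by (simp add: gderiv_def)
  then show ?thesis by (simp add: GDERIV_imp_grad)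
qed

section \<open>Lebesgue points of Bochner integrable functions\<close>

lemma emeasure_UN_countable_le:
  assumes "\<And>i. i \<in> I \<Longrightarrow> X i \<in> sets M" "countable I"
  shows "emeasure M (\<Union>i\<in>I. X i) \<le> (\<integral>\<^sup>+i. emeasure M (X i) \<partial>count_space I)"
proof -
  have U: "(\<Union>i\<in>I. X i) \<in> sets M" using assms by (intro sets.countable_UN') auto
  have "emeasure M (\<Union>i\<in>I. X i) = (\<integral>\<^sup>+x. indicator (\<Union>i\<in>I. X i) x \<partial>M)"
    using U by simp
  also have "\<dots> \<le> (\<integral>\<^sup>+x. \<integral>\<^sup>+i. indicator (X i) x \<partial>count_space I \<partial>M)"
  proof (rule nn_integral_mono)
    fix x
    show "indicator (\<Union>i\<in>I. X i) x \<le> (\<integral>\<^sup>+i. indicator (X i) x \<partial>count_space I)"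
    proof (cases "x \<in> (\<Union>i\<in>I. X i)")
      case True
      then obtain i where i: "i \<in> I" "x \<in> X i" by blast
      have "(1::ennreal) = indicator (X i) x" using i by simp
      also have "\<dots> \<le> (\<integral>\<^sup>+i. indicator (X i) x \<partial>count_space I)"
        by (rule nn_integral_ge_point[OF i(1)])
      finally show ?thesis using True by simp
    qed simp
  qed
  also have "\<dots> = (\<integral>\<^sup>+i. \<integral>\<^sup>+x. indicator (X i) x \<partial>M \<partial>count_space I)"
    using assms by (intro nn_integral_count_space_nn_integral) auto
  also have "\<dots> = (\<integral>\<^sup>+i. emeasure M (X i) \<partial>count_space I)"
    using assms by (intro nn_integral_cong) auto
  finally show ?thesis .
qed

lemma set_integrable_of_integrable:
  fixes f :: "_ \<Rightarrow> 'b::{banach, second_countable_topology}"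
  shows "integrable M f \<Longrightarrow> A \<in> sets M \<Longrightarrow> set_integrable M A f"
  unfolding set_integrable_def by (rule integrable_mult_indicator)

text \<open>Lebesgue's differentiation theorem at the zeros of a nonnegative function. The measure with density
  \<open>f\<close> vanishes on \<open>S\<close>, so by outer regularity it is small on some open \<open>U \<supseteq> S\<close>. The points of \<open>S\<close>
  where the averages exceed \<open>1 / Suc n\<close> for arbitrarily small radii are covered by balls inside \<open>U\<close> whose length is at most a
  multiple of their \<open>f\<close>-mass; by Vitali's covering lemma the set of these points has small measure.\<close>

lemma AE_average_zero:
  fixes f :: "real \<Rightarrow> real"
  assumes int: "integrable lborel f" and nn: "\<And>t. 0 \<le> f t"
    and S: "S \<in> sets borel" and zero: "\<And>t. t \<in> S \<Longrightarrow> f t = 0"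
  shows "AE t in lborel. t \<in> S \<longrightarrow> ((\<lambda>r. (LINT s:ball t r|lborel. f s) / r) \<longlongrightarrow> 0) (at_right 0)"
proof -
  have [measurable]: "f \<in> borel_measurable borel" using int by auto
  define \<nu> where "\<nu> = density lborel (\<lambda>t. ennreal (f t))"
  have sets_nu[simp, measurable_cong]: "sets \<nu> = sets borel" by (simp add: \<nu>_def)
  have nuA: "emeasure \<nu> A = ennreal (LINT s:A|lborel. f s)" if "A \<in> sets borel" for A
  proof -
    have "emeasure \<nu> A = (\<integral>\<^sup>+s\<in>A. ennreal (f s) \<partial>lborel)"
      unfolding \<nu>_def using that by (simp add: emeasure_density)
    also have "\<dots> = ennreal (LINT s:A|lborel. f s)"
      using that int nn by (intro nn_set_integral_eq_set_integral) auto
    finally show ?thesis .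
  qed
  have fin: "emeasure \<nu> A \<noteq> \<infinity>" if "A \<in> sets borel" for A using nuA[OF that] by simp
  have nuS: "emeasure \<nu> S = 0"
  proof -
    have "(LINT s:S|lborel. f s) = (LINT s:S|lborel. 0)"
      using S zero by (intro set_lebesgue_integral_cong) auto
    then show ?thesis using nuA[OF S] by simp
  qed
  define E where "E n = {t \<in> S. \<exists>\<^sub>F r in at_right 0. r / real (Suc n) < (LINT s:ball t r|lborel. f s)}" for n
  have negl: "negligible (E n)" for n
    unfolding negligible_outer_le
  proof (intro allI impI)
    fix e :: real assume "e > 0"
    \<comment> \<open>\<open>10\<close>: the balls are enlarged five times and have twice their radius as length.\<close>
    define \<epsilon> where "\<epsilon> = e / (10 * real (Suc n))"
    have "\<epsilon> > 0" using \<open>e > 0\<close> by (simp add: \<epsilon>_def)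
    have "emeasure \<nu> S = (INF U\<in>{U. S \<subseteq> U \<and> open U}. emeasure \<nu> U)"
      using fin S fin[of UNIV] by (intro outer_regular) (auto simp: \<nu>_def)
    then have "(INF U\<in>{U. S \<subseteq> U \<and> open U}. emeasure \<nu> U) < ennreal \<epsilon>"
      using nuS \<open>\<epsilon> > 0\<close> by simp
    then obtain U where U: "S \<subseteq> U" "open U" "emeasure \<nu> U < ennreal \<epsilon>"
      by (auto simp: INF_less_iff)
    define K where "K = {(t, r). t \<in> E n \<and> 0 < r \<and> r \<le> 1 \<and> ball t r \<subseteq> U
        \<and> r / real (Suc n) < (LINT s:ball t r|lborel. f s)}"
    have cov: "E n \<subseteq> (\<Union>i\<in>K. ball (fst i) (snd i))"
    proof
      fix t assume t: "t \<in> E n"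
      then have "t \<in> U" using U by (auto simp: E_def)
      then obtain \<rho> where \<rho>: "\<rho> > 0" "ball t \<rho> \<subseteq> U" using U(2) openE by blast
      have ev: "\<forall>\<^sub>F r in at_right (0::real). 0 < r \<and> r < min 1 \<rho>"
        using \<rho>(1) by (auto simp: eventually_at_right_field intro!: exI[of _ "min 1 \<rho>"])
      have "\<exists>\<^sub>F r in at_right 0. r / real (Suc n) < (LINT s:ball t r|lborel. f s)"
        using t by (simp add: E_def)
      then have "\<exists>\<^sub>F r in at_right 0. r / real (Suc n) < (LINT s:ball t r|lborel. f s) \<and> (0 < r \<and> r < min 1 \<rho>)"
        by (rule frequently_rev_mp) (rule eventually_mono[OF ev], simp)
      then obtain r where r: "r / real (Suc n) < (LINT s:ball t r|lborel. f s)" "0 < r" "r < min 1 \<rho>"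
        using frequently_ex by blast
      have "ball t r \<subseteq> U" using \<rho>(2) r(3) by (meson min_less_iff_conj order_trans subset_ball less_imp_le)
      then have "(t, r) \<in> K" using r t by (simp add: K_def)
      then show "t \<in> (\<Union>i\<in>K. ball (fst i) (snd i))" using r(2) by (intro UN_I[of "(t, r)"]) simp_all
    qed
    have bnd: "0 < snd i \<and> snd i \<le> 1" if "i \<in> K" for i
      using that by (simp add: K_def case_prod_beta)
    obtain C where C: "countable C" "C \<subseteq> K"
      and pw: "pairwise (\<lambda>i j. disjnt (ball (fst i) (snd i)) (ball (fst j) (snd j))) C"
      and cov5: "E n \<subseteq> (\<Union>i\<in>C. ball (fst i) (5 * snd i))"
      by (rule Vitali_covering_lemma_balls[OF cov bnd])
    define V where "V = (\<Union>i\<in>C. ball (fst i) (5 * snd i))"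
    have Vo: "open V" unfolding V_def by (intro open_UN) auto
    have "emeasure lborel V \<le> (\<integral>\<^sup>+i. emeasure lborel (ball (fst i) (5 * snd i)) \<partial>count_space C)"
      unfolding V_def using C by (intro emeasure_UN_countable_le) auto
    also have "\<dots> \<le> (\<integral>\<^sup>+i. ennreal (10 * real (Suc n)) * emeasure \<nu> (ball (fst i) (snd i)) \<partial>count_space C)"
    proof (rule nn_integral_mono)
      fix i assume "i \<in> space (count_space C)"
      then have "i \<in> K" using C by auto
      then have i: "0 < snd i" "snd i / real (Suc n) < (LINT s:ball (fst i) (snd i)|lborel. f s)"
        by (auto simp: K_def)
      have "emeasure lborel (ball (fst i) (5 * snd i)) = ennreal (10 * snd i)"
        using i(1) by (simp add: ball_eq_greaterThanLessThan)
      also have "\<dots> \<le> ennreal (10 * real (Suc n) * (LINT s:ball (fst i) (snd i)|lborel. f s))"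
        using i(2) by (intro ennreal_leI) (simp add: field_simps)
      also have "\<dots> = ennreal (10 * real (Suc n)) * emeasure \<nu> (ball (fst i) (snd i))"
        by (simp add: nuA ennreal_mult' )
      finally show "emeasure lborel (ball (fst i) (5 * snd i))
          \<le> ennreal (10 * real (Suc n)) * emeasure \<nu> (ball (fst i) (snd i))" .
    qed
    also have "\<dots> = ennreal (10 * real (Suc n)) * (\<integral>\<^sup>+i. emeasure \<nu> (ball (fst i) (snd i)) \<partial>count_space C)"
      by (rule nn_integral_cmult) simp
    also have "(\<integral>\<^sup>+i. emeasure \<nu> (ball (fst i) (snd i)) \<partial>count_space C) = emeasure \<nu> (\<Union>i\<in>C. ball (fst i) (snd i))"
      using C pw
      by (intro emeasure_UN_countable[symmetric])
         (auto simp: disjoint_family_on_def pairwise_def disjnt_def)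
    also have "\<dots> \<le> emeasure \<nu> U"
    proof (rule emeasure_mono)
      have "ball (fst i) (snd i) \<subseteq> U" if "i \<in> K" for i
        using that by (simp add: K_def case_prod_beta)
      then show "(\<Union>i\<in>C. ball (fst i) (snd i)) \<subseteq> U"
        using C(2) by blast
      show "U \<in> sets \<nu>" using U(2) by simp
    qed
    also have "ennreal (10 * real (Suc n)) * emeasure \<nu> U \<le> ennreal (10 * real (Suc n)) * ennreal \<epsilon>"
      using U(3) by (intro mult_left_mono) auto
    also have "\<dots> = ennreal (10 * real (Suc n) * \<epsilon>)"
      using \<open>\<epsilon> > 0\<close> by (intro ennreal_mult[symmetric]) auto
    also have "10 * real (Suc n) * \<epsilon> = e"
      by (simp add: \<epsilon>_def)
    finally have V: "emeasure lborel V \<le> ennreal e"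
      by (simp add: mult_left_mono)
    show "\<exists>T. E n \<subseteq> T \<and> T \<in> lmeasurable \<and> measure lebesgue T \<le> e"
    proof (intro exI conjI)
      show "E n \<subseteq> V" using cov5 by (simp add: V_def)
      have eV: "emeasure lebesgue V = emeasure lborel V" using Vo by simp
      then show "V \<in> lmeasurable"
        using V Vo by (intro fmeasurableI) (auto simp: le_less_trans[OF _ ennreal_less_top])
      show "measure lebesgue V \<le> e"
        using V eV \<open>e > 0\<close> by (simp add: measure_def enn2real_leI)
    qed
  qed
  have "negligible (\<Union>n. E n)"
    by (rule negligible_countable_Union) (use negl in auto)
  then have "(\<Union>n. E n) \<in> null_sets lebesgue"
    by (simp add: negligible_iff_null_sets)
  then have "AE t in lebesgue. t \<notin> (\<Union>n. E n)"
    by (rule AE_not_in)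
  then have "AE t in lborel. t \<notin> (\<Union>n. E n)"
    by (simp add: AE_completion_iff)
  then show ?thesis
  proof eventually_elim
    fix t assume t: "t \<notin> (\<Union>n. E n)"
    show "t \<in> S \<longrightarrow> ((\<lambda>r. (LINT s:ball t r|lborel. f s) / r) \<longlongrightarrow> 0) (at_right 0)"
    proof
      assume "t \<in> S"
      have ev: "\<forall>\<^sub>F r in at_right 0. (LINT s:ball t r|lborel. f s) \<le> r / real (Suc n)" for n
      proof -
        have "\<not> (\<exists>\<^sub>F r in at_right 0. r / real (Suc n) < (LINT s:ball t r|lborel. f s))"
          using t \<open>t \<in> S\<close> by (auto simp: E_def)
        then show ?thesis by (simp add: frequently_def not_less)
      qed
      show "((\<lambda>r. (LINT s:ball t r|lborel. f s) / r) \<longlongrightarrow> 0) (at_right 0)"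
      proof (rule tendstoI)
        fix e :: real assume "e > 0"
        then obtain n where n: "inverse (real (Suc n)) < e" using reals_Archimedean by blast
        have "\<forall>\<^sub>F r in at_right (0::real). 0 < r" by (rule eventually_at_right_less)
        with ev[of n] show "\<forall>\<^sub>F r in at_right 0. dist ((LINT s:ball t r|lborel. f s) / r) 0 < e"
        proof eventually_elim
          fix r :: real assume r: "(LINT s:ball t r|lborel. f s) \<le> r / real (Suc n)" "0 < r"
          have "0 \<le> (LINT s:ball t r|lborel. f s)"
            unfolding set_lebesgue_integral_def by (intro integral_nonneg_AE AE_I2) (simp add: nn)
          moreover have "(LINT s:ball t r|lborel. f s) / r \<le> inverse (real (Suc n))"
            using r by (simp add: field_simps)
          ultimately show "dist ((LINT s:ball t r|lborel. f s) / r) 0 < e"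
            using n r(2) by simp
        qed
      qed
    qed
  qed
qed

lemma set_integral_nonneg_real:
  fixes f :: "_ \<Rightarrow> real"
  assumes "\<And>x. x \<in> A \<Longrightarrow> 0 \<le> f x"
  shows "0 \<le> (LINT x:A|M. f x)"
  unfolding set_lebesgue_integral_def
  by (intro integral_nonneg_AE AE_I2) (use assms in \<open>auto split: split_indicator\<close>)

text \<open>Separability reduces the statement to scalar functions: for each \<open>q\<close> of a countable dense set and
  each tolerance, apply \<open>AE_average_zero\<close> to \<open>\<parallel>v - q\<parallel>\<close> cut off where it is below the tolerance. At
  a given \<open>t\<close> choose \<open>q\<close> near \<open>v t\<close>.\<close>

lemma AE_Lebesgue_point:
  fixes v :: "real \<Rightarrow> 'b::{banach, second_countable_topology}"
  assumes int: "integrable lborel v"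
  shows "AE t in lborel. ((\<lambda>r. (LINT s:ball t r|lborel. norm (v s - v t)) / r) \<longlongrightarrow> 0) (at_right 0)"
proof -
  have [measurable]: "v \<in> borel_measurable borel" using int by auto
  obtain D :: "'b set" where D: "countable D" "\<And>X. open X \<Longrightarrow> X \<noteq> {} \<Longrightarrow> \<exists>d\<in>D. d \<in> X"
    by (erule countable_dense_setE)
  define S where "S q n = {t. norm (v t - q) < inverse (real (Suc n))}" for q n
  have S[measurable]: "S q n \<in> sets borel" for q n
    unfolding S_def by measurable
  define f where "f q n m t = indicator ({- real m..real m} - S q n) t * norm (v t - q)" for q n m t
  have intI: "set_integrable lborel {- real m..real m} (\<lambda>s. norm (v s - q))" for m q
    unfolding set_integrable_def
  proof (rule Bochner_Integration.integrable_bound)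
    show "integrable lborel (\<lambda>s. norm (v s) + indicator {- real m..real m} s *\<^sub>R norm q)"
      using int by (intro Bochner_Integration.integrable_add integrable_norm) auto
    show "AE s in lborel. norm (indicat_real {- real m..real m} s *\<^sub>R norm (v s - q))
        \<le> norm (norm (v s) + indicator {- real m..real m} s *\<^sub>R norm q)"
      by (intro AE_I2) (auto split: split_indicator intro: norm_triangle_ineq4)
  qed measurable
  have int_f: "integrable lborel (f q n m)" for q n m
  proof -
    have "set_integrable lborel ({- real m..real m} - S q n) (\<lambda>s. norm (v s - q))"
      by (rule set_integrable_subset[OF intI]) (auto intro: S)
    then show ?thesis by (simp add: set_integrable_def f_def[abs_def])
  qed
  have "AE t in lborel. \<forall>q\<in>D. \<forall>n m. t \<in> S q n \<longrightarrow>
      ((\<lambda>r. (LINT s:ball t r|lborel. f q n m s) / r) \<longlongrightarrow> 0) (at_right 0)"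
    by (intro AE_ball_countable' AE_all_countable[THEN iffD2] allI D(1)
        AE_average_zero[OF int_f _ S]) (auto simp: f_def)
  then show ?thesis
  proof eventually_elim
    fix t assume H: "\<forall>q\<in>D. \<forall>n m. t \<in> S q n \<longrightarrow>
      ((\<lambda>r. (LINT s:ball t r|lborel. f q n m s) / r) \<longlongrightarrow> 0) (at_right 0)"
    show "((\<lambda>r. (LINT s:ball t r|lborel. norm (v s - v t)) / r) \<longlongrightarrow> 0) (at_right 0)"
    proof (rule tendstoI)
      fix e :: real assume "e > 0"
      obtain n where n: "inverse (real (Suc n)) < e / 5"
        using reals_Archimedean[of "e / 5"] \<open>e > 0\<close> by auto
      define \<eta> where "\<eta> = inverse (real (Suc n))"
      have \<eta>: "\<eta> > 0" "\<eta> < e / 5" using n by (auto simp: \<eta>_def)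
      obtain q where q: "q \<in> D" "q \<in> ball (v t) \<eta>"
        using D(2)[of "ball (v t) \<eta>"] \<eta>(1) by auto
      have tS: "t \<in> S q n" using q(2) by (simp add: S_def \<eta>_def dist_norm)
      obtain m :: nat where m: "\<bar>t\<bar> + 1 \<le> real m" using real_arch_simple by blast
      have "((\<lambda>r. (LINT s:ball t r|lborel. f q n m s) / r) \<longlongrightarrow> 0) (at_right 0)"
        using H q(1) tS by blast
      then have "\<forall>\<^sub>F r in at_right 0. dist ((LINT s:ball t r|lborel. f q n m s) / r) 0 < \<eta>"
        using \<eta>(1) by (rule tendstoD)
      moreover have "\<forall>\<^sub>F r in at_right (0::real). 0 < r \<and> r < 1"
        by (auto simp: eventually_at_right_field intro!: exI[of _ 1])
      ultimately show "\<forall>\<^sub>F r in at_right 0. dist ((LINT s:ball t r|lborel. norm (v s - v t)) / r) 0 < e"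
      proof eventually_elim
        fix r :: real
        assume r1: "dist ((LINT s:ball t r|lborel. f q n m s) / r) 0 < \<eta>" and r: "0 < r \<and> r < 1"
        have sub: "ball t r \<subseteq> {- real m..real m}" using m r by (auto simp: dist_real_def)
        have ib: "set_integrable lborel (ball t r) (\<lambda>s. norm (v s - p))" for p
          by (rule set_integrable_subset[OF intI _ sub]) simp
        have ic: "set_integrable lborel (ball t r) (\<lambda>s. 2 * \<eta>)"
          unfolding set_integrable_def using r by (auto simp: ball_eq_greaterThanLessThan)
        have ifb: "set_integrable lborel (ball t r) (f q n m)"
          by (rule set_integrable_of_integrable[OF int_f]) simp
        have "(LINT s:ball t r|lborel. norm (v s - v t)) \<le> (LINT s:ball t r|lborel. f q n m s + 2 * \<eta>)"
        proof (rule set_integral_mono)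
          fix s assume s: "s \<in> ball t r"
          have "norm (v s - v t) \<le> norm (v s - q) + norm (q - v t)"
            using norm_triangle_ineq[of "v s - q" "q - v t"] by simp
          moreover have "norm (q - v t) < \<eta>" using q(2) by (simp add: dist_norm norm_minus_commute)
          moreover have "norm (v s - q) \<le> f q n m s + \<eta>"
          proof (cases "s \<in> S q n")
            case True
            then have "norm (v s - q) < \<eta>" by (simp add: S_def \<eta>_def)
            moreover have "0 \<le> f q n m s" by (simp add: f_def)
            ultimately show ?thesis by linarith
          next
            case False
            then show ?thesis using s sub \<eta> by (auto simp: f_def indicator_def)
          qed
          ultimately show "norm (v s - v t) \<le> f q n m s + 2 * \<eta>" by linarith
        qed (use ib ifb ic in auto)
        also have "\<dots> = (LINT s:ball t r|lborel. f q n m s) + (LINT s:ball t r|lborel. 2 * \<eta>)"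
          by (rule set_integral_add[OF ifb ic])
        also have "(LINT s:ball t r|lborel. 2 * \<eta>) = 4 * \<eta> * r"
          unfolding set_lebesgue_integral_def using r by (simp add: ball_eq_greaterThanLessThan)
        finally have "(LINT s:ball t r|lborel. norm (v s - v t)) / r
            \<le> (LINT s:ball t r|lborel. f q n m s) / r + 4 * \<eta>"
          using r by (simp add: field_simps)
        moreover have "(LINT s:ball t r|lborel. f q n m s) / r < \<eta>"
          using r1 by (simp add: abs_if split: if_splits)
        moreover have "0 \<le> (LINT s:ball t r|lborel. norm (v s - v t)) / r"
          using r by (intro divide_nonneg_nonneg set_integral_nonneg_real) auto
        ultimately show "dist ((LINT s:ball t r|lborel. norm (v s - v t)) / r) 0 < e"
          using \<eta>(2) by simp
      qed
    qed
  qed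
qed

section \<open>Velocity fields and their primitives\<close>

text \<open>Half-open intervals make consecutive time intervals disjoint. Measurability is demanded on the whole
  line, which allows restricting, shifting and concatenating without changing the function.\<close>

definition L2_on :: "real \<Rightarrow> (real \<Rightarrow> 'a::real_normed_vector) \<Rightarrow> bool" where
  "L2_on T v \<longleftrightarrow> v \<in> borel_measurable borel \<and> set_integrable lborel {0<..T} (\<lambda>t. (norm (v t))\<^sup>2)"

definition primitive :: "(real \<Rightarrow> 'a::{banach, second_countable_topology}) \<Rightarrow> real \<Rightarrow> 'a" where
  "primitive v t = (LINT s:{0<..t}|lborel. v s)"

lemma set_integrable_of_square:
  fixes f :: "real \<Rightarrow> 'a::{banach, second_countable_topology}"
  assumes [measurable]: "f \<in> borel_measurable borel" "A \<in> sets borel"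
    and fin: "emeasure lborel A < \<infinity>" and sq: "set_integrable lborel A (\<lambda>t. (norm (f t))\<^sup>2)"
  shows "set_integrable lborel A f"
  unfolding set_integrable_def
proof (rule Bochner_Integration.integrable_bound)
  show "integrable lborel (\<lambda>t. indicator A t + indicator A t *\<^sub>R (norm (f t))\<^sup>2)"
    using sq fin by (intro Bochner_Integration.integrable_add) (auto simp: set_integrable_def)
  show "AE t in lborel. norm (indicat_real A t *\<^sub>R f t) \<le> norm (indicator A t + indicator A t *\<^sub>R (norm (f t))\<^sup>2)"
  proof (rule AE_I2)
    fix t
    have "norm (f t) \<le> 1 + (norm (f t))\<^sup>2"
    proof -
      have "0 \<le> (norm (f t) - 1)\<^sup>2" by simp
      then have "2 * norm (f t) \<le> (norm (f t))\<^sup>2 + 1" by (simp add: power2_diff)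
      then show ?thesis using norm_ge_zero[of "f t"] by linarith
    qed
    then show "norm (indicat_real A t *\<^sub>R f t) \<le> norm (indicator A t + indicator A t *\<^sub>R (norm (f t))\<^sup>2)"
      by (auto split: split_indicator)
  qed
qed measurable

text \<open>Cauchy--Schwarz against the constant one, read off from the nonnegative variance of \<open>f\<close>.\<close>

lemma set_integral_square_le:
  fixes f :: "real \<Rightarrow> real"
  assumes [measurable]: "f \<in> borel_measurable borel"
    and "a \<le> b" and sq: "set_integrable lborel {a<..b} (\<lambda>t. (f t)\<^sup>2)"
  shows "(LINT t:{a<..b}|lborel. f t)\<^sup>2 \<le> (b - a) * (LINT t:{a<..b}|lborel. (f t)\<^sup>2)"
proof (cases "a = b")
  case True
  then show ?thesis by (simp add: set_lebesgue_integral_def)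
next
  case False
  then have l: "b - a > 0" using \<open>a \<le> b\<close> by simp
  have f: "set_integrable lborel {a<..b} f"
    by (rule set_integrable_of_square) (use sq \<open>a \<le> b\<close> in auto)
  define I where "I = (LINT t:{a<..b}|lborel. f t)"
  define Q where "Q = (LINT t:{a<..b}|lborel. (f t)\<^sup>2)"
  define c where "c = I / (b - a)"
  have ic: "set_integrable lborel {a<..b} (\<lambda>t. c\<^sup>2)"
    unfolding set_integrable_def using \<open>a \<le> b\<close> by simp
  have "0 \<le> (LINT t:{a<..b}|lborel. (f t - c)\<^sup>2)"
    by (rule set_integral_nonneg_real) simp
  also have "(LINT t:{a<..b}|lborel. (f t - c)\<^sup>2) = (LINT t:{a<..b}|lborel. ((f t)\<^sup>2 - 2 * c * f t) + c\<^sup>2)"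
    by (simp add: power2_diff algebra_simps)
  also have "\<dots> = (LINT t:{a<..b}|lborel. (f t)\<^sup>2 - 2 * c * f t) + (LINT t:{a<..b}|lborel. c\<^sup>2)"
    using f sq ic by (intro set_integral_add set_integral_diff) auto
  also have "(LINT t:{a<..b}|lborel. (f t)\<^sup>2 - 2 * c * f t) = Q - 2 * c * I"
    unfolding Q_def I_def using f sq by (subst set_integral_diff) auto
  also have "(LINT t:{a<..b}|lborel. c\<^sup>2) = c\<^sup>2 * (b - a)"
    unfolding set_lebesgue_integral_def using \<open>a \<le> b\<close> by simp
  also have "Q - 2 * c * I + c\<^sup>2 * (b - a) = Q - I\<^sup>2 / (b - a)"
  proof -
    have "c * (b - a) = I" using l by (simp add: c_def)
    then have "c\<^sup>2 * (b - a) = c * I" by (simp add: power2_eq_square)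
    moreover have "c * I = I\<^sup>2 / (b - a)" by (simp add: c_def power2_eq_square)
    ultimately show ?thesis by simp
  qed
  finally have "I\<^sup>2 / (b - a) \<le> Q" by simp
  then show ?thesis using l by (simp add: I_def Q_def field_simps)
qed

lemma L2_on_set_integrable_sq:
  assumes "L2_on T v" "0 \<le> s" "t \<le> T"
  shows "set_integrable lborel {s<..t} (\<lambda>t. (norm (v t))\<^sup>2)"
  by (rule set_integrable_subset[of _ "{0<..T}"]) (use assms in \<open>auto simp: L2_on_def\<close>)

lemma L2_on_subset: "L2_on T v \<Longrightarrow> t \<le> T \<Longrightarrow> L2_on t v"
  using L2_on_set_integrable_sq[of T v 0 t] by (simp add: L2_on_def)

lemma L2_on_set_integrable:
  fixes v :: "real \<Rightarrow> 'a::{banach, second_countable_topology}"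
  assumes "L2_on T v" "0 \<le> s" "t \<le> T"
  shows "set_integrable lborel {s<..t} v"
proof (rule set_integrable_of_square[OF _ _ _ L2_on_set_integrable_sq[OF assms]])
  show "emeasure lborel {s<..t} < \<infinity>"
    by (cases "s \<le> t") auto
qed (use assms in \<open>auto simp: L2_on_def\<close>)

lemma primitive_diff:
  fixes v :: "real \<Rightarrow> 'a::{banach, second_countable_topology}"
  assumes v: "L2_on T v" and st: "0 \<le> s" "s \<le> t" "t \<le> T"
  shows "primitive v t - primitive v s = (LINT u:{s<..t}|lborel. v u)"
proof -
  have "{0<..t} = {0<..s} \<union> {s<..t}" using st by auto
  then have "primitive v t = primitive v s + (LINT u:{s<..t}|lborel. v u)"
    unfolding primitive_def
    using set_integral_Un[of "{0<..s}" "{s<..t}" lborel v]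
      L2_on_set_integrable[OF v, of 0 s] L2_on_set_integrable[OF v, of s t] st by auto
  then show ?thesis by simp
qed

lemma norm_primitive_diff_le:
  fixes v :: "real \<Rightarrow> 'a::{banach, second_countable_topology}"
  assumes v: "L2_on T v" and st: "0 \<le> s" "s \<le> t" "t \<le> T"
  shows "norm (primitive v t - primitive v s) \<le> (LINT u:{s<..t}|lborel. norm (v u))"
    and "(norm (primitive v t - primitive v s))\<^sup>2 \<le> (t - s) * (LINT u:{s<..t}|lborel. (norm (v u))\<^sup>2)"
proof -
  show *: "norm (primitive v t - primitive v s) \<le> (LINT u:{s<..t}|lborel. norm (v u))"
    unfolding primitive_diff[OF assms]
    by (rule set_integral_norm_bound) (use L2_on_set_integrable[OF v] st in auto)
  have "(norm (primitive v t - primitive v s))\<^sup>2 \<le> (LINT u:{s<..t}|lborel. norm (v u))\<^sup>2"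
    using * by (intro power_mono) auto
  also have "\<dots> \<le> (t - s) * (LINT u:{s<..t}|lborel. (norm (v u))\<^sup>2)"
    using L2_on_set_integrable_sq[OF v, of s t] st v
    by (intro set_integral_square_le) (auto simp: L2_on_def)
  finally show "(norm (primitive v t - primitive v s))\<^sup>2 \<le> (t - s) * (LINT u:{s<..t}|lborel. (norm (v u))\<^sup>2)" .
qed

lemma primitive_0 [simp]: "primitive v 0 = 0"
  by (simp add: primitive_def set_lebesgue_integral_def)

lemma set_integral_sq_mono:
  assumes v: "L2_on T v" and st: "0 \<le> s" "t \<le> T"
  shows "(LINT u:{s<..t}|lborel. (norm (v u))\<^sup>2) \<le> (LINT u:{0<..T}|lborel. (norm (v u))\<^sup>2)"
  unfolding set_lebesgue_integral_def
  by (rule integral_mono)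
     (use v L2_on_set_integrable_sq[OF v st] st in \<open>auto simp: L2_on_def set_integrable_def split: split_indicator\<close>)

lemma continuous_of_Hoelder:
  fixes X :: "real \<Rightarrow> 'a::real_normed_vector"
  assumes "\<And>s t. s \<in> A \<Longrightarrow> t \<in> A \<Longrightarrow> s \<le> t \<Longrightarrow> (norm (X t - X s))\<^sup>2 \<le> (t - s) * B"
  shows "uniformly_continuous_on A X"
  unfolding uniformly_continuous_on_def
proof (intro allI impI)
  fix e :: real assume "e > 0"
  define d where "d = e\<^sup>2 / (\<bar>B\<bar> + 1)"
  have "d > 0" using \<open>e > 0\<close> by (simp add: d_def)
  have main: "norm (X t - X s) < e" if "s \<in> A" "t \<in> A" "s \<le> t" "t - s < d" for s t
  proof -
    have "(norm (X t - X s))\<^sup>2 \<le> (t - s) * B" using assms that by blast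
    also have "\<dots> \<le> (t - s) * (\<bar>B\<bar> + 1)" using that by (intro mult_left_mono) auto
    also have "\<dots> < d * (\<bar>B\<bar> + 1)" using that by (intro mult_strict_right_mono) auto
    also have "\<dots> = e\<^sup>2" by (simp add: d_def)
    finally show ?thesis using \<open>e > 0\<close> by (simp add: power2_less_imp_less)
  qed
  show "\<exists>d>0. \<forall>x\<in>A. \<forall>x'\<in>A. dist x' x < d \<longrightarrow> dist (X x') (X x) < e"
  proof (intro exI[of _ d] conjI ballI impI \<open>d > 0\<close>)
    fix x y assume "x \<in> A" "y \<in> A" "dist y x < d"
    then show "dist (X y) (X x) < e"
      using main[of x y] main[of y x] by (cases "x \<le> y") (auto simp: dist_norm norm_minus_commute)
  qed
qed

lemma uniformly_continuous_primitive:
  fixes v :: "real \<Rightarrow> 'a::{banach, second_countable_topology}"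
  assumes v: "L2_on T v"
  shows "uniformly_continuous_on {0..T} (primitive v)"
proof (rule continuous_of_Hoelder)
  fix s t assume st: "s \<in> {0..T}" "t \<in> {0..T}" "s \<le> t"
  then have "(norm (primitive v t - primitive v s))\<^sup>2 \<le> (t - s) * (LINT u:{s<..t}|lborel. (norm (v u))\<^sup>2)"
    by (intro norm_primitive_diff_le[OF v]) auto
  also have "\<dots> \<le> (t - s) * (LINT u:{0<..T}|lborel. (norm (v u))\<^sup>2)"
    using st by (intro mult_left_mono set_integral_sq_mono[OF v]) auto
  finally show "(norm (primitive v t - primitive v s))\<^sup>2 \<le> (t - s) * (LINT u:{0<..T}|lborel. (norm (v u))\<^sup>2)" .
qed

lemma continuous_primitive:
  fixes v :: "real \<Rightarrow> 'a::{banach, second_countable_topology}"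
  shows "L2_on T v \<Longrightarrow> continuous_on {0..T} (primitive v)"
  by (intro uniformly_continuous_imp_continuous uniformly_continuous_primitive)

text \<open>At a Lebesgue point \<open>t\<close> of \<open>v\<close> the difference quotient of the primitive differs from \<open>v t\<close> by
  at most the average of \<open>\<parallel>v - v t\<parallel>\<close>.\<close>

lemma AE_primitive_derivative:
  fixes v :: "real \<Rightarrow> 'a::{banach, second_countable_topology}"
  assumes v: "L2_on T v"
  shows "AE t in lborel. t \<in> {0<..<T} \<longrightarrow> (primitive v has_vector_derivative v t) (at t)"
proof -
  define w where "w t = indicator {0<..T} t *\<^sub>R v t" for t
  have "set_integrable lborel {0<..T} v" by (rule L2_on_set_integrable[OF v]) auto
  then have w: "integrable lborel w" by (simp add: set_integrable_def w_def[abs_def])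
  show ?thesis using AE_Lebesgue_point[OF w]
  proof eventually_elim
    fix t assume L: "((\<lambda>r. (LINT s:ball t r|lborel. norm (w s - w t)) / r) \<longlongrightarrow> 0) (at_right 0)"
    show "t \<in> {0<..<T} \<longrightarrow> (primitive v has_vector_derivative v t) (at t)"
    proof
      assume t: "t \<in> {0<..<T}"
      have dst: "norm (primitive v y - primitive v x - (y - x) *\<^sub>R v t) \<le> (LINT s:ball t r|lborel. norm (w s - w t))"
        if xy: "0 < x" "x \<le> y" "y < T" "{x<..y} \<subseteq> ball t r" "ball t r \<subseteq> {0<..T}" for x y r
      proof -
        have i1: "set_integrable lborel {x<..y} v" using L2_on_set_integrable[OF v, of x y] xy by auto
        have i2: "set_integrable lborel {x<..y} (\<lambda>_. v t)"
          using xy by (simp add: set_integrable_def)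
        have c: "(LINT u:{x<..y}|lborel. v t) = (y - x) *\<^sub>R v t"
          using xy by (simp add: set_lebesgue_integral_def)
        have "primitive v y - primitive v x - (y - x) *\<^sub>R v t = (LINT u:{x<..y}|lborel. v u - v t)"
          using xy primitive_diff[OF v, of x y] i1 i2 by (simp add: set_integral_diff c)
        also have "norm \<dots> \<le> (LINT u:{x<..y}|lborel. norm (v u - v t))"
          using i1 i2 by (intro set_integral_norm_bound set_integral_diff)
        also have "\<dots> = (LINT u:{x<..y}|lborel. norm (w u - w t))"
          using xy t by (intro set_lebesgue_integral_cong) (auto simp: w_def)
        also have "\<dots> \<le> (LINT s:ball t r|lborel. norm (w s - w t))"
        proof -
          have ib: "set_integrable lborel (ball t r) (\<lambda>s. norm (w s - w t))"
          proof -
            have "set_integrable lborel (ball t r) (\<lambda>s. w t)"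
              by (cases "r > 0") (auto simp: set_integrable_def ball_eq_greaterThanLessThan)
            then have "set_integrable lborel (ball t r) (\<lambda>s. w s - w t)"
              by (intro set_integral_diff set_integrable_of_integrable[OF w]) auto
            then show ?thesis by (rule set_integrable_norm)
          qed
          then have "set_integrable lborel {x<..y} (\<lambda>s. norm (w s - w t))"
            by (rule set_integrable_subset) (use xy in auto)
          with ib xy show ?thesis unfolding set_lebesgue_integral_def set_integrable_def
            by (intro integral_mono) (auto split: split_indicator)
        qed
        finally show ?thesis .
      qed
      show "(primitive v has_vector_derivative v t) (at t)"
        unfolding has_vector_derivative_def has_derivative_at'
      proof
        show "bounded_linear (\<lambda>x. x *\<^sub>R v t)" by (rule bounded_linear_scaleR_left)
        show "\<forall>e>0. \<exists>d>0. \<forall>y. 0 < norm (y - t) \<and> norm (y - t) < d \<longrightarrow>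
            norm (primitive v y - primitive v t - (y - t) *\<^sub>R v t) / norm (y - t) < e"
        proof (intro allI impI)
          fix e :: real assume "e > 0"
          then have "\<forall>\<^sub>F r in at_right 0. dist ((LINT s:ball t r|lborel. norm (w s - w t)) / r) 0 < e / 2"
            using L by (intro tendstoD) auto
          then obtain \<rho> where \<rho>: "\<rho> > 0" "\<And>r. 0 < r \<Longrightarrow> r < \<rho> \<Longrightarrow> dist ((LINT s:ball t r|lborel. norm (w s - w t)) / r) 0 < e / 2"
            by (auto simp: eventually_at_right_field)
          define \<delta> where "\<delta> = min \<rho> (min t (T - t)) / 2"
          have \<delta>: "\<delta> > 0" using \<rho> t by (auto simp: \<delta>_def)
          show "\<exists>d>0. \<forall>y. 0 < norm (y - t) \<and> norm (y - t) < d \<longrightarrow>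
              norm (primitive v y - primitive v t - (y - t) *\<^sub>R v t) / norm (y - t) < e"
          proof (intro exI[of _ \<delta>] conjI \<delta> allI impI)
            fix y assume y: "0 < norm (y - t) \<and> norm (y - t) < \<delta>"
            define r where "r = 2 * \<bar>y - t\<bar>"
            have r: "0 < r" "r < \<rho>" "r < t" "r < T - t" using y by (auto simp: r_def \<delta>_def dist_real_def)
            have bt: "ball t r \<subseteq> {0<..T}" using r by (auto simp: dist_real_def)
            have "norm (primitive v y - primitive v t - (y - t) *\<^sub>R v t) \<le> (LINT s:ball t r|lborel. norm (w s - w t))"
            proof (cases "t \<le> y")
              case True
              then have "{t<..y} \<subseteq> ball t r" using r by (auto simp: r_def dist_real_def)
              then have "norm (primitive v y - primitive v t - (y - t) *\<^sub>R v t) \<le> (LINT s:ball t r|lborel. norm (w s - w t))"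
                using t True r bt by (intro dst) (auto simp: r_def)
              then show ?thesis by (simp add: algebra_simps)
            next
              case False
              then have "{y<..t} \<subseteq> ball t r" using r by (auto simp: r_def dist_real_def)
              then have "norm (primitive v t - primitive v y - (t - y) *\<^sub>R v t) \<le> (LINT s:ball t r|lborel. norm (w s - w t))"
                using t False r bt by (intro dst) (auto simp: r_def)
              moreover have "primitive v y - primitive v t - (y - t) *\<^sub>R v t
                 = - (primitive v t - primitive v y - (t - y) *\<^sub>R v t)"
                by (simp add: algebra_simps)
              ultimately show ?thesis by (simp only: norm_minus_cancel)
            qed
            also have "(LINT s:ball t r|lborel. norm (w s - w t)) < e / 2 * r"
              using \<rho>(2)[OF r(1,2)] r(1) by (auto simp: abs_if field_simps split: if_splits)
            also have "e / 2 * r = e * \<bar>y - t\<bar>" by (simp add: r_def)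
            finally show "norm (primitive v y - primitive v t - (y - t) *\<^sub>R v t) / norm (y - t) < e"
              using y by (simp add: pos_divide_less_eq)
          qed
        qed
      qed
    qed
  qed
qed

lemma L2_on_diff:
  fixes v w :: "real \<Rightarrow> 'a::{real_inner, banach, second_countable_topology}"
  assumes v: "L2_on T v" and w: "L2_on T w"
  shows "L2_on T (\<lambda>t. v t - w t)"
proof -
  have [measurable]: "v \<in> borel_measurable borel" "w \<in> borel_measurable borel"
    using v w by (auto simp: L2_on_def)
  have i: "set_integrable lborel {0<..T} (\<lambda>t. 2 * (norm (v t))\<^sup>2 + 2 * (norm (w t))\<^sup>2)"
    using v w by (auto simp: L2_on_def)
  have le: "(norm (v t - w t))\<^sup>2 \<le> 2 * (norm (v t))\<^sup>2 + 2 * (norm (w t))\<^sup>2" for t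
    by (rule norm_diff_sq_le)
  have "set_integrable lborel {0<..T} (\<lambda>t. (norm (v t - w t))\<^sup>2)"
    by (rule set_integrable_bound[OF i])
       (use le in \<open>auto simp: set_borel_measurable_def intro!: AE_I2\<close>)
  then show ?thesis by (simp add: L2_on_def)
qed

lemma L2_on_scaleR:
  "L2_on T v \<Longrightarrow> L2_on T (\<lambda>t. c *\<^sub>R v t)" for v :: "real \<Rightarrow> 'a::{banach, second_countable_topology}"
  by (auto simp: L2_on_def power_mult_distrib)

lemma L2_on_add:
  fixes v w :: "real \<Rightarrow> 'a::{real_inner, banach, second_countable_topology}"
  assumes v: "L2_on T v" and w: "L2_on T w"
  shows "L2_on T (\<lambda>t. v t + w t)"
  using L2_on_diff[OF v L2_on_scaleR[OF w, of "-1"]] by simp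

lemma L2_on_bounded:
  fixes v :: "real \<Rightarrow> 'a::{banach, second_countable_topology}"
  assumes [measurable]: "v \<in> borel_measurable borel" and le: "\<And>t. 0 < t \<Longrightarrow> t \<le> T \<Longrightarrow> norm (v t) \<le> B"
  shows "L2_on T v"
proof -
  have "set_integrable lborel {0<..T} (\<lambda>t. B\<^sup>2)"
    unfolding set_integrable_def by (cases "0 \<le> T") auto
  then have "set_integrable lborel {0<..T} (\<lambda>t. (norm (v t))\<^sup>2)"
    by (rule set_integrable_bound)
       (use le in \<open>auto simp: set_borel_measurable_def intro!: AE_I2 power_mono\<close>)
  then show ?thesis by (simp add: L2_on_def)
qed

lemma L2_on_inner:
  fixes v w :: "real \<Rightarrow> 'a::{real_inner, banach, second_countable_topology}"
  assumes v: "L2_on T v" and w: "L2_on T w"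
  shows "set_integrable lborel {0<..T} (\<lambda>t. v t \<bullet> w t)"
proof -
  have [measurable]: "v \<in> borel_measurable borel" "w \<in> borel_measurable borel"
    using v w by (auto simp: L2_on_def)
  have i: "set_integrable lborel {0<..T} (\<lambda>t. (norm (v t))\<^sup>2 + (norm (w t))\<^sup>2)"
    using v w by (auto simp: L2_on_def)
  have le: "\<bar>v t \<bullet> w t\<bar> \<le> (norm (v t))\<^sup>2 + (norm (w t))\<^sup>2" for t
  proof -
    have "\<bar>v t \<bullet> w t\<bar> \<le> norm (v t) * norm (w t)" by (rule Cauchy_Schwarz_ineq2)
    moreover have "2 * norm (v t) * norm (w t) \<le> (norm (v t))\<^sup>2 + (norm (w t))\<^sup>2"
      by (rule sum_squares_bound)
    moreover have "0 \<le> norm (v t) * norm (w t)" by simp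
    ultimately show ?thesis by linarith
  qed
  show ?thesis
    by (rule set_integrable_bound[OF i])
       (use le in \<open>auto simp: set_borel_measurable_def intro!: AE_I2\<close>)
qed

lemma set_integral_inner_left:
  fixes v :: "real \<Rightarrow> 'a::{real_inner, banach, second_countable_topology}"
  assumes "set_integrable lborel A v"
  shows "(LINT t:A|lborel. v t \<bullet> c) = (LINT t:A|lborel. v t) \<bullet> c"
proof -
  have "(LINT t:A|lborel. v t \<bullet> c) = (LINT t|lborel. (indicator A t *\<^sub>R v t) \<bullet> c)"
    by (simp add: set_lebesgue_integral_def)
  also have "\<dots> = (LINT t:A|lborel. v t) \<bullet> c"
    unfolding set_lebesgue_integral_def
    by (rule integral_inner_left) (use assms in \<open>simp add: set_integrable_def\<close>)
  finally show ?thesis .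
qed

lemma set_integral_norm_le_sqrt:
  fixes v :: "real \<Rightarrow> 'a::{banach, second_countable_topology}"
  assumes v: "L2_on T v" and "T \<ge> 0"
  shows "(LINT t:{0<..T}|lborel. norm (v t)) \<le> sqrt (T * (LINT t:{0<..T}|lborel. (norm (v t))\<^sup>2))"
proof (rule real_le_rsqrt)
  show "(LINT t:{0<..T}|lborel. norm (v t))\<^sup>2 \<le> T * (LINT t:{0<..T}|lborel. (norm (v t))\<^sup>2)"
    using set_integral_square_le[of "\<lambda>t. norm (v t)" 0 T] v \<open>T \<ge> 0\<close> by (auto simp: L2_on_def)
qed

section \<open>Absolutely continuous curves in a Hilbert space\<close>

text \<open>The Radon--Nikodym property of Hilbert spaces, for curves with square integrable modulus. The
  difference quotients \<open>w n\<close> of \<open>X\<close> over the dyadic intervals of length \<open>T / 2 ^ n\<close> form a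
  martingale: for \<open>n \<le> m\<close>, the averages of \<open>w m\<close> over the intervals of level \<open>n\<close> are those of \<open>w n\<close>.
  Hence the increments are orthogonal, so that \<open>\<parallel>w m - w n\<parallel>\<^sup>2 = E m - E n\<close> for the energies
  \<open>E n = \<parallel>w n\<parallel>\<^sup>2\<close>. These increase and are bounded by \<open>\<integral> b\<^sup>2\<close>. So \<open>w\<close> is Cauchy in mean square, and
  the primitive of its limit agrees with \<open>X\<close> at the dyadic points, hence everywhere.\<close>

theorem Hilbert_AC_primitive:
  fixes X :: "real \<Rightarrow> 'a::{real_inner, banach, second_countable_topology}"
  assumes "T > 0" and b: "L2_on T b"
    and X: "\<And>s t. 0 \<le> s \<Longrightarrow> s \<le> t \<Longrightarrow> t \<le> T \<Longrightarrow> norm (X t - X s) \<le> (LINT u:{s<..t}|lborel. (b u :: real))"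
  obtains v where "L2_on T v" "\<And>t. 0 \<le> t \<Longrightarrow> t \<le> T \<Longrightarrow> X t = X 0 + primitive v t"
proof -
  define B where "B = (LINT u:{0<..T}|lborel. (b u)\<^sup>2)"
  define d where "d n = T / 2 ^ n" for n :: nat
  define p where "p n k = real k * d n" for n k
  define I where "I n k = {p n k<..p n (Suc k)}" for n k
  define \<Delta> where "\<Delta> n k = X (p n (Suc k)) - X (p n k)" for n k
  define c where "c n k = \<Delta> n k /\<^sub>R d n" for n k
  define w where "w n t = (\<Sum>k<2 ^ n. indicator (I n k) t *\<^sub>R c n k)" for n t
  have d: "d n > 0" for n using \<open>T > 0\<close> by (simp add: d_def)
  have p0: "p n 0 = 0" and pT: "p n (2 ^ n) = T" and pS: "p n (Suc k) = p n k + d n" for n k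
    by (auto simp: p_def d_def algebra_simps add_divide_distrib)
  have pmono: "p n k \<le> p n l" if "k \<le> l" for n k l
    using that d[of n] by (auto simp: p_def intro!: mult_right_mono)
  have p_ge0: "0 \<le> p n k" for n k using d[of n] by (simp add: p_def)
  have p_leT: "p n k \<le> T" if "k \<le> 2 ^ n" for n k using pmono[OF that, of n] pT[of n] by simp
  have Isub: "I n k \<subseteq> {0<..T}" if "k < 2 ^ n" for n k
    using p_ge0[of n k] p_leT[of "Suc k" n] that by (auto simp: I_def)
  have XX: "(norm (X t - X s))\<^sup>2 \<le> (t - s) * (LINT u:{s<..t}|lborel. (b u)\<^sup>2)"
    if "0 \<le> s" "s \<le> t" "t \<le> T" for s t
  proof -
    have "(norm (X t - X s))\<^sup>2 \<le> (LINT u:{s<..t}|lborel. b u)\<^sup>2"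
      using X[OF that] by (intro power_mono) auto
    also have "\<dots> \<le> (t - s) * (LINT u:{s<..t}|lborel. (b u)\<^sup>2)"
      using L2_on_set_integrable_sq[OF b, of s t] b that
      by (intro set_integral_square_le) (auto simp: L2_on_def)
    finally show ?thesis .
  qed
  have wI: "w n t = c n j" if "j < 2 ^ n" "t \<in> I n j" for n j t
  proof -
    have uniq: "indicator (I n k) t *\<^sub>R c n k = (if k = j then c n j else 0)" for k
    proof -
      have "t \<notin> I n k" if "k \<noteq> j"
      proof (cases "k < j")
        case True
        then show ?thesis using pmono[of "Suc k" j n] \<open>t \<in> I n j\<close> by (auto simp: I_def)
      next
        case False
        then show ?thesis using pmono[of "Suc j" k n] \<open>t \<in> I n j\<close> that by (auto simp: I_def)
      qed
      then show ?thesis using \<open>t \<in> I n j\<close> by auto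
    qed
    show ?thesis unfolding w_def uniq using that by simp
  qed
  have w_meas[measurable]: "w n \<in> borel_measurable borel" for n
    unfolding w_def I_def by measurable
  have wL2: "L2_on T (w n)" for n
  proof (rule L2_on_bounded[OF w_meas])
    fix t show "norm (w n t) \<le> (\<Sum>k<2 ^ n. norm (c n k))"
      unfolding w_def by (rule order_trans[OF norm_sum]) (intro sum_mono, auto simp: indicator_def)
  qed
  have split: "(LINT u:{0<..p n k}|lborel. g u) = (\<Sum>j<k. LINT u:I n j|lborel. g u)"
    if g: "set_integrable lborel {0<..T} g" and "k \<le> 2 ^ n"
    for g :: "real \<Rightarrow> 'c::{banach, second_countable_topology}" and n k
    using \<open>k \<le> 2 ^ n\<close>
  proof (induction k)
    case 0
    show ?case by (simp add: p0 set_lebesgue_integral_def)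
  next
    case (Suc k)
    have eq: "{0<..p n (Suc k)} = {0<..p n k} \<union> I n k"
      using p_ge0[of n k] pmono[of k "Suc k" n] by (auto simp: I_def)
    have "set_integrable lborel {0<..p n k} g" "set_integrable lborel (I n k) g"
      using Suc Isub[of k n] p_leT[of k n]
      by (auto intro!: set_integrable_subset[OF g] simp: I_def)
    then have "(LINT u:{0<..p n (Suc k)}|lborel. g u) = (LINT u:{0<..p n k}|lborel. g u) + (LINT u:I n k|lborel. g u)"
      unfolding eq by (intro set_integral_Un) (auto simp: I_def)
    then show ?case using Suc by simp
  qed
  have Iint: "(LINT u:I n j|lborel. w n u) = \<Delta> n j" if "j < 2 ^ n" for n j
  proof -
    have "(LINT u:I n j|lborel. w n u) = (LINT u:I n j|lborel. c n j)"
      using wI[OF that] by (intro set_lebesgue_integral_cong) (auto simp: I_def)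
    also have "\<dots> = d n *\<^sub>R c n j"
      using d[of n] by (simp add: set_lebesgue_integral_def I_def pS)
    also have "\<dots> = \<Delta> n j" using d[of n] by (simp add: c_def)
    finally show ?thesis .
  qed
  have Wp: "primitive (w n) (p n k) = X (p n k) - X 0" if "k \<le> 2 ^ n" for n k
  proof -
    have "set_integrable lborel {0<..T} (w n)" by (rule L2_on_set_integrable[OF wL2]) auto
    then have "primitive (w n) (p n k) = (\<Sum>j<k. LINT u:I n j|lborel. w n u)"
      unfolding primitive_def by (rule split) (rule that)
    also have "\<dots> = (\<Sum>j<k. X (p n (Suc j)) - X (p n j))"
      using that by (intro sum.cong) (auto simp: Iint \<Delta>_def)
    also have "\<dots> = X (p n k) - X (p n 0)" by (rule sum_lessThan_telescope)
    finally show ?thesis by (simp add: p0)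
  qed
  have Iint': "(LINT u:I n j|lborel. w m u) = \<Delta> n j" if "j < 2 ^ n" "n \<le> m" for n m j
  proof -
    have pp: "p n k = p m (k * 2 ^ (m - n))" for k
      using that(2) by (simp add: p_def d_def field_simps flip: power_add)
    have le: "k * 2 ^ (m - n) \<le> 2 ^ m" if "k \<le> 2 ^ n" for k :: nat
    proof -
      have "k * 2 ^ (m - n) \<le> 2 ^ n * 2 ^ (m - n)" using that by (rule mult_right_mono) simp
      then show ?thesis using \<open>n \<le> m\<close> by (simp flip: power_add)
    qed
    have "(LINT u:I n j|lborel. w m u) = primitive (w m) (p n (Suc j)) - primitive (w m) (p n j)"
      unfolding I_def using that p_ge0 p_leT[of "Suc j" n] pmono[of j "Suc j" n]
      by (intro primitive_diff[symmetric, OF wL2]) auto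
    also have "\<dots> = \<Delta> n j"
      unfolding pp using that le[of "Suc j"] le[of j] by (simp add: Wp \<Delta>_def pp)
    finally show ?thesis .
  qed
  define E where "E n = (LINT u:{0<..T}|lborel. w n u \<bullet> w n u)" for n
  have cross: "(LINT u:{0<..T}|lborel. w m u \<bullet> w n u) = (\<Sum>j<2 ^ n. \<Delta> n j \<bullet> c n j)" if "n \<le> m" for n m
  proof -
    have "(LINT u:{0<..p n (2 ^ n)}|lborel. w m u \<bullet> w n u) = (\<Sum>j<2 ^ n. LINT u:I n j|lborel. w m u \<bullet> w n u)"
      by (rule split[OF L2_on_inner[OF wL2 wL2]]) simp
    also have "\<dots> = (\<Sum>j<2 ^ n. \<Delta> n j \<bullet> c n j)"
    proof (rule sum.cong[OF refl])
      fix j assume "j \<in> {..<(2::nat) ^ n}"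
      then have j: "j < 2 ^ n" by simp
      have "(LINT u:I n j|lborel. w m u \<bullet> w n u) = (LINT u:I n j|lborel. w m u \<bullet> c n j)"
        using wI[OF j] by (intro set_lebesgue_integral_cong) (auto simp: I_def)
      also have "\<dots> = (LINT u:I n j|lborel. w m u) \<bullet> c n j"
      proof (rule set_integral_inner_left)
        have "set_integrable lborel {0<..T} (w m)" by (rule L2_on_set_integrable[OF wL2]) auto
        then show "set_integrable lborel (I n j) (w m)"
          by (rule set_integrable_subset[OF _ _ Isub[OF j]]) (simp add: I_def)
      qed
      finally show "(LINT u:I n j|lborel. w m u \<bullet> w n u) = \<Delta> n j \<bullet> c n j"
        using Iint'[OF j that] by simp
    qed
    finally show ?thesis by (simp add: pT)
  qed
  have E_eq: "E n = (\<Sum>j<2 ^ n. \<Delta> n j \<bullet> c n j)" for n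
    unfolding E_def by (rule cross) simp
  have E_le: "E n \<le> B" for n
  proof -
    have "E n \<le> (\<Sum>j<2 ^ n. LINT u:I n j|lborel. (b u)\<^sup>2)"
      unfolding E_eq
    proof (rule sum_mono)
      fix j assume "j \<in> {..<(2::nat) ^ n}"
      then have "(norm (\<Delta> n j))\<^sup>2 \<le> (p n (Suc j) - p n j) * (LINT u:I n j|lborel. (b u)\<^sup>2)"
        unfolding \<Delta>_def I_def using p_ge0 p_leT[of "Suc j" n] pmono[of j "Suc j" n]
        by (intro XX) auto
      then show "\<Delta> n j \<bullet> c n j \<le> (LINT u:I n j|lborel. (b u)\<^sup>2)"
        using d[of n] by (simp add: c_def pS power2_norm_eq_inner field_simps)
    qed
    also have "\<dots> = (LINT u:{0<..p n (2 ^ n)}|lborel. (b u)\<^sup>2)"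
      using b by (intro split[symmetric]) (auto simp: L2_on_def)
    finally show ?thesis by (simp add: pT B_def)
  qed
  have orth: "(LINT u:{0<..T}|lborel. (norm (w m u - w n u))\<^sup>2) = E m - E n" if "n \<le> m" for n m
  proof -
    have i: "set_integrable lborel {0<..T} (\<lambda>u. w k u \<bullet> w l u)" for k l
      by (rule L2_on_inner[OF wL2 wL2])
    have "(LINT u:{0<..T}|lborel. (norm (w m u - w n u))\<^sup>2)
      = (LINT u:{0<..T}|lborel. (w m u \<bullet> w m u - 2 * (w m u \<bullet> w n u)) + w n u \<bullet> w n u)"
      by (simp add: power2_norm_eq_inner inner_diff_left inner_diff_right inner_commute algebra_simps)
    also have "\<dots> = (LINT u:{0<..T}|lborel. w m u \<bullet> w m u - 2 * (w m u \<bullet> w n u)) + E n"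
      unfolding E_def by (intro set_integral_add set_integral_diff set_integrable_mult_right i)
    also have "(LINT u:{0<..T}|lborel. w m u \<bullet> w m u - 2 * (w m u \<bullet> w n u))
       = E m - 2 * (LINT u:{0<..T}|lborel. w m u \<bullet> w n u)"
      unfolding E_def using i by (subst set_integral_diff) auto
    also have "(LINT u:{0<..T}|lborel. w m u \<bullet> w n u) = E n"
      using cross[OF that] E_eq by simp
    finally show ?thesis by simp
  qed
  have "incseq E"
  proof (rule incseq_SucI)
    fix n
    have "0 \<le> (LINT u:{0<..T}|lborel. (norm (w (Suc n) u - w n u))\<^sup>2)"
      by (rule set_integral_nonneg_real) simp
    then show "E n \<le> E (Suc n)" using orth[of n "Suc n"] by simp
  qed
  then obtain l where "E \<longlonglongrightarrow> l" using incseq_convergent[of E B] E_le by blast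
  then have "Cauchy E" by (rule LIMSEQ_imp_Cauchy)
  define R where "R = restrict_space lborel {0<..T}"
  have Rint: "(LINT u|R. f u) = (LINT u:{0<..T}|lborel. f u)"
    and Rintegrable: "integrable R f \<longleftrightarrow> set_integrable lborel {0<..T} f"
    for f :: "real \<Rightarrow> real"
    unfolding R_def set_lebesgue_integral_def set_integrable_def
    by (simp_all add: integral_restrict_space integrable_restrict_space)
  have finR: "finite_measure R"
    unfolding R_def using \<open>T > 0\<close>
    by (intro finite_measureI) (auto simp: emeasure_restrict_space space_restrict_space)
  have wR: "w n \<in> borel_measurable R" for n
    unfolding R_def by (intro measurable_restrict_space1) simp
  have wRint: "integrable R (\<lambda>u. (norm (w n u))\<^sup>2)" for n
    unfolding Rintegrable using wL2 by (auto simp: L2_on_def)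
  obtain g where g: "g \<in> borel_measurable R" "integrable R (\<lambda>x. (norm (g x))\<^sup>2)"
    "(\<lambda>n. LINT x|R. (norm (w n x - g x))\<^sup>2) \<longlonglongrightarrow> 0"
  proof (rule L2_Cauchy_converges[OF finR wR wRint])
    fix e :: real assume "e > 0"
    then obtain N where N: "\<And>m n. m \<ge> N \<Longrightarrow> n \<ge> N \<Longrightarrow> norm (E m - E n) < e"
      using \<open>Cauchy E\<close> CauchyD by blast
    have "(LINT x|R. (norm (w m x - w n x))\<^sup>2) < e" if "m \<ge> N" "n \<ge> N" for m n
    proof (cases "n \<le> m")
      case True
      then show ?thesis unfolding Rint using orth[OF True] N[OF that] by simp
    next
      case False
      then show ?thesis unfolding Rint using orth[of m n] N[OF that] by (simp add: norm_minus_commute)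
    qed
    then show "\<exists>N. \<forall>m\<ge>N. \<forall>n\<ge>N. (LINT x|R. (norm (w m x - w n x))\<^sup>2) < e" by blast
  qed
  define v where "v t = indicator {0<..T} t *\<^sub>R g t" for t
  have v_meas: "v \<in> borel_measurable borel"
    using g(1) unfolding R_def v_def[abs_def] by (simp add: borel_measurable_restrict_space_iff)
  have "set_integrable lborel {0<..T} (\<lambda>x. (norm (v x))\<^sup>2) = set_integrable lborel {0<..T} (\<lambda>x. (norm (g x))\<^sup>2)"
    by (intro set_integrable_cong) (auto simp: v_def)
  then have vL2: "L2_on T v" using v_meas g(2) by (simp add: L2_on_def Rintegrable)
  have lim: "(\<lambda>n. LINT u:{0<..T}|lborel. (norm (w n u - v u))\<^sup>2) \<longlonglongrightarrow> 0"
  proof -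
    have "(LINT u:{0<..T}|lborel. (norm (w n u - v u))\<^sup>2) = (LINT u:{0<..T}|lborel. (norm (w n u - g u))\<^sup>2)" for n
      by (intro set_lebesgue_integral_cong) (auto simp: v_def)
    then show ?thesis using g(3) by (simp add: Rint)
  qed
  have lim1: "(\<lambda>n. LINT u:{0<..T}|lborel. norm (w n u - v u)) \<longlonglongrightarrow> 0"
  proof (rule tendsto_sandwich)
    show "\<forall>\<^sub>F n in sequentially. (LINT u:{0<..T}|lborel. norm (w n u - v u))
        \<le> sqrt (T * (LINT u:{0<..T}|lborel. (norm (w n u - v u))\<^sup>2))"
      using set_integral_norm_le_sqrt[OF L2_on_diff[OF wL2 vL2]] \<open>T > 0\<close> by simp
    show "\<forall>\<^sub>F n in sequentially. 0 \<le> (LINT u:{0<..T}|lborel. norm (w n u - v u))"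
      by (intro always_eventually allI set_integral_nonneg_real) simp
    have "(\<lambda>n. sqrt (T * (LINT u:{0<..T}|lborel. (norm (w n u - v u))\<^sup>2))) \<longlonglongrightarrow> sqrt (T * 0)"
      by (intro tendsto_intros lim)
    then show "(\<lambda>n. sqrt (T * (LINT u:{0<..T}|lborel. (norm (w n u - v u))\<^sup>2))) \<longlonglongrightarrow> 0" by simp
  qed simp
  have Xc: "continuous_on {0..T} X"
  proof (rule uniformly_continuous_imp_continuous[OF continuous_of_Hoelder])
    fix s t assume st: "s \<in> {0..T}" "t \<in> {0..T}" "s \<le> t"
    have "(norm (X t - X s))\<^sup>2 \<le> (t - s) * (LINT u:{s<..t}|lborel. (b u)\<^sup>2)"
      using st by (intro XX) auto
    also have "\<dots> \<le> (t - s) * B"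
      unfolding B_def using set_integral_sq_mono[OF b, of s t] st by (intro mult_left_mono) auto
    finally show "(norm (X t - X s))\<^sup>2 \<le> (t - s) * B" .
  qed
  show thesis
  proof (rule that[OF vL2])
    fix t assume t: "0 \<le> t" "t \<le> T"
    \<comment> \<open>\<open>a n\<close> is the largest dyadic point of level \<open>n\<close> that does not exceed \<open>t\<close>.\<close>
    define k where "k n = nat \<lfloor>t / d n\<rfloor>" for n
    define a where "a n = p n (k n)" for n
    have kn: "real (k n) \<le> t / d n" "t / d n < real (k n) + 1" for n
      using t d[of n] by (auto simp: k_def)
    have a_le: "a n \<le> t" and a_gt: "t < a n + d n" for n
      using kn[of n] d[of n] by (auto simp: a_def p_def field_simps)
    have k_le: "k n \<le> 2 ^ n" for n
    proof -
      have "t / d n \<le> T / d n" using t d[of n] by (intro divide_right_mono) auto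
      also have "\<dots> = 2 ^ n" using \<open>T > 0\<close> by (simp add: d_def)
      finally have "real (k n) \<le> 2 ^ n" using kn(1)[of n] by linarith
      then show ?thesis by (simp flip: of_nat_le_iff)
    qed
    have a0: "0 \<le> a n" for n by (simp add: a_def p_ge0)
    have "d \<longlonglongrightarrow> 0"
      unfolding d_def by (rule LIMSEQ_divide_realpow_zero) simp
    then have "(\<lambda>n. t - d n) \<longlonglongrightarrow> t - 0" by (intro tendsto_intros)
    then have at: "a \<longlonglongrightarrow> t"
      by (intro tendsto_sandwich[of "\<lambda>n. t - d n" a sequentially "\<lambda>n. t" t])
         (use a_le a_gt less_imp_le in \<open>auto intro!: always_eventually simp: algebra_simps\<close>)
    have aT: "a n \<le> T" for n using a_le[of n] t by linarith
    have c1: "(\<lambda>n. X (a n)) \<longlonglongrightarrow> X t"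
      by (rule continuous_on_tendsto_compose[OF Xc at]) (use t aT a0 in auto)
    have c2: "(\<lambda>n. primitive v (a n)) \<longlonglongrightarrow> primitive v t"
      by (rule continuous_on_tendsto_compose[OF continuous_primitive[OF vL2] at]) (use t aT a0 in auto)
    have "(\<lambda>n. (X (a n) - X 0) - primitive v (a n)) \<longlonglongrightarrow> 0"
    proof (rule Lim_null_comparison[OF _ lim1])
      show "\<forall>\<^sub>F n in sequentially. norm ((X (a n) - X 0) - primitive v (a n)) \<le> (LINT u:{0<..T}|lborel. norm (w n u - v u))"
      proof (intro always_eventually allI)
        fix n
        have iw: "set_integrable lborel {0<..a n} (w n)" "set_integrable lborel {0<..a n} v"
          using L2_on_set_integrable[OF wL2, of 0 "a n" n] L2_on_set_integrable[OF vL2, of 0 "a n"] aT by auto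
        have id: "set_integrable lborel {0<..T} (\<lambda>u. w n u - v u)"
          by (rule L2_on_set_integrable[OF L2_on_diff[OF wL2 vL2]]) auto
        have "(X (a n) - X 0) - primitive v (a n) = (LINT u:{0<..a n}|lborel. w n u - v u)"
          using Wp[OF k_le[of n]] iw by (simp add: a_def primitive_def set_integral_diff)
        also have "norm \<dots> \<le> (LINT u:{0<..a n}|lborel. norm (w n u - v u))"
          using iw by (intro set_integral_norm_bound set_integral_diff)
        also have "\<dots> \<le> (LINT u:{0<..T}|lborel. norm (w n u - v u))"
          unfolding set_lebesgue_integral_def
        proof (rule integral_mono)
          show "integrable lborel (\<lambda>x. indicator {0<..a n} x *\<^sub>R norm (w n x - v x))"
            using set_integrable_norm[OF set_integral_diff(1)[OF iw]] by (simp add: set_integrable_def)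
          show "integrable lborel (\<lambda>x. indicator {0<..T} x *\<^sub>R norm (w n x - v x))"
            using set_integrable_norm[OF id] by (simp add: set_integrable_def)
        qed (use aT[of n] in \<open>auto split: split_indicator\<close>)
        finally show "norm ((X (a n) - X 0) - primitive v (a n)) \<le> (LINT u:{0<..T}|lborel. norm (w n u - v u))" .
      qed
    qed
    moreover have "(\<lambda>n. (X (a n) - X 0) - primitive v (a n)) \<longlonglongrightarrow> (X t - X 0) - primitive v t"
      by (intro tendsto_intros c1 c2)
    ultimately have "(X t - X 0) - primitive v t = 0" using LIMSEQ_unique by blast
    then show "X t = X 0 + primitive v t" by (simp add: algebra_simps)
  qed
qed

lemma lebesgue_on_interval_integral:
  fixes b :: "real \<Rightarrow> real"
  assumes "b \<in> borel_measurable borel"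
  shows "(LINT u|lebesgue_on {s..t}. b u) = (LINT u:{s<..t}|lborel. b u)"
proof -
  have "(LINT u|lebesgue_on {s..t}. b u) = (LINT u|lebesgue. indicator {s..t} u *\<^sub>R b u)"
    by (rule integral_restrict_space) simp
  also have "\<dots> = (LINT u|lborel. indicator {s..t} u *\<^sub>R b u)"
    using assms by (intro integral_completion) measurable
  also have "\<dots> = (LINT u|lborel. indicator {s<..t} u *\<^sub>R b u)"
  proof (rule integral_cong_AE)
    have "AE u in lborel. u \<noteq> s" by (rule AE_lborel_singleton)
    then show "AE u in lborel. indicator {s..t} u *\<^sub>R b u = indicator {s<..t} u *\<^sub>R b u"
      by eventually_elim (auto simp: indicator_def)
  qed (use assms in measurable)
  finally show ?thesis by (simp add: set_lebesgue_integral_def)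
qed

text \<open>The modulus is replaced by a Borel one, and the curve is extended continuously to the closed
  interval, where \<open>Hilbert_AC_primitive\<close> applies.\<close>

theorem AC2_imp_primitive:
  fixes x :: "real \<Rightarrow> 'a::{real_inner, banach, second_countable_topology}"
  assumes "T > 0" and x: "x \<in> AC2 T" and M: "(x \<longlongrightarrow> M) (at_right 0)"
  obtains v where "L2_on T v" "\<And>t. 0 < t \<Longrightarrow> t < T \<Longrightarrow> x t = M + primitive v t"
proof -
  obtain \<beta> :: "real \<Rightarrow> real" where \<beta>: "\<beta> \<in> borel_measurable (lebesgue_on {0<..<T})"
    "integrable (lebesgue_on {0<..<T}) (\<lambda>u. (\<beta> u)\<^sup>2)"
    "\<And>s t. 0 < s \<Longrightarrow> s < t \<Longrightarrow> t < T \<Longrightarrow> norm (x t - x s) \<le> (LINT u|lebesgue_on {s..t}. \<beta> u)"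
    using x unfolding AC2_def by blast
  have "(\<lambda>u. indicator {0<..<T} u *\<^sub>R \<beta> u) \<in> borel_measurable lebesgue"
    using \<beta>(1) by (subst (asm) borel_measurable_restrict_space_iff) auto
  then obtain b0 where b0: "b0 \<in> borel_measurable lborel"
    "AE u in lborel. indicator {0<..<T} u *\<^sub>R \<beta> u = b0 u"
    using completion_ex_borel_measurable_real by blast
  define b where "b u = \<bar>b0 u\<bar>" for u
  have b[measurable]: "b \<in> borel_measurable borel" using b0(1) unfolding b_def[abs_def] by simp
  have b_abs: "AE u in lborel. u \<in> {0<..<T} \<longrightarrow> \<bar>\<beta> u\<bar> = b u"
    using b0(2) by eventually_elim (auto simp: b_def)
  have bL2: "L2_on T b"
  proof -
    have i: "integrable lebesgue (\<lambda>u. indicator {0<..<T} u *\<^sub>R (\<beta> u)\<^sup>2)"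
      using \<beta>(2) by (subst (asm) integrable_restrict_space) auto
    have ae: "AE u in lebesgue. indicator {0<..<T} u *\<^sub>R (\<beta> u)\<^sup>2 = indicator {0<..T} u *\<^sub>R (b u)\<^sup>2"
    proof -
      have "AE u in lborel. u \<noteq> T" by (rule AE_lborel_singleton)
      then have "AE u in lborel. indicator {0<..<T} u *\<^sub>R (\<beta> u)\<^sup>2 = indicator {0<..T} u *\<^sub>R (b u)\<^sup>2"
        using b_abs
      proof eventually_elim
        fix u assume u: "u \<noteq> T" "u \<in> {0<..<T} \<longrightarrow> \<bar>\<beta> u\<bar> = b u"
        show "indicator {0<..<T} u *\<^sub>R (\<beta> u)\<^sup>2 = indicator {0<..T} u *\<^sub>R (b u)\<^sup>2"
        proof (cases "u \<in> {0<..<T}")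
          case True
          then have "(\<beta> u)\<^sup>2 = (b u)\<^sup>2" using u(2) power2_abs[of "\<beta> u"] by simp
          then show ?thesis using True by simp
        next
          case False
          then show ?thesis using u(1) by (auto simp: indicator_def)
        qed
      qed
      then show ?thesis by (simp add: AE_completion_iff)
    qed
    have m: "(\<lambda>u. indicator {0<..T} u *\<^sub>R (b u)\<^sup>2) \<in> borel_measurable lebesgue"
      by (intro measurable_completion) measurable
    have "integrable lebesgue (\<lambda>u. indicator {0<..T} u *\<^sub>R (b u)\<^sup>2)"
      by (rule integrable_cong_AE_imp[OF i m ae])
    then have "integrable lborel (\<lambda>u. indicator {0<..T} u *\<^sub>R (b u)\<^sup>2)"
      by (subst (asm) integrable_completion) measurable
    then show ?thesis by (simp add: L2_on_def set_integrable_def)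
  qed
  have xb: "norm (x t - x s) \<le> primitive b t - primitive b s" if st: "0 < s" "s \<le> t" "t < T" for s t
  proof (cases "s = t")
    case False
    then have "s < t" using st by simp
    have sub: "u \<in> {s..t} \<Longrightarrow> u \<in> {0<..<T}" for u using st by auto
    have ib: "integrable (lebesgue_on {s..t}) b"
    proof -
      have "set_integrable lborel {s<..t} b" using L2_on_set_integrable[OF bL2, of s t] st by simp
      then have i: "integrable lborel (\<lambda>u. indicator {s<..t} u *\<^sub>R b u)" by (simp add: set_integrable_def)
      have ae: "AE u in lborel. indicator {s<..t} u *\<^sub>R b u = indicator {s..t} u *\<^sub>R b u"
        using AE_lborel_singleton[of s] by eventually_elim (auto simp: indicator_def)
      have m: "(\<lambda>u. indicator {s..t} u *\<^sub>R b u) \<in> borel_measurable lborel" by measurable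
      have "integrable lborel (\<lambda>u. indicator {s..t} u *\<^sub>R b u)"
        by (rule integrable_cong_AE_imp[OF i m ae])
      then have "integrable lebesgue (\<lambda>u. indicator {s..t} u *\<^sub>R b u)"
        by (subst integrable_completion) measurable
      then show ?thesis by (subst integrable_restrict_space) auto
    qed
    have "norm (x t - x s) \<le> (LINT u|lebesgue_on {s..t}. \<beta> u)"
      using \<beta>(3) st \<open>s < t\<close> by blast
    also have "\<dots> \<le> (LINT u|lebesgue_on {s..t}. b u)"
    proof (rule integral_mono_AE')
      show "integrable (lebesgue_on {s..t}) b" by (rule ib)
      have "AE u in lborel. u \<in> {s..t} \<longrightarrow> \<beta> u \<le> b u"
        using b_abs
      proof eventually_elim
        fix u assume u: "u \<in> {0<..<T} \<longrightarrow> \<bar>\<beta> u\<bar> = b u"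
        show "u \<in> {s..t} \<longrightarrow> \<beta> u \<le> b u"
        proof
          assume "u \<in> {s..t}"
          then have "\<bar>\<beta> u\<bar> = b u" using u sub by blast
          then show "\<beta> u \<le> b u" by linarith
        qed
      qed
      moreover have "AE u in lborel. u \<in> {s..t} \<longrightarrow> 0 \<le> b u"
        by (simp add: b_def)
      ultimately have "AE u in lebesgue. u \<in> {s..t} \<longrightarrow> \<beta> u \<le> b u" "AE u in lebesgue. u \<in> {s..t} \<longrightarrow> 0 \<le> b u"
        by (simp_all add: AE_completion_iff)
      then show "AE u in lebesgue_on {s..t}. \<beta> u \<le> b u" "AE u in lebesgue_on {s..t}. 0 \<le> b u"
        by (simp_all add: AE_restrict_space_iff)
    qed
    also have "\<dots> = primitive b t - primitive b s"
      using primitive_diff[OF bL2, of s t] st by (simp add: lebesgue_on_interval_integral)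
    finally show ?thesis .
  qed simp
  have ucx: "uniformly_continuous_on {0<..<T} x"
    unfolding uniformly_continuous_on_def
  proof (intro allI impI)
    fix e :: real assume "e > 0"
    from uniformly_continuous_primitive[OF bL2, unfolded uniformly_continuous_on_def, rule_format, OF this]
    obtain d where d: "d > 0"
      "\<forall>s\<in>{0..T}. \<forall>t\<in>{0..T}. dist t s < d \<longrightarrow> dist (primitive b t) (primitive b s) < e"
      by (elim exE conjE)
    show "\<exists>d>0. \<forall>s\<in>{0<..<T}. \<forall>t\<in>{0<..<T}. dist t s < d \<longrightarrow> dist (x t) (x s) < e"
    proof (intro exI[of _ d] conjI d(1) ballI impI)
      fix s t assume st: "s \<in> {0<..<T}" "t \<in> {0<..<T}" "dist t s < d"
      have D: "dist (primitive b t) (primitive b s) < e" using st by (intro d(2)[rule_format]) auto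
      show "dist (x t) (x s) < e"
      proof (cases "s \<le> t")
        case True
        then show ?thesis using xb[of s t] st D by (auto simp: dist_norm)
      next
        case False
        then show ?thesis using xb[of t s] st D by (auto simp: dist_norm norm_minus_commute)
      qed
    qed
  qed
  obtain X where X: "uniformly_continuous_on (closure {0<..<T}) X" "\<And>t. t \<in> {0<..<T} \<Longrightarrow> x t = X t"
  proof (rule uniformly_continuous_on_extension_on_closure[OF ucx])
    fix g assume "uniformly_continuous_on (closure {0<..<T}) g" "\<And>t. t \<in> {0<..<T} \<Longrightarrow> x t = g t"
    then show thesis by (rule that)
  qed
  have clos: "closure {0<..<T} = {0..T}" using \<open>T > 0\<close> by simp
  have Xc: "continuous_on {0..T} X" by (rule uniformly_continuous_imp_continuous[OF X(1)[unfolded clos]])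
  have bc: "continuous_on {0..T} (primitive b)" by (rule continuous_primitive[OF bL2])
  have XX: "norm (X t - X s) \<le> primitive b t - primitive b s" if st: "0 \<le> s" "s \<le> t" "t \<le> T" for s t
  proof (cases "s = t")
    case False
    \<comment> \<open>Approach a possibly terminal \<open>s\<close> or \<open>t\<close> from inside; \<open>\<theta> n \<le> (t - s) / 3\<close> keeps the two points in order.\<close>
    define \<theta> where "\<theta> n = (t - s) * inverse (real (Suc (Suc (Suc n))))" for n :: nat
    have "(\<lambda>n. (t - s) * inverse (real (Suc (Suc (Suc n))))) \<longlonglongrightarrow> (t - s) * 0"
      by (intro tendsto_intros LIMSEQ_Suc[OF LIMSEQ_Suc[OF LIMSEQ_inverse_real_of_nat]])
    then have \<theta>0: "\<theta> \<longlonglongrightarrow> 0" by (simp add: \<theta>_def[abs_def])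
    have \<theta>: "0 < \<theta> n" "2 * \<theta> n < t - s" for n
    proof -
      show "0 < \<theta> n" using st False by (simp add: \<theta>_def)
      have "\<theta> n \<le> (t - s) * inverse 3"
        unfolding \<theta>_def using st by (intro mult_left_mono le_imp_inverse_le) auto
      then show "2 * \<theta> n < t - s" using st False by simp
    qed
    have s': "(\<lambda>n. s + \<theta> n) \<longlonglongrightarrow> s" using tendsto_add[OF tendsto_const \<theta>0, of s] by simp
    have t': "(\<lambda>n. t - \<theta> n) \<longlonglongrightarrow> t" using tendsto_diff[OF tendsto_const \<theta>0, of t] by simp
    have ins: "s + \<theta> n \<in> {0..T}" "t - \<theta> n \<in> {0..T}" "s + \<theta> n \<in> {0<..<T}" "t - \<theta> n \<in> {0<..<T}" "s + \<theta> n \<le> t - \<theta> n" for n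
      using \<theta>[of n] st by auto
    have stT: "s \<in> {0..T}" "t \<in> {0..T}" using st by auto
    have "(\<lambda>n. norm (X (t - \<theta> n) - X (s + \<theta> n))) \<longlonglongrightarrow> norm (X t - X s)"
      by (intro tendsto_norm tendsto_diff continuous_on_tendsto_compose[OF Xc t' stT(2)]
          continuous_on_tendsto_compose[OF Xc s' stT(1)] always_eventually allI ins)
    moreover have "(\<lambda>n. primitive b (t - \<theta> n) - primitive b (s + \<theta> n)) \<longlonglongrightarrow> primitive b t - primitive b s"
      by (intro tendsto_diff continuous_on_tendsto_compose[OF bc t' stT(2)]
          continuous_on_tendsto_compose[OF bc s' stT(1)] always_eventually allI ins)
    ultimately show ?thesis
    proof (rule LIMSEQ_le)
      have "norm (X (t - \<theta> n) - X (s + \<theta> n)) \<le> primitive b (t - \<theta> n) - primitive b (s + \<theta> n)" for n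
        using xb[of "s + \<theta> n" "t - \<theta> n"] ins[of n] X(2) by auto
      then show "\<exists>N. \<forall>n\<ge>N. norm (X (t - \<theta> n) - X (s + \<theta> n)) \<le> primitive b (t - \<theta> n) - primitive b (s + \<theta> n)"
        by blast
    qed
  qed simp
  have X0: "X 0 = M"
  proof -
    have "(X \<longlongrightarrow> X 0) (at 0 within {0..T})"
      by (rule continuous_on_def[THEN iffD1, OF Xc, rule_format]) (use \<open>T > 0\<close> in simp)
    then have *: "(X \<longlongrightarrow> X 0) (at_right 0)"
      using \<open>T > 0\<close> by (simp add: at_within_Icc_at_right)
    have "\<forall>\<^sub>F t in at_right 0. x t = X t"
      by (rule eventually_at_rightI[OF _ \<open>T > 0\<close>]) (rule X(2))
    with M have "(X \<longlongrightarrow> M) (at_right 0)"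
      by (rule Lim_transform_eventually)
    with * show ?thesis by (rule tendsto_unique[OF trivial_limit_at_right_real])
  qed
  have XXb: "norm (X t - X s) \<le> (LINT u:{s<..t}|lborel. b u)" if "0 \<le> s" "s \<le> t" "t \<le> T" for s t
    using XX[OF that] primitive_diff[OF bL2 that] by simp
  show thesis
  proof (rule Hilbert_AC_primitive[OF \<open>T > 0\<close> bL2 XXb])
    fix v assume v: "L2_on T v" "\<And>t. 0 \<le> t \<Longrightarrow> t \<le> T \<Longrightarrow> X t = X 0 + primitive v t"
    show thesis
    proof (rule that[OF v(1)])
      fix t assume t: "0 < t" "t < T"
      have "x t = X t" using t by (intro X(2)) simp
      also have "\<dots> = X 0 + primitive v t" using t by (intro v(2)) simp_all
      finally show "x t = M + primitive v t" by (simp only: X0)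
    qed
  qed
qed

lemma primitive_imp_AC2:
  fixes x :: "real \<Rightarrow> 'a::{real_inner, banach, second_countable_topology}"
  assumes v: "L2_on T v" and x: "\<And>t. 0 < t \<Longrightarrow> t < T \<Longrightarrow> x t = M + primitive v t"
  shows "x \<in> AC2 T"
  unfolding AC2_def mem_Collect_eq
proof (intro exI conjI allI impI)
  have vm: "(\<lambda>t. norm (v t)) \<in> borel_measurable borel" using v by (auto simp: L2_on_def)
  show "(\<lambda>t. norm (v t)) \<in> borel_measurable (lebesgue_on {0<..<T})"
    using vm by (intro measurable_restrict_space1 measurable_completion) simp
  have "set_integrable lborel {0<..T} (\<lambda>t. (norm (v t))\<^sup>2)" using v by (simp add: L2_on_def)
  then have "set_integrable lborel {0<..<T} (\<lambda>t. (norm (v t))\<^sup>2)"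
    by (rule set_integrable_subset) auto
  then show "integrable (lebesgue_on {0<..<T}) (\<lambda>u. (norm (v u))\<^sup>2)"
    using vm by (simp add: integrable_restrict_space set_integrable_def integrable_completion)
  fix s t assume st: "0 < s" "s < t" "t < T"
  then show "norm (x t - x s) \<le> (LINT u|lebesgue_on {s..t}. norm (v u))"
    using norm_primitive_diff_le(1)[OF v, of s t] x vm by (simp add: lebesgue_on_interval_integral)
qed

lemma primitive_tendsto_right:
  fixes x :: "real \<Rightarrow> 'a::{real_inner, banach, second_countable_topology}"
  assumes "T > 0" and v: "L2_on T v" and x: "\<And>t. 0 < t \<Longrightarrow> t < T \<Longrightarrow> x t = M + primitive v t"
  shows "(x \<longlongrightarrow> M) (at_right 0)"
proof -
  have "(primitive v \<longlongrightarrow> primitive v 0) (at 0 within {0..T})"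
    by (rule continuous_on_def[THEN iffD1, OF continuous_primitive[OF v], rule_format])
       (use \<open>T > 0\<close> in simp)
  then have "((\<lambda>t. M + primitive v t) \<longlongrightarrow> M + primitive v 0) (at_right 0)"
    using \<open>T > 0\<close> by (intro tendsto_intros) (simp add: at_within_Icc_at_right)
  moreover have "\<forall>\<^sub>F t in at_right 0. M + primitive v t = x t"
    by (rule eventually_at_rightI[OF _ \<open>T > 0\<close>]) (simp add: x)
  ultimately show ?thesis by (simp add: Lim_transform_eventually)
qed

lemma primitive_Lim_left:
  fixes x :: "real \<Rightarrow> 'a::{real_inner, banach, second_countable_topology}"
  assumes "T > 0" and v: "L2_on T v" and x: "\<And>t. 0 < t \<Longrightarrow> t < T \<Longrightarrow> x t = M + primitive v t"
  shows "Lim (at_left T) x = M + primitive v T"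
proof -
  have "(primitive v \<longlongrightarrow> primitive v T) (at T within {0..T})"
    by (rule continuous_on_def[THEN iffD1, OF continuous_primitive[OF v], rule_format])
       (use \<open>T > 0\<close> in simp)
  then have "((\<lambda>t. M + primitive v t) \<longlongrightarrow> M + primitive v T) (at_left T)"
    using \<open>T > 0\<close> by (intro tendsto_intros) (simp add: at_within_Icc_at_left)
  moreover have "\<forall>\<^sub>F t in at_left T. M + primitive v t = x t"
    by (rule eventually_at_leftI[OF _ \<open>T > 0\<close>]) (simp add: x)
  ultimately have "(x \<longlongrightarrow> M + primitive v T) (at_left T)"
    by (simp add: Lim_transform_eventually)
  then show ?thesis by (intro tendsto_Lim) auto
qed

lemma AE_vector_derivative_primitive:
  fixes x :: "real \<Rightarrow> 'a::{real_inner, banach, second_countable_topology}"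
  assumes v: "L2_on T v" and x: "\<And>t. 0 < t \<Longrightarrow> t < T \<Longrightarrow> x t = M + primitive v t"
  shows "AE t in lborel. t \<in> {0<..<T} \<longrightarrow> vector_derivative x (at t) = v t"
  using AE_primitive_derivative[OF v]
proof eventually_elim
  fix t assume H: "t \<in> {0<..<T} \<longrightarrow> (primitive v has_vector_derivative v t) (at t)"
  show "t \<in> {0<..<T} \<longrightarrow> vector_derivative x (at t) = v t"
  proof
    assume t: "t \<in> {0<..<T}"
    then have "((\<lambda>t. M + primitive v t) has_vector_derivative 0 + v t) (at t)"
      using H by (intro has_vector_derivative_add has_vector_derivative_const) auto
    then have "(x has_vector_derivative v t) (at t)"
      unfolding add_0_left
    proof (rule has_vector_derivative_transform_within_open)
      show "open {0<..<T}" "t \<in> {0<..<T}" using t by auto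
      show "M + primitive v s = x s" if "s \<in> {0<..<T}" for s
        using that by (intro x[symmetric]) auto
    qed
    then show "vector_derivative x (at t) = v t" by (rule vector_derivative_at)
  qed
qed

section \<open>Functions with quadratic remainder\<close>

lemma GDERIV_of_quadratic_remainder:
  fixes f :: "'b::real_inner \<Rightarrow> real"
  assumes quad: "\<And>h. \<bar>f (w + h) - f w - D \<bullet> h\<bar> \<le> K * (norm h)\<^sup>2"
  shows "GDERIV f w :> D"
  unfolding gderiv_def has_derivative_at'
proof (intro conjI allI impI)
  show "bounded_linear (\<lambda>h. h \<bullet> D)" by (rule bounded_linear_inner_left)
  fix e :: real assume "e > 0"
  have K1: "\<bar>K\<bar> + 1 > 0" by simp
  show "\<exists>d>0. \<forall>y. 0 < norm (y - w) \<and> norm (y - w) < d \<longrightarrow> norm (f y - f w - (y - w) \<bullet> D) / norm (y - w) < e"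
  proof (intro exI[of _ "e / (\<bar>K\<bar> + 1)"] conjI allI impI)
    show "0 < e / (\<bar>K\<bar> + 1)" using \<open>e > 0\<close> K1 by simp
    fix y assume y: "0 < norm (y - w) \<and> norm (y - w) < e / (\<bar>K\<bar> + 1)"
    have "\<bar>f y - f w - D \<bullet> (y - w)\<bar> \<le> K * (norm (y - w))\<^sup>2"
      using quad[of "y - w"] by simp
    also have "\<dots> \<le> (\<bar>K\<bar> + 1) * (norm (y - w))\<^sup>2" by (intro mult_right_mono) auto
    also have "\<dots> < e * norm (y - w)"
    proof -
      have "(\<bar>K\<bar> + 1) * norm (y - w) < e" using y K1 by (simp add: pos_less_divide_eq mult.commute)
      then have "(\<bar>K\<bar> + 1) * norm (y - w) * norm (y - w) < e * norm (y - w)"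
        using y by (intro mult_strict_right_mono) auto
      then show ?thesis by (simp add: power2_eq_square mult.assoc)
    qed
    finally show "norm (f y - f w - (y - w) \<bullet> D) / norm (y - w) < e"
      using y by (simp add: inner_commute pos_divide_less_eq)
  qed
qed

text \<open>A two-sided quadratic bound on the Taylor remainder makes the gradient Lipschitz: compare
  the expansions around \<open>w\<close> and \<open>z\<close> at the point \<open>w - h\<close>. If \<open>\<parallel>h\<parallel> = \<parallel>w - z\<parallel>\<close>, the three remainders add
  up to \<open>(1 + 1 + 4) K \<parallel>w - z\<parallel>\<^sup>2\<close>.\<close>

lemma Lipschitz_of_quadratic_remainder:
  fixes f :: "'b::real_inner \<Rightarrow> real"
  assumes quad: "\<And>w h. \<bar>f (w + h) - f w - D w \<bullet> h\<bar> \<le> K * (norm h)\<^sup>2" 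
  shows "norm (D w - D z) \<le> 6 * K * norm (w - z)"
proof -
  define r where "r = norm (w - z)"
  have main: "(D w - D z) \<bullet> h \<le> 6 * K * r\<^sup>2" if h: "norm h = r" for h
  proof -
    have K: "0 \<le> K * (norm h)\<^sup>2" using quad[of w h] abs_ge_zero order_trans by blast
    define g where "g = (w + - h) - z"
    have e: "w + - h = z + g" "w = z + (w - z)" by (auto simp: g_def)
    have q1: "f (w + - h) \<le> f w - D w \<bullet> h + K * (norm h)\<^sup>2"
      using quad[of w "- h"] by (simp add: abs_le_iff)
    have q2: "f z + D z \<bullet> g - K * (norm g)\<^sup>2 \<le> f (w + - h)"
      using quad[of z g] unfolding e(1) by (simp add: abs_le_iff)
    have q3: "f w \<le> f z + D z \<bullet> (w - z) + K * r\<^sup>2"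
      using quad[of z "w - z"] by (simp add: abs_le_iff r_def)
    have q4: "D z \<bullet> g = D z \<bullet> (w - z) - D z \<bullet> h"
      by (simp add: g_def inner_diff_right inner_add_right)
    have "(norm g)\<^sup>2 \<le> (2 * r)\<^sup>2"
      using norm_triangle_ineq4[of "w - z" h] h by (intro power_mono) (auto simp: g_def r_def algebra_simps)
    then have q5: "(norm g)\<^sup>2 \<le> 4 * r\<^sup>2" by (simp add: power_mult_distrib)
    have q6: "K * (norm g)\<^sup>2 \<le> K * (4 * r\<^sup>2)"
    proof (cases "r = 0")
      case True
      then have "norm g = 0" using q5 by simp
      then show ?thesis using True by simp
    next
      case False
      then have "K \<ge> 0" using K h by (simp add: zero_le_mult_iff)
      then show ?thesis using q5 by (rule mult_left_mono[rotated])
    qed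
    have "D w \<bullet> h - D z \<bullet> h \<le> K * (4 * r\<^sup>2) + K * r\<^sup>2 + K * r\<^sup>2"
      using q1 q2 q3 q4 q6 h by simp
    then show ?thesis by (simp add: inner_diff_left)
  qed
  show ?thesis
  proof (cases "D w = D z \<or> r = 0")
    case True
    then show ?thesis
    proof
      assume "D w = D z"
      have "0 \<le> K * r\<^sup>2" using quad[of w "w - z"] abs_ge_zero order_trans unfolding r_def by blast
      then have "0 \<le> K * r" by (cases "r = 0") (auto simp: zero_le_mult_iff r_def)
      then show ?thesis using \<open>D w = D z\<close> by (simp add: r_def)
    next
      assume "r = 0" then show ?thesis by (simp add: r_def)
    qed
  next
    case False
    then have n: "norm (D w - D z) > 0" and r: "r > 0" by (auto simp: r_def)
    define h where "h = (r / norm (D w - D z)) *\<^sub>R (D w - D z)"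
    have "norm h = r" using n r by (simp add: h_def)
    from main[OF this] have "(r / norm (D w - D z)) * (norm (D w - D z))\<^sup>2 \<le> 6 * K * r\<^sup>2"
      by (simp add: h_def power2_norm_eq_inner)
    then have "r * norm (D w - D z) \<le> r * (6 * K * r)"
      using n by (simp add: power2_eq_square field_simps)
    then have "norm (D w - D z) \<le> 6 * K * r" using r by simp
    then show ?thesis by (simp add: r_def)
  qed
qed

section \<open>Global solutions of Lipschitz differential equations\<close>

text \<open>Picard's iteration in the weighted norm \<open>sup\<^sub>t exp (- 2 l t) \<parallel>y t\<parallel>\<close>, in which it is a
  contraction on the whole half-line at once. The fixed point \<open>z\<close> is \<open>y\<close> multiplied by the weight, so
  that it lies in the space of bounded continuous functions; the time \<open>max 0 t\<close> makes everything
  constant on the negative axis.\<close>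

theorem Lipschitz_ODE_global_solution:
  fixes F :: "'b::banach \<Rightarrow> 'b"
  assumes lip: "\<And>y z. norm (F y - F z) \<le> l * norm (y - z)" and l: "l > 0"
  obtains y where "y 0 = y0" "\<And>t. t \<ge> 0 \<Longrightarrow> (y has_vector_derivative F (y t)) (at t within {0..})"
    "continuous_on UNIV y"
proof -
  define a where "a = 2 * l"
  have a: "a > 0" using l by (simp add: a_def)
  have Fc: "continuous_on UNIV F"
  proof (rule continuous_onI)
    fix x and e :: real assume "e > 0"
    show "\<exists>d>0. \<forall>x'\<in>UNIV. dist x' x < d \<longrightarrow> dist (F x') (F x) \<le> e"
    proof (intro exI[of _ "e / l"] conjI ballI impI)
      show "0 < e / l" using \<open>e > 0\<close> l by simp
      fix x' assume "dist x' x < e / l"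
      then have "l * norm (x' - x) < e" using l by (simp add: dist_norm pos_less_divide_eq mult.commute)
      then show "dist (F x') (F x) \<le> e" using lip[of x' x] by (simp add: dist_norm)
    qed
  qed
  define G where "G z s = F (exp (a * s) *\<^sub>R apply_bcontfun z s)" for z :: "real \<Rightarrow>\<^sub>C 'b" and s
  have Gc: "continuous_on S (G z)" for z S
    unfolding G_def by (intro continuous_on_compose2[OF Fc] continuous_intros) auto
  have Gi: "G z integrable_on {0..t}" for z t by (rule integrable_continuous_real[OF Gc])
  have expI: "((\<lambda>s. exp (a * s)) has_integral (exp (a * t) - 1) / a) {0..t}" if "t \<ge> 0" for t
  proof -
    have "((\<lambda>s. exp (a * s)) has_integral exp (a * t) / a - exp (a * 0) / a) {0..t}"
      using that a
      by (intro fundamental_theorem_of_calculus)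
         (auto intro!: derivative_eq_intros simp: has_real_derivative_iff_has_vector_derivative[symmetric])
    then show ?thesis by (simp add: diff_divide_distrib)
  qed
  have G_diff: "exp (- a * t) * norm (integral {0..t} (G z) - integral {0..t} (G z')) \<le> dist z z' / 2"
    if "t \<ge> 0" for z z' t
  proof -
    have "norm (integral {0..t} (G z) - integral {0..t} (G z')) = norm (integral {0..t} (\<lambda>s. G z s - G z' s))"
      by (simp add: Henstock_Kurzweil_Integration.integral_diff Gi)
    also have "\<dots> \<le> integral {0..t} (\<lambda>s. l * dist z z' * exp (a * s))"
    proof (rule integral_norm_bound_integral)
      show "(\<lambda>s. G z s - G z' s) integrable_on {0..t}" by (intro integrable_diff Gi)
      show "(\<lambda>s. l * dist z z' * exp (a * s)) integrable_on {0..t}"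
        by (intro integrable_continuous_real continuous_intros)
      fix s assume "s \<in> {0..t}"
      have "norm (G z s - G z' s) \<le> l * norm (exp (a * s) *\<^sub>R apply_bcontfun z s - exp (a * s) *\<^sub>R apply_bcontfun z' s)"
        unfolding G_def by (rule lip)
      also have "\<dots> = l * (exp (a * s) * dist (apply_bcontfun z s) (apply_bcontfun z' s))"
        by (simp add: dist_norm flip: scaleR_diff_right)
      also have "\<dots> \<le> l * (exp (a * s) * dist z z')"
        using l by (intro mult_left_mono dist_bounded) auto
      finally show "norm (G z s - G z' s) \<le> l * dist z z' * exp (a * s)" by (simp add: mult_ac)
    qed
    also have "\<dots> = l * dist z z' * ((exp (a * t) - 1) / a)"
      using has_integral_mult_right[OF expI[OF that], of "l * dist z z'"] by (rule integral_unique)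
    also have "\<dots> \<le> l * dist z z' * (exp (a * t) / a)"
      using a l by (intro mult_left_mono divide_right_mono) auto
    also have "\<dots> = dist z z' / 2 * exp (a * t)" using l by (simp add: a_def)
    finally have "exp (- a * t) * norm (integral {0..t} (G z) - integral {0..t} (G z'))
        \<le> exp (- a * t) * (dist z z' / 2 * exp (a * t))"
      by (intro mult_left_mono) auto
    also have "\<dots> = dist z z' / 2" by (simp add: exp_minus field_simps)
    finally show ?thesis .
  qed
  define \<Phi> where "\<Phi> z t = exp (- a * max 0 t) *\<^sub>R (y0 + integral {0..max 0 t} (G z))" for z :: "real \<Rightarrow>\<^sub>C 'b" and t
  have int_cont: "continuous_on UNIV (\<lambda>t. integral {0..max 0 t} (G z))" for z
  proof -
    have *: "continuous_on {0..T} (\<lambda>t. integral {0..t} (G z))" for T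
      by (rule indefinite_integral_continuous_1[OF Gi])
    have "isCont (\<lambda>t. integral {0..max 0 t} (G z)) u" for u
    proof -
      have "continuous_on {..<\<bar>u\<bar> + 1} (\<lambda>t. integral {0..max 0 t} (G z))"
        by (rule continuous_on_compose2[OF *[of "\<bar>u\<bar> + 1"]]) (auto intro!: continuous_intros)
      then show ?thesis
        by (rule continuous_on_interior) (simp add: interior_open)
    qed
    then show ?thesis by (simp add: continuous_at_imp_continuous_on)
  qed
  have \<Phi>c: "continuous_on UNIV (\<Phi> z)" for z
    unfolding \<Phi>_def by (intro continuous_intros int_cont)
  have \<Phi>0: "norm (\<Phi> 0 t) \<le> norm y0 + norm (F 0) / a" for t
  proof -
    define u where "u = max 0 t"
    have u: "u \<ge> 0" by (simp add: u_def)
    have "norm (\<Phi> 0 t) = exp (- a * u) * norm (y0 + u *\<^sub>R F 0)"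
      using u by (simp add: \<Phi>_def u_def[symmetric] G_def[abs_def])
    also have "\<dots> \<le> exp (- a * u) * (norm y0 + u * norm (F 0))"
      using norm_triangle_ineq[of y0 "u *\<^sub>R F 0"] u by (intro mult_left_mono) auto
    also have "\<dots> = exp (- a * u) * norm y0 + exp (- a * u) * u * norm (F 0)"
      by (simp add: algebra_simps)
    also have "\<dots> \<le> 1 * norm y0 + (1 / a) * norm (F 0)"
    proof (intro add_mono mult_right_mono)
      show "exp (- a * u) \<le> 1" using a u by simp
      have "a * u \<le> exp (a * u)" using exp_ge_add_one_self[of "a * u"] by linarith
      then show "exp (- a * u) * u \<le> 1 / a" using a by (simp add: exp_minus field_simps)
    qed auto
    finally show ?thesis by simp
  qed
  have \<Phi>d: "dist (\<Phi> z t) (\<Phi> z' t) \<le> dist z z' / 2" for z z' t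
  proof -
    have "\<Phi> z t - \<Phi> z' t = exp (- a * max 0 t) *\<^sub>R (integral {0..max 0 t} (G z) - integral {0..max 0 t} (G z'))"
      unfolding \<Phi>_def by (simp flip: scaleR_diff_right)
    then show ?thesis using G_diff[of "max 0 t" z z'] by (simp add: dist_norm)
  qed
  have \<Phi>b: "\<Phi> z \<in> bcontfun" for z
  proof (rule bcontfun_normI[OF \<Phi>c])
    fix t
    have "norm (\<Phi> z t) \<le> norm (\<Phi> 0 t) + norm (\<Phi> z t - \<Phi> 0 t)"
      by (rule norm_triangle_sub)
    then show "norm (\<Phi> z t) \<le> (norm y0 + norm (F 0) / a) + dist z 0 / 2"
      using \<Phi>0[of t] \<Phi>d[of z t 0] unfolding dist_norm[of "\<Phi> z t"] by linarith
  qed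
  have "\<exists>!z. Bcontfun (\<Phi> z) = z"
  proof (rule banach_fix_type[of "1/2"])
    show "\<forall>z z'. dist (Bcontfun (\<Phi> z)) (Bcontfun (\<Phi> z')) \<le> 1 / 2 * dist z z'"
      using \<Phi>d by (intro allI dist_bound) (simp add: Bcontfun_inverse[OF \<Phi>b])
  qed auto
  then obtain z where z: "Bcontfun (\<Phi> z) = z" by blast
  then have zfix: "apply_bcontfun z t = \<Phi> z t" for t
    using Bcontfun_inverse[OF \<Phi>b, of z] by simp
  define y where "y t = y0 + integral {0..max 0 t} (G z)" for t
  have Gy: "G z s = F (y s)" if "s \<ge> 0" for s
  proof -
    have "exp (a * s) *\<^sub>R apply_bcontfun z s = (exp (a * s) * exp (- a * s)) *\<^sub>R y s"
      unfolding zfix using that by (simp add: \<Phi>_def y_def)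
    also have "\<dots> = y s" by (simp flip: exp_add)
    finally show ?thesis by (simp add: G_def)
  qed
  show thesis
  proof (rule that[of y])
    show "y 0 = y0" by (simp add: y_def)
    show "continuous_on UNIV y" unfolding y_def by (intro continuous_intros int_cont)
    fix t :: real assume t: "t \<ge> 0"
    have "((\<lambda>u. integral {0..u} (G z)) has_vector_derivative G z t) (at t within {0..t + 1})"
      by (rule integral_has_vector_derivative[OF Gc]) (use t in auto)
    then have "((\<lambda>u. y0 + integral {0..u} (G z)) has_vector_derivative 0 + G z t) (at t within {0..t + 1})"
      by (intro has_vector_derivative_add has_vector_derivative_const)
    then have "((\<lambda>u. y0 + integral {0..u} (G z)) has_vector_derivative F (y t)) (at t within {0..t + 1})"
      using Gy[OF t] by simp
    then have "(y has_vector_derivative F (y t)) (at t within {0..t + 1})"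
      by (rule has_vector_derivative_transform[rotated 2]) (use t in \<open>auto simp: y_def max_def\<close>)
    moreover have "at t within {0..t + 1} = at t within {0..}"
      by (rule at_within_nhd[where S = "{..<t + 1}"]) auto
    ultimately show "(y has_vector_derivative F (y t)) (at t within {0..})" by simp
  qed
qed

section \<open>Strongly convex Lagrangians and the Legendre transform\<close>

text \<open>\<open>p\<close> and \<open>q\<close> stand for the partial gradients in position and in velocity; \<open>lower\<close> and \<open>upper\<close>
  determine them. The bound \<open>lower\<close> is strong convexity in the velocity together with semiconvexity in the
  position.\<close>

locale lagrangian =
  fixes \<Lambda> :: "'a::{real_inner, banach, second_countable_topology} \<Rightarrow> 'a \<Rightarrow> real"
    and p q :: "'a \<Rightarrow> 'a \<Rightarrow> 'a" and K \<gamma> \<alpha> A B :: real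
  assumes K: "K > 0" and \<gamma>: "\<gamma> > 0" and \<alpha>: "\<alpha> > 0" and A: "A \<ge> 0" and B: "B \<ge> 0"
    and lower: "\<Lambda> (x + h) (v + k) - \<Lambda> x v - p x v \<bullet> h - q x v \<bullet> k \<ge> \<gamma> * (norm k)\<^sup>2 - K * (norm h)\<^sup>2"
    and upper: "\<Lambda> (x + h) (v + k) - \<Lambda> x v - p x v \<bullet> h - q x v \<bullet> k \<le> K * (norm k)\<^sup>2 + K * (norm h)\<^sup>2"
    and coercive: "\<Lambda> x v \<ge> \<alpha> * (norm v)\<^sup>2 - A"
    and growth: "\<Lambda> x v \<le> B * (1 + (norm x)\<^sup>2 + (norm v)\<^sup>2)"
begin

lemma quadratic_remainder:
  "\<bar>case_prod \<Lambda> (w + h) - case_prod \<Lambda> w - (case_prod p w, case_prod q w) \<bullet> h\<bar> \<le> K * (norm h)\<^sup>2"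
proof (cases w; cases h)
  fix x v k l assume [simp]: "w = (x, v)" "h = (k, l)"
  have n: "(norm h)\<^sup>2 = (norm k)\<^sup>2 + (norm l)\<^sup>2" by (simp add: norm_Pair)
  have "0 \<le> K * (norm l)\<^sup>2" "0 \<le> \<gamma> * (norm l)\<^sup>2" using K \<gamma> by auto
  then show ?thesis
    using lower[where x = x and h = k and v = v and k = l] upper[where x = x and h = k and v = v and k = l] unfolding n
    by (simp add: inner_Pair abs_le_iff algebra_simps)
qed

lemma grad_Lipschitz:
  "norm (p x v - p y w) \<le> 6 * K * (norm (x - y) + norm (v - w))"
  "norm (q x v - q y w) \<le> 6 * K * (norm (x - y) + norm (v - w))"
proof -
  have "norm ((p x v, q x v) - (p y w, q y w)) \<le> 6 * K * norm ((x, v) - (y, w))"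
    using Lipschitz_of_quadratic_remainder[where D = "\<lambda>w. (case_prod p w, case_prod q w)",
        OF quadratic_remainder, of "(x, v)" "(y, w)"] by simp
  also have "\<dots> \<le> 6 * K * (norm (x - y) + norm (v - w))"
    using norm_Pair_le[of "x - y" "v - w"] K by (intro mult_left_mono) auto
  finally have *: "norm (p x v - p y w, q x v - q y w) \<le> 6 * K * (norm (x - y) + norm (v - w))"
    by simp
  show "norm (p x v - p y w) \<le> 6 * K * (norm (x - y) + norm (v - w))"
    using order_trans[OF norm_fst_le *] .
  show "norm (q x v - q y w) \<le> 6 * K * (norm (x - y) + norm (v - w))"
    using order_trans[OF norm_snd_le *] .
qed

lemma q_monotone: "2 * \<gamma> * (norm (v - w))\<^sup>2 \<le> (q x v - q x w) \<bullet> (v - w)"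
proof -
  have "\<Lambda> x w - \<Lambda> x v - q x v \<bullet> (w - v) \<ge> \<gamma> * (norm (w - v))\<^sup>2"
    using lower[where x = x and h = 0 and v = v and k = "w - v"] by simp
  moreover have "\<Lambda> x v - \<Lambda> x w - q x w \<bullet> (v - w) \<ge> \<gamma> * (norm (v - w))\<^sup>2"
    using lower[where x = x and h = 0 and v = w and k = "v - w"] by simp
  ultimately show ?thesis
    by (simp add: norm_minus_commute inner_diff_left inner_diff_right)
qed

text \<open>For fixed \<open>x\<close> the map \<open>q x\<close> is strongly monotone with constant \<open>2 \<gamma>\<close> and Lipschitz with constant
  \<open>6 K\<close>, so that \<open>v \<mapsto> v - \<tau> (q x v - r)\<close> is a contraction for small \<open>\<tau>\<close>.\<close>

lemma ex1_velocity: "\<exists>!v. q x v = r"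
proof -
  \<comment> \<open>The minimum point of \<open>1 - 4 \<tau> \<gamma> + 36 K\<^sup>2 \<tau>\<^sup>2\<close>. The \<open>max\<close> in \<open>c\<close> only makes the root well defined.\<close>
  define \<tau> where "\<tau> = \<gamma> / (18 * K\<^sup>2)"
  have \<tau>: "\<tau> > 0" using \<gamma> K by (simp add: \<tau>_def)
  define f where "f v = v - \<tau> *\<^sub>R (q x v - r)" for v
  define c where "c = sqrt (max 0 (1 - \<gamma>\<^sup>2 / (9 * K\<^sup>2)))"
  have c: "0 \<le> c" "c < 1"
  proof -
    show "0 \<le> c" by (simp add: c_def)
    have "max 0 (1 - \<gamma>\<^sup>2 / (9 * K\<^sup>2)) < 1" using \<gamma> K by simp
    then show "c < 1" unfolding c_def by simp
  qed
  have "dist (f v) (f w) \<le> c * dist v w" for v w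
  proof -
    define g where "g = q x v - q x w"
    have eq: "f v - f w = (v - w) - \<tau> *\<^sub>R g"
      by (simp add: f_def g_def algebra_simps)
    have "(norm (f v - f w))\<^sup>2 = (norm (v - w))\<^sup>2 - 2 * \<tau> * (g \<bullet> (v - w)) + \<tau>\<^sup>2 * (norm g)\<^sup>2"
      unfolding eq power2_norm_eq_inner
      by (simp add: inner_diff_left inner_diff_right inner_commute algebra_simps power2_eq_square)
    also have "\<dots> \<le> (norm (v - w))\<^sup>2 - 2 * \<tau> * (2 * \<gamma> * (norm (v - w))\<^sup>2) + \<tau>\<^sup>2 * (6 * K * norm (v - w))\<^sup>2"
      using q_monotone[of v w x] grad_Lipschitz(2)[of x v x w] \<tau>
      unfolding g_def[symmetric]
      by (intro add_mono diff_mono mult_left_mono power_mono) auto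
    also have "\<dots> = (1 - 4 * \<tau> * \<gamma> + 36 * K\<^sup>2 * \<tau>\<^sup>2) * (norm (v - w))\<^sup>2"
      by (simp add: power_mult_distrib algebra_simps)
    also have "1 - 4 * \<tau> * \<gamma> + 36 * K\<^sup>2 * \<tau>\<^sup>2 = 1 - \<gamma>\<^sup>2 / (9 * K\<^sup>2)"
      using K by (simp add: \<tau>_def power2_eq_square field_simps)
    also have "(1 - \<gamma>\<^sup>2 / (9 * K\<^sup>2)) * (norm (v - w))\<^sup>2 \<le> c\<^sup>2 * (norm (v - w))\<^sup>2"
      unfolding c_def by (intro mult_right_mono) auto
    finally have "(norm (f v - f w))\<^sup>2 \<le> (c * norm (v - w))\<^sup>2"
      by (simp add: power_mult_distrib)
    then show ?thesis
      unfolding dist_norm by (rule power2_le_imp_le) (use c in simp)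
  qed
  then have "\<exists>!v. f v = v"
    by (intro banach_fix_type[OF c] allI)
  moreover have "f v = v \<longleftrightarrow> q x v = r" for v
    using \<tau> by (simp add: f_def)
  ultimately show ?thesis by simp
qed

text \<open>The velocity that has momentum \<open>r\<close> at position \<open>x\<close>.\<close>

definition \<Psi> where "\<Psi> x r = (THE v. q x v = r)"

lemma q_Psi [simp]: "q x (\<Psi> x r) = r"
  unfolding \<Psi>_def by (rule theI'[OF ex1_velocity])

text \<open>Strong monotonicity of the momentum in the velocity, in quantitative form. It is used twice: for the
  Lipschitz dependence of \<open>\<Psi>\<close>, and to recover a velocity field from its residual.\<close>

lemma velocity_stability:
  "norm (v - w) \<le> (norm (q x v - q y w) + 6 * K * norm (x - y)) / (2 * \<gamma>)"
proof (cases "v = w")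
  case True
  then show ?thesis using K \<gamma> by simp
next
  case False
  then have n: "norm (v - w) > 0" by simp
  have "2 * \<gamma> * (norm (v - w))\<^sup>2 \<le> (q x v - q x w) \<bullet> (v - w)" by (rule q_monotone)
  also have "\<dots> \<le> norm (q x v - q x w) * norm (v - w)" by (rule norm_cauchy_schwarz)
  also have "\<dots> \<le> (norm (q x v - q y w) + 6 * K * norm (x - y)) * norm (v - w)"
  proof (rule mult_right_mono)
    have "norm (q x v - q x w) \<le> norm (q x v - q y w) + norm (q y w - q x w)"
      using norm_triangle_ineq[of "q x v - q y w" "q y w - q x w"] by simp
    moreover have "norm (q y w - q x w) \<le> 6 * K * norm (x - y)"
      using grad_Lipschitz(2)[of y w x w] by (simp add: norm_minus_commute)
    ultimately show "norm (q x v - q x w) \<le> norm (q x v - q y w) + 6 * K * norm (x - y)" by linarith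
  qed simp
  finally have "norm (v - w) * (2 * \<gamma> * norm (v - w)) \<le> norm (v - w) * (norm (q x v - q y w) + 6 * K * norm (x - y))"
    by (simp add: power2_eq_square mult_ac)
  then have "2 * \<gamma> * norm (v - w) \<le> norm (q x v - q y w) + 6 * K * norm (x - y)"
    using n by simp
  then show ?thesis using \<gamma> by (simp add: field_simps)
qed

lemma Psi_maximizes:
  "- (P \<bullet> w) - \<Lambda> x w \<le> - (P \<bullet> \<Psi> x (- P)) - \<Lambda> x (\<Psi> x (- P))"
proof -
  define v where "v = \<Psi> x (- P)"
  have "\<Lambda> x w - \<Lambda> x v + P \<bullet> (w - v) \<ge> \<gamma> * (norm (w - v))\<^sup>2"
    using lower[where x = x and h = 0 and v = v and k = "w - v"] by (simp add: v_def)
  moreover have "0 \<le> \<gamma> * (norm (w - v))\<^sup>2" using \<gamma> by simp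
  ultimately show ?thesis unfolding v_def[symmetric] by (simp add: inner_diff_right)
qed

lemma SUP_Psi:
  "(SUP w. - (P \<bullet> w) - \<Lambda> x w) = - (P \<bullet> \<Psi> x (- P)) - \<Lambda> x (\<Psi> x (- P))"
  by (rule cSup_eq_maximum) (use Psi_maximizes in auto)

text \<open>Inserting the maximizer for \<open>P\<close> in the supremum for \<open>P + h\<close>, and conversely, encloses the
  increment of the Legendre transform between \<open>- h \<bullet> v\<close> and \<open>- h \<bullet> v'\<close>; the two maximizers differ by at
  most a multiple of \<open>\<parallel>h\<parallel>\<close>.\<close>

lemma grad_Legendre:
  "grad (\<lambda>P. SUP w. - (P \<bullet> w) - \<Lambda> x w) P = - \<Psi> x (- P)"
proof (rule GDERIV_imp_grad, rule GDERIV_of_quadratic_remainder)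
  fix h
  define v where "v = \<Psi> x (- P)"
  define v' where "v' = \<Psi> x (- (P + h))"
  have a: "- ((P + h) \<bullet> v) - \<Lambda> x v \<le> - ((P + h) \<bullet> v') - \<Lambda> x v'"
    unfolding v'_def by (rule Psi_maximizes)
  have b: "- (P \<bullet> v') - \<Lambda> x v' \<le> - (P \<bullet> v) - \<Lambda> x v"
    unfolding v_def by (rule Psi_maximizes)
  have "norm (v' - v) \<le> norm h / (2 * \<gamma>)"
    using velocity_stability[of v' v x x] by (simp add: v_def v'_def)
  then have "norm h * norm (v' - v) \<le> norm h * (norm h / (2 * \<gamma>))"
    by (intro mult_left_mono) auto
  moreover have "- (h \<bullet> (v' - v)) \<le> norm h * norm (v' - v)"
    using Cauchy_Schwarz_ineq2[of h "v' - v"] by linarith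
  ultimately have c: "- (h \<bullet> (v' - v)) \<le> 1 / (2 * \<gamma>) * (norm h)\<^sup>2"
    by (simp add: power2_eq_square)
  have "0 \<le> 1 / (2 * \<gamma>) * (norm h)\<^sup>2" using \<gamma> by simp
  then show "\<bar>(SUP w. - ((P + h) \<bullet> w) - \<Lambda> x w) - (SUP w. - (P \<bullet> w) - \<Lambda> x w) - (- \<Psi> x (- P)) \<bullet> h\<bar>
      \<le> 1 / (2 * \<gamma>) * (norm h)\<^sup>2"
    unfolding SUP_Psi unfolding v_def[symmetric] v'_def[symmetric]
    using a b c by (simp add: abs_le_iff inner_add_left inner_diff_right inner_commute[of h])
qed

lemma continuous_Lambda: "continuous_on UNIV (case_prod \<Lambda>)"
proof -
  have "isCont (case_prod \<Lambda>) w" for w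
    using GDERIV_of_quadratic_remainder[OF quadratic_remainder, of w]
    unfolding gderiv_def by (rule has_derivative_continuous)
  then show ?thesis by (simp add: continuous_at_imp_continuous_on)
qed

lemma continuous_p: "continuous_on UNIV (case_prod p)"
  and continuous_q: "continuous_on UNIV (case_prod q)"
proof -
  have *: "dist (case_prod p y) (case_prod p z) \<le> 6 * K * 2 * dist y z"
    "dist (case_prod q y) (case_prod q z) \<le> 6 * K * 2 * dist y z" for y z
  proof -
    obtain x v x' v' where [simp]: "y = (x, v)" "z = (x', v')" by (cases y, cases z)
    have "norm (x - x') + norm (v - v') \<le> 2 * norm (y - z)"
      using norm_fst_le[of "x - x'" "v - v'"] norm_snd_le[of "v - v'" "x - x'"] by simp
    then have le: "6 * K * (norm (x - x') + norm (v - v')) \<le> 6 * K * (2 * norm (y - z))"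
      using K by (intro mult_left_mono) auto
    show "dist (case_prod p y) (case_prod p z) \<le> 6 * K * 2 * dist y z"
      using order_trans[OF grad_Lipschitz(1) le] by (simp add: dist_norm)
    show "dist (case_prod q y) (case_prod q z) \<le> 6 * K * 2 * dist y z"
      using order_trans[OF grad_Lipschitz(2) le] by (simp add: dist_norm)
  qed
  have L: "(6 * K * 2)-lipschitz_on UNIV (case_prod p)" "(6 * K * 2)-lipschitz_on UNIV (case_prod q)"
    using * K by (auto intro!: lipschitz_onI simp del: split_paired_All)
  show "continuous_on UNIV (case_prod p)" "continuous_on UNIV (case_prod q)"
    by (rule lipschitz_on_continuous_on[OF L(1)], rule lipschitz_on_continuous_on[OF L(2)])
qed

lemma borel_measurable_compose:
  assumes [measurable]: "x \<in> borel_measurable N" "v \<in> borel_measurable N"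
  shows "(\<lambda>t. \<Lambda> (x t) (v t)) \<in> borel_measurable N"
    and "(\<lambda>t. p (x t) (v t)) \<in> borel_measurable N"
    and "(\<lambda>t. q (x t) (v t)) \<in> borel_measurable N"
proof -
  have xv: "(\<lambda>t. (x t, v t)) \<in> borel_measurable N" by measurable
  show "(\<lambda>t. \<Lambda> (x t) (v t)) \<in> borel_measurable N"
    using measurable_compose[OF xv borel_measurable_continuous_onI[OF continuous_Lambda]] by simp
  show "(\<lambda>t. p (x t) (v t)) \<in> borel_measurable N"
    using measurable_compose[OF xv borel_measurable_continuous_onI[OF continuous_p]] by simp
  show "(\<lambda>t. q (x t) (v t)) \<in> borel_measurable N"
    using measurable_compose[OF xv borel_measurable_continuous_onI[OF continuous_q]] by simp
qed

lemma continuous_compose: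
  assumes "continuous_on S x" "continuous_on S v"
  shows "continuous_on S (\<lambda>t. \<Lambda> (x t) (v t))" and "continuous_on S (\<lambda>t. p (x t) (v t))"
    and "continuous_on S (\<lambda>t. q (x t) (v t))"
proof -
  have xv: "continuous_on S (\<lambda>t. (x t, v t))" using assms by (intro continuous_intros)
  show "continuous_on S (\<lambda>t. \<Lambda> (x t) (v t))"
    using continuous_on_compose2[OF continuous_Lambda xv] by simp
  show "continuous_on S (\<lambda>t. p (x t) (v t))"
    using continuous_on_compose2[OF continuous_p xv] by simp
  show "continuous_on S (\<lambda>t. q (x t) (v t))"
    using continuous_on_compose2[OF continuous_q xv] by simp
qed

lemma Psi_Lipschitz:
  "norm (\<Psi> x r - \<Psi> y s) \<le> (norm (r - s) + 6 * K * norm (x - y)) / (2 * \<gamma>)"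
  using velocity_stability[of "\<Psi> x r" "\<Psi> y s" x y] by simp

text \<open>In the variables position and momentum the Euler--Lagrange equation is the autonomous system
  \<open>x' = \<Psi> x r\<close>, \<open>r' = p x (\<Psi> x r)\<close> with a globally Lipschitz right-hand side.\<close>

theorem Euler_Lagrange_solution:
  obtains x w where "x 0 = M" "q (x 0) (w 0) = r0"
    "\<And>t. t \<ge> 0 \<Longrightarrow> (x has_vector_derivative w t) (at t within {0..})"
    "\<And>t. t \<ge> 0 \<Longrightarrow> ((\<lambda>s. q (x s) (w s)) has_vector_derivative p (x t) (w t)) (at t within {0..})"
    "continuous_on UNIV x" "continuous_on UNIV w"
proof -
  define F where "F z = (\<Psi> (fst z) (snd z), p (fst z) (\<Psi> (fst z) (snd z)))" for z
  define c where "c = (1 + 6 * K) / (2 * \<gamma>)"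
  have c: "c > 0" using K \<gamma> by (simp add: c_def)
  have nf: "norm (fst y - fst z) \<le> norm (y - z)" and ns: "norm (snd y - snd z) \<le> norm (y - z)" for y z :: "'a \<times> 'a"
    using norm_fst_le[of "fst (y - z)" "snd (y - z)"] norm_snd_le[of "snd (y - z)" "fst (y - z)"]
    by (simp_all only: prod.collapse fst_diff[symmetric] snd_diff[symmetric])
  have Psi_le: "norm (\<Psi> (fst y) (snd y) - \<Psi> (fst z) (snd z)) \<le> c * norm (y - z)" for y z
  proof -
    have "norm (snd y - snd z) + 6 * K * norm (fst y - fst z) \<le> norm (y - z) + 6 * K * norm (y - z)"
      using nf[of y z] ns[of y z] K by (intro add_mono mult_left_mono) auto
    then have "(norm (snd y - snd z) + 6 * K * norm (fst y - fst z)) / (2 * \<gamma>) \<le> (norm (y - z) + 6 * K * norm (y - z)) / (2 * \<gamma>)"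
      using \<gamma> by (intro divide_right_mono) auto
    also have "\<dots> = c * norm (y - z)" by (simp add: c_def algebra_simps)
    finally show ?thesis by (rule order_trans[OF Psi_Lipschitz])
  qed
  have lip: "norm (F y - F z) \<le> (c + 6 * K * (1 + c)) * norm (y - z)" for y z
  proof -
    let ?v = "\<Psi> (fst y) (snd y)" and ?w = "\<Psi> (fst z) (snd z)"
    have "norm (F y - F z) \<le> norm (?v - ?w) + norm (p (fst y) ?v - p (fst z) ?w)"
      unfolding F_def using norm_Pair_le by simp
    also have "norm (p (fst y) ?v - p (fst z) ?w) \<le> 6 * K * (norm (fst y - fst z) + norm (?v - ?w))"
      by (rule grad_Lipschitz)
    also have "\<dots> \<le> 6 * K * (norm (y - z) + c * norm (y - z))"
      using Psi_le[of y z] nf[of y z] K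
      by (intro mult_left_mono add_mono) auto
    also have "norm (?v - ?w) + 6 * K * (norm (y - z) + c * norm (y - z)) \<le> c * norm (y - z) + 6 * K * (norm (y - z) + c * norm (y - z))"
      using Psi_le[of y z] by simp
    finally show ?thesis by (simp add: algebra_simps)
  qed
  have cc: "c + 6 * K * (1 + c) > 0" using c K by (simp add: add_pos_pos)
  obtain y where y: "y 0 = (M, r0)" "\<And>t. t \<ge> 0 \<Longrightarrow> (y has_vector_derivative F (y t)) (at t within {0..})"
    "continuous_on UNIV y"
    by (rule Lipschitz_ODE_global_solution[OF lip cc, of "(M, r0)"]) (rule that)
  define x where "x t = fst (y t)" for t
  define w where "w t = \<Psi> (fst (y t)) (snd (y t))" for t
  have qw: "(\<lambda>s. q (x s) (w s)) = (\<lambda>s. snd (y s))" by (simp add: x_def w_def)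
  have Psi_cont: "continuous_on UNIV (\<lambda>z. \<Psi> (fst z) (snd z))"
    by (rule lipschitz_on_continuous_on[of c]) (use Psi_le c in \<open>auto intro!: lipschitz_onI simp: dist_norm\<close>)
  show thesis
  proof (rule that[of x w])
    show "x 0 = M" by (simp add: x_def y)
    show "q (x 0) (w 0) = r0" by (simp add: x_def w_def y)
    show "continuous_on UNIV x" unfolding x_def by (intro continuous_intros y)
    show "continuous_on UNIV w"
      unfolding w_def using continuous_on_compose2[OF Psi_cont y(3)] by simp
    fix t :: real assume t: "t \<ge> 0"
    have "((\<lambda>s. fst (y s)) has_vector_derivative fst (F (y t))) (at t within {0..})"
      by (rule bounded_linear.has_vector_derivative[OF bounded_linear_fst y(2)[OF t]])
    then show "(x has_vector_derivative w t) (at t within {0..})"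
      by (simp add: x_def[abs_def] w_def F_def)
    have "((\<lambda>s. snd (y s)) has_vector_derivative snd (F (y t))) (at t within {0..})"
      by (rule bounded_linear.has_vector_derivative[OF bounded_linear_snd y(2)[OF t]])
    then show "((\<lambda>s. q (x s) (w s)) has_vector_derivative p (x t) (w t)) (at t within {0..})"
      unfolding qw by (simp add: x_def w_def F_def)
  qed
qed

end

section \<open>Integration by parts and Gronwall's inequality\<close>

lemma borel_measurable_primitive [measurable (raw)]:
  fixes v :: "real \<Rightarrow> 'a::{banach, second_countable_topology}"
  assumes [measurable]: "v \<in> borel_measurable borel"
  shows "primitive v \<in> borel_measurable borel"
proof -
  have "(\<lambda>t. LINT s|lborel. (if 0 < s \<and> s \<le> t then v s else 0)) \<in> borel_measurable borel"
    by (rule lborel.borel_measurable_lebesgue_integral) measurable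
  moreover have "primitive v = (\<lambda>t. LINT s|lborel. (if 0 < s \<and> s \<le> t then v s else 0))"
    unfolding primitive_def set_lebesgue_integral_def
    by (intro ext Bochner_Integration.integral_cong) (auto simp: indicator_def)
  ultimately show ?thesis by simp
qed

lemma set_integral_Icc_Ioc:
  fixes f :: "real \<Rightarrow> 'a::{banach, second_countable_topology}"
  assumes [measurable]: "f \<in> borel_measurable borel"
  shows "(LINT u:{s..t}|lborel. f u) = (LINT u:{s<..t}|lborel. f u)"
  unfolding set_lebesgue_integral_def
proof (rule integral_cong_AE)
  show "AE u in lborel. indicator {s..t} u *\<^sub>R f u = indicator {s<..t} u *\<^sub>R f u"
    using AE_lborel_singleton[of s] by eventually_elim (auto simp: indicator_def)
qed measurable

lemma set_integral_mono_set:
  fixes f :: "real \<Rightarrow> real"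
  assumes "set_integrable lborel B f" "A \<in> sets borel" "A \<subseteq> B" "\<And>x. x \<in> B \<Longrightarrow> 0 \<le> f x"
  shows "(LINT u:A|lborel. f u) \<le> (LINT u:B|lborel. f u)"
proof -
  have "set_integrable lborel A f" by (rule set_integrable_subset[OF assms(1)]) (use assms in auto)
  with assms show ?thesis
    unfolding set_lebesgue_integral_def set_integrable_def
    by (intro integral_mono) (auto split: split_indicator)
qed

text \<open>Testing against each vector reduces this to the fundamental theorem of calculus for scalar functions.\<close>

lemma primitive_of_derivative:
  fixes x w :: "real \<Rightarrow> 'a::{real_inner, banach, second_countable_topology}"
  assumes w: "continuous_on UNIV w"
    and x: "\<And>t. t \<ge> 0 \<Longrightarrow> (x has_vector_derivative w t) (at t within {0..})"
    and t: "t \<ge> 0"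
  shows "x t = x 0 + primitive w t"
proof -
  have wm: "w \<in> borel_measurable borel" by (rule borel_measurable_continuous_onI[OF w])
  have wi: "set_integrable lborel {0<..t} w"
  proof -
    have "continuous_on {0..t} w" by (rule continuous_on_subset[OF w]) simp
    then have "set_integrable lborel {0..t} w"
      unfolding set_integrable_def by (intro borel_integrable_compact) auto
    then show ?thesis by (rule set_integrable_subset) auto
  qed
  have "(x t - x 0) \<bullet> z = primitive w t \<bullet> z" for z
  proof -
    have "(LINT u|lborel. indicator {0..t} u *\<^sub>R (w u \<bullet> z)) = x t \<bullet> z - x 0 \<bullet> z"
    proof (rule integral_FTC_atLeastAtMost[OF t])
      show "continuous_on {0..t} (\<lambda>u. w u \<bullet> z)"
        using continuous_on_subset[OF w, of "{0..t}"] by (intro continuous_intros) auto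
      fix s assume s: "0 \<le> s" "s \<le> t"
      have "((\<lambda>u. x u \<bullet> z) has_vector_derivative w s \<bullet> z) (at s within {0..})"
        by (rule bounded_linear.has_vector_derivative[OF bounded_linear_inner_left x[OF s(1)]])
      then show "((\<lambda>u. x u \<bullet> z) has_vector_derivative w s \<bullet> z) (at s within {0..t})"
        by (rule has_vector_derivative_within_subset) auto
    qed
    moreover have "(LINT u|lborel. indicator {0..t} u *\<^sub>R (w u \<bullet> z)) = (LINT u:{0<..t}|lborel. w u \<bullet> z)"
      using set_integral_Icc_Ioc[of "\<lambda>u. w u \<bullet> z" 0 t] wm by (simp add: set_lebesgue_integral_def)
    moreover have "(LINT u:{0<..t}|lborel. w u \<bullet> z) = primitive w t \<bullet> z"
      unfolding primitive_def by (rule set_integral_inner_left[OF wi])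
    ultimately show ?thesis by (simp add: inner_diff_left)
  qed
  then have "((x t - x 0) - primitive w t) \<bullet> ((x t - x 0) - primitive w t) = 0"
    by (simp add: inner_diff_left)
  then have "(x t - x 0) - primitive w t = 0" by (simp only: inner_eq_zero_iff)
  then show ?thesis by (simp add: algebra_simps)
qed

lemma L2_on_continuous:
  fixes w :: "real \<Rightarrow> 'a::{banach, second_countable_topology}"
  assumes w: "continuous_on UNIV w"
  shows "L2_on T w"
proof -
  have "bounded (w ` {0..T})"
    by (intro compact_imp_bounded compact_continuous_image continuous_on_subset[OF w]) auto
  then obtain b where "\<forall>t\<in>{0..T}. norm (w t) \<le> b" by (auto simp: bounded_iff)
  then show ?thesis
    by (intro L2_on_bounded[of w T b] borel_measurable_continuous_onI[OF w]) auto
qed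

lemma primitive_bounded:
  fixes v :: "real \<Rightarrow> 'a::{banach, second_countable_topology}"
  assumes v: "L2_on T v"
  obtains R where "\<forall>t\<in>{0..T}. norm (primitive v t) \<le> R"
  using compact_imp_bounded[OF compact_continuous_image[OF continuous_primitive[OF v] compact_Icc]]
  by (auto simp: bounded_iff)

text \<open>Fubini's theorem for \<open>a t \<bullet> b s\<close> on the triangle \<open>s \<le> t\<close>.\<close>

lemma integral_by_parts:
  fixes a b :: "real \<Rightarrow> 'a::{real_inner, banach, second_countable_topology}"
  assumes a: "L2_on T a" and b: "L2_on T b"
  shows "(LINT t:{0<..T}|lborel. a t \<bullet> primitive b t) + (LINT t:{0<..T}|lborel. primitive a t \<bullet> b t)
    = primitive a T \<bullet> primitive b T"
proof -
  define a' where "a' t = indicator {0<..T} t *\<^sub>R a t" for t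
  define b' where "b' t = indicator {0<..T} t *\<^sub>R b t" for t
  have am[measurable]: "a \<in> borel_measurable borel" and bm[measurable]: "b \<in> borel_measurable borel"
    using a b by (auto simp: L2_on_def)
  have a'm[measurable]: "a' \<in> borel_measurable borel" "b' \<in> borel_measurable borel"
    unfolding a'_def b'_def by measurable
  have ai: "integrable lborel a'" and bi: "integrable lborel b'"
    using L2_on_set_integrable[OF a, of 0 T] L2_on_set_integrable[OF b, of 0 T]
    by (simp_all add: set_integrable_def a'_def[abs_def] b'_def[abs_def])
  have ai_in: "integrable lborel (\<lambda>t. indicator S t *\<^sub>R (a' t \<bullet> z))"
    and bi_in: "integrable lborel (\<lambda>t. indicator S t *\<^sub>R (z \<bullet> b' t))" if "S \<in> sets borel" for S z
    by (intro integrable_mult_indicator integrable_inner_left integrable_inner_right ai bi; use that in simp)+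
  define f where "f t s = (if s \<le> t then a' t \<bullet> b' s else 0)" for t s
  have fm: "(\<lambda>(t, s). f t s) \<in> borel_measurable (lborel \<Otimes>\<^sub>M lborel)"
    unfolding f_def by measurable
  have fs: "integrable lborel (f t)" for t
  proof -
    have "f t = (\<lambda>s. indicator {..t} s *\<^sub>R (a' t \<bullet> b' s))"
      by (auto simp: f_def indicator_def)
    then show ?thesis using bi_in[of "{..t}" "a' t"] by simp
  qed
  have fint: "integrable (lborel \<Otimes>\<^sub>M lborel) (\<lambda>(t, s). f t s)"
  proof (rule lborel_pair.Fubini_integrable[OF fm])
    show "AE t in lborel. integrable lborel (\<lambda>s. case (t, s) of (t, s) \<Rightarrow> f t s)"
      using fs by simp
    have "integrable lborel (\<lambda>t. norm (a' t) * (LINT s|lborel. norm (b' s)))"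
      using ai by auto
    then have "integrable lborel (\<lambda>t. LINT s|lborel. norm (f t s))"
    proof (rule Bochner_Integration.integrable_bound)
      have "(\<lambda>(t, s). norm (f t s)) \<in> borel_measurable (lborel \<Otimes>\<^sub>M lborel)"
        unfolding f_def by measurable
      then show "(\<lambda>t. LINT s|lborel. norm (f t s)) \<in> borel_measurable lborel"
        by (rule lborel.borel_measurable_lebesgue_integral)
      show "AE t in lborel. norm (LINT s|lborel. norm (f t s)) \<le> norm (norm (a' t) * (LINT s|lborel. norm (b' s)))"
      proof (rule AE_I2)
        fix t
        have "(LINT s|lborel. norm (f t s)) \<le> (LINT s|lborel. norm (a' t) * norm (b' s))"
        proof (rule integral_mono)
          show "integrable lborel (\<lambda>s. norm (f t s))" using fs by (rule integrable_norm)
          show "integrable lborel (\<lambda>s. norm (a' t) * norm (b' s))" using bi by auto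
          show "norm (f t s) \<le> norm (a' t) * norm (b' s)" for s
            using Cauchy_Schwarz_ineq2[of "a' t" "b' s"] by (auto simp: f_def)
        qed
        then show "norm (LINT s|lborel. norm (f t s)) \<le> norm (norm (a' t) * (LINT s|lborel. norm (b' s)))"
          by (simp add: abs_of_nonneg integral_nonneg_AE)
      qed
    qed
    then show "integrable lborel (\<lambda>t. LINT s|lborel. norm (case (t, s) of (t, s) \<Rightarrow> f t s))"
      by simp
  qed
  have swap: "(LINT s|lborel. LINT t|lborel. f t s) = (LINT t|lborel. LINT s|lborel. f t s)"
    by (rule lborel_pair.Fubini_integral[OF fint])
  have prim_b: "primitive b t = (LINT s|lborel. indicator {..t} s *\<^sub>R b' s)" if "t \<le> T" for t
    unfolding primitive_def set_lebesgue_integral_def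
    by (intro Bochner_Integration.integral_cong) (use that in \<open>auto simp: b'_def indicator_def\<close>)
  have prim_a: "primitive a t = (LINT s|lborel. indicator {..t} s *\<^sub>R a' s)" if "t \<le> T" for t
    unfolding primitive_def set_lebesgue_integral_def
    by (intro Bochner_Integration.integral_cong) (use that in \<open>auto simp: a'_def indicator_def\<close>)
  have I1: "(LINT t:{0<..T}|lborel. a t \<bullet> primitive b t) = (LINT t|lborel. LINT s|lborel. f t s)"
    unfolding set_lebesgue_integral_def
  proof (rule Bochner_Integration.integral_cong[OF refl])
    fix t
    have "(LINT s|lborel. f t s) = (LINT s|lborel. a' t \<bullet> (indicator {..t} s *\<^sub>R b' s))"
      by (intro Bochner_Integration.integral_cong) (auto simp: f_def indicator_def)
    also have "\<dots> = a' t \<bullet> (LINT s|lborel. indicator {..t} s *\<^sub>R b' s)"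
      using bi by (intro integral_inner_right integrable_mult_indicator) auto
    finally show "indicator {0<..T} t *\<^sub>R (a t \<bullet> primitive b t) = (LINT s|lborel. f t s)"
      using prim_b[of t] by (auto simp: a'_def indicator_def)
  qed
  have I2: "(LINT s:{0<..T}|lborel. primitive a s \<bullet> b s) = (LINT s|lborel. primitive a T \<bullet> b' s) - (LINT s|lborel. LINT t|lborel. f t s)"
  proof -
    have eq: "(LINT t|lborel. f t s) = primitive a T \<bullet> b' s - indicator {0<..T} s *\<^sub>R (primitive a s \<bullet> b s)" for s
    proof (cases "s \<in> {0<..T}")
      case False
      then have i0: "indicator {0<..T} s = (0::real)" by (rule indicator_simps(2))
      then have b0: "b' s = 0" by (simp add: b'_def)
      have "f t s = 0" for t by (simp add: f_def b0)
      then show ?thesis by (simp add: b0 i0)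
    next
      case True
      have "(LINT t|lborel. f t s) = (LINT t|lborel. (indicator {s..} t *\<^sub>R a' t) \<bullet> b' s)"
        by (intro Bochner_Integration.integral_cong) (auto simp: f_def indicator_def)
      also have "\<dots> = (LINT t|lborel. indicator {s..} t *\<^sub>R a' t) \<bullet> b' s"
        using ai by (intro integral_inner_left integrable_mult_indicator) auto
      also have "(LINT t|lborel. indicator {s..} t *\<^sub>R a' t) = (LINT t|lborel. indicator {..T} t *\<^sub>R a' t - indicator {..s} t *\<^sub>R a' t)"
      proof (rule integral_cong_AE)
        show "AE t in lborel. indicator {s..} t *\<^sub>R a' t = indicator {..T} t *\<^sub>R a' t - indicator {..s} t *\<^sub>R a' t"
          using AE_lborel_singleton[of s]
          by eventually_elim (use True in \<open>auto simp: a'_def indicator_def\<close>)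
      qed measurable
      also have "\<dots> = primitive a T - primitive a s"
        using True ai by (subst Bochner_Integration.integral_diff) (auto simp: prim_a intro!: integrable_mult_indicator)
      finally show ?thesis using True by (simp add: inner_diff_left b'_def)
    qed
    have i1: "integrable lborel (\<lambda>s. primitive a T \<bullet> b' s)"
      using bi by auto
    obtain R where R: "\<forall>t\<in>{0..T}. norm (primitive a t) \<le> R"
      by (rule primitive_bounded[OF a])
    have i2: "integrable lborel (\<lambda>s. indicator {0<..T} s *\<^sub>R (primitive a s \<bullet> b s))"
    proof (rule Bochner_Integration.integrable_bound)
      show "integrable lborel (\<lambda>s. R * norm (b' s))" using bi by auto
      show "AE s in lborel. norm (indicator {0<..T} s *\<^sub>R (primitive a s \<bullet> b s)) \<le> norm (R * norm (b' s))"
      proof (rule AE_I2)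
        fix s
        have "\<bar>primitive a s \<bullet> b s\<bar> \<le> R * norm (b s)" if "s \<in> {0<..T}"
        proof -
          have "\<bar>primitive a s \<bullet> b s\<bar> \<le> norm (primitive a s) * norm (b s)" by (rule Cauchy_Schwarz_ineq2)
          also have "\<dots> \<le> R * norm (b s)" using R that by (intro mult_right_mono) auto
          finally show ?thesis .
        qed
        then show "norm (indicator {0<..T} s *\<^sub>R (primitive a s \<bullet> b s)) \<le> norm (R * norm (b' s))"
          by (cases "s \<in> {0<..T}") (auto simp: b'_def intro: order_trans[OF _ abs_ge_self])
      qed
    qed measurable
    have "(LINT s|lborel. LINT t|lborel. f t s) = (LINT s|lborel. primitive a T \<bullet> b' s) - (LINT s:{0<..T}|lborel. primitive a s \<bullet> b s)"
      unfolding eq set_lebesgue_integral_def by (rule Bochner_Integration.integral_diff[OF i1 i2])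
    then show ?thesis by simp
  qed
  have "(LINT s|lborel. primitive a T \<bullet> b' s) = primitive a T \<bullet> (LINT s|lborel. b' s)"
    using bi by (intro integral_inner_right) auto
  also have "(LINT s|lborel. b' s) = primitive b T"
    by (simp add: primitive_def set_lebesgue_integral_def b'_def)
  finally show ?thesis using I1 I2 swap by simp
qed

text \<open>Multiply by a decaying exponential whose rate exceeds \<open>2 a\<close> and evaluate the inequality at a maximum
  point of the product: there the integral term takes up at most half of the maximum.\<close>

lemma Gronwall:
  fixes R :: "real \<Rightarrow> real"
  assumes "T \<ge> 0" and cont: "continuous_on {0..T} R" and "a \<ge> 0"
    and meas[measurable]: "R \<in> borel_measurable borel"
    and le: "\<And>t. 0 \<le> t \<Longrightarrow> t \<le> T \<Longrightarrow> R t \<le> b + a * (LINT s:{0<..t}|lborel. R s)"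
    and t: "0 \<le> t" "t \<le> T"
  shows "R t \<le> 2 * \<bar>b\<bar> * exp ((2 * a + 1) * t)"
proof -
  define k where "k = 2 * a + 1"
  have k: "k > 0" "a \<le> k / 2" using \<open>a \<ge> 0\<close> by (auto simp: k_def)
  have "continuous_on {0..T} (\<lambda>s. exp (- k * s) * R s)" by (intro continuous_intros cont)
  then obtain t0 where t0: "t0 \<in> {0..T}" "\<And>s. s \<in> {0..T} \<Longrightarrow> exp (- k * s) * R s \<le> exp (- k * t0) * R t0"
    using continuous_attains_sup[of "{0..T}" "\<lambda>s. exp (- k * s) * R s"] \<open>T \<ge> 0\<close> by auto
  define m where "m = exp (- k * t0) * R t0"
  have Rm: "R s \<le> m * exp (k * s)" if "s \<in> {0..T}" for s
    using t0(2)[OF that] unfolding m_def[symmetric]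
    by (simp add: exp_minus field_simps)
  have "m \<le> 2 * \<bar>b\<bar>"
  proof (cases "m \<le> 0")
    case True then show ?thesis by (rule order_trans) simp
  next
    case False
    have ei: "set_integrable lborel {0..t0} (\<lambda>s. m * exp (k * s))"
      unfolding set_integrable_def by (intro borel_integrable_compact continuous_intros) auto
    have eio: "set_integrable lborel {0<..t0} (\<lambda>s. m * exp (k * s))"
      by (rule set_integrable_subset[OF ei]) auto
    have Ri: "set_integrable lborel {0<..t0} R"
    proof -
      have "set_integrable lborel {0..T} R"
        unfolding set_integrable_def using cont by (intro borel_integrable_compact) auto
      then show ?thesis by (rule set_integrable_subset) (use t0 in auto)
    qed
    have "(LINT s:{0<..t0}|lborel. R s) \<le> (LINT s:{0<..t0}|lborel. m * exp (k * s))"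
      by (rule set_integral_mono[OF Ri eio]) (use Rm t0 in auto)
    also have "\<dots> = (LINT s:{0..t0}|lborel. m * exp (k * s))"
      by (rule set_integral_Icc_Ioc[symmetric]) measurable
    also have "\<dots> = m * exp (k * t0) / k - m * exp (k * 0) / k"
      unfolding set_lebesgue_integral_def
    proof (rule integral_FTC_atLeastAtMost)
      show "0 \<le> t0" using t0 by simp
      show "continuous_on {0..t0} (\<lambda>s. m * exp (k * s))" by (intro continuous_intros)
      fix s
      have "((\<lambda>s. m * exp (k * s) / k) has_real_derivative m * exp (k * s)) (at s within {0..t0})"
        using k by (auto intro!: derivative_eq_intros)
      then show "((\<lambda>s. m * exp (k * s) / k) has_vector_derivative m * exp (k * s)) (at s within {0..t0})"
        by (simp add: has_real_derivative_iff_has_vector_derivative)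
    qed
    also have "\<dots> \<le> m * exp (k * t0) / k" using False k by simp
    finally have "a * (LINT s:{0<..t0}|lborel. R s) \<le> a * (m * exp (k * t0) / k)"
      using \<open>a \<ge> 0\<close> by (rule mult_left_mono)
    also have "\<dots> \<le> (k / 2) * (m * exp (k * t0) / k)"
      using k False by (intro mult_right_mono) auto
    also have "\<dots> = m * exp (k * t0) / 2" using k by simp
    finally have "R t0 \<le> b + m * exp (k * t0) / 2"
      using le[of t0] t0 by auto
    then have "exp (- k * t0) * R t0 \<le> exp (- k * t0) * (b + m * exp (k * t0) / 2)"
      by (intro mult_left_mono) auto
    also have "\<dots> = exp (- k * t0) * b + m / 2"
      by (simp add: exp_minus field_simps)
    also have "exp (- k * t0) * b \<le> 1 * \<bar>b\<bar>"
    proof -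
      have "exp (- k * t0) * b \<le> exp (- k * t0) * \<bar>b\<bar>" by (intro mult_left_mono) auto
      also have "\<dots> \<le> 1 * \<bar>b\<bar>" using k t0 by (intro mult_right_mono) auto
      finally show ?thesis .
    qed
    finally show ?thesis by (simp add: m_def)
  qed
  then have "m * exp (k * t) \<le> 2 * \<bar>b\<bar> * exp (k * t)" by (intro mult_right_mono) auto
  from order_trans[OF Rm this] show ?thesis using t by (simp add: k_def)
qed

section \<open>The action and the Euler--Lagrange residual\<close>

lemma L2_on_affine_bound:
  fixes f :: "real \<Rightarrow> 'b::{banach, second_countable_topology}"
    and v :: "real \<Rightarrow> 'a::{banach, second_countable_topology}"
  assumes [measurable]: "f \<in> borel_measurable borel" and v: "L2_on T v"
    and le: "\<And>t. 0 < t \<Longrightarrow> t \<le> T \<Longrightarrow> norm (f t) \<le> c + d * norm (v t)"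
  shows "L2_on T f"
proof -
  have vi: "set_integrable lborel {0<..T} (\<lambda>t. (norm (v t))\<^sup>2)" using v by (simp add: L2_on_def)
  have ci: "set_integrable lborel {0<..T} (\<lambda>t. 2 * c\<^sup>2)"
    unfolding set_integrable_def by (cases "0 \<le> T") auto
  have i: "set_integrable lborel {0<..T} (\<lambda>t. 2 * c\<^sup>2 + 2 * d\<^sup>2 * (norm (v t))\<^sup>2)"
    by (intro set_integral_add(1) ci set_integrable_mult_right vi)
  have le2: "(norm (f t))\<^sup>2 \<le> 2 * c\<^sup>2 + 2 * d\<^sup>2 * (norm (v t))\<^sup>2" if t: "0 < t" "t \<le> T" for t
  proof -
    have "(norm (f t))\<^sup>2 \<le> (c + d * norm (v t))\<^sup>2" using le[OF t] by (intro power_mono) auto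
    moreover have "0 \<le> (c - d * norm (v t))\<^sup>2" by simp
    then have "(c + d * norm (v t))\<^sup>2 \<le> 2 * c\<^sup>2 + 2 * (d * norm (v t))\<^sup>2"
      by (simp add: power2_eq_square algebra_simps)
    ultimately show ?thesis by (simp add: power_mult_distrib)
  qed
  have "set_integrable lborel {0<..T} (\<lambda>t. (norm (f t))\<^sup>2)"
    by (rule set_integrable_bound[OF i]) (use le2 in \<open>auto simp: set_borel_measurable_def intro!: AE_I2\<close>)
  then show ?thesis by (simp add: L2_on_def)
qed

lemma primitive_minus:
  fixes v w :: "real \<Rightarrow> 'a::{banach, second_countable_topology}"
  assumes "L2_on T v" "L2_on T w" "t \<le> T"
  shows "primitive (\<lambda>s. v s - w s) t = primitive v t - primitive w t"
  unfolding primitive_def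
  by (rule set_integral_diff(2)) (use L2_on_set_integrable[of T _ 0 t] assms in auto)

lemma primitive_scaleR:
  fixes v :: "real \<Rightarrow> 'a::{banach, second_countable_topology}"
  shows "primitive (\<lambda>s. c *\<^sub>R v s) t = c *\<^sub>R primitive v t"
  unfolding primitive_def by (rule set_integral_scaleR_right)

lemma L2_on_norm: "L2_on T v \<Longrightarrow> L2_on T (\<lambda>t. norm (v t))"
  by (auto simp: L2_on_def)

lemma norm_primitive_le:
  fixes v :: "real \<Rightarrow> 'a::{banach, second_countable_topology}"
  assumes "L2_on T v" "0 \<le> t" "t \<le> T"
  shows "norm (primitive v t) \<le> primitive (\<lambda>s. norm (v s)) t"
  using norm_primitive_diff_le(1)[OF assms(1) order_refl assms(2,3)]
  unfolding primitive_def[of "\<lambda>s. norm (v s)"] by simp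

lemma L2_on_primitive:
  fixes v :: "real \<Rightarrow> 'a::{banach, second_countable_topology}"
  assumes v: "L2_on T v"
  shows "L2_on T (primitive v)"
proof -
  obtain R where R: "\<forall>t\<in>{0..T}. norm (primitive v t) \<le> R"
    by (rule primitive_bounded[OF v])
  show ?thesis
  proof (rule L2_on_bounded)
    show "primitive v \<in> borel_measurable borel"
      using v by (intro borel_measurable_primitive) (simp add: L2_on_def)
    show "norm (primitive v t) \<le> R" if "0 < t" "t \<le> T" for t using R that by auto
  qed
qed

context lagrangian begin

definition action :: "real \<Rightarrow> 'a \<Rightarrow> (real \<Rightarrow> 'a) \<Rightarrow> real" where
  "action T M v = (LINT t:{0<..T}|lborel. \<Lambda> (M + primitive v t) (v t))"

lemma path_measurable:
  assumes "L2_on T v"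
  shows "(\<lambda>t. M + primitive v t) \<in> borel_measurable borel" "v \<in> borel_measurable borel"
  using assms borel_measurable_primitive[of v] by (auto simp: L2_on_def)

lemma path_bounded:
  assumes v: "L2_on T v"
  obtains R where "\<forall>t\<in>{0..T}. norm (M + primitive v t) \<le> R"
proof -
  obtain R where R: "\<forall>t\<in>{0..T}. norm (primitive v t) \<le> R"
    by (rule primitive_bounded[OF v])
  have "\<forall>t\<in>{0..T}. norm (M + primitive v t) \<le> norm M + R"
    using R norm_triangle_le[of M _ "norm M + R"] by auto
  then show thesis by (rule that)
qed

lemma set_integrable_Lambda:
  assumes v: "L2_on T v"
  shows "set_integrable lborel {0<..T} (\<lambda>t. \<Lambda> (M + primitive v t) (v t))"
proof -
  obtain R where R: "\<forall>t\<in>{0..T}. norm (M + primitive v t) \<le> R"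
    by (rule path_bounded[OF v])
  have vi: "set_integrable lborel {0<..T} (\<lambda>t. (norm (v t))\<^sup>2)" using v by (simp add: L2_on_def)
  have ci: "set_integrable lborel {0<..T} (\<lambda>t. A + B * (1 + R\<^sup>2))"
    unfolding set_integrable_def by (cases "0 \<le> T") auto
  have i: "set_integrable lborel {0<..T} (\<lambda>t. (A + B * (1 + R\<^sup>2)) + B * (norm (v t))\<^sup>2)"
    by (intro set_integral_add(1) ci set_integrable_mult_right vi)
  have le: "\<bar>\<Lambda> (M + primitive v t) (v t)\<bar> \<le> (A + B * (1 + R\<^sup>2)) + B * (norm (v t))\<^sup>2" if t: "0 < t" "t \<le> T" for t
  proof -
    have "(norm (M + primitive v t))\<^sup>2 \<le> R\<^sup>2" using R t by (intro power_mono) auto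
    then have "B * (1 + (norm (M + primitive v t))\<^sup>2 + (norm (v t))\<^sup>2) \<le> B * (1 + R\<^sup>2 + (norm (v t))\<^sup>2)"
      using B by (intro mult_left_mono) auto
    then have 1: "\<Lambda> (M + primitive v t) (v t) \<le> B * (1 + R\<^sup>2) + B * (norm (v t))\<^sup>2"
      using growth[of "M + primitive v t" "v t"] by (simp add: algebra_simps)
    have "0 \<le> \<alpha> * (norm (v t))\<^sup>2" "0 \<le> B * (1 + R\<^sup>2)" "0 \<le> B * (norm (v t))\<^sup>2"
      using \<alpha> B by (auto intro!: mult_nonneg_nonneg)
    then show ?thesis using 1 coercive[of "v t" "M + primitive v t"] A by (simp add: abs_le_iff)
  qed
  have m: "(\<lambda>t. \<Lambda> (M + primitive v t) (v t)) \<in> borel_measurable borel"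
    by (rule borel_measurable_compose(1)[OF path_measurable[OF v]])
  show ?thesis
  proof (rule set_integrable_bound[OF i])
    show "set_borel_measurable lborel {0<..T} (\<lambda>t. \<Lambda> (M + primitive v t) (v t))"
      using m by (simp add: set_borel_measurable_def)
    show "AE t in lborel. t \<in> {0<..T} \<longrightarrow> norm (\<Lambda> (M + primitive v t) (v t)) \<le> norm ((A + B * (1 + R\<^sup>2)) + B * (norm (v t))\<^sup>2)"
    proof (intro AE_I2 impI)
      fix t assume "t \<in> {0<..T}"
      then have "\<bar>\<Lambda> (M + primitive v t) (v t)\<bar> \<le> (A + B * (1 + R\<^sup>2)) + B * (norm (v t))\<^sup>2"
        by (intro le) auto
      also have "\<dots> \<le> \<bar>(A + B * (1 + R\<^sup>2)) + B * (norm (v t))\<^sup>2\<bar>" by (rule abs_ge_self)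
      finally show "norm (\<Lambda> (M + primitive v t) (v t)) \<le> norm ((A + B * (1 + R\<^sup>2)) + B * (norm (v t))\<^sup>2)"
        by (simp only: real_norm_def)
    qed
  qed
qed

lemma gradient_L2:
  assumes v: "L2_on T v"
  shows "L2_on T (\<lambda>t. p (M + primitive v t) (v t))" and "L2_on T (\<lambda>t. q (M + primitive v t) (v t))"
proof -
  obtain R where R: "\<forall>t\<in>{0..T}. norm (M + primitive v t) \<le> R"
    by (rule path_bounded[OF v])
  have le: "6 * K * (norm (M + primitive v t - 0) + norm (v t - 0)) \<le> 6 * K * R + 6 * K * norm (v t)"
    if "0 < t" "t \<le> T" for t
    using R that K by (simp add: distrib_left)
  show "L2_on T (\<lambda>t. p (M + primitive v t) (v t))"
  proof (rule L2_on_affine_bound[OF borel_measurable_compose(2)[OF path_measurable[OF v]] v])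
    fix t assume t: "0 < t" "t \<le> T"
    have "norm (p (M + primitive v t) (v t) - p 0 0) \<le> 6 * K * R + 6 * K * norm (v t)"
      by (rule order_trans[OF grad_Lipschitz(1) le[OF t]])
    then show "norm (p (M + primitive v t) (v t)) \<le> (norm (p 0 0) + 6 * K * R) + 6 * K * norm (v t)"
      using norm_triangle_sub[of "p (M + primitive v t) (v t)" "p 0 0"] by linarith
  qed
  show "L2_on T (\<lambda>t. q (M + primitive v t) (v t))"
  proof (rule L2_on_affine_bound[OF borel_measurable_compose(3)[OF path_measurable[OF v]] v])
    fix t assume t: "0 < t" "t \<le> T"
    have "norm (q (M + primitive v t) (v t) - q 0 0) \<le> 6 * K * R + 6 * K * norm (v t)"
      by (rule order_trans[OF grad_Lipschitz(2) le[OF t]])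
    then show "norm (q (M + primitive v t) (v t)) \<le> (norm (q 0 0) + 6 * K * R) + 6 * K * norm (v t)"
      using norm_triangle_sub[of "q (M + primitive v t) (v t)" "q 0 0"] by linarith
  qed
qed

text \<open>The Euler--Lagrange equation in integrated form, with initial momentum \<open>- P\<close>: it holds on
  \<open>(0, T]\<close> exactly when the residual vanishes there.\<close>

definition residual :: "'a \<Rightarrow> 'a \<Rightarrow> (real \<Rightarrow> 'a) \<Rightarrow> real \<Rightarrow> 'a" where
  "residual M P v t = q (M + primitive v t) (v t)
     - primitive (\<lambda>s. p (M + primitive v s) (v s)) t + P"

lemma L2_on_const: "L2_on T (\<lambda>t. c)" for c :: "'b::{banach, second_countable_topology}"
  by (rule L2_on_bounded[of _ _ "norm c"]) auto

lemma residual_L2: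
  assumes v: "L2_on T v"
  shows "L2_on T (residual M P v)"
  unfolding residual_def[abs_def]
  by (intro L2_on_add L2_on_diff gradient_L2 L2_on_primitive L2_on_const v)

text \<open>The velocity is changed by \<open>- \<kappa> g\<close>, and the initial point by \<open>\<kappa> \<integral> g\<close>, so that the
  position at time \<open>t\<close> changes by \<open>\<kappa> \<integral>\<^sub>t\<^sup>T g\<close> and the end point stays in place. Integrating the position
  term by parts turns the first variation into \<open>- \<kappa> \<integral> (q - \<integral> p) \<bullet> g\<close>, and \<open>q - \<integral> p = g - P\<close> by
  definition of the residual. The second-order terms are controlled by \<open>upper\<close>.\<close>

lemma residual_variation:
  fixes M P v and T \<kappa> :: real
  defines "g \<equiv> residual M P v"
  defines "G \<equiv> (LINT t:{0<..T}|lborel. (norm (g t))\<^sup>2)"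
  assumes T: "T \<ge> 0" and v: "L2_on T v"
  shows "action T (M + \<kappa> *\<^sub>R primitive g T) (\<lambda>t. v t - \<kappa> *\<^sub>R g t)
    \<le> action T M v - \<kappa> * G + P \<bullet> (\<kappa> *\<^sub>R primitive g T) + K * (1 + T\<^sup>2) * (\<kappa>\<^sup>2 * G)"
proof -
  define x where "x t = M + primitive v t" for t
  define pp where "pp t = p (x t) (v t)" for t
  define qq where "qq t = q (x t) (v t)" for t
  define \<phi> where "\<phi> t = primitive g T - primitive g t" for t
  have g: "L2_on T g" unfolding g_def by (rule residual_L2[OF v])
  have pL: "L2_on T pp" and qL: "L2_on T qq"
    unfolding pp_def[abs_def] qq_def[abs_def] x_def by (rule gradient_L2[OF v])+
  have kg: "L2_on T (\<lambda>t. \<kappa> *\<^sub>R g t)" by (rule L2_on_scaleR[OF g])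
  have v': "L2_on T (\<lambda>t. v t - \<kappa> *\<^sub>R g t)" by (rule L2_on_diff[OF v kg])
  have G0: "G \<ge> 0" unfolding G_def by (rule set_integral_nonneg_real) simp
  have path: "(M + \<kappa> *\<^sub>R primitive g T) + primitive (\<lambda>t. v t - \<kappa> *\<^sub>R g t) t = x t + \<kappa> *\<^sub>R \<phi> t" if "t \<le> T" for t
    using that by (simp add: primitive_minus[OF v kg] primitive_scaleR x_def \<phi>_def algebra_simps)
  have phi_le: "(norm (\<phi> t))\<^sup>2 \<le> T * G" if t: "0 < t" "t \<le> T" for t
  proof -
    have "(norm (\<phi> t))\<^sup>2 \<le> (T - t) * (LINT u:{t<..T}|lborel. (norm (g u))\<^sup>2)"
      unfolding \<phi>_def by (rule norm_primitive_diff_le(2)[OF g]) (use t in auto)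
    also have "\<dots> \<le> T * G"
      unfolding G_def using t set_integral_sq_mono[OF g, of t T]
      by (intro mult_mono set_integral_nonneg_real) auto
    finally show ?thesis .
  qed
  have pt: "\<Lambda> (x t + \<kappa> *\<^sub>R \<phi> t) (v t - \<kappa> *\<^sub>R g t)
     \<le> \<Lambda> (x t) (v t) + \<kappa> * (pp t \<bullet> primitive g T - pp t \<bullet> primitive g t) - \<kappa> * (qq t \<bullet> g t)
        + K * \<kappa>\<^sup>2 * (norm (g t))\<^sup>2 + K * \<kappa>\<^sup>2 * (T * G)" if t: "0 < t" "t \<le> T" for t
  proof -
    have "\<Lambda> (x t + \<kappa> *\<^sub>R \<phi> t) (v t - \<kappa> *\<^sub>R g t) - \<Lambda> (x t) (v t) - pp t \<bullet> (\<kappa> *\<^sub>R \<phi> t) - qq t \<bullet> (- (\<kappa> *\<^sub>R g t))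
      \<le> K * (norm (- (\<kappa> *\<^sub>R g t)))\<^sup>2 + K * (norm (\<kappa> *\<^sub>R \<phi> t))\<^sup>2"
      using upper[where x = "x t" and h = "\<kappa> *\<^sub>R \<phi> t" and v = "v t" and k = "- (\<kappa> *\<^sub>R g t)"]
      unfolding pp_def qq_def by (simp only: add_uminus_conv_diff)
    moreover have "K * (norm (\<kappa> *\<^sub>R \<phi> t))\<^sup>2 \<le> K * \<kappa>\<^sup>2 * (T * G)"
    proof -
      have "K * \<kappa>\<^sup>2 * (norm (\<phi> t))\<^sup>2 \<le> K * \<kappa>\<^sup>2 * (T * G)"
        using phi_le[OF t] K by (intro mult_left_mono) auto
      then show ?thesis by (simp add: power_mult_distrib mult.assoc)
    qed
    moreover have "K * (norm (- (\<kappa> *\<^sub>R g t)))\<^sup>2 = K * \<kappa>\<^sup>2 * (norm (g t))\<^sup>2"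
      by (simp add: power_mult_distrib)
    moreover have "pp t \<bullet> (\<kappa> *\<^sub>R \<phi> t) = \<kappa> * (pp t \<bullet> primitive g T - pp t \<bullet> primitive g t)"
      by (simp add: \<phi>_def inner_diff_right)
    moreover have "qq t \<bullet> (- (\<kappa> *\<^sub>R g t)) = - (\<kappa> * (qq t \<bullet> g t))" by simp
    ultimately show ?thesis by linarith
  qed
  have i1: "set_integrable lborel {0<..T} (\<lambda>t. \<Lambda> (x t) (v t))"
    unfolding x_def by (rule set_integrable_Lambda[OF v])
  have i2: "set_integrable lborel {0<..T} (\<lambda>t. pp t \<bullet> primitive g T)"
    by (rule L2_on_inner[OF pL L2_on_const])
  have i3: "set_integrable lborel {0<..T} (\<lambda>t. pp t \<bullet> primitive g t)"
    by (rule L2_on_inner[OF pL L2_on_primitive[OF g]])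
  have i4: "set_integrable lborel {0<..T} (\<lambda>t. qq t \<bullet> g t)"
    by (rule L2_on_inner[OF qL g])
  have i5: "set_integrable lborel {0<..T} (\<lambda>t. (norm (g t))\<^sup>2)"
    using g by (simp add: L2_on_def)
  have i6: "set_integrable lborel {0<..T} (\<lambda>t. K * \<kappa>\<^sup>2 * (T * G))"
    unfolding set_integrable_def using T by auto
  have i7: "set_integrable lborel {0<..T} (\<lambda>t. primitive pp t \<bullet> g t)"
    by (rule L2_on_inner[OF L2_on_primitive[OF pL] g])
  have i8: "set_integrable lborel {0<..T} (\<lambda>t. P \<bullet> g t)"
    by (rule L2_on_inner[OF L2_on_const g])
  have "action T (M + \<kappa> *\<^sub>R primitive g T) (\<lambda>t. v t - \<kappa> *\<^sub>R g t)
    = (LINT t:{0<..T}|lborel. \<Lambda> (x t + \<kappa> *\<^sub>R \<phi> t) (v t - \<kappa> *\<^sub>R g t))"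
    unfolding action_def by (intro set_lebesgue_integral_cong) (auto simp: path)
  also have "\<dots> \<le> (LINT t:{0<..T}|lborel. \<Lambda> (x t) (v t) + \<kappa> * (pp t \<bullet> primitive g T - pp t \<bullet> primitive g t) - \<kappa> * (qq t \<bullet> g t)
        + K * \<kappa>\<^sup>2 * (norm (g t))\<^sup>2 + K * \<kappa>\<^sup>2 * (T * G))"
  proof (rule set_integral_mono)
    have "set_integrable lborel {0<..T} (\<lambda>t. \<Lambda> ((M + \<kappa> *\<^sub>R primitive g T) + primitive (\<lambda>t. v t - \<kappa> *\<^sub>R g t) t) (v t - \<kappa> *\<^sub>R g t))"
      by (rule set_integrable_Lambda[OF v'])
    then show "set_integrable lborel {0<..T} (\<lambda>t. \<Lambda> (x t + \<kappa> *\<^sub>R \<phi> t) (v t - \<kappa> *\<^sub>R g t))"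
      by (rule set_integrable_cong[THEN iffD1, rotated 3]) (auto simp: path)
  qed (use pt in \<open>auto intro!: set_integral_add(1) set_integral_diff(1) set_integrable_mult_right i1 i2 i3 i4 i5 i6\<close>)
  also have "\<dots> = (LINT t:{0<..T}|lborel. \<Lambda> (x t) (v t)) + \<kappa> * ((LINT t:{0<..T}|lborel. pp t \<bullet> primitive g T) - (LINT t:{0<..T}|lborel. pp t \<bullet> primitive g t))
     - \<kappa> * (LINT t:{0<..T}|lborel. qq t \<bullet> g t) + K * \<kappa>\<^sup>2 * G + (LINT t:{0<..T}|lborel. K * \<kappa>\<^sup>2 * (T * G))"
    unfolding G_def
    by (simp add: set_integral_add set_integral_diff set_integrable_mult_right i1 i2 i3 i4 i5 i6[unfolded G_def])
  also have "(LINT t:{0<..T}|lborel. K * \<kappa>\<^sup>2 * (T * G)) = K * \<kappa>\<^sup>2 * (T * G) * T"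
    unfolding set_lebesgue_integral_def using T by simp
  also have "(LINT t:{0<..T}|lborel. pp t \<bullet> primitive g T) = primitive pp T \<bullet> primitive g T"
    unfolding primitive_def[of pp] by (rule set_integral_inner_left[OF L2_on_set_integrable[OF pL]]) auto
  also have "(LINT t:{0<..T}|lborel. qq t \<bullet> g t) = G + (LINT t:{0<..T}|lborel. primitive pp t \<bullet> g t) - P \<bullet> primitive g T"
  proof -
    have "qq t \<bullet> g t = (norm (g t))\<^sup>2 + primitive pp t \<bullet> g t - P \<bullet> g t" for t
    proof -
      have "qq t = g t + primitive pp t - P"
        unfolding g_def residual_def qq_def x_def pp_def[abs_def] by simp
      then show ?thesis by (simp add: inner_add_left inner_diff_left power2_norm_eq_inner)
    qed
    moreover have "(LINT t:{0<..T}|lborel. P \<bullet> g t) = P \<bullet> primitive g T"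
      using set_integral_inner_left[OF L2_on_set_integrable[OF g], of 0 T P]
      by (simp add: primitive_def inner_commute)
    ultimately show ?thesis
      unfolding G_def by (simp add: set_integral_add set_integral_diff i5 i7 i8)
  qed
  finally have main: "action T (M + \<kappa> *\<^sub>R primitive g T) (\<lambda>t. v t - \<kappa> *\<^sub>R g t)
    \<le> action T M v + \<kappa> * (primitive pp T \<bullet> primitive g T - (LINT t:{0<..T}|lborel. pp t \<bullet> primitive g t))
      - \<kappa> * (G + (LINT t:{0<..T}|lborel. primitive pp t \<bullet> g t) - P \<bullet> primitive g T)
      + K * \<kappa>\<^sup>2 * G + K * \<kappa>\<^sup>2 * (T * G) * T"
    unfolding action_def x_def .
  have "primitive pp T \<bullet> primitive g T - (LINT t:{0<..T}|lborel. pp t \<bullet> primitive g t) = (LINT t:{0<..T}|lborel. primitive pp t \<bullet> g t)"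
    using integral_by_parts[OF pL g] by simp
  with main show ?thesis by (simp add: algebra_simps power2_eq_square)
qed

text \<open>Subtract the equations \<open>q (x, v) = g + \<integral> p (x, v) - P\<close> for \<open>v\<close> and for \<open>w\<close>. By
  \<open>velocity_stability\<close> this bounds \<open>\<parallel>v t - w t\<parallel>\<close> by \<open>\<parallel>g t\<parallel>\<close> and by the integral of \<open>\<parallel>v - w\<parallel>\<close> up to
  time \<open>t\<close>, to which Gronwall's inequality applies.\<close>

theorem velocity_gap:
  fixes v w :: "real \<Rightarrow> 'a" and M P T
  defines "a \<equiv> (6 * K * (T + 1) + 6 * K) / (2 * \<gamma>)"
  assumes T: "T > 0" and v: "L2_on T v" and w: "L2_on T w"
    and EL: "\<And>t. 0 < t \<Longrightarrow> t \<le> T \<Longrightarrow> residual M P w t = 0"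
  shows "(LINT t:{0<..T}|lborel. norm (v t - w t))
    \<le> 2 * (1 / (2 * \<gamma>) * sqrt (T * (LINT t:{0<..T}|lborel. (norm (residual M P v t))\<^sup>2))) * exp ((2 * a + 1) * T)"
proof -
  define c where "c = 1 / (2 * \<gamma>)"
  have c: "c > 0" using \<gamma> by (simp add: c_def)
  have a0: "a \<ge> 0" using K \<gamma> T by (simp add: a_def)
  define u where "u t = norm (v t - w t)" for t
  define R where "R = primitive u"
  define g where "g = residual M P v"
  have d: "L2_on T (\<lambda>t. v t - w t)" by (rule L2_on_diff[OF v w])
  have u: "L2_on T u" unfolding u_def[abs_def] by (rule L2_on_norm[OF d])
  have g: "L2_on T g" unfolding g_def by (rule residual_L2[OF v])
  have um: "u \<in> borel_measurable borel" using u by (simp add: L2_on_def)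
  have Rm: "R \<in> borel_measurable borel" unfolding R_def by (rule borel_measurable_primitive[OF um])
  have Rmono: "R s \<le> R t" if "0 \<le> s" "s \<le> t" "t \<le> T" for s t
  proof -
    have "0 \<le> (LINT r:{s<..t}|lborel. u r)" by (rule set_integral_nonneg_real) (simp add: u_def)
    then show ?thesis using primitive_diff[OF u that] by (simp add: R_def)
  qed
  have R0: "0 \<le> R t" if "0 \<le> t" "t \<le> T" for t
    using Rmono[of 0 t] that by (simp add: R_def)
  have gap: "norm ((M + primitive v t) - (M + primitive w t)) \<le> R t" if "0 \<le> t" "t \<le> T" for t
    using norm_primitive_le[OF d that] primitive_minus[OF v w that(2)]
    by (simp add: R_def u_def[abs_def])
  have Ri: "set_integrable lborel {0<..t} R" if "t \<le> T" for t
    using L2_on_set_integrable[OF L2_on_primitive[OF u], of 0 t] that by (simp add: R_def)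
  have ui: "set_integrable lborel {0<..t} u" if "t \<le> T" for t
    using L2_on_set_integrable[OF u, of 0 t] that by simp
  define pv where "pv t = p (M + primitive v t) (v t)" for t
  define pw where "pw t = p (M + primitive w t) (w t)" for t
  have pvL: "L2_on T pv" and pwL: "L2_on T pw"
    unfolding pv_def[abs_def] pw_def[abs_def] by (rule gradient_L2 v w)+
  have pd: "norm (primitive pv t - primitive pw t) \<le> 6 * K * (T + 1) * R t" if t: "0 < t" "t \<le> T" for t
  proof -
    have "norm (primitive pv t - primitive pw t) \<le> primitive (\<lambda>s. norm (pv s - pw s)) t"
      using norm_primitive_le[OF L2_on_diff[OF pvL pwL], of t] primitive_minus[OF pvL pwL, of t] t by simp
    also have "\<dots> \<le> (LINT s:{0<..t}|lborel. 6 * K * (R t + u s))"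
      unfolding primitive_def
    proof (rule set_integral_mono)
      show "set_integrable lborel {0<..t} (\<lambda>s. norm (pv s - pw s))"
        using L2_on_set_integrable[OF L2_on_norm[OF L2_on_diff[OF pvL pwL]], of 0 t] t by simp
      have "set_integrable lborel {0<..t} (\<lambda>s. R t)"
        unfolding set_integrable_def using t by auto
      then show "set_integrable lborel {0<..t} (\<lambda>s. 6 * K * (R t + u s))"
        by (intro set_integrable_mult_right set_integral_add(1) ui t(2))
      fix s assume s: "s \<in> {0<..t}"
      have "norm (pv s - pw s) \<le> 6 * K * (norm ((M + primitive v s) - (M + primitive w s)) + norm (v s - w s))"
        unfolding pv_def pw_def by (rule grad_Lipschitz)
      also have "\<dots> \<le> 6 * K * (R t + u s)"
        using gap[of s] Rmono[of s t] s t K by (intro mult_left_mono add_mono) (auto simp: u_def)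
      finally show "norm (pv s - pw s) \<le> 6 * K * (R t + u s)" .
    qed
    also have "\<dots> = 6 * K * ((LINT s:{0<..t}|lborel. R t) + R t)"
    proof -
      have "set_integrable lborel {0<..t} (\<lambda>s. R t)"
        unfolding set_integrable_def using t by auto
      then show ?thesis using ui[OF t(2)] by (simp add: set_integral_add R_def primitive_def[of u])
    qed
    also have "(LINT s:{0<..t}|lborel. R t) = t * R t"
      unfolding set_lebesgue_integral_def using t by simp
    also have "6 * K * (t * R t + R t) \<le> 6 * K * (T * R t + R t)"
      using t K R0[of t] by (intro mult_left_mono add_mono mult_right_mono) auto
    finally show ?thesis by (simp add: algebra_simps)
  qed
  have upt: "u t \<le> c * norm (g t) + a * R t" if t: "0 < t" "t \<le> T" for t
  proof -
    have "g t = q (M + primitive v t) (v t) - primitive pv t + P"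
      unfolding g_def residual_def pv_def[abs_def] ..
    moreover have "0 = q (M + primitive w t) (w t) - primitive pw t + P"
      using EL[OF t] unfolding residual_def pw_def[abs_def] by simp
    ultimately have "g t - 0 = (q (M + primitive v t) (v t) - primitive pv t + P) - (q (M + primitive w t) (w t) - primitive pw t + P)"
      by simp
    then have "q (M + primitive v t) (v t) - q (M + primitive w t) (w t) = g t + (primitive pv t - primitive pw t)"
      by simp
    then have "norm (q (M + primitive v t) (v t) - q (M + primitive w t) (w t)) \<le> norm (g t) + 6 * K * (T + 1) * R t"
      using norm_triangle_ineq[of "g t" "primitive pv t - primitive pw t"] pd[OF t] by simp
    moreover have "6 * K * norm ((M + primitive v t) - (M + primitive w t)) \<le> 6 * K * R t"
      using gap[of t] t K by (intro mult_left_mono) auto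
    ultimately have "norm (q (M + primitive v t) (v t) - q (M + primitive w t) (w t)) + 6 * K * norm ((M + primitive v t) - (M + primitive w t))
       \<le> norm (g t) + (6 * K * (T + 1) + 6 * K) * R t"
      by (simp add: algebra_simps)
    then have "(norm (q (M + primitive v t) (v t) - q (M + primitive w t) (w t)) + 6 * K * norm ((M + primitive v t) - (M + primitive w t))) / (2 * \<gamma>)
       \<le> (norm (g t) + (6 * K * (T + 1) + 6 * K) * R t) / (2 * \<gamma>)"
      using \<gamma> by (intro divide_right_mono) auto
    also have "\<dots> = c * norm (g t) + a * R t"
      unfolding c_def a_def by (simp only: add_divide_distrib[of "norm (g t)"] times_divide_eq_left mult_1)
    finally show ?thesis
      unfolding u_def by (rule order_trans[OF velocity_stability])
  qed
  have gi: "set_integrable lborel {0<..t} (\<lambda>s. norm (g s))" if "t \<le> T" for t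
    using L2_on_set_integrable[OF L2_on_norm[OF g], of 0 t] that by simp
  define b where "b = c * (LINT s:{0<..T}|lborel. norm (g s))"
  have b0: "b \<ge> 0" unfolding b_def using c by (intro mult_nonneg_nonneg set_integral_nonneg_real) auto
  have "R T \<le> 2 * \<bar>b\<bar> * exp ((2 * a + 1) * T)"
  proof (rule Gronwall[OF _ _ a0 Rm])
    show "continuous_on {0..T} R" unfolding R_def by (rule continuous_primitive[OF u])
    fix t assume t: "0 \<le> t" "t \<le> T"
    have "R t \<le> (LINT s:{0<..t}|lborel. c * norm (g s) + a * R s)"
      unfolding R_def primitive_def[of u t]
    proof (rule set_integral_mono)
      show "set_integrable lborel {0<..t} u" by (rule ui[OF t(2)])
      show "set_integrable lborel {0<..t} (\<lambda>s. c * norm (g s) + a * primitive u s)"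
        using gi[OF t(2)] Ri[OF t(2)] unfolding R_def by (intro set_integral_add(1) set_integrable_mult_right)
      show "u s \<le> c * norm (g s) + a * primitive u s" if "s \<in> {0<..t}" for s
        using upt[of s] that t by (simp add: R_def)
    qed
    also have "\<dots> = c * (LINT s:{0<..t}|lborel. norm (g s)) + a * (LINT s:{0<..t}|lborel. R s)"
      using gi[OF t(2)] Ri[OF t(2)] by (simp add: set_integral_add set_integrable_mult_right)
    also have "c * (LINT s:{0<..t}|lborel. norm (g s)) \<le> b"
      unfolding b_def using c t gi[of T] by (intro mult_left_mono set_integral_mono_set) auto
    finally show "R t \<le> b + a * (LINT s:{0<..t}|lborel. R s)" by simp
  qed (use T in auto)
  also have "\<bar>b\<bar> = b" using b0 by simp
  also have "2 * b * exp ((2 * a + 1) * T) \<le> 2 * (c * sqrt (T * (LINT t:{0<..T}|lborel. (norm (g t))\<^sup>2))) * exp ((2 * a + 1) * T)"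
    unfolding b_def using c T set_integral_norm_le_sqrt[OF g]
    by (intro mult_right_mono mult_left_mono) auto
  finally show ?thesis unfolding R_def primitive_def u_def c_def g_def .
qed

end

section \<open>Super- and subdifferentials\<close>

lemma smallo_at_0_bound:
  fixes r :: "'a::real_normed_vector \<Rightarrow> real"
  assumes r: "r \<in> o[at 0](norm)" and e: "e > 0"
  obtains d where "d > 0" "\<forall>X. X \<noteq> 0 \<and> norm X < d \<longrightarrow> \<bar>r X\<bar> \<le> e * norm X"
proof -
  have "\<forall>\<^sub>F X in at 0. norm (r X) \<le> e * norm (norm X)"
    by (rule landau_o.smallD[OF r e])
  then obtain d where d: "d > 0" "\<forall>X. X \<noteq> 0 \<and> dist X 0 < d \<longrightarrow> norm (r X) \<le> e * norm (norm X)"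
    unfolding eventually_at by auto
  show thesis
    by (rule that[OF d(1)]) (use d(2) in simp)
qed

lemma superdifferential_bound:
  fixes M :: "'a::real_inner"
  assumes \<zeta>: "\<zeta> \<in> superdifferential U M" and e: "e > 0"
  obtains d where "d > 0" "\<forall>X. norm X < d \<longrightarrow> U (M + X) \<le> U M + \<zeta> \<bullet> X + e * norm X"
proof -
  obtain r where r: "r \<in> o[at 0](norm)" "\<forall>X. U (M + X) \<le> U M + \<zeta> \<bullet> X + r X"
    using \<zeta> by (auto simp: superdifferential_def)
  obtain d where d: "d > 0" "\<forall>X. X \<noteq> 0 \<and> norm X < d \<longrightarrow> \<bar>r X\<bar> \<le> e * norm X"
    by (rule smallo_at_0_bound[OF r(1) e])
  have "\<forall>X. norm X < d \<longrightarrow> U (M + X) \<le> U M + \<zeta> \<bullet> X + e * norm X"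
  proof (intro allI impI)
    fix X :: 'a assume X: "norm X < d"
    show "U (M + X) \<le> U M + \<zeta> \<bullet> X + e * norm X"
    proof (cases "X = 0")
      case False
      then have "\<bar>r X\<bar> \<le> e * norm X" using d(2) X by simp
      moreover have "U (M + X) \<le> U M + \<zeta> \<bullet> X + r X" using r(2) by simp
      ultimately show ?thesis by linarith
    qed simp
  qed
  with d(1) show thesis by (rule that)
qed

lemma subdifferential_bound:
  fixes M :: "'a::real_inner"
  assumes \<zeta>: "\<zeta> \<in> subdifferential U M" and e: "e > 0"
  obtains d where "d > 0" "\<forall>X. norm X < d \<longrightarrow> U M + \<zeta> \<bullet> X - e * norm X \<le> U (M + X)"
proof -
  obtain r where r: "r \<in> o[at 0](norm)" "\<forall>X. U (M + X) \<ge> U M + \<zeta> \<bullet> X + r X"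
    using \<zeta> by (auto simp: subdifferential_def)
  obtain d where d: "d > 0" "\<forall>X. X \<noteq> 0 \<and> norm X < d \<longrightarrow> \<bar>r X\<bar> \<le> e * norm X"
    by (rule smallo_at_0_bound[OF r(1) e])
  have "\<forall>X. norm X < d \<longrightarrow> U M + \<zeta> \<bullet> X - e * norm X \<le> U (M + X)"
  proof (intro allI impI)
    fix X :: 'a assume X: "norm X < d"
    show "U M + \<zeta> \<bullet> X - e * norm X \<le> U (M + X)"
    proof (cases "X = 0")
      case False
      then have "\<bar>r X\<bar> \<le> e * norm X" using d(2) X by simp
      moreover have "U (M + X) \<ge> U M + \<zeta> \<bullet> X + r X" using r(2) by simp
      ultimately show ?thesis by linarith
    qed simp
  qed
  with d(1) show thesis by (rule that)
qed

lemma primitive_const: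
  fixes c :: "'b::{banach, second_countable_topology}"
  shows "t \<ge> 0 \<Longrightarrow> primitive (\<lambda>_. c) t = t *\<^sub>R c"
  by (simp add: primitive_def set_lebesgue_integral_def)

lemma set_integral_const_Ioc: "0 \<le> T \<Longrightarrow> (LINT t:{0<..T}|lborel. (c::real)) = T * c"
  and set_integrable_const_Ioc: "set_integrable lborel {0<..T} (\<lambda>t. c)"
  by (simp add: set_lebesgue_integral_def, cases "0 \<le> T", auto simp: set_integrable_def)

section \<open>Functions satisfying the dynamic programming principle\<close>

text \<open>The last two assumptions say that \<open>U M\<close> is the infimum of the cost over velocity fields, without
  requiring it to be attained.\<close>

locale weak_KAM = lagrangian \<Lambda> p q K \<gamma> \<alpha> A B
  for \<Lambda> :: "'a::{real_inner, banach, second_countable_topology} \<Rightarrow> 'a \<Rightarrow> real"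
    and p q K \<gamma> \<alpha> A B +
  fixes U :: "'a \<Rightarrow> real" and h l :: real
  assumes l: "l \<ge> 0" and U_Lipschitz: "\<bar>U x - U y\<bar> \<le> l * norm (x - y)"
    and dpp_le: "T > 0 \<Longrightarrow> L2_on T v \<Longrightarrow> U M \<le> action T M v + T * h + U (M + primitive v T)"
    and dpp_near: "T > 0 \<Longrightarrow> \<delta> > 0 \<Longrightarrow>
      \<exists>v. L2_on T v \<and> action T M v + T * h + U (M + primitive v T) \<le> U M + \<delta>"
begin

text \<open>The key estimate. Apply \<open>residual_variation\<close> with \<open>\<kappa> = s / \<parallel>g\<parallel>\<close>, so that the displacement of
  the initial point is at most \<open>s \<surd>T\<close> whatever the size of \<open>g\<close>. Comparing \<open>dpp_le\<close> at the displaced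
  point with the differentiability of \<open>U\<close> at \<open>M\<close> gives
  \<open>s \<parallel>g\<parallel> \<le> \<delta> + e s \<surd>T + K1 s\<^sup>2\<close>. For a fixed small \<open>s\<close> and \<open>\<delta>\<close> small compared with \<open>s\<close> this
  contradicts a large residual.\<close>

lemma near_minimizer_residual:
  assumes P: "GDERIV U M :> P" and T: "T > 0" and \<eta>: "\<eta> > 0"
  shows "\<exists>\<delta>>0. \<forall>v. L2_on T v \<longrightarrow> action T M v + T * h + U (M + primitive v T) \<le> U M + \<delta> \<longrightarrow>
      (LINT t:{0<..T}|lborel. (norm (residual M P v t))\<^sup>2) \<le> \<eta>"
proof -
  define K1 where "K1 = K * (1 + T\<^sup>2)"
  have K1: "K1 > 0" unfolding K1_def using K by (intro mult_pos_pos) (auto simp: add_pos_nonneg)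
  define m where "m = sqrt \<eta>"
  have m: "m > 0" using \<eta> by (simp add: m_def)
  define e where "e = m / (4 * sqrt T)"
  have e: "e > 0" using m T by (simp add: e_def)
  from P[unfolded gderiv_def has_derivative_at'] e obtain \<rho> where \<rho>: "\<rho> > 0"
    "\<forall>y. 0 < norm (y - M) \<and> norm (y - M) < \<rho> \<longrightarrow> norm (U y - U M - (y - M) \<bullet> P) / norm (y - M) < e"
    by (elim conjE) (drule spec[of _ e], auto)
  have lowU: "U M + P \<bullet> k - e * norm k \<le> U (M + k)" if k: "norm k < \<rho>" for k
  proof (cases "k = 0")
    case False
    then have n: "norm k > 0" by simp
    then have "norm (U (M + k) - U M - k \<bullet> P) / norm k < e"
      using \<rho>(2)[rule_format, of "M + k"] k by simp
    then have "\<bar>U (M + k) - U M - k \<bullet> P\<bar> < e * norm k" using n by (simp add: pos_divide_less_eq)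
    then show ?thesis by (simp add: inner_commute abs_less_iff)
  qed simp
  \<comment> \<open>\<open>s\<close>, \<open>e\<close> and \<open>\<delta> = s m / 4\<close> let each of the three error terms be at most \<open>s m / 4\<close>, where \<open>m\<^sup>2 = \<eta>\<close>.\<close>
  define s where "s = min (m / (4 * K1)) (\<rho> / (2 * sqrt T))"
  have s: "s > 0" using m K1 \<rho>(1) T by (simp add: s_def)
  have sK: "K1 * s \<le> m / 4"
  proof -
    have "K1 * s \<le> K1 * (m / (4 * K1))" unfolding s_def using K1 by (intro mult_left_mono) auto
    then show ?thesis using K1 by simp
  qed
  have s\<rho>: "s * sqrt T < \<rho>"
  proof -
    have "s * sqrt T \<le> \<rho> / (2 * sqrt T) * sqrt T" unfolding s_def using T by (intro mult_right_mono) auto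
    also have "\<dots> = \<rho> / 2" using T by simp
    finally show ?thesis using \<rho>(1) by simp
  qed
  show ?thesis
  proof (intro exI[of _ "s * m / 4"] conjI allI impI)
    show "s * m / 4 > 0" using s m by simp
    fix v assume v: "L2_on T v" and J: "action T M v + T * h + U (M + primitive v T) \<le> U M + s * m / 4"
    define g where "g = residual M P v"
    define G where "G = (LINT t:{0<..T}|lborel. (norm (g t))\<^sup>2)"
    have g: "L2_on T g" unfolding g_def by (rule residual_L2[OF v])
    show "(LINT t:{0<..T}|lborel. (norm (residual M P v t))\<^sup>2) \<le> \<eta>"
    proof (rule ccontr)
      assume "\<not> ?thesis"
      then have G: "\<eta> < G" by (simp add: G_def g_def)
      then have Gpos: "G > 0" using \<eta> by simp
      have mG: "m < sqrt G" using G by (simp add: m_def)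
      define \<kappa> where "\<kappa> = s / sqrt G"
      define k where "k = \<kappa> *\<^sub>R primitive g T"
      have \<kappa>: "\<kappa> > 0" using s Gpos by (simp add: \<kappa>_def)
      have sG: "sqrt G * sqrt G = G" "sqrt G > 0" using Gpos by auto
      have kG: "\<kappa> * G = s * sqrt G" and kG2: "\<kappa>\<^sup>2 * G = s\<^sup>2"
        using sG Gpos by (simp_all add: \<kappa>_def power_divide field_simps)
      have "(norm (primitive g T))\<^sup>2 \<le> T * G"
        using norm_primitive_diff_le(2)[OF g, of 0 T] T by (simp add: G_def)
      then have "norm (primitive g T) \<le> sqrt (T * G)" by (rule real_le_rsqrt)
      then have "norm k \<le> \<kappa> * sqrt (T * G)"
        using \<kappa> by (simp add: k_def)
      also have "\<dots> = s * sqrt T" using Gpos by (simp add: \<kappa>_def real_sqrt_mult)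
      finally have nk: "norm k \<le> s * sqrt T" .
      have kg: "L2_on T (\<lambda>t. \<kappa> *\<^sub>R g t)" by (rule L2_on_scaleR[OF g])
      have v': "L2_on T (\<lambda>t. v t - \<kappa> *\<^sub>R g t)" by (rule L2_on_diff[OF v kg])
      have fin: "(M + k) + primitive (\<lambda>t. v t - \<kappa> *\<^sub>R g t) T = M + primitive v T"
        by (simp add: primitive_minus[OF v kg] primitive_scaleR k_def)
      have "U (M + k) \<le> action T (M + k) (\<lambda>t. v t - \<kappa> *\<^sub>R g t) + T * h + U (M + primitive v T)"
        using dpp_le[OF T v', of "M + k"] unfolding fin .
      also have "action T (M + k) (\<lambda>t. v t - \<kappa> *\<^sub>R g t) \<le> action T M v - \<kappa> * G + P \<bullet> k + K1 * (\<kappa>\<^sup>2 * G)"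
        using residual_variation[of T v M \<kappa> P] T v unfolding g_def[symmetric] G_def[symmetric] k_def[symmetric] K1_def by simp
      finally have "U (M + k) \<le> U M + s * m / 4 - s * sqrt G + P \<bullet> k + K1 * s\<^sup>2"
        using J unfolding kG kG2 by linarith
      moreover have "U M + P \<bullet> k - e * norm k \<le> U (M + k)"
        using nk s\<rho> by (intro lowU) linarith
      moreover have "e * norm k \<le> s * (m / 4)"
      proof -
        have "e * norm k \<le> e * (s * sqrt T)" using nk e by (intro mult_left_mono) auto
        also have "\<dots> = s * (m / 4)" using T by (simp add: e_def)
        finally show ?thesis .
      qed
      moreover have "K1 * s\<^sup>2 \<le> s * (m / 4)"
      proof -
        have "s * (K1 * s) \<le> s * (m / 4)" using sK s by (intro mult_left_mono) auto
        then show ?thesis by (simp add: power2_eq_square mult_ac)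
      qed
      ultimately have "s * sqrt G \<le> s * (3 * m / 4)" by (simp add: algebra_simps)
      then have "sqrt G \<le> 3 * m / 4" using s by simp
      then show False using mG m by simp
    qed
  qed
qed

theorem near_minimizers_converge:
  assumes P: "GDERIV U M :> P" and T: "T > 0" and w: "L2_on T w"
    and EL: "\<forall>t\<in>{0<..T}. residual M P w t = 0" and e: "e > 0"
  shows "\<exists>\<delta>>0. \<forall>v. L2_on T v \<longrightarrow> action T M v + T * h + U (M + primitive v T) \<le> U M + \<delta> \<longrightarrow>
      (LINT t:{0<..T}|lborel. norm (v t - w t)) \<le> e"
proof -
  define a where "a = (6 * K * (T + 1) + 6 * K) / (2 * \<gamma>)"
  define C where "C = 2 * (1 / (2 * \<gamma>)) * exp ((2 * a + 1) * T)"
  have C: "C > 0" using \<gamma> by (simp add: C_def)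
  define \<eta> where "\<eta> = (e / C)\<^sup>2 / T"
  have \<eta>: "\<eta> > 0" using e C T by (simp add: \<eta>_def)
  obtain \<delta> where \<delta>: "\<delta> > 0"
    "\<forall>v. L2_on T v \<longrightarrow> action T M v + T * h + U (M + primitive v T) \<le> U M + \<delta> \<longrightarrow>
      (LINT t:{0<..T}|lborel. (norm (residual M P v t))\<^sup>2) \<le> \<eta>"
    using near_minimizer_residual[OF P T \<eta>] by (elim exE conjE)
  show ?thesis
  proof (intro exI[of _ \<delta>] conjI allI impI)
    show "\<delta> > 0" by (rule \<delta>(1))
    fix v assume v: "L2_on T v" and J: "action T M v + T * h + U (M + primitive v T) \<le> U M + \<delta>"
    have "(LINT t:{0<..T}|lborel. norm (v t - w t))
      \<le> C * sqrt (T * (LINT t:{0<..T}|lborel. (norm (residual M P v t))\<^sup>2))"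
      using velocity_gap[OF T v w, of M P] EL by (simp add: C_def a_def mult_ac)
    also have "\<dots> \<le> C * sqrt (T * \<eta>)"
      using C T \<delta>(2)[rule_format, OF v J] by (intro mult_left_mono real_sqrt_le_mono) auto
    also have "\<dots> = e" using T C e by (simp add: \<eta>_def)
    finally show "(LINT t:{0<..T}|lborel. norm (v t - w t)) \<le> e" .
  qed
qed

text \<open>Near minimizers converge to \<open>w\<close> only in \<open>L\<^sup>1\<close>, while the action grows quadratically in the velocity.
  The bound \<open>lower\<close>, expanded around the extremal, still gives lower semicontinuity: its linear
  terms have bounded coefficients along a continuous extremal, and the quadratic term in the velocity has
  the good sign.\<close>

theorem Euler_Lagrange_minimizes:
  assumes P: "GDERIV U M :> P" and T: "T > 0" and w: "continuous_on UNIV w"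
    and EL: "\<forall>t\<in>{0<..T}. residual M P w t = 0"
  shows "action T M w + T * h + U (M + primitive w T) = U M"
proof (rule antisym)
  have wL: "L2_on T w" by (rule L2_on_continuous[OF w])
  show "U M \<le> action T M w + T * h + U (M + primitive w T)"
    by (rule dpp_le[OF T wL])
  define x where "x t = M + primitive w t" for t
  have xc: "continuous_on {0..T} x"
    unfolding x_def by (intro continuous_intros continuous_primitive[OF wL])
  have wc: "continuous_on {0..T} w" by (rule continuous_on_subset[OF w]) simp
  obtain D1 where D1: "\<forall>t\<in>{0..T}. norm (p (x t) (w t)) \<le> D1"
    using compact_imp_bounded[OF compact_continuous_image[OF continuous_compose(2)[OF xc wc] compact_Icc]]
    by (auto simp: bounded_iff)
  obtain D2 where D2: "\<forall>t\<in>{0..T}. norm (q (x t) (w t)) \<le> D2"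
    using compact_imp_bounded[OF compact_continuous_image[OF continuous_compose(3)[OF xc wc] compact_Icc]]
    by (auto simp: bounded_iff)
  have D0: "D1 \<ge> 0" "D2 \<ge> 0"
    using D1[rule_format, of 0] D2[rule_format, of 0] T norm_ge_zero order_trans[OF norm_ge_zero] by auto
  define C where "C = D1 * T + D2 + K * T + l"
  have C: "C \<ge> 0" using D0 T K l by (simp add: C_def)
  show "action T M w + T * h + U (M + primitive w T) \<le> U M"
  proof (rule field_le_epsilon)
    fix \<epsilon> :: real assume \<epsilon>: "\<epsilon> > 0"
    define e where "e = min 1 (\<epsilon> / (2 * (C + 1)))"
    have e: "e > 0" "e \<le> 1" using \<epsilon> C by (auto simp: e_def)
    have Ce: "C * e \<le> \<epsilon> / 2"
    proof -
      have "C * e \<le> (C + 1) * (\<epsilon> / (2 * (C + 1)))"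
        unfolding e_def using C \<epsilon> by (intro mult_mono) auto
      also have "\<dots> = \<epsilon> / 2" using C by (simp add: field_simps)
      finally show ?thesis .
    qed
    obtain \<delta> where \<delta>: "\<delta> > 0"
      "\<forall>v. L2_on T v \<longrightarrow> action T M v + T * h + U (M + primitive v T) \<le> U M + \<delta> \<longrightarrow>
        (LINT t:{0<..T}|lborel. norm (v t - w t)) \<le> e"
      using near_minimizers_converge[OF P T wL EL e(1)] by (elim exE conjE)
    have \<delta>': "min \<delta> (\<epsilon> / 2) > 0" using \<delta>(1) \<epsilon> by simp
    obtain v where v: "L2_on T v" and J: "action T M v + T * h + U (M + primitive v T) \<le> U M + min \<delta> (\<epsilon> / 2)"
      using dpp_near[OF T \<delta>'] by blast
    have gap: "(LINT t:{0<..T}|lborel. norm (v t - w t)) \<le> e"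
      using J by (intro \<delta>(2)[rule_format, OF v]) simp
    have dL: "L2_on T (\<lambda>t. v t - w t)" by (rule L2_on_diff[OF v wL])
    have di: "set_integrable lborel {0<..T} (\<lambda>t. norm (v t - w t))"
      using L2_on_set_integrable[OF L2_on_norm[OF dL], of 0 T] by simp
    define y where "y t = primitive v t - primitive w t" for t
    have y: "norm (y t) \<le> e" if t: "0 \<le> t" "t \<le> T" for t
    proof -
      have "norm (y t) \<le> primitive (\<lambda>s. norm (v s - w s)) t"
        using norm_primitive_le[OF dL t] primitive_minus[OF v wL t(2)] by (simp add: y_def)
      also have "\<dots> \<le> (LINT t:{0<..T}|lborel. norm (v t - w t))"
        unfolding primitive_def using t by (intro set_integral_mono_set[OF di]) auto
      finally show ?thesis using gap by simp
    qed
    have pt: "\<Lambda> (x t) (w t) \<le> \<Lambda> (M + primitive v t) (v t) + (D1 * e + K * e) + D2 * norm (v t - w t)"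
      if t: "0 < t" "t \<le> T" for t
    proof -
      have "\<gamma> * (norm (v t - w t))\<^sup>2 - K * (norm (y t))\<^sup>2
        \<le> \<Lambda> (x t + y t) (w t + (v t - w t)) - \<Lambda> (x t) (w t) - p (x t) (w t) \<bullet> y t - q (x t) (w t) \<bullet> (v t - w t)"
        by (rule lower)
      moreover have "x t + y t = M + primitive v t" by (simp add: x_def y_def)
      moreover have "\<bar>p (x t) (w t) \<bullet> y t\<bar> \<le> D1 * e"
        using D1 D0 y[of t] t by (intro order_trans[OF Cauchy_Schwarz_ineq2] mult_mono) auto
      moreover have "\<bar>q (x t) (w t) \<bullet> (v t - w t)\<bar> \<le> D2 * norm (v t - w t)"
        using D2 t by (intro order_trans[OF Cauchy_Schwarz_ineq2] mult_right_mono) auto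
      moreover have "K * (norm (y t))\<^sup>2 \<le> K * e"
      proof (rule mult_left_mono)
        have "(norm (y t))\<^sup>2 \<le> e\<^sup>2" using y[of t] t by (intro power_mono) auto
        also have "e\<^sup>2 \<le> e" using e by (simp add: power2_eq_square mult_left_le)
        finally show "(norm (y t))\<^sup>2 \<le> e" .
      qed (use K in simp)
      moreover have "0 \<le> \<gamma> * (norm (v t - w t))\<^sup>2" using \<gamma> by simp
      ultimately show ?thesis by (simp add: abs_le_iff)
    qed
    have iv: "set_integrable lborel {0<..T} (\<lambda>t. \<Lambda> (M + primitive v t) (v t))"
      by (rule set_integrable_Lambda[OF v])
    have "action T M w \<le> (LINT t:{0<..T}|lborel. \<Lambda> (M + primitive v t) (v t) + (D1 * e + K * e) + D2 * norm (v t - w t))"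
      unfolding action_def
    proof (rule set_integral_mono)
      show "set_integrable lborel {0<..T} (\<lambda>t. \<Lambda> (M + primitive w t) (w t))"
        by (rule set_integrable_Lambda[OF wL])
      show "set_integrable lborel {0<..T} (\<lambda>t. \<Lambda> (M + primitive v t) (v t) + (D1 * e + K * e) + D2 * norm (v t - w t))"
        by (intro set_integral_add(1) set_integrable_mult_right iv di set_integrable_const_Ioc)
    qed (use pt in \<open>auto simp: x_def\<close>)
    also have "\<dots> = action T M v + T * (D1 * e + K * e) + D2 * (LINT t:{0<..T}|lborel. norm (v t - w t))"
      unfolding action_def using T
      by (simp add: set_integral_add set_integrable_const_Ioc set_integral_const_Ioc iv di set_integrable_mult_right algebra_simps)
    also have "\<dots> \<le> action T M v + T * (D1 * e + K * e) + D2 * e"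
      using gap D0 by (intro add_left_mono mult_left_mono) auto
    finally have 1: "action T M w \<le> action T M v + T * (D1 * e + K * e) + D2 * e" .
    have "U (M + primitive w T) \<le> U (M + primitive v T) + l * norm (y T)"
      using U_Lipschitz[of "M + primitive v T" "M + primitive w T"] by (simp add: y_def abs_le_iff)
    also have "l * norm (y T) \<le> l * e" using y[of T] T l by (intro mult_left_mono) auto
    finally have 2: "U (M + primitive w T) \<le> U (M + primitive v T) + l * e" by simp
    have 3: "T * (D1 * e + K * e) + D2 * e + l * e = C * e" by (simp add: C_def algebra_simps)
    have 4: "action T M v + T * h + U (M + primitive v T) \<le> U M + \<epsilon> / 2" using J by simp
    show "action T M w + T * h + U (M + primitive w T) \<le> U M + \<epsilon>"
      using 1 2 3 4 Ce by linarith
  qed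
qed

theorem minimizer_unique:
  assumes P: "GDERIV U M :> P" and T: "T > 0" and w: "L2_on T w"
    and EL: "\<forall>t\<in>{0<..T}. residual M P w t = 0"
    and v: "L2_on T v" and J: "action T M v + T * h + U (M + primitive v T) \<le> U M"
    and t: "0 \<le> t" "t \<le> T"
  shows "primitive v t = primitive w t"
proof -
  have dL: "L2_on T (\<lambda>t. v t - w t)" by (rule L2_on_diff[OF v w])
  have di: "set_integrable lborel {0<..T} (\<lambda>t. norm (v t - w t))"
    using L2_on_set_integrable[OF L2_on_norm[OF dL], of 0 T] by simp
  have le: "(LINT t:{0<..T}|lborel. norm (v t - w t)) \<le> 0 + e" if e: "e > 0" for e
  proof -
    obtain \<delta> where \<delta>: "\<delta> > 0"
      "\<forall>v. L2_on T v \<longrightarrow> action T M v + T * h + U (M + primitive v T) \<le> U M + \<delta> \<longrightarrow>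
        (LINT t:{0<..T}|lborel. norm (v t - w t)) \<le> e"
      using near_minimizers_converge[OF P T w EL e] by (elim exE conjE)
    show ?thesis using \<delta>(2)[rule_format, OF v] J \<delta>(1) by simp
  qed
  have "norm (primitive v t - primitive w t) \<le> primitive (\<lambda>s. norm (v s - w s)) t"
    using norm_primitive_le[OF dL t] primitive_minus[OF v w t(2)] by simp
  also have "\<dots> \<le> (LINT t:{0<..T}|lborel. norm (v t - w t))"
    unfolding primitive_def using t by (intro set_integral_mono_set[OF di]) auto
  also have "\<dots> \<le> 0" by (rule field_le_epsilon[OF le])
  finally show ?thesis by simp
qed


text \<open>The principle along the straight line \<open>M + t N\<close> over a short time.\<close>

theorem superdifferential_inequality:
  assumes \<zeta>: "\<zeta> \<in> superdifferential U M"
  shows "- (\<zeta> \<bullet> N) - \<Lambda> M N \<le> h"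
proof (rule field_le_epsilon)
  fix \<epsilon> :: real assume \<epsilon>: "\<epsilon> > 0"
  define n where "n = norm N + 1"
  have n: "n \<ge> 1" "norm N \<le> n" by (auto simp: n_def)
  define e where "e = \<epsilon> / (2 * n)"
  have e: "e > 0" using \<epsilon> n by (simp add: e_def)
  obtain d where d: "d > 0" "\<forall>X. norm X < d \<longrightarrow> U (M + X) \<le> U M + \<zeta> \<bullet> X + e * norm X"
    by (rule superdifferential_bound[OF \<zeta> e])
  define C where "C = \<bar>p M N \<bullet> N\<bar> + K * (norm N)\<^sup>2"
  have C: "C \<ge> 0" using K by (simp add: C_def)
  define T where "T = min 1 (min (d / (2 * n)) (\<epsilon> / (2 * (C + 1))))"
  have T: "T > 0" "T \<le> 1" using d(1) n \<epsilon> C by (auto simp: T_def)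
  have TC: "C * T \<le> \<epsilon> / 2"
  proof -
    have "C * T \<le> (C + 1) * (\<epsilon> / (2 * (C + 1)))"
      using C T \<epsilon> by (intro mult_mono) (auto simp: T_def)
    also have "\<dots> = \<epsilon> / 2" using C by (simp add: field_simps)
    finally show ?thesis .
  qed
  have Td: "T * norm N < d"
  proof -
    have "T * norm N \<le> d / (2 * n) * n"
      using n T d(1) by (intro mult_mono) (auto simp: T_def)
    also have "\<dots> = d / 2" using n by simp
    finally show ?thesis using d(1) by simp
  qed
  have vL: "L2_on T (\<lambda>_. N)" by (rule L2_on_const)
  have "action T M (\<lambda>_. N) \<le> (LINT t:{0<..T}|lborel. \<Lambda> M N + T * C)"
    unfolding action_def
  proof (rule set_integral_mono)
    show "set_integrable lborel {0<..T} (\<lambda>t. \<Lambda> (M + primitive (\<lambda>_. N) t) N)"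
      by (rule set_integrable_Lambda[OF vL])
    show "set_integrable lborel {0<..T} (\<lambda>t. \<Lambda> M N + T * C)" by (rule set_integrable_const_Ioc)
    fix t assume "t \<in> {0<..T}"
    then have t: "0 < t" "t \<le> T" by auto
    have "\<Lambda> (M + t *\<^sub>R N) (N + 0) - \<Lambda> M N - p M N \<bullet> (t *\<^sub>R N) - q M N \<bullet> 0
      \<le> K * (norm (0::'a))\<^sup>2 + K * (norm (t *\<^sub>R N))\<^sup>2" by (rule upper)
    then have "\<Lambda> (M + t *\<^sub>R N) N \<le> \<Lambda> M N + t * (p M N \<bullet> N) + (t * t) * (K * (norm N)\<^sup>2)"
      by (simp add: power_mult_distrib power2_eq_square mult_ac)
    also have "t * (p M N \<bullet> N) \<le> T * \<bar>p M N \<bullet> N\<bar>"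
    proof -
      have "t * (p M N \<bullet> N) \<le> t * \<bar>p M N \<bullet> N\<bar>" using t by (intro mult_left_mono) auto
      also have "\<dots> \<le> T * \<bar>p M N \<bullet> N\<bar>" using t by (intro mult_right_mono) auto
      finally show ?thesis .
    qed
    also have "(t * t) * (K * (norm N)\<^sup>2) \<le> (T * 1) * (K * (norm N)\<^sup>2)"
      using t T K by (intro mult_right_mono mult_mono) auto
    finally show "\<Lambda> (M + primitive (\<lambda>_. N) t) N \<le> \<Lambda> M N + T * C"
      using t by (simp add: primitive_const C_def algebra_simps)
  qed
  also have "\<dots> = T * (\<Lambda> M N + T * C)" using T by (intro set_integral_const_Ioc) simp
  finally have "U M \<le> T * (\<Lambda> M N + T * C) + T * h + U (M + T *\<^sub>R N)"
    using dpp_le[OF T(1) vL, of M] T(1) by (simp add: primitive_const)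
  moreover have "U (M + T *\<^sub>R N) \<le> U M + T * (\<zeta> \<bullet> N) + e * (T * norm N)"
    using d(2)[rule_format, of "T *\<^sub>R N"] T Td by simp
  ultimately have "0 \<le> T * (\<Lambda> M N + T * C) + T * h + T * (\<zeta> \<bullet> N) + e * (T * norm N)"
    by linarith
  also have "\<dots> = T * (\<Lambda> M N + C * T + h + \<zeta> \<bullet> N + e * norm N)"
    by (simp add: algebra_simps)
  finally have "0 \<le> \<Lambda> M N + C * T + h + \<zeta> \<bullet> N + e * norm N"
    using T(1) by (simp add: zero_le_mult_iff)
  moreover have "e * norm N \<le> \<epsilon> / 2"
  proof -
    have "e * norm N \<le> e * n" using n e by (intro mult_left_mono) auto
    also have "\<dots> = \<epsilon> / 2" using n by (simp add: e_def)
    finally show ?thesis .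
  qed
  ultimately show "- (\<zeta> \<bullet> N) - \<Lambda> M N \<le> h + \<epsilon>" using TC by linarith
qed

text \<open>Coercivity bounds the mean square speed \<open>s\<^sup>2\<close> by \<open>\<alpha> s\<^sup>2 \<le> D + l s\<close>, because \<open>U\<close> can gain at
  most \<open>l T s\<close> along the curve. Hence near minimizers over a short time \<open>T\<close> stay within a distance of
  order \<open>T\<close>.\<close>

lemma near_minimizer_speed:
  fixes M v and T :: real
  defines "C \<equiv> (l + (1 + \<bar>h\<bar> + A)) / \<alpha> + 1"
  assumes T: "0 < T" "T \<le> 1" and v: "L2_on T v"
    and J: "action T M v + T * h + U (M + primitive v T) \<le> U M + T\<^sup>2"
  shows "(LINT t:{0<..T}|lborel. norm (v t)) \<le> C * T"
proof -
  define S where "S = (LINT t:{0<..T}|lborel. (norm (v t))\<^sup>2)"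
  define D where "D = 1 + \<bar>h\<bar> + A"
  have D: "D \<ge> 1" using A by (simp add: D_def)
  have S0: "S \<ge> 0" unfolding S_def by (rule set_integral_nonneg_real) simp
  define s where "s = sqrt (S / T)"
  have s0: "s \<ge> 0" using S0 T by (simp add: s_def)
  have S: "S = T * s\<^sup>2" using S0 T by (simp add: s_def)
  have n1: "(LINT t:{0<..T}|lborel. norm (v t)) \<le> T * s"
  proof -
    have "(LINT t:{0<..T}|lborel. norm (v t)) \<le> sqrt (T * S)"
      unfolding S_def by (rule set_integral_norm_le_sqrt[OF v]) (use T in simp)
    also have "T * S = (T * s)\<^sup>2" by (simp add: S power2_eq_square)
    finally show ?thesis using T s0 by simp
  qed
  have vi: "set_integrable lborel {0<..T} (\<lambda>t. (norm (v t))\<^sup>2)" using v by (simp add: L2_on_def)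
  have "\<alpha> * S - T * A = (LINT t:{0<..T}|lborel. \<alpha> * (norm (v t))\<^sup>2 - A)"
    unfolding S_def using T
    by (simp add: set_integral_diff vi set_integrable_mult_right set_integrable_const_Ioc set_integral_const_Ioc)
  also have "\<dots> \<le> action T M v"
    unfolding action_def
    by (rule set_integral_mono[OF set_integral_diff(1)[OF set_integrable_mult_right[OF vi] set_integrable_const_Ioc] set_integrable_Lambda[OF v]])
       (rule coercive)
  finally have a: "\<alpha> * S - T * A \<le> action T M v" .
  have "norm (primitive v T) \<le> T * s"
    using norm_primitive_le[OF v, of T] n1 T by (simp add: primitive_def)
  then have "l * norm (primitive v T) \<le> l * (T * s)" using l by (intro mult_left_mono)
  moreover have "U M - U (M + primitive v T) \<le> l * norm (primitive v T)"
    using U_Lipschitz[of M "M + primitive v T"] by (simp add: abs_le_iff)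
  moreover have "- (T * h) \<le> T * \<bar>h\<bar>" using T by (simp add: abs_if)
  moreover have "T\<^sup>2 \<le> T" using T by (simp add: power2_eq_square mult_left_le)
  ultimately have "\<alpha> * S \<le> T * D + l * (T * s)"
    using a J unfolding D_def by (simp add: algebra_simps)
  then have "T * (\<alpha> * s\<^sup>2) \<le> T * (D + l * s)" unfolding S by (simp add: algebra_simps)
  then have q: "\<alpha> * s\<^sup>2 \<le> D + l * s" using T by simp
  have "s \<le> C"
  proof (cases "s \<le> 1")
    case True
    have "0 \<le> (l + D) / \<alpha>" using l D \<alpha> by simp
    then show ?thesis using True by (simp add: C_def D_def)
  next
    case False
    then have "D * 1 \<le> D * s" using D by (intro mult_left_mono) auto
    then have "s * (\<alpha> * s) \<le> s * (l + D)" using q by (simp add: power2_eq_square algebra_simps)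
    then have "\<alpha> * s \<le> l + D" using False by simp
    then have "s \<le> (l + D) / \<alpha>" using \<alpha> by (simp add: pos_le_divide_eq mult.commute)
    then show ?thesis by (simp add: C_def D_def)
  qed
  then have "T * s \<le> C * T" using T by (simp add: mult.commute mult_left_mono)
  with n1 show ?thesis by simp
qed

text \<open>Take a velocity field that is optimal up to \<open>T\<^sup>2\<close>. It moves by at most \<open>C T\<close>, so that freezing the
  position at \<open>M\<close> changes the action only by \<open>O(T\<^sup>2)\<close>; the Legendre inequality
  \<open>\<Lambda> M w \<ge> - \<sigma> - \<zeta> \<bullet> w\<close> then bounds it from below by \<open>- T \<sigma> - \<zeta> \<bullet> (x T - M)\<close>.\<close>

theorem subdifferential_inequality:
  assumes \<zeta>: "\<zeta> \<in> subdifferential U M"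
  shows "h \<le> - (\<zeta> \<bullet> \<Psi> M (- \<zeta>)) - \<Lambda> M (\<Psi> M (- \<zeta>))"
proof (rule field_le_epsilon)
  define \<sigma> where "\<sigma> = - (\<zeta> \<bullet> \<Psi> M (- \<zeta>)) - \<Lambda> M (\<Psi> M (- \<zeta>))"
  have \<sigma>: "- \<sigma> - \<zeta> \<bullet> w \<le> \<Lambda> M w" for w
    using Psi_maximizes[of \<zeta> w M] by (simp add: \<sigma>_def)
  fix \<epsilon> :: real assume \<epsilon>: "\<epsilon> > 0"
  define C where "C = (l + (1 + \<bar>h\<bar> + A)) / \<alpha> + 1"
  have C: "C \<ge> 1" using l A \<alpha> by (simp add: C_def)
  define c where "c = norm (p M 0)"
  define C1 where "C1 = C * c + 6 * K * C\<^sup>2 + K * C\<^sup>2"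
  have C1: "C1 \<ge> 0" using C K by (simp add: C1_def c_def)
  define e where "e = \<epsilon> / (2 * C)"
  have e: "e > 0" using \<epsilon> C by (simp add: e_def)
  obtain d where d: "d > 0" "\<forall>X. norm X < d \<longrightarrow> U M + \<zeta> \<bullet> X - e * norm X \<le> U (M + X)"
    by (rule subdifferential_bound[OF \<zeta> e])
  define T where "T = min 1 (min (d / (2 * C)) (\<epsilon> / (2 * (C1 + 1))))"
  have T: "0 < T" "T \<le> 1" using d(1) C C1 \<epsilon> by (auto simp: T_def)
  have TC: "(C1 + 1) * T \<le> \<epsilon> / 2"
  proof -
    have "(C1 + 1) * T \<le> (C1 + 1) * (\<epsilon> / (2 * (C1 + 1)))"
      using C1 by (intro mult_left_mono) (auto simp: T_def)
    also have "\<dots> = \<epsilon> / 2" using C1 by (simp add: field_simps)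
    finally show ?thesis .
  qed
  have Td: "C * T < d"
  proof -
    have "C * T \<le> C * (d / (2 * C))" using C by (intro mult_left_mono) (auto simp: T_def)
    also have "\<dots> = d / 2" using C by simp
    finally show ?thesis using d(1) by simp
  qed
  have "T\<^sup>2 > 0" using T by simp
  from dpp_near[OF T(1) this] obtain v where v: "L2_on T v"
    and J: "action T M v + T * h + U (M + primitive v T) \<le> U M + T\<^sup>2" by blast
  have N1: "(LINT t:{0<..T}|lborel. norm (v t)) \<le> C * T"
    unfolding C_def by (rule near_minimizer_speed[OF T v J])
  have ni: "set_integrable lborel {0<..T} (\<lambda>t. norm (v t))"
    using L2_on_set_integrable[OF L2_on_norm[OF v], of 0 T] by simp
  have vi: "set_integrable lborel {0<..T} v"
    using L2_on_set_integrable[OF v, of 0 T] by simp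
  have y: "norm (primitive v t) \<le> C * T" if t: "0 \<le> t" "t \<le> T" for t
  proof -
    have "norm (primitive v t) \<le> (LINT s:{0<..t}|lborel. norm (v s))"
      using norm_primitive_le[OF v t] by (simp add: primitive_def)
    also have "\<dots> \<le> (LINT s:{0<..T}|lborel. norm (v s))"
      using t by (intro set_integral_mono_set[OF ni]) auto
    finally show ?thesis using N1 by simp
  qed
  have pt: "- \<sigma> - v t \<bullet> \<zeta> - (C * T * c + 6 * K * (C * T) * norm (v t)) - K * (C * T)\<^sup>2 \<le> \<Lambda> (M + primitive v t) (v t)"
    if t: "0 < t" "t \<le> T" for t
  proof -
    have "\<gamma> * (norm (0::'a))\<^sup>2 - K * (norm (primitive v t))\<^sup>2
      \<le> \<Lambda> (M + primitive v t) (v t + 0) - \<Lambda> M (v t) - p M (v t) \<bullet> primitive v t - q M (v t) \<bullet> 0"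
      by (rule lower)
    moreover have "K * (norm (primitive v t))\<^sup>2 \<le> K * (C * T)\<^sup>2"
      using y[of t] t K by (intro mult_left_mono power_mono) auto
    moreover have "\<bar>p M (v t) \<bullet> primitive v t\<bar> \<le> C * T * c + 6 * K * (C * T) * norm (v t)"
    proof -
      have "norm (p M (v t)) \<le> c + 6 * K * norm (v t)"
        using grad_Lipschitz(1)[of M "v t" M 0] norm_triangle_sub[of "p M (v t)" "p M 0"] by (simp add: c_def)
      then have "norm (p M (v t)) * norm (primitive v t) \<le> (c + 6 * K * norm (v t)) * (C * T)"
        using y[of t] t K by (intro mult_mono) (auto simp: c_def)
      then have "\<bar>p M (v t) \<bullet> primitive v t\<bar> \<le> (c + 6 * K * norm (v t)) * (C * T)"
        by (rule order_trans[OF Cauchy_Schwarz_ineq2])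
      then show ?thesis by (simp add: algebra_simps)
    qed
    ultimately show ?thesis using \<sigma>[of "v t"] by (simp add: abs_le_iff inner_commute)
  qed
  have zi: "set_integrable lborel {0<..T} (\<lambda>t. v t \<bullet> \<zeta>)" by (rule L2_on_inner[OF v L2_on_const])
  have c0: "0 \<le> 6 * K * (C * T)" using K C T by simp
  have "- (T * \<sigma>) - primitive v T \<bullet> \<zeta> - (T * (C * T * c) + 6 * K * (C * T) * (LINT t:{0<..T}|lborel. norm (v t))) - T * (K * (C * T)\<^sup>2)
     = (LINT t:{0<..T}|lborel. - \<sigma> - v t \<bullet> \<zeta> - (C * T * c + 6 * K * (C * T) * norm (v t)) - K * (C * T)\<^sup>2)"
    using T set_integral_inner_left[OF vi, of \<zeta>]
    by (simp add: set_integral_diff set_integral_add set_integrable_mult_right set_integrable_const_Ioc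
         set_integral_const_Ioc zi ni primitive_def)
  also have "\<dots> \<le> action T M v"
    unfolding action_def
  proof (rule set_integral_mono)
    show "set_integrable lborel {0<..T} (\<lambda>t. - \<sigma> - v t \<bullet> \<zeta> - (C * T * c + 6 * K * (C * T) * norm (v t)) - K * (C * T)\<^sup>2)"
      by (intro set_integral_diff(1) set_integral_add(1) set_integrable_mult_right set_integrable_const_Ioc zi ni)
    show "set_integrable lborel {0<..T} (\<lambda>t. \<Lambda> (M + primitive v t) (v t))" by (rule set_integrable_Lambda[OF v])
  qed (use pt in auto)
  finally have act: "- (T * \<sigma>) - primitive v T \<bullet> \<zeta> - (T * (C * T * c) + 6 * K * (C * T) * (LINT t:{0<..T}|lborel. norm (v t))) - T * (K * (C * T)\<^sup>2) \<le> action T M v" .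
  have e1: "6 * K * (C * T) * (LINT t:{0<..T}|lborel. norm (v t)) \<le> 6 * K * (C * T) * (C * T)"
    using N1 c0 by (rule mult_left_mono)
  have e2: "T * (K * (C * T)\<^sup>2) \<le> 1 * (K * (C * T)\<^sup>2)"
    using T K by (intro mult_right_mono) auto
  have e3: "T * (C * T * c) + 6 * K * (C * T) * (C * T) + 1 * (K * (C * T)\<^sup>2) = T * (C1 * T)"
    by (simp add: C1_def power2_eq_square algebra_simps)
  have X: "norm (primitive v T) \<le> C * T" using y[of T] T by simp
  have "U M + \<zeta> \<bullet> primitive v T - e * norm (primitive v T) \<le> U (M + primitive v T)"
    using X Td by (intro d(2)[rule_format]) simp
  moreover have "e * norm (primitive v T) \<le> T * (\<epsilon> / 2)"
  proof -
    have "e * norm (primitive v T) \<le> e * (C * T)" using X e by (intro mult_left_mono) auto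
    also have "\<dots> = T * (\<epsilon> / 2)" using C by (simp add: e_def)
    finally show ?thesis .
  qed
  moreover have "primitive v T \<bullet> \<zeta> = \<zeta> \<bullet> primitive v T" by (rule inner_commute)
  ultimately have "T * h \<le> T * \<sigma> + T * (C1 * T) + T\<^sup>2 + T * (\<epsilon> / 2)"
    using act e1 e2 e3 J by linarith
  also have "\<dots> = T * (\<sigma> + (C1 + 1) * T + \<epsilon> / 2)"
    by (simp add: power2_eq_square algebra_simps)
  finally have "h \<le> \<sigma> + (C1 + 1) * T + \<epsilon> / 2" using T by simp
  with TC show "h \<le> - (\<zeta> \<bullet> \<Psi> M (- \<zeta>)) - \<Lambda> M (\<Psi> M (- \<zeta>)) + \<epsilon>"
    unfolding \<sigma>_def[symmetric] by linarith
qed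

end

section \<open>Extended integrals on the half-line\<close>

lemma ext_integral_cong_AE:
  assumes "AE t in lborel. t \<in> S \<longrightarrow> f t = g t"
  shows "ext_integral S f = ext_integral S g"
proof -
  have "(\<integral>\<^sup>+ t\<in>S. ennreal (f t) \<partial>lborel) = (\<integral>\<^sup>+ t\<in>S. ennreal (g t) \<partial>lborel)"
    by (rule nn_integral_cong_AE) (use assms in \<open>eventually_elim, auto simp: indicator_def\<close>)
  moreover have "(\<integral>\<^sup>+ t\<in>S. ennreal (- f t) \<partial>lborel) = (\<integral>\<^sup>+ t\<in>S. ennreal (- g t) \<partial>lborel)"
    by (rule nn_integral_cong_AE) (use assms in \<open>eventually_elim, auto simp: indicator_def\<close>)
  ultimately show ?thesis by (simp add: ext_integral_def nn_integral_completion)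
qed

lemma nn_integral_indicator_real:
  "(\<integral>\<^sup>+ t\<in>S. ennreal (g t) \<partial>lborel) = (\<integral>\<^sup>+ t. ennreal (indicator S t *\<^sub>R g t) \<partial>lborel)"
  by (intro nn_integral_cong) (auto simp: indicator_def)

lemma enn2ereal_diff_real:
  assumes "a < \<infinity>" "b < \<infinity>"
  shows "enn2ereal a - enn2ereal b = ereal (enn2real a - enn2real b)"
proof -
  have "enn2ereal a = ereal (enn2real a)" "enn2ereal b = ereal (enn2real b)"
    using assms by (auto simp: enn2ereal_ennreal[symmetric] less_top)
  then show ?thesis by simp
qed

lemma ext_integral_integrable:
  assumes g: "set_integrable lborel S g"
  shows "ext_integral S g = ereal (LINT t:S|lborel. g t)"
proof -
  have i: "integrable lborel (\<lambda>t. indicator S t *\<^sub>R g t)" using g by (simp add: set_integrable_def)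
  have P: "(\<integral>\<^sup>+ t. ennreal (indicator S t *\<^sub>R g t) \<partial>lborel) < \<infinity>"
    and N: "(\<integral>\<^sup>+ t. ennreal (- (indicator S t *\<^sub>R g t)) \<partial>lborel) < \<infinity>"
    using i by (auto simp: real_integrable_def less_top)
  have N': "(\<integral>\<^sup>+ t\<in>S. ennreal (- g t) \<partial>lborel) = (\<integral>\<^sup>+ t. ennreal (- (indicator S t *\<^sub>R g t)) \<partial>lborel)"
    by (simp add: nn_integral_indicator_real)
  show ?thesis
    unfolding ext_integral_def nn_integral_completion nn_integral_indicator_real[where S = S and g = g] N'
      enn2ereal_diff_real[OF P N] set_lebesgue_integral_def
    by (simp only: real_lebesgue_integral_def[OF i])
qed

lemma set_integrable_exp_decay:
  assumes "\<epsilon> > (0::real)"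
  shows "set_integrable lborel {0<..} (\<lambda>t. c * exp (- \<epsilon> * t))"
    and "(LINT t:{0<..}|lborel. c * exp (- \<epsilon> * t)) = c / \<epsilon>"
proof -
  have nn: "(\<integral>\<^sup>+ t. ennreal (exp (- \<epsilon> * t)) * indicator {0..} t \<partial>lborel) = ennreal (0 - (- exp (- \<epsilon> * 0) / \<epsilon>))"
  proof (rule nn_integral_FTC_atLeast)
    show "((\<lambda>t. - exp (- \<epsilon> * t) / \<epsilon>) \<longlongrightarrow> 0) at_top"
    proof -
      have "filterlim (\<lambda>t. - \<epsilon> * t) at_bot at_top"
        using assms by (simp add: filterlim_uminus_at_bot filterlim_tendsto_pos_mult_at_top[OF tendsto_const _ filterlim_ident])
      then have "((\<lambda>t. exp (- \<epsilon> * t)) \<longlongrightarrow> 0) at_top"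
        by (rule filterlim_compose[OF exp_at_bot])
      then have "((\<lambda>t. - exp (- \<epsilon> * t) / \<epsilon>) \<longlongrightarrow> - 0 / \<epsilon>) at_top"
        by (intro tendsto_intros) (use assms in auto)
      then show ?thesis by simp
    qed
    show "DERIV (\<lambda>t. - exp (- \<epsilon> * t) / \<epsilon>) t :> exp (- \<epsilon> * t)" for t
      using assms by (auto intro!: derivative_eq_intros)
  qed auto
  have hb: "has_bochner_integral lborel (\<lambda>t. indicator {0..} t *\<^sub>R exp (- \<epsilon> * t)) (1 / \<epsilon>)"
  proof (rule has_bochner_integral_nn_integral)
    have "(\<integral>\<^sup>+ t. ennreal (indicator {0..} t *\<^sub>R exp (- \<epsilon> * t)) \<partial>lborel)
       = (\<integral>\<^sup>+ t. ennreal (exp (- \<epsilon> * t)) * indicator {0..} t \<partial>lborel)"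
      by (intro nn_integral_cong) (auto simp: indicator_def)
    then show "(\<integral>\<^sup>+ t. ennreal (indicator {0..} t *\<^sub>R exp (- \<epsilon> * t)) \<partial>lborel) = ennreal (1 / \<epsilon>)"
      using nn by simp
  qed (use assms in auto)
  have "AE t in lborel. indicator {0..} t *\<^sub>R exp (- \<epsilon> * t) = indicator {0<..} t *\<^sub>R exp (- \<epsilon> * t)"
    using AE_lborel_singleton[of 0] by eventually_elim (auto simp: indicator_def)
  with hb have hb': "has_bochner_integral lborel (\<lambda>t. indicator {0<..} t *\<^sub>R exp (- \<epsilon> * t)) (1 / \<epsilon>)"
    by (subst (asm) has_bochner_integral_cong_AE) auto
  have e: "set_integrable lborel {0<..} (\<lambda>t. exp (- \<epsilon> * t))" "(LINT t:{0<..}|lborel. exp (- \<epsilon> * t)) = 1 / \<epsilon>"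
    using hb' by (auto simp: has_bochner_integral_iff set_integrable_def set_lebesgue_integral_def)
  show "set_integrable lborel {0<..} (\<lambda>t. c * exp (- \<epsilon> * t))" using e(1) by (rule set_integrable_mult_right)
  show "(LINT t:{0<..}|lborel. c * exp (- \<epsilon> * t)) = c / \<epsilon>" using e(2) by simp
qed

text \<open>An integrable lower bound makes the negative part integrable, so the extended integral is
  finite only for integrable functions.\<close>

lemma ext_integral_bounded_below:
  assumes \<epsilon>: "\<epsilon> > (0::real)" and A: "A \<ge> 0" and g: "g \<in> borel_measurable borel"
    and low: "\<And>t. t > 0 \<Longrightarrow> - A * exp (- \<epsilon> * t) \<le> g t"
  shows "ereal (- A / \<epsilon>) \<le> ext_integral {0<..} g"
    and "ext_integral {0<..} g < \<infinity> \<Longrightarrow> set_integrable lborel {0<..} g"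
proof -
  have meas: "(\<lambda>t. indicator {0<..} t *\<^sub>R g t) \<in> borel_measurable lborel" using g by measurable
  let ?P = "\<integral>\<^sup>+ t. ennreal (indicator {0<..} t *\<^sub>R g t) \<partial>lborel"
  let ?N = "\<integral>\<^sup>+ t. ennreal (- (indicator {0<..} t *\<^sub>R g t)) \<partial>lborel"
  have i: "integrable lborel (\<lambda>t. indicator {0<..} t *\<^sub>R (A * exp (- \<epsilon> * t)))"
    using set_integrable_exp_decay(1)[OF \<epsilon>] by (simp add: set_integrable_def)
  have "?N \<le> (\<integral>\<^sup>+ t. ennreal (indicator {0<..} t *\<^sub>R (A * exp (- \<epsilon> * t))) \<partial>lborel)"
    by (intro nn_integral_mono ennreal_leI) (use low in \<open>auto simp: indicator_def minus_le_iff\<close>)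
  also have "\<dots> = ennreal (LINT t:{0<..}|lborel. A * exp (- \<epsilon> * t))"
    unfolding set_lebesgue_integral_def
    by (rule nn_integral_eq_integral[OF i]) (use A in \<open>auto simp: indicator_def\<close>)
  finally have N: "?N \<le> ennreal (A / \<epsilon>)" using set_integrable_exp_decay(2)[OF \<epsilon>] by simp
  have ext: "ext_integral {0<..} g = enn2ereal ?P - enn2ereal ?N"
  proof -
    have N': "(\<integral>\<^sup>+ t\<in>{0<..}. ennreal (- g t) \<partial>lborel) = ?N"
      by (simp add: nn_integral_indicator_real)
    show ?thesis unfolding ext_integral_def nn_integral_completion nn_integral_indicator_real[where S = "{0<..}" and g = g] N' ..
  qed
  have Nfin: "?N < \<infinity>" using N by (simp add: le_less_trans[OF _ ennreal_less_top])
  have Nr: "enn2ereal ?N = ereal (enn2real ?N)" "enn2real ?N \<le> A / \<epsilon>"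
    using Nfin N A \<epsilon> by (auto simp: enn2ereal_ennreal[symmetric] less_top enn2real_leI)
  have "ereal (- A / \<epsilon>) \<le> 0 - enn2ereal ?N" using Nr by simp
  also have "\<dots> \<le> enn2ereal ?P - enn2ereal ?N"
    by (intro ereal_minus_mono) auto
  finally show "ereal (- A / \<epsilon>) \<le> ext_integral {0<..} g" unfolding ext .
  assume fin: "ext_integral {0<..} g < \<infinity>"
  have "?P < \<infinity>"
  proof (rule ccontr)
    assume "\<not> ?thesis"
    then have "?P = \<infinity>" unfolding infinity_ennreal_def less_top[symmetric] not_not .
    then have "enn2ereal ?P = \<infinity>" by simp
    then have "ext_integral {0<..} g = \<infinity>" unfolding ext Nr(1) by simp
    then show False using fin by simp
  qed
  then show "set_integrable lborel {0<..} g"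
    unfolding set_integrable_def using meas Nfin by (subst real_integrable_def) (auto simp: less_top)
qed

lemma set_integral_shift:
  fixes f :: "real \<Rightarrow> 'a::{banach, second_countable_topology}"
  shows "(LINT t:{a + T<..b + T}|lborel. f t) = (LINT t:{a<..b}|lborel. f (t + T))"
    and "(LINT t:{T<..}|lborel. f t) = (LINT t:{0<..}|lborel. f (t + T))"
    and "set_integrable lborel {a + T<..b + T} f \<longleftrightarrow> set_integrable lborel {a<..b} (\<lambda>t. f (t + T))"
    and "set_integrable lborel {T<..} f \<longleftrightarrow> set_integrable lborel {0<..} (\<lambda>t. f (t + T))"
proof -
  have i1: "indicator {a + T<..b + T} (T + t) = (indicator {a<..b} t :: real)"
    and i2: "indicator {T<..} (T + t) = (indicator {0<..} t :: real)" for t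
    by (auto simp: indicator_def)
  show "(LINT t:{a + T<..b + T}|lborel. f t) = (LINT t:{a<..b}|lborel. f (t + T))"
    unfolding set_lebesgue_integral_def
    using lborel_integral_real_affine[where c = 1 and t = T and f = "\<lambda>t. indicator {a + T<..b + T} t *\<^sub>R f t"]
    by (simp only: i1 mult_1 abs_one scaleR_one) (simp add: add.commute)
  show "(LINT t:{T<..}|lborel. f t) = (LINT t:{0<..}|lborel. f (t + T))"
    unfolding set_lebesgue_integral_def
    using lborel_integral_real_affine[where c = 1 and t = T and f = "\<lambda>t. indicator {T<..} t *\<^sub>R f t"]
    by (simp only: i2 mult_1 abs_one scaleR_one) (simp add: add.commute)
  show "set_integrable lborel {a + T<..b + T} f \<longleftrightarrow> set_integrable lborel {a<..b} (\<lambda>t. f (t + T))"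
    unfolding set_integrable_def
    using lborel_integrable_real_affine_iff[where c = 1 and t = T and f = "\<lambda>t. indicator {a + T<..b + T} t *\<^sub>R f t"]
    by (simp only: i1 mult_1) (simp add: add.commute)
  show "set_integrable lborel {T<..} f \<longleftrightarrow> set_integrable lborel {0<..} (\<lambda>t. f (t + T))"
    unfolding set_integrable_def
    using lborel_integrable_real_affine_iff[where c = 1 and t = T and f = "\<lambda>t. indicator {T<..} t *\<^sub>R f t"]
    by (simp only: i2 mult_1) (simp add: add.commute)
qed

section \<open>Dynamic programming for the discounted value\<close>

lemma primitive_cong_AE:
  fixes v w :: "real \<Rightarrow> 'a::{banach, second_countable_topology}"
  assumes "v \<in> borel_measurable borel" "w \<in> borel_measurable borel"
    and "AE t in lborel. t \<in> {0<..T} \<longrightarrow> v t = w t"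
  shows "primitive v T = primitive w T"
  unfolding primitive_def by (rule set_lebesgue_integral_cong_AE) (use assms in auto)

lemma primitive_cong:
  fixes v w :: "real \<Rightarrow> 'a::{banach, second_countable_topology}"
  assumes "\<And>t. 0 < t \<Longrightarrow> t \<le> T \<Longrightarrow> v t = w t"
  shows "primitive v T = primitive w T"
  unfolding primitive_def by (rule set_lebesgue_integral_cong) (use assms in auto)

text \<open>The velocity fields obtained on the intervals \<open>(0, n)\<close> agree a.e., since each of them is the
  a.e. derivative of the curve; at time \<open>t\<close> one that belongs to an interval beyond \<open>t\<close> is used.\<close>

theorem AC2_loc_imp_primitive:
  fixes x :: "real \<Rightarrow> 'a::{real_inner, banach, second_countable_topology}"
  assumes x: "x \<in> AC2_loc" and M: "(x \<longlongrightarrow> M) (at_right 0)"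
  shows "\<exists>v. (\<forall>T. L2_on T v) \<and> (\<forall>t>0. x t = M + primitive v t)"
proof -
  have "\<forall>n. \<exists>v. L2_on (real (Suc n)) v \<and> (\<forall>t. 0 < t \<longrightarrow> t < real (Suc n) \<longrightarrow> x t = M + primitive v t)"
  proof
    fix n
    have T: "real (Suc n) > 0" by simp
    have "x \<in> AC2 (real (Suc n))" using x T unfolding AC2_loc_def by blast
    from AC2_imp_primitive[OF T this M]
    show "\<exists>v. L2_on (real (Suc n)) v \<and> (\<forall>t. 0 < t \<longrightarrow> t < real (Suc n) \<longrightarrow> x t = M + primitive v t)"
      by metis
  qed
  then obtain V where V: "\<forall>n. L2_on (real (Suc n)) (V n) \<and> (\<forall>t. 0 < t \<longrightarrow> t < real (Suc n) \<longrightarrow> x t = M + primitive (V n) t)"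
    by (rule choice[THEN exE])
  have Vm: "V n \<in> borel_measurable borel" for n using V by (simp add: L2_on_def)
  define v where "v t = V (nat \<lceil>t\<rceil>) t" for t
  have vm: "v \<in> borel_measurable borel"
    unfolding v_def
    by (rule measurable_compose_countable[of V borel borel "\<lambda>t. nat \<lceil>t\<rceil>"]) (use Vm in \<open>auto\<close>)
  have "AE t in lborel. \<forall>n. t \<in> {0<..<real (Suc n)} \<longrightarrow> vector_derivative x (at t) = V n t"
    unfolding AE_all_countable using V by (intro allI AE_vector_derivative_primitive) auto
  then have eq: "AE t in lborel. \<forall>n. t \<in> {0<..<real (Suc n)} \<longrightarrow> v t = V n t"
  proof eventually_elim
    fix t assume H: "\<forall>n. t \<in> {0<..<real (Suc n)} \<longrightarrow> vector_derivative x (at t) = V n t"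
    show "\<forall>n. t \<in> {0<..<real (Suc n)} \<longrightarrow> v t = V n t"
    proof (intro allI impI)
      fix n assume t: "t \<in> {0<..<real (Suc n)}"
      have "t \<in> {0<..<real (Suc (nat \<lceil>t\<rceil>))}" using t by auto linarith
      then have "vector_derivative x (at t) = V (nat \<lceil>t\<rceil>) t" using H by blast
      moreover have "vector_derivative x (at t) = V n t" using H t by blast
      ultimately show "v t = V n t" by (simp add: v_def)
    qed
  qed
  have main: "L2_on T v \<and> primitive v T = primitive (V n) T" if n: "T < real (Suc n)" for T n
  proof -
    have ae: "AE t in lborel. t \<in> {0<..T} \<longrightarrow> v t = V n t"
      using eq by eventually_elim (use n in auto)
    have "L2_on T (V n)" by (rule L2_on_subset[of "real (Suc n)"]) (use V n in auto)
    then have i: "set_integrable lborel {0<..T} (\<lambda>t. (norm (V n t))\<^sup>2)" by (simp add: L2_on_def)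
    have "set_integrable lborel {0<..T} (\<lambda>t. (norm (v t))\<^sup>2) = set_integrable lborel {0<..T} (\<lambda>t. (norm (V n t))\<^sup>2)"
    proof (rule set_integrable_cong_AE)
      show "AE t\<in>{0<..T} in lborel. (norm (v t))\<^sup>2 = (norm (V n t))\<^sup>2"
        using ae by eventually_elim simp
    qed (use vm Vm in auto)
    then show ?thesis using vm i primitive_cong_AE[OF vm Vm ae] by (simp add: L2_on_def)
  qed
  have ex: "\<exists>n. T < real (Suc n)" for T
    using reals_Archimedean2[of T] by (metis less_Suc_eq_le less_imp_le of_nat_less_iff order.strict_trans lessI)
  show ?thesis
  proof (intro exI[of _ v] conjI allI impI)
    fix T show "L2_on T v" using ex[of T] main by blast
  next
    fix t :: real assume "t > 0"
    obtain n where n: "t < real (Suc n)" using ex by blast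
    have "x t = M + primitive (V n) t" using V n \<open>t > 0\<close> by blast
    then show "x t = M + primitive v t" using main[OF n] by simp
  qed
qed

lemma primitive_imp_AC2_loc:
  fixes v :: "real \<Rightarrow> 'a::{real_inner, banach, second_countable_topology}"
  assumes v: "\<forall>T. L2_on T v"
  shows "(\<lambda>t. M + primitive v t) \<in> AC2_loc" and "((\<lambda>t. M + primitive v t) \<longlongrightarrow> M) (at_right 0)"
proof -
  show "(\<lambda>t. M + primitive v t) \<in> AC2_loc"
    unfolding AC2_loc_def using v by (auto intro!: primitive_imp_AC2[of _ v _ M])
  show "((\<lambda>t. M + primitive v t) \<longlongrightarrow> M) (at_right 0)"
    by (rule primitive_tendsto_right[of 1 v]) (use v in auto)
qed

lemma AE_vector_derivative_half_line:
  fixes x :: "real \<Rightarrow> 'a::{real_inner, banach, second_countable_topology}"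
  assumes v: "\<forall>T. L2_on T v" and x: "\<forall>t>0. x t = M + primitive v t"
  shows "AE t in lborel. t \<in> {0<..} \<longrightarrow> vector_derivative x (at t) = v t"
proof -
  have "AE t in lborel. \<forall>n. t \<in> {0<..<real n} \<longrightarrow> vector_derivative x (at t) = v t"
    unfolding AE_all_countable
    by (intro allI AE_vector_derivative_primitive[where M = M]) (use v x in auto)
  then show ?thesis
  proof eventually_elim
    fix t assume H: "\<forall>n. t \<in> {0<..<real n} \<longrightarrow> vector_derivative x (at t) = v t"
    show "t \<in> {0<..} \<longrightarrow> vector_derivative x (at t) = v t"
      using H reals_Archimedean2[of t] by auto
  qed
qed

lemma L2_on_concat:
  fixes u :: "real \<Rightarrow> 'a::{banach, second_countable_topology}"
  assumes T: "T \<ge> 0" and u: "L2_on T u" and tail: "\<forall>S. L2_on S (\<lambda>t. u (t + T))"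
  shows "L2_on S u"
proof (cases "S \<le> T")
  case True
  then show ?thesis using L2_on_subset[OF u] by blast
next
  case False
  have "set_integrable lborel {0 + T<..(S - T) + T} (\<lambda>t. (norm (u t))\<^sup>2)"
    unfolding set_integral_shift(3) using tail by (simp add: L2_on_def)
  then have "set_integrable lborel ({0<..T} \<union> {T<..S}) (\<lambda>t. (norm (u t))\<^sup>2)"
    using u by (intro set_integrable_Un) (auto simp: L2_on_def)
  moreover have "{0<..T} \<union> {T<..S} = {0<..S}" using False T by auto
  ultimately show ?thesis using u by (simp add: L2_on_def)
qed

lemma primitive_shift:
  fixes u :: "real \<Rightarrow> 'a::{banach, second_countable_topology}"
  assumes u: "\<forall>S. L2_on S u" and T: "T \<ge> 0" and s: "s \<ge> 0"
  shows "primitive u (s + T) = primitive u T + primitive (\<lambda>t. u (t + T)) s"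
proof -
  have "primitive u (s + T) - primitive u T = (LINT t:{0 + T<..s + T}|lborel. u t)"
    using primitive_diff[of "s + T" u T "s + T"] u T s by simp
  also have "\<dots> = primitive (\<lambda>t. u (t + T)) s"
    unfolding set_integral_shift(1) primitive_def ..
  finally show ?thesis by (simp add: algebra_simps)
qed

lemma L2_on_shift:
  fixes u :: "real \<Rightarrow> 'a::{banach, second_countable_topology}"
  assumes u: "\<forall>S. L2_on S u" and T: "T \<ge> 0"
  shows "L2_on S (\<lambda>t. u (t + T))"
proof -
  have [measurable]: "u \<in> borel_measurable borel" using u by (simp add: L2_on_def)
  have "set_integrable lborel {T<..S + T} (\<lambda>t. (norm (u t))\<^sup>2)"
    using L2_on_set_integrable_sq[of "S + T" u T "S + T"] u T by simp
  then have "set_integrable lborel {0<..S} (\<lambda>t. (norm (u (t + T)))\<^sup>2)"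
    using set_integral_shift(3)[of 0 T S "\<lambda>t. (norm (u t))\<^sup>2"] by simp
  then show ?thesis by (simp add: L2_on_def)
qed

context lagrangian begin

definition running :: "real \<Rightarrow> 'a \<Rightarrow> (real \<Rightarrow> 'a) \<Rightarrow> real \<Rightarrow> real" where
  "running \<epsilon> M v t = exp (- \<epsilon> * t) * \<Lambda> (M + primitive v t) (v t)"

text \<open>The discounted value for a Lagrangian on an arbitrary Hilbert space.\<close>

definition disc_value :: "real \<Rightarrow> 'a \<Rightarrow> real" where
  "disc_value \<epsilon> M = real_of_ereal
     (INF x \<in> {x \<in> AC2_loc. (x \<longlongrightarrow> M) (at_right 0)}.
        ext_integral {0<..} (\<lambda>t. exp (- \<epsilon> * t) * \<Lambda> (x t) (vector_derivative x (at t))))"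

lemma Lambda_lower: "- A \<le> \<Lambda> x v"
proof -
  have "0 \<le> \<alpha> * (norm v)\<^sup>2" using \<alpha> by simp
  then show ?thesis using coercive[of v x] by linarith
qed

lemma running_measurable:
  "v \<in> borel_measurable borel \<Longrightarrow> running \<epsilon> M v \<in> borel_measurable borel"
  unfolding running_def[abs_def]
  by (intro borel_measurable_times borel_measurable_compose(1) borel_measurable_add borel_measurable_const borel_measurable_primitive)
     (auto intro!: borel_measurable_continuous_onI continuous_intros)

lemma running_lower: "- A * exp (- \<epsilon> * t) \<le> running \<epsilon> M v t"
  using mult_left_mono[OF Lambda_lower[of "M + primitive v t" "v t"], of "exp (- \<epsilon> * t)"]
  by (simp add: running_def mult.commute)

lemma running_set_integrable:
  assumes v: "L2_on T v"
  shows "set_integrable lborel {0<..T} (running \<epsilon> M v)"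
proof -
  have i: "set_integrable lborel {0<..T} (\<lambda>t. exp (\<bar>\<epsilon>\<bar> * \<bar>T\<bar>) * \<bar>\<Lambda> (M + primitive v t) (v t)\<bar>)"
    using set_integrable_abs[OF set_integrable_Lambda[OF v]] by (rule set_integrable_mult_right)
  have "exp (- \<epsilon> * t) \<le> exp (\<bar>\<epsilon>\<bar> * \<bar>T\<bar>)" if "0 < t" "t \<le> T" for t
  proof -
    have "- \<epsilon> * t \<le> \<bar>\<epsilon>\<bar> * t" using that by (intro mult_right_mono) auto
    also have "\<dots> \<le> \<bar>\<epsilon>\<bar> * \<bar>T\<bar>" using that by (intro mult_left_mono) auto
    finally show ?thesis by simp
  qed
  then have le: "norm (running \<epsilon> M v t) \<le> norm (exp (\<bar>\<epsilon>\<bar> * \<bar>T\<bar>) * \<bar>\<Lambda> (M + primitive v t) (v t)\<bar>)"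
    if "t \<in> {0<..T}" for t
    using that by (auto simp: running_def abs_mult intro!: mult_right_mono)
  have "running \<epsilon> M v \<in> borel_measurable borel" using v by (intro running_measurable) (simp add: L2_on_def)
  then show ?thesis
    by (intro set_integrable_bound[OF i] AE_I2 impI le) (simp_all add: set_borel_measurable_def)
qed

lemma discounted_cost_eq:
  assumes v: "\<forall>T. L2_on T v" and x: "\<forall>t>0. x t = M + primitive v t"
  shows "ext_integral {0<..} (\<lambda>t. exp (- \<epsilon> * t) * \<Lambda> (x t) (vector_derivative x (at t)))
    = ext_integral {0<..} (running \<epsilon> M v)"
proof (rule ext_integral_cong_AE)
  show "AE t in lborel. t \<in> {0<..} \<longrightarrow> exp (- \<epsilon> * t) * \<Lambda> (x t) (vector_derivative x (at t)) = running \<epsilon> M v t"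
    using AE_vector_derivative_half_line[OF v x]
    by eventually_elim (use x in \<open>simp add: running_def\<close>)
qed

end

text \<open>A curve at rest has finite discounted cost if \<open>\<Lambda> x 0\<close> is bounded, so the value is finite.\<close>

locale bounded_at_rest = lagrangian \<Lambda> p q K \<gamma> \<alpha> A B
  for \<Lambda> :: "'a::{real_inner, banach, second_countable_topology} \<Rightarrow> 'a \<Rightarrow> real"
    and p q K \<gamma> \<alpha> A B +
  fixes B0 :: real
  assumes rest: "\<Lambda> x 0 \<le> B0"
begin

text \<open>The infimum of the extended costs is a real number, by comparison with \<open>- A exp (- \<epsilon> t)\<close> from
  below and with the constant curve from above; so the conversion to the reals loses nothing.\<close>

lemma ereal_disc_value:
  assumes \<epsilon>: "\<epsilon> > 0"
  shows "ereal (disc_value \<epsilon> M) = (INF x \<in> {x \<in> AC2_loc. (x \<longlongrightarrow> M) (at_right 0)}.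
        ext_integral {0<..} (\<lambda>t. exp (- \<epsilon> * t) * \<Lambda> (x t) (vector_derivative x (at t))))"
    (is "_ = ?I")
proof -
  have low: "ereal (- A / \<epsilon>) \<le> ?I"
  proof (rule INF_greatest)
    fix x :: "real \<Rightarrow> 'a" assume "x \<in> {x \<in> AC2_loc. (x \<longlongrightarrow> M) (at_right 0)}"
    then obtain v where v: "\<forall>T. L2_on T v" "\<forall>t>0. x t = M + primitive v t"
      using AC2_loc_imp_primitive[of x M] by auto
    have vm: "v \<in> borel_measurable borel" using v(1) by (simp add: L2_on_def)
    show "ereal (- A / \<epsilon>) \<le> ext_integral {0<..} (\<lambda>t. exp (- \<epsilon> * t) * \<Lambda> (x t) (vector_derivative x (at t)))"
      unfolding discounted_cost_eq[OF v]
      by (rule ext_integral_bounded_below(1)[OF \<epsilon> A running_measurable[OF vm] running_lower])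
  qed
  have z: "\<forall>T. L2_on T (\<lambda>_. 0 :: 'a)" by (simp add: L2_on_const)
  have "?I \<le> ext_integral {0<..} (\<lambda>t. exp (- \<epsilon> * t) * \<Lambda> (M + primitive (\<lambda>_. 0) t) (vector_derivative (\<lambda>t. M + primitive (\<lambda>_. 0) t) (at t)))"
    by (rule INF_lower) (use primitive_imp_AC2_loc[OF z] in auto)
  also have "\<dots> = ext_integral {0<..} (running \<epsilon> M (\<lambda>_. 0))"
    by (rule discounted_cost_eq[OF z]) simp
  also have "\<dots> = ext_integral {0<..} (\<lambda>t. \<Lambda> M 0 * exp (- \<epsilon> * t))"
    by (rule ext_integral_cong_AE) (simp add: running_def primitive_const mult.commute)
  also have "\<dots> = ereal (\<Lambda> M 0 / \<epsilon>)"
    using ext_integral_integrable[OF set_integrable_exp_decay(1)[OF \<epsilon>]] set_integrable_exp_decay(2)[OF \<epsilon>] by simp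
  finally have up: "?I \<le> ereal (\<Lambda> M 0 / \<epsilon>)" .
  have "\<bar>?I\<bar> \<noteq> \<infinity>"
    using low up by (cases ?I) auto
  then show ?thesis unfolding disc_value_def by (rule ereal_real')
qed

lemma disc_value_le:
  assumes \<epsilon>: "\<epsilon> > 0" and v: "\<forall>T. L2_on T v" and i: "set_integrable lborel {0<..} (running \<epsilon> M v)"
  shows "disc_value \<epsilon> M \<le> (LINT t:{0<..}|lborel. running \<epsilon> M v t)"
proof -
  have "ereal (disc_value \<epsilon> M) \<le> ext_integral {0<..} (\<lambda>t. exp (- \<epsilon> * t) * \<Lambda> (M + primitive v t) (vector_derivative (\<lambda>t. M + primitive v t) (at t)))"
    unfolding ereal_disc_value[OF \<epsilon>] by (rule INF_lower) (use primitive_imp_AC2_loc[OF v] in auto)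
  also have "\<dots> = ext_integral {0<..} (running \<epsilon> M v)"
    by (rule discounted_cost_eq[OF v]) simp
  also have "\<dots> = ereal (LINT t:{0<..}|lborel. running \<epsilon> M v t)"
    by (rule ext_integral_integrable[OF i])
  finally show ?thesis by simp
qed

lemma disc_value_near:
  assumes \<epsilon>: "\<epsilon> > 0" and \<delta>: "\<delta> > 0"
  shows "\<exists>v. (\<forall>T. L2_on T v) \<and> set_integrable lborel {0<..} (running \<epsilon> M v)
    \<and> (LINT t:{0<..}|lborel. running \<epsilon> M v t) \<le> disc_value \<epsilon> M + \<delta>"
proof -
  have "(INF x \<in> {x \<in> AC2_loc. (x \<longlongrightarrow> M) (at_right 0)}.
        ext_integral {0<..} (\<lambda>t. exp (- \<epsilon> * t) * \<Lambda> (x t) (vector_derivative x (at t)))) < ereal (disc_value \<epsilon> M + \<delta>)"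
    unfolding ereal_disc_value[OF \<epsilon>, symmetric] using \<delta> by simp
  then obtain x where x: "x \<in> AC2_loc" "(x \<longlongrightarrow> M) (at_right 0)"
    "ext_integral {0<..} (\<lambda>t. exp (- \<epsilon> * t) * \<Lambda> (x t) (vector_derivative x (at t))) < ereal (disc_value \<epsilon> M + \<delta>)"
    unfolding INF_less_iff by blast
  obtain v where v: "\<forall>T. L2_on T v" "\<forall>t>0. x t = M + primitive v t"
    using AC2_loc_imp_primitive[OF x(1,2)] by (elim exE conjE)
  have vm: "v \<in> borel_measurable borel" using v(1) by (simp add: L2_on_def)
  have lt: "ext_integral {0<..} (running \<epsilon> M v) < ereal (disc_value \<epsilon> M + \<delta>)"
    using x(3) unfolding discounted_cost_eq[OF v] .
  then have "ext_integral {0<..} (running \<epsilon> M v) < \<infinity>" by (rule less_trans) simp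
  then have i: "set_integrable lborel {0<..} (running \<epsilon> M v)"
    by (rule ext_integral_bounded_below(2)[OF \<epsilon> A running_measurable[OF vm] running_lower])
  have "(LINT t:{0<..}|lborel. running \<epsilon> M v t) \<le> disc_value \<epsilon> M + \<delta>"
    using lt unfolding ext_integral_integrable[OF i] by simp
  with v(1) i show ?thesis by (intro exI[of _ v] conjI)
qed

lemma running_tail:
  assumes v: "\<forall>S. L2_on S v" and T: "T \<ge> 0" and s: "s > 0"
  shows "running \<epsilon> M v (s + T) = exp (- \<epsilon> * T) * running \<epsilon> (M + primitive v T) (\<lambda>t. v (t + T)) s"
  using primitive_shift[OF v T, of s] s
  by (simp add: running_def algebra_simps exp_add[symmetric] mult_exp_exp)

lemma running_split:
  assumes v: "\<forall>S. L2_on S v" and T: "T \<ge> 0"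
  shows "set_integrable lborel {0<..} (running \<epsilon> M v)
      \<longleftrightarrow> set_integrable lborel {0<..} (running \<epsilon> (M + primitive v T) (\<lambda>t. v (t + T)))"
    and "set_integrable lborel {0<..} (running \<epsilon> M v) \<Longrightarrow>
      (LINT t:{0<..}|lborel. running \<epsilon> M v t) = (LINT t:{0<..T}|lborel. running \<epsilon> M v t)
        + exp (- \<epsilon> * T) * (LINT t:{0<..}|lborel. running \<epsilon> (M + primitive v T) (\<lambda>t. v (t + T)) t)"
proof -
  let ?r = "running \<epsilon> (M + primitive v T) (\<lambda>t. v (t + T))"
  have vm: "v \<in> borel_measurable borel" using v by (simp add: L2_on_def)
  have U: "{0<..} = {0<..T} \<union> {T<..}" using T by auto
  have i0: "set_integrable lborel {0<..T} (running \<epsilon> M v)" using v by (intro running_set_integrable) simp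
  have "set_integrable lborel {T<..} (running \<epsilon> M v) \<longleftrightarrow> set_integrable lborel {0<..} (\<lambda>t. running \<epsilon> M v (t + T))"
    by (rule set_integral_shift(4))
  also have "\<dots> \<longleftrightarrow> set_integrable lborel {0<..} (\<lambda>t. exp (- \<epsilon> * T) * ?r t)"
    by (intro set_integrable_cong refl) (simp add: running_tail[OF v T])
  also have "\<dots> \<longleftrightarrow> set_integrable lborel {0<..} ?r" by simp
  finally have tail: "set_integrable lborel {T<..} (running \<epsilon> M v) \<longleftrightarrow> set_integrable lborel {0<..} ?r" .
  have "set_integrable lborel {0<..} (running \<epsilon> M v) \<longleftrightarrow> set_integrable lborel {T<..} (running \<epsilon> M v)"
  proof
    assume "set_integrable lborel {0<..} (running \<epsilon> M v)"
    then show "set_integrable lborel {T<..} (running \<epsilon> M v)"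
      by (rule set_integrable_subset) (use T in auto)
  next
    assume "set_integrable lborel {T<..} (running \<epsilon> M v)"
    then show "set_integrable lborel {0<..} (running \<epsilon> M v)"
      unfolding U by (intro set_integrable_Un i0) auto
  qed
  with tail show "set_integrable lborel {0<..} (running \<epsilon> M v) \<longleftrightarrow> set_integrable lborel {0<..} ?r" by simp
  assume i: "set_integrable lborel {0<..} (running \<epsilon> M v)"
  have iT: "set_integrable lborel {T<..} (running \<epsilon> M v)"
    by (rule set_integrable_subset[OF i]) (use T in auto)
  have "(LINT t:{0<..}|lborel. running \<epsilon> M v t) = (LINT t:{0<..T}|lborel. running \<epsilon> M v t) + (LINT t:{T<..}|lborel. running \<epsilon> M v t)"
    unfolding U by (rule set_integral_Un[OF _ i0 iT]) auto
  also have "(LINT t:{T<..}|lborel. running \<epsilon> M v t) = (LINT t:{0<..}|lborel. running \<epsilon> M v (t + T))"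
    by (rule set_integral_shift(2))
  also have "\<dots> = (LINT t:{0<..}|lborel. exp (- \<epsilon> * T) * ?r t)"
    by (intro set_lebesgue_integral_cong) (auto simp: running_tail[OF v T])
  also have "\<dots> = exp (- \<epsilon> * T) * (LINT t:{0<..}|lborel. ?r t)" by simp
  finally show "(LINT t:{0<..}|lborel. running \<epsilon> M v t) = (LINT t:{0<..T}|lborel. running \<epsilon> M v t)
        + exp (- \<epsilon> * T) * (LINT t:{0<..}|lborel. ?r t)" .
qed

text \<open>Cut a near-optimal curve at time \<open>T\<close>; its tail competes in the value at its point at time \<open>T\<close>.\<close>

theorem disc_dpp_near:
  assumes \<epsilon>: "\<epsilon> > 0" and T: "T > 0" and \<delta>: "\<delta> > 0"
  shows "\<exists>v. L2_on T v \<and> (LINT t:{0<..T}|lborel. running \<epsilon> M v t)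
      + exp (- \<epsilon> * T) * disc_value \<epsilon> (M + primitive v T) \<le> disc_value \<epsilon> M + \<delta>"
proof -
  obtain v where v: "\<forall>T. L2_on T v" and i: "set_integrable lborel {0<..} (running \<epsilon> M v)"
    and le: "(LINT t:{0<..}|lborel. running \<epsilon> M v t) \<le> disc_value \<epsilon> M + \<delta>"
    using disc_value_near[OF \<epsilon> \<delta>, of M] by (elim exE conjE)
  have T0: "T \<ge> 0" using T by simp
  have tail: "\<forall>S. L2_on S (\<lambda>t. v (t + T))" using L2_on_shift[OF v T0] by blast
  have "disc_value \<epsilon> (M + primitive v T) \<le> (LINT t:{0<..}|lborel. running \<epsilon> (M + primitive v T) (\<lambda>t. v (t + T)) t)"
    using i running_split(1)[OF v T0] by (intro disc_value_le[OF \<epsilon> tail]) simp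
  then have "exp (- \<epsilon> * T) * disc_value \<epsilon> (M + primitive v T)
     \<le> exp (- \<epsilon> * T) * (LINT t:{0<..}|lborel. running \<epsilon> (M + primitive v T) (\<lambda>t. v (t + T)) t)"
    by (rule mult_left_mono) simp
  then have "(LINT t:{0<..T}|lborel. running \<epsilon> M v t) + exp (- \<epsilon> * T) * disc_value \<epsilon> (M + primitive v T) \<le> disc_value \<epsilon> M + \<delta>"
    using le running_split(2)[OF v T0 i] by linarith
  with v show ?thesis by blast
qed

text \<open>Continue the given curve after time \<open>T\<close> by a near-optimal curve from its end point.\<close>

theorem disc_dpp_le:
  assumes \<epsilon>: "\<epsilon> > 0" and T: "T > 0" and v: "L2_on T v"
  shows "disc_value \<epsilon> M \<le> (LINT t:{0<..T}|lborel. running \<epsilon> M v t)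
      + exp (- \<epsilon> * T) * disc_value \<epsilon> (M + primitive v T)"
proof (rule field_le_epsilon)
  fix \<delta> :: real assume \<delta>: "\<delta> > 0"
  define y where "y = M + primitive v T"
  obtain z where z: "\<forall>T. L2_on T z" and i: "set_integrable lborel {0<..} (running \<epsilon> y z)"
    and le: "(LINT t:{0<..}|lborel. running \<epsilon> y z t) \<le> disc_value \<epsilon> y + \<delta>"
    using disc_value_near[OF \<epsilon> \<delta>, of y] by (elim exE conjE)
  have [measurable]: "v \<in> borel_measurable borel" "z \<in> borel_measurable borel"
    using v z by (auto simp: L2_on_def)
  define u where "u t = (if t \<le> T then v t else z (t - T))" for t
  have um[measurable]: "u \<in> borel_measurable borel" unfolding u_def by measurable
  have T0: "T \<ge> 0" using T by simp
  have uv: "u t = v t" if "t \<le> T" for t using that by (simp add: u_def)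
  have uz: "u (t + T) = z t" if "t > 0" for t using that by (simp add: u_def)
  have uT: "L2_on T u"
  proof -
    have "set_integrable lborel {0<..T} (\<lambda>t. (norm (u t))\<^sup>2) = set_integrable lborel {0<..T} (\<lambda>t. (norm (v t))\<^sup>2)"
      by (intro set_integrable_cong refl) (simp add: uv)
    then show ?thesis using v um by (simp add: L2_on_def)
  qed
  have utail: "\<forall>S. L2_on S (\<lambda>t. u (t + T))"
  proof
    fix S
    have "set_integrable lborel {0<..S} (\<lambda>t. (norm (u (t + T)))\<^sup>2) = set_integrable lborel {0<..S} (\<lambda>t. (norm (z t))\<^sup>2)"
      by (intro set_integrable_cong refl) (simp add: uz)
    moreover have "(\<lambda>t. u (t + T)) \<in> borel_measurable borel" by measurable
    ultimately show "L2_on S (\<lambda>t. u (t + T))" using z by (simp add: L2_on_def)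
  qed
  have uL: "\<forall>S. L2_on S u" using L2_on_concat[OF T0 uT utail] by blast
  have pv: "primitive u t = primitive v t" if "t \<le> T" for t
    by (rule primitive_cong) (use that in \<open>simp add: uv\<close>)
  have pz: "primitive (\<lambda>t. u (t + T)) t = primitive z t" for t
    by (rule primitive_cong) (simp add: uz)
  have rz: "running \<epsilon> (M + primitive u T) (\<lambda>t. u (t + T)) t = running \<epsilon> y z t" if "t > 0" for t
    using that by (simp add: running_def pz uz pv y_def)
  have rv: "running \<epsilon> M u t = running \<epsilon> M v t" if "t \<le> T" for t
    using that by (simp add: running_def pv uv)
  have "set_integrable lborel {0<..} (running \<epsilon> (M + primitive u T) (\<lambda>t. u (t + T))) = set_integrable lborel {0<..} (running \<epsilon> y z)"
    by (intro set_integrable_cong refl) (simp add: rz)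
  then have iu: "set_integrable lborel {0<..} (running \<epsilon> M u)"
    using i running_split(1)[OF uL T0] by simp
  have "disc_value \<epsilon> M \<le> (LINT t:{0<..}|lborel. running \<epsilon> M u t)"
    by (rule disc_value_le[OF \<epsilon> uL iu])
  also have "\<dots> = (LINT t:{0<..T}|lborel. running \<epsilon> M u t)
        + exp (- \<epsilon> * T) * (LINT t:{0<..}|lborel. running \<epsilon> (M + primitive u T) (\<lambda>t. u (t + T)) t)"
    by (rule running_split(2)[OF uL T0 iu])
  also have "(LINT t:{0<..T}|lborel. running \<epsilon> M u t) = (LINT t:{0<..T}|lborel. running \<epsilon> M v t)"
    by (intro set_lebesgue_integral_cong) (auto simp: rv)
  also have "(LINT t:{0<..}|lborel. running \<epsilon> (M + primitive u T) (\<lambda>t. u (t + T)) t) = (LINT t:{0<..}|lborel. running \<epsilon> y z t)"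
    by (intro set_lebesgue_integral_cong) (auto simp: rz)
  finally have "disc_value \<epsilon> M \<le> (LINT t:{0<..T}|lborel. running \<epsilon> M v t) + exp (- \<epsilon> * T) * (LINT t:{0<..}|lborel. running \<epsilon> y z t)" .
  moreover have "exp (- \<epsilon> * T) * (LINT t:{0<..}|lborel. running \<epsilon> y z t) \<le> exp (- \<epsilon> * T) * (disc_value \<epsilon> y + \<delta>)"
    using le by (rule mult_left_mono) simp
  moreover have "exp (- \<epsilon> * T) * \<delta> \<le> 1 * \<delta>"
    using \<epsilon> T \<delta> by (intro mult_right_mono) auto
  ultimately show "disc_value \<epsilon> M \<le> (LINT t:{0<..T}|lborel. running \<epsilon> M v t) + exp (- \<epsilon> * T) * disc_value \<epsilon> (M + primitive v T) + \<delta>"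
    unfolding y_def by (simp add: distrib_left)
qed

end

section \<open>The vanishing discount limit\<close>

lemma set_integral_Ioo_Ioc:
  fixes f :: "real \<Rightarrow> 'a::{banach, second_countable_topology}"
  assumes [measurable]: "f \<in> borel_measurable borel"
  shows "(LINT u:{s<..<t}|lborel. f u) = (LINT u:{s<..t}|lborel. f u)"
  unfolding set_lebesgue_integral_def
proof (rule integral_cong_AE)
  show "AE u in lborel. indicator {s<..<t} u *\<^sub>R f u = indicator {s<..t} u *\<^sub>R f u"
    using AE_lborel_singleton[of t] by eventually_elim (auto simp: indicator_def)
qed measurable

context lagrangian begin

lemma bolza_cost_eq:
  assumes T: "T > 0" and v: "L2_on T v" and x: "\<And>t. 0 < t \<Longrightarrow> t < T \<Longrightarrow> x t = M + primitive v t"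
  shows "ext_integral {0<..<T} (\<lambda>s. \<Lambda> (x s) (vector_derivative x (at s)) + h) + ereal (U (Lim (at_left T) x))
    = ereal (action T M v + T * h + U (M + primitive v T))"
proof -
  let ?g = "\<lambda>t. \<Lambda> (M + primitive v t) (v t) + h"
  have gm: "?g \<in> borel_measurable borel"
    by (intro borel_measurable_add borel_measurable_compose(1) path_measurable[OF v] borel_measurable_const)
  have gi: "set_integrable lborel {0<..T} ?g"
    by (intro set_integral_add(1) set_integrable_Lambda[OF v] set_integrable_const_Ioc)
  then have gi': "set_integrable lborel {0<..<T} ?g"
    by (rule set_integrable_subset) auto
  have "ext_integral {0<..<T} (\<lambda>s. \<Lambda> (x s) (vector_derivative x (at s)) + h) = ext_integral {0<..<T} ?g"
  proof (rule ext_integral_cong_AE)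
    have "AE t in lborel. t \<in> {0<..<T} \<longrightarrow> vector_derivative x (at t) = v t"
      by (rule AE_vector_derivative_primitive[OF v x])
    then show "AE t in lborel. t \<in> {0<..<T} \<longrightarrow> \<Lambda> (x t) (vector_derivative x (at t)) + h = ?g t"
      by eventually_elim (simp add: x)
  qed
  also have "\<dots> = ereal (LINT t:{0<..<T}|lborel. ?g t)" by (rule ext_integral_integrable[OF gi'])
  also have "(LINT t:{0<..<T}|lborel. ?g t) = (LINT t:{0<..T}|lborel. ?g t)"
    by (rule set_integral_Ioo_Ioc[OF gm])
  also have "\<dots> = action T M v + T * h"
    unfolding action_def using T
    by (simp add: set_integral_add set_integrable_Lambda[OF v] set_integrable_const_Ioc set_integral_const_Ioc)
  finally show ?thesis by (simp add: primitive_Lim_left[OF T v x])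
qed

text \<open>On \<open>(0, T]\<close> the discount factor lies between \<open>exp (- \<epsilon> T)\<close> and \<open>1\<close>. As \<open>\<Lambda>\<close> may be
  negative, these bounds are applied to \<open>\<Lambda> + A \<ge> 0\<close>. In the second estimate the action is bounded by the
  discounted cost and not conversely, so that it applies to velocity fields that depend on \<open>\<epsilon>\<close>.\<close>

lemma running_action_compare:
  assumes \<epsilon>: "\<epsilon> > 0" and T: "T > 0" and v: "L2_on T v"
  shows "(LINT t:{0<..T}|lborel. running \<epsilon> M v t) \<le> action T M v + T * (A * (1 - exp (- \<epsilon> * T)))"
    and "action T M v \<le> exp (\<epsilon> * T) * (LINT t:{0<..T}|lborel. running \<epsilon> M v t) + T * (A * (exp (\<epsilon> * T) - 1))"
proof -
  have iL: "set_integrable lborel {0<..T} (\<lambda>t. \<Lambda> (M + primitive v t) (v t))" by (rule set_integrable_Lambda[OF v])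
  have iR: "set_integrable lborel {0<..T} (running \<epsilon> M v)" by (rule running_set_integrable[OF v])
  have pos: "0 \<le> \<Lambda> (M + primitive v t) (v t) + A" for t using Lambda_lower[of "M + primitive v t" "v t"] by simp
  have "(LINT t:{0<..T}|lborel. running \<epsilon> M v t) \<le> (LINT t:{0<..T}|lborel. \<Lambda> (M + primitive v t) (v t) + A * (1 - exp (- \<epsilon> * T)))"
  proof (rule set_integral_mono[OF iR set_integral_add(1)[OF iL set_integrable_const_Ioc]])
    fix t assume "t \<in> {0<..T}"
    then have t: "0 < t" "t \<le> T" by auto
    have e: "exp (- \<epsilon> * t) \<le> 1" "exp (- \<epsilon> * T) \<le> exp (- \<epsilon> * t)" using \<epsilon> t by auto
    have "exp (- \<epsilon> * t) * (\<Lambda> (M + primitive v t) (v t) + A) \<le> 1 * (\<Lambda> (M + primitive v t) (v t) + A)"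
      using e pos by (intro mult_right_mono)
    moreover have "exp (- \<epsilon> * T) * A \<le> exp (- \<epsilon> * t) * A" using e A by (intro mult_right_mono)
    ultimately show "running \<epsilon> M v t \<le> \<Lambda> (M + primitive v t) (v t) + A * (1 - exp (- \<epsilon> * T))"
      by (simp add: running_def algebra_simps)
  qed
  also have "\<dots> = action T M v + T * (A * (1 - exp (- \<epsilon> * T)))"
    unfolding action_def using T set_integral_const_Ioc[of T "A * (1 - exp (- \<epsilon> * T))"]
    by (simp only: set_integral_add(2)[OF iL set_integrable_const_Ioc])
  finally show "(LINT t:{0<..T}|lborel. running \<epsilon> M v t) \<le> action T M v + T * (A * (1 - exp (- \<epsilon> * T)))" .
  have "action T M v \<le> (LINT t:{0<..T}|lborel. exp (\<epsilon> * T) * running \<epsilon> M v t + A * (exp (\<epsilon> * T) - 1))"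
    unfolding action_def
  proof (rule set_integral_mono[OF iL set_integral_add(1)[OF set_integrable_mult_right[OF iR] set_integrable_const_Ioc]])
    fix t assume "t \<in> {0<..T}"
    then have t: "0 < t" "t \<le> T" by auto
    have e: "1 \<le> exp (\<epsilon> * T) * exp (- \<epsilon> * t)" "exp (\<epsilon> * T) * exp (- \<epsilon> * t) \<le> exp (\<epsilon> * T)"
      using \<epsilon> t by (auto simp flip: exp_add)
    have "1 * (\<Lambda> (M + primitive v t) (v t) + A) \<le> (exp (\<epsilon> * T) * exp (- \<epsilon> * t)) * (\<Lambda> (M + primitive v t) (v t) + A)"
      using e pos by (intro mult_right_mono)
    moreover have "(exp (\<epsilon> * T) * exp (- \<epsilon> * t)) * A \<le> exp (\<epsilon> * T) * A" using e A by (intro mult_right_mono)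
    ultimately show "\<Lambda> (M + primitive v t) (v t) \<le> exp (\<epsilon> * T) * running \<epsilon> M v t + A * (exp (\<epsilon> * T) - 1)"
      by (simp add: running_def algebra_simps)
  qed
  also have "\<dots> = exp (\<epsilon> * T) * (LINT t:{0<..T}|lborel. running \<epsilon> M v t) + T * (A * (exp (\<epsilon> * T) - 1))"
    using T set_integral_const_Ioc[of T "A * (exp (\<epsilon> * T) - 1)"]
    by (simp only: set_integral_add(2)[OF set_integrable_mult_right[OF iR] set_integrable_const_Ioc] set_integral_mult_right)
  finally show "action T M v \<le> exp (\<epsilon> * T) * (LINT t:{0<..T}|lborel. running \<epsilon> M v t) + T * (A * (exp (\<epsilon> * T) - 1))" .
qed

lemma extremal_with_momentum:
  obtains x w where "x 0 = M" "w 0 = \<Psi> M (- P)"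
    "\<forall>t\<ge>0. (x has_vector_derivative w t) (at t within {0..})"
    "\<forall>t\<ge>0. ((\<lambda>s. q (x s) (w s)) has_vector_derivative p (x t) (w t)) (at t within {0..})"
    "continuous_on UNIV w" "\<forall>t\<ge>0. x t = M + primitive w t"
    "\<forall>t\<ge>0. residual M P w t = 0"
proof (rule Euler_Lagrange_solution[of M "- P"])
  fix x w
  assume x0: "x 0 = M" and q0: "q (x 0) (w 0) = - P"
    and dx: "\<And>t. t \<ge> 0 \<Longrightarrow> (x has_vector_derivative w t) (at t within {0..})"
    and dq: "\<And>t. t \<ge> 0 \<Longrightarrow> ((\<lambda>s. q (x s) (w s)) has_vector_derivative p (x t) (w t)) (at t within {0..})"
    and xc: "continuous_on UNIV x" and wc: "continuous_on UNIV w"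
  have xp: "x t = M + primitive w t" if "t \<ge> 0" for t
    using primitive_of_derivative[OF wc dx that] x0 by simp
  have qp: "q (x t) (w t) = - P + primitive (\<lambda>s. p (x s) (w s)) t" if "t \<ge> 0" for t
    using primitive_of_derivative[OF continuous_compose(2)[OF xc wc] dq that] q0 by simp
  have res: "residual M P w t = 0" if t: "t \<ge> 0" for t
  proof -
    have "primitive (\<lambda>s. p (M + primitive w s) (w s)) t = primitive (\<lambda>s. p (x s) (w s)) t"
      by (rule primitive_cong) (simp add: xp)
    then show ?thesis using qp[OF t] by (simp add: residual_def flip: xp[OF t])
  qed
  have "norm (w 0 - \<Psi> M (- P)) \<le> 0"
    using velocity_stability[of "w 0" "\<Psi> M (- P)" M M] q0 x0 by simp
  then have "w 0 = \<Psi> M (- P)" by simp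
  then show thesis
    using x0 dx dq wc xp res by (intro that[of x w]) auto
qed

end

text \<open>With \<open>u j = disc_value (\<epsilon> j) - m j\<close>, the discounted principle reads
  \<open>u j M = inf (\<integral> running + exp (- \<epsilon> j T) u j (x T) - (1 - exp (- \<epsilon> j T)) m j)\<close>. Since \<open>\<epsilon> j m j\<close> tends to
  \<open>- h\<close>, the last term tends to \<open>T h\<close>. For the upper bound one \<open>v\<close> is fixed and pointwise convergence
  suffices; in the lower bound the end point of the near-optimal curve varies with \<open>j\<close>, and uniform
  convergence of \<open>u j\<close> is used.\<close>

theorem (in bounded_at_rest) vanishing_discount:
  fixes \<epsilon> m :: "nat \<Rightarrow> real"
  assumes pos: "\<And>j. \<epsilon> j > 0" and eps: "\<epsilon> \<longlonglongrightarrow> 0"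
    and H: "uniform_limit UNIV (\<lambda>j M. \<epsilon> j * disc_value (\<epsilon> j) M) (\<lambda>M. - h) sequentially"
    and Ul: "uniform_limit UNIV (\<lambda>j M. disc_value (\<epsilon> j) M - m j) U sequentially"
    and l: "l \<ge> 0" and Lip: "\<And>x y. \<bar>U x - U y\<bar> \<le> l * norm (x - y)"
  shows "weak_KAM \<Lambda> p q K \<gamma> \<alpha> A B U h l"
proof -
  define u where "u j M = disc_value (\<epsilon> j) M - m j" for j M
  have u: "(\<lambda>j. u j M) \<longlonglongrightarrow> U M" for M
    unfolding u_def by (rule tendsto_uniform_limitI[OF Ul]) simp
  have em: "(\<lambda>j. \<epsilon> j * m j) \<longlonglongrightarrow> - h"
  proof -
    have "(\<lambda>j. \<epsilon> j * disc_value (\<epsilon> j) 0) \<longlonglongrightarrow> - h"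
      by (rule tendsto_uniform_limitI[OF H]) simp
    then have "(\<lambda>j. \<epsilon> j * disc_value (\<epsilon> j) 0 - \<epsilon> j * u j 0) \<longlonglongrightarrow> - h - 0 * U 0"
      by (intro tendsto_intros eps u)
    then show ?thesis by (simp add: u_def algebra_simps)
  qed
  have ceq: "(\<lambda>j. (1 - exp (- \<epsilon> j * T)) * m j) \<longlonglongrightarrow> - (T * h)" if T: "T > 0" for T
  proof -
    have z0: "(\<lambda>j. - \<epsilon> j * T) \<longlonglongrightarrow> 0" using tendsto_mult[OF tendsto_minus[OF eps] tendsto_const[of T]] by simp
    have "filterlim (\<lambda>j. - \<epsilon> j * T) (at 0) sequentially"
      unfolding filterlim_at using z0 pos T by (auto intro!: always_eventually simp: less_imp_neq[symmetric] dest: less_imp_neq)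
    then have "(\<lambda>j. (exp (- \<epsilon> j * T) - 1) / (- \<epsilon> j * T)) \<longlonglongrightarrow> 1"
      by (rule filterlim_compose[OF lim_exp_minus_1])
    then have "(\<lambda>j. (exp (- \<epsilon> j * T) - 1) / (- \<epsilon> j * T) * (T * (\<epsilon> j * m j))) \<longlonglongrightarrow> 1 * (T * (- h))"
      by (intro tendsto_intros em)
    moreover have "(exp (- \<epsilon> j * T) - 1) / (- \<epsilon> j * T) * (T * (\<epsilon> j * m j)) = (1 - exp (- \<epsilon> j * T)) * m j" for j
      using pos[of j] T by (simp add: field_simps)
    ultimately show ?thesis by simp
  qed
  have e1: "(\<lambda>j. exp (- \<epsilon> j * T)) \<longlonglongrightarrow> 1" and e2: "(\<lambda>j. exp (\<epsilon> j * T)) \<longlonglongrightarrow> 1" for T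
  proof -
    have "(\<lambda>j. exp (- \<epsilon> j * T)) \<longlonglongrightarrow> exp (- 0 * T)" "(\<lambda>j. exp (\<epsilon> j * T)) \<longlonglongrightarrow> exp (0 * T)"
      by (intro tendsto_intros eps)+
    then show "(\<lambda>j. exp (- \<epsilon> j * T)) \<longlonglongrightarrow> 1" "(\<lambda>j. exp (\<epsilon> j * T)) \<longlonglongrightarrow> 1" by simp_all
  qed
  have le: "U M \<le> action T M v + T * h + U (M + primitive v T)" if T: "T > 0" and v: "L2_on T v" for T M v
  proof -
    define y where "y = M + primitive v T"
    have pt: "u j M \<le> action T M v + T * (A * (1 - exp (- \<epsilon> j * T))) + exp (- \<epsilon> j * T) * u j y - (1 - exp (- \<epsilon> j * T)) * m j" for j
    proof -
      have "disc_value (\<epsilon> j) M \<le> (LINT t:{0<..T}|lborel. running (\<epsilon> j) M v t) + exp (- \<epsilon> j * T) * disc_value (\<epsilon> j) y"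
        unfolding y_def by (rule disc_dpp_le[OF pos T v])
      also have "disc_value (\<epsilon> j) y = u j y + m j" by (simp add: u_def)
      finally show ?thesis using running_action_compare(1)[OF pos[of j] T v, of M]
        by (simp add: u_def algebra_simps)
    qed
    have "(\<lambda>j. action T M v + T * (A * (1 - exp (- \<epsilon> j * T))) + exp (- \<epsilon> j * T) * u j y - (1 - exp (- \<epsilon> j * T)) * m j)
      \<longlonglongrightarrow> action T M v + T * (A * (1 - 1)) + 1 * U y - (- (T * h))"
      by (intro tendsto_intros e1 u ceq T)
    from LIMSEQ_le[OF u this] pt have "U M \<le> action T M v + T * (A * (1 - 1)) + 1 * U y - (- (T * h))" by blast
    then show ?thesis by (simp add: y_def)
  qed
  have near: "\<exists>v. L2_on T v \<and> action T M v + T * h + U (M + primitive v T) \<le> U M + \<delta>" if T: "T > 0" and \<delta>: "\<delta> > 0" for T \<delta> M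
  proof -
    \<comment> \<open>\<open>r j - u j y\<close> will bound the action of the near-optimal curve for \<open>\<epsilon> j\<close>, where \<open>y\<close> is its end point.\<close>
    define r where "r j = exp (\<epsilon> j * T) * (u j M + \<delta> / 2 + (1 - exp (- \<epsilon> j * T)) * m j) + T * (A * (exp (\<epsilon> j * T) - 1))" for j
    have "r \<longlonglongrightarrow> 1 * (U M + \<delta> / 2 + - (T * h)) + T * (A * (1 - 1))"
      unfolding r_def by (intro tendsto_intros e2 u ceq T)
    then have "r \<longlonglongrightarrow> U M + \<delta> / 2 - T * h" by simp
    then have ev1: "\<forall>\<^sub>F j in sequentially. r j < U M + \<delta> / 2 - T * h + \<delta> / 4"
      by (rule order_tendstoD) (use \<delta> in simp)
    have ev2: "\<forall>\<^sub>F j in sequentially. \<forall>y\<in>UNIV. dist (u j y) (U y) < \<delta> / 4"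
      using uniform_limitD[OF Ul, of "\<delta> / 4"] \<delta> unfolding u_def by simp
    obtain j where j: "r j < U M + \<delta> / 2 - T * h + \<delta> / 4" "\<forall>y\<in>UNIV. dist (u j y) (U y) < \<delta> / 4"
      using eventually_happens'[OF sequentially_bot eventually_conj[OF ev1 ev2]] by blast
    have "\<delta> / 2 > 0" using \<delta> by simp
    from disc_dpp_near[OF pos[of j] T this, of M] obtain v where v: "L2_on T v"
      and vle: "(LINT t:{0<..T}|lborel. running (\<epsilon> j) M v t) + exp (- \<epsilon> j * T) * disc_value (\<epsilon> j) (M + primitive v T) \<le> disc_value (\<epsilon> j) M + \<delta> / 2"
      by blast
    define y where "y = M + primitive v T"
    define I where "I = (LINT t:{0<..T}|lborel. running (\<epsilon> j) M v t)"
    have "I + exp (- \<epsilon> j * T) * (u j y + m j) \<le> (u j M + m j) + \<delta> / 2"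
      using vle unfolding I_def y_def u_def by simp
    then have "I \<le> (u j M + \<delta> / 2 + (1 - exp (- \<epsilon> j * T)) * m j) - exp (- \<epsilon> j * T) * u j y"
      by (simp add: algebra_simps)
    then have "exp (\<epsilon> j * T) * I \<le> exp (\<epsilon> j * T) * ((u j M + \<delta> / 2 + (1 - exp (- \<epsilon> j * T)) * m j) - exp (- \<epsilon> j * T) * u j y)"
      by (rule mult_left_mono) simp
    also have "\<dots> = exp (\<epsilon> j * T) * (u j M + \<delta> / 2 + (1 - exp (- \<epsilon> j * T)) * m j) - u j y"
      by (simp add: right_diff_distrib exp_minus)
    finally have "action T M v \<le> r j - u j y"
      using running_action_compare(2)[OF pos[of j] T v, of M] unfolding I_def[symmetric] r_def by linarith
    moreover have "U y - u j y \<le> \<delta> / 4"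
      using bspec[OF j(2) UNIV_I, of y] unfolding dist_real_def by linarith
    ultimately have "action T M v + T * h + U y \<le> U M + \<delta>" using j(1) by linarith
    with v show ?thesis unfolding y_def by blast
  qed
  show ?thesis
    by (intro weak_KAM.intro lagrangian_axioms weak_KAM_axioms.intro l Lip le near)
qed

section \<open>Calibrated trajectories and the viscosity equation\<close>

lemma velocity_eq:
  fixes x :: "real \<Rightarrow> 'a::real_normed_vector"
  assumes x: "(x has_vector_derivative w) (at t within {0..})" and t: "t \<ge> 0"
  shows "velocity x t = w"
  unfolding velocity_def
proof (rule vector_derivative_within[OF _ x])
  have "at_right t \<le> at t within {0..}" by (rule at_le) (use t in auto)
  then show "at t within {0..} \<noteq> bot"
    using trivial_limit_at_right_real[of t] bot.extremum_uniqueI[of "at_right t"] by auto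
qed

theorem (in weak_KAM) viscosity_inequalities:
  shows "\<zeta> \<in> superdifferential U M \<Longrightarrow> (SUP N. - (\<zeta> \<bullet> N) - \<Lambda> M N) \<le> h"
    and "\<zeta> \<in> subdifferential U M \<Longrightarrow> h \<le> (SUP N. - (\<zeta> \<bullet> N) - \<Lambda> M N)"
  unfolding SUP_Psi by (rule superdifferential_inequality, assumption, rule subdifferential_inequality)

lemma const_L2_inner:
  "const_L2 c \<bullet> N = (LINT z|cube_measure. c \<bullet> rep_L2 N z)"
proof -
  have "const_L2 c \<bullet> N = abs_L2 (\<lambda>z. c) \<bullet> abs_L2 (rep_L2 N)"
    by (simp add: abs_rep_L2 const_L2.abs_eq)
  also have "\<dots> = (LINT z|cube_measure. c \<bullet> rep_L2 N z)"
    by (rule inner_L2.abs_eq) (auto intro: L2_eq_refl square_integrable_const square_integrable_rep_L2)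
  finally show ?thesis .
qed

lemma shifted_lagrangian_eq: "shifted_lagrangian L c M N = L M N + const_L2 c \<bullet> N"
  by (simp add: shifted_lagrangian_def const_L2_inner)

lemma shifted_hamiltonian_eq:
  "shifted_hamiltonian L c M P = (SUP N. - (P \<bullet> N) - shifted_lagrangian L c M N)"
  unfolding shifted_hamiltonian_def hamiltonian_def shifted_lagrangian_eq
  by (intro arg_cong[where f = Sup] image_cong refl) (simp add: inner_add_left)

lemma admissible_lagrangian_bounds:
  fixes L :: "'d::finite L2 \<Rightarrow> 'd L2 \<Rightarrow> real"
  assumes "admissible_lagrangian L"
  shows "\<exists>C>0. \<exists>K>0. \<exists>\<gamma>>0. (\<forall>M N. L M N \<ge> 0)
    \<and> (\<forall>M N. L M N \<le> C * (1 + (norm M)\<^sup>2 + (norm N)\<^sup>2) \<and> \<bar>L M 0\<bar> \<le> C)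
    \<and> (\<forall>M N H1 H2. L (M + H1) (N + H2) - L M N - Dx L M N \<bullet> H1 - Dv L M N \<bullet> H2
            \<ge> \<gamma> * (norm H2)\<^sup>2 - K * (norm H1)\<^sup>2)
    \<and> (\<forall>M N H1 H2. L (M + H1) (N + H2) - L M N - Dx L M N \<bullet> H1 - Dv L M N \<bullet> H2
            \<le> K * (norm H2)\<^sup>2 + K * (norm H1)\<^sup>2)"
  using assms unfolding admissible_lagrangian_def by (elim exE conjE) (intro exI conjI; assumption)

text \<open>Coercivity is a consequence of strong convexity at rest, once the momentum \<open>Dv L M 0\<close> is bounded
  uniformly in \<open>M\<close>. This holds because \<open>L \<ge> 0\<close>: a gradient step from rest decreases \<open>L M 0 \<le> C\<close> by
  \<open>\<parallel>Dv L M 0\<parallel>\<^sup>2 / (4 K)\<close>. The linear shift changes the momentum by a constant.\<close>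

theorem shifted_lagrangian_locale:
  fixes L :: "'d::finite L2 \<Rightarrow> 'd L2 \<Rightarrow> real" and c :: "real ^ 'd"
  assumes "admissible_lagrangian L"
  shows "\<exists>K \<gamma> \<alpha> A B B0. bounded_at_rest (shifted_lagrangian L c)
    (Dx (shifted_lagrangian L c)) (Dv (shifted_lagrangian L c)) K \<gamma> \<alpha> A B B0"
proof -
  obtain C K \<gamma> where C: "C > 0" and K: "K > 0" and \<gamma>: "\<gamma> > 0"
    and nonneg: "\<forall>M N. L M N \<ge> 0"
    and gr: "\<forall>M N. L M N \<le> C * (1 + (norm M)\<^sup>2 + (norm N)\<^sup>2) \<and> \<bar>L M 0\<bar> \<le> C"
    and low: "\<forall>M N H1 H2. L (M + H1) (N + H2) - L M N - Dx L M N \<bullet> H1 - Dv L M N \<bullet> H2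
            \<ge> \<gamma> * (norm H2)\<^sup>2 - K * (norm H1)\<^sup>2"
    and up: "\<forall>M N H1 H2. L (M + H1) (N + H2) - L M N - Dx L M N \<bullet> H1 - Dv L M N \<bullet> H2
            \<le> K * (norm H2)\<^sup>2 + K * (norm H1)\<^sup>2"
    using admissible_lagrangian_bounds[OF assms] by (elim exE conjE)
  define b where "b = const_L2 c"
  define \<Lambda> where "\<Lambda> = shifted_lagrangian L c"
  have \<Lambda>: "\<Lambda> M N = L M N + b \<bullet> N" for M N
    by (simp add: \<Lambda>_def b_def shifted_lagrangian_eq)
  have dx: "Dx \<Lambda> M N = Dx L M N" for M N
    unfolding Dx_def[of \<Lambda>]
  proof (rule GDERIV_imp_grad, rule GDERIV_of_quadratic_remainder)
    fix H :: "'d L2"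
    show "\<bar>\<Lambda> (M + H) N - \<Lambda> M N - Dx L M N \<bullet> H\<bar> \<le> K * (norm H)\<^sup>2"
      using low[rule_format, of 0 H M N] up[rule_format, of M H N 0] by (simp add: \<Lambda> abs_le_iff)
  qed
  have dv: "Dv \<Lambda> M N = Dv L M N + b" for M N
    unfolding Dv_def[of \<Lambda>]
  proof (rule GDERIV_imp_grad, rule GDERIV_of_quadratic_remainder)
    fix H :: "'d L2"
    have "0 \<le> \<gamma> * (norm H)\<^sup>2" "0 \<le> K * (norm H)\<^sup>2" using \<gamma> K by auto
    then show "\<bar>\<Lambda> M (N + H) - \<Lambda> M N - (Dv L M N + b) \<bullet> H\<bar> \<le> K * (norm H)\<^sup>2"
      using low[rule_format, of H 0 M N] up[rule_format, of M 0 N H]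
      by (simp add: \<Lambda> abs_le_iff inner_add_left inner_add_right)
  qed
  define D where "D = sqrt (4 * K * C)"
  have D: "norm (Dv L M 0) \<le> D" for M
  proof -
    define g where "g = Dv L M 0"
    \<comment> \<open>The step length that minimizes the quadratic upper bound.\<close>
    define s where "s = 1 / (2 * K)"
    have "L M (0 + - (s *\<^sub>R g)) - L M 0 - Dv L M 0 \<bullet> (- (s *\<^sub>R g)) \<le> K * (norm (- (s *\<^sub>R g)))\<^sup>2"
      using up[rule_format, of M 0 0 "- (s *\<^sub>R g)"] by simp
    then have "L M (- (s *\<^sub>R g)) \<le> L M 0 - s * (norm g)\<^sup>2 + K * (s\<^sup>2 * (norm g)\<^sup>2)"
      by (simp add: g_def[symmetric] power2_norm_eq_inner[symmetric] power_mult_distrib)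
    moreover have "K * (s\<^sup>2 * (norm g)\<^sup>2) = s * (norm g)\<^sup>2 / 2"
      using K by (simp add: s_def power2_eq_square)
    moreover have "0 \<le> L M (- (s *\<^sub>R g))" using nonneg by simp
    moreover have "L M 0 \<le> C" using gr by (simp add: abs_le_iff)
    ultimately have "s * (norm g)\<^sup>2 \<le> 2 * C" by simp
    then have "(norm g)\<^sup>2 \<le> 4 * K * C" using K by (simp add: s_def field_simps)
    then show ?thesis unfolding D_def g_def by (rule real_le_rsqrt)
  qed
  define E where "E = D + norm b"
  have D0: "D \<ge> 0" using K C by (simp add: D_def)
  have E: "E \<ge> 0" using D0 by (simp add: E_def)
  have "bounded_at_rest \<Lambda> (Dx \<Lambda>) (Dv \<Lambda>) K \<gamma> (\<gamma> / 2) (E\<^sup>2 / (2 * \<gamma>)) (C + norm b) C"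
  proof
    show "K > 0" "\<gamma> > 0" "\<gamma> / 2 > 0" "E\<^sup>2 / (2 * \<gamma>) \<ge> 0" "C + norm b \<ge> 0"
      using K \<gamma> C by auto
    fix x h v k :: "'d L2"
    show "\<gamma> * (norm k)\<^sup>2 - K * (norm h)\<^sup>2 \<le> \<Lambda> (x + h) (v + k) - \<Lambda> x v - Dx \<Lambda> x v \<bullet> h - Dv \<Lambda> x v \<bullet> k"
      using low[rule_format, of k h x v] by (simp add: \<Lambda> dx dv inner_add_left inner_add_right)
    show "\<Lambda> (x + h) (v + k) - \<Lambda> x v - Dx \<Lambda> x v \<bullet> h - Dv \<Lambda> x v \<bullet> k \<le> K * (norm k)\<^sup>2 + K * (norm h)\<^sup>2"
      using up[rule_format, of x h v k] by (simp add: \<Lambda> dx dv inner_add_left inner_add_right)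
    show "\<gamma> / 2 * (norm v)\<^sup>2 - E\<^sup>2 / (2 * \<gamma>) \<le> \<Lambda> x v"
    proof -
      have "\<gamma> * (norm v)\<^sup>2 \<le> L x v - L x 0 - Dv L x 0 \<bullet> v"
        using low[rule_format, of v 0 x 0] by simp
      moreover have "0 \<le> L x 0" using nonneg by simp
      moreover have "\<bar>Dv L x 0 \<bullet> v\<bar> \<le> D * norm v"
        using D[of x] by (intro order_trans[OF Cauchy_Schwarz_ineq2] mult_right_mono) auto
      moreover have "\<bar>b \<bullet> v\<bar> \<le> norm b * norm v" by (rule Cauchy_Schwarz_ineq2)
      ultimately have 1: "\<gamma> * (norm v)\<^sup>2 - E * norm v \<le> \<Lambda> x v"
        unfolding \<Lambda> E_def by (simp add: distrib_right abs_le_iff)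
      have "0 \<le> (\<gamma> * norm v - E)\<^sup>2 / (2 * \<gamma>)" using \<gamma> by simp
      also have "\<dots> = \<gamma> / 2 * (norm v)\<^sup>2 - E * norm v + E\<^sup>2 / (2 * \<gamma>)"
        using \<gamma> by (simp add: power2_diff power_mult_distrib field_simps power2_eq_square)
      finally show ?thesis using 1 by (simp add: field_simps)
    qed
    show "\<Lambda> x v \<le> (C + norm b) * (1 + (norm x)\<^sup>2 + (norm v)\<^sup>2)"
    proof -
      have "L x v \<le> C * (1 + (norm x)\<^sup>2 + (norm v)\<^sup>2)" using gr by simp
      moreover have "b \<bullet> v \<le> norm b * norm v" by (rule norm_cauchy_schwarz)
      moreover have "norm b * norm v \<le> norm b * (1 + (norm x)\<^sup>2 + (norm v)\<^sup>2)"
      proof (rule mult_left_mono)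
        have "0 \<le> (norm v - 1)\<^sup>2" by simp
        then have "2 * norm v \<le> (norm v)\<^sup>2 + 1" by (simp add: power2_diff)
        moreover have "0 \<le> (norm x)\<^sup>2" "0 \<le> norm v" by auto
        ultimately show "norm v \<le> 1 + (norm x)\<^sup>2 + (norm v)\<^sup>2" by linarith
      qed simp
      ultimately show ?thesis unfolding \<Lambda> by (simp add: distrib_right)
    qed
    show "\<Lambda> x 0 \<le> C" using gr by (simp add: \<Lambda> abs_le_iff)
  qed
  then show ?thesis unfolding \<Lambda>_def by blast
qed

context
  fixes \<Lambda> :: "'d::finite L2 \<Rightarrow> 'd L2 \<Rightarrow> real" and p q K \<gamma> \<alpha> A B U h l
  assumes wk: "weak_KAM \<Lambda> p q K \<gamma> \<alpha> A B U h l"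
begin

interpretation weak_KAM \<Lambda> p q K \<gamma> \<alpha> A B U h l by (rule wk)

lemma admissible_bolza:
  assumes T: "T > 0" and x: "x \<in> admissible_curves T M"
  obtains v where "L2_on T v" "\<forall>t. 0 < t \<longrightarrow> t < T \<longrightarrow> x t = M + primitive v t"
    "bolza_cost \<Lambda> h U T x = ereal (action T M v + T * h + U (M + primitive v T))"
proof -
  have x': "x \<in> AC2 T" "(x \<longlongrightarrow> M) (at_right 0)" using x by (auto simp: admissible_curves_def)
  show thesis
  proof (rule AC2_imp_primitive[OF T x'])
    fix v assume v: "L2_on T v" "\<And>t. 0 < t \<Longrightarrow> t < T \<Longrightarrow> x t = M + primitive v t"
    have "bolza_cost \<Lambda> h U T x = ereal (action T M v + T * h + U (M + primitive v T))"
      unfolding bolza_cost_def by (rule bolza_cost_eq[OF T v])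
    moreover have "\<forall>t. 0 < t \<longrightarrow> t < T \<longrightarrow> x t = M + primitive v t" using v(2) by blast
    ultimately show thesis by (intro that[OF v(1)])
  qed
qed

text \<open>The trajectory is the extremal with initial momentum \<open>- P\<close>. Any calibrated trajectory restricts to a
  minimizer on each \<open>[0, T]\<close>, so it agrees with the extremal at positive times; at time zero the two
  agree because both curves tend to \<open>M\<close>.\<close>

theorem calibrated_trajectory_exists:
  assumes P: "GDERIV U M :> P"
  shows "\<exists>x. calibrated_trajectory \<Lambda> h U M x
     \<and> (\<forall>y. calibrated_trajectory \<Lambda> h U M y \<longrightarrow> (\<forall>t\<ge>0. y t = x t))
     \<and> (\<forall>s\<ge>0. ((\<lambda>s. q (x s) (velocity x s)) has_vector_derivative p (x s) (velocity x s)) (at s within {0..}))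
     \<and> x 0 = M \<and> velocity x 0 = \<Psi> M (- P)"
proof -
  obtain x w where x0: "x 0 = M" and w0: "w 0 = \<Psi> M (- P)"
    and dx: "\<forall>t\<ge>0. (x has_vector_derivative w t) (at t within {0..})"
    and dq: "\<forall>t\<ge>0. ((\<lambda>s. q (x s) (w s)) has_vector_derivative p (x t) (w t)) (at t within {0..})"
    and wc: "continuous_on UNIV w" and xp: "\<forall>t\<ge>0. x t = M + primitive w t"
    and res: "\<forall>t\<ge>0. residual M P w t = 0"
    by (rule extremal_with_momentum)
  have vel: "velocity x t = w t" if "t \<ge> 0" for t
    using dx that by (intro velocity_eq) auto
  have wL: "L2_on T w" for T by (rule L2_on_continuous[OF wc])
  have resT: "\<forall>t\<in>{0<..T}. residual M P w t = 0" for T using res by auto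
  have min: "action T M w + T * h + U (M + primitive w T) = U M" if "T > 0" for T
    by (rule Euler_Lagrange_minimizes[OF P that wc resT])
  have adm: "x \<in> admissible_curves T M" if T: "T > 0" for T
    unfolding admissible_curves_def
  proof (intro CollectI conjI)
    have xT: "x t = M + primitive w t" if "0 < t" "t < T" for t
      by (rule xp[rule_format]) (use that in simp)
    show "x \<in> AC2 T" by (rule primitive_imp_AC2[OF wL xT])
    show "(x \<longlongrightarrow> M) (at_right 0)" by (rule primitive_tendsto_right[OF T wL xT])
  qed
  have bx: "bolza_cost \<Lambda> h U T x = ereal (U M)" if T: "T > 0" for T
  proof -
    have xT: "x t = M + primitive w t" if "0 < t" "t < T" for t
      by (rule xp[rule_format]) (use that in simp)
    have "bolza_cost \<Lambda> h U T x = ereal (action T M w + T * h + U (M + primitive w T))"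
      unfolding bolza_cost_def by (rule bolza_cost_eq[OF T wL xT])
    then show ?thesis by (simp only: min[OF T])
  qed
  have by_ge: "ereal (U M) \<le> bolza_cost \<Lambda> h U T y" if T: "T > 0" and y: "y \<in> admissible_curves T M" for T y
  proof (rule admissible_bolza[OF T y])
    fix v assume v: "L2_on T v" and b: "bolza_cost \<Lambda> h U T y = ereal (action T M v + T * h + U (M + primitive v T))"
    show ?thesis unfolding b using dpp_le[OF T v, of M] by simp
  qed
  have C1: "x \<in> C1_half_line"
    unfolding C1_half_line_def
  proof (intro CollectI conjI allI impI)
    fix t :: real assume "t \<ge> 0"
    then show "x differentiable (at t within {0..})"
      using dx by (auto intro: differentiableI_vector)
  next
    have "continuous_on {0..} w" by (rule continuous_on_subset[OF wc]) simp
    then show "continuous_on {0..} (velocity x)"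
      by (subst continuous_on_cong[OF refl]) (use vel in auto)
  qed
  have cal: "calibrated_trajectory \<Lambda> h U M x"
    unfolding calibrated_trajectory_def
  proof (intro conjI allI impI C1)
    fix T :: real assume T: "T > 0"
    show "x \<in> admissible_curves T M" by (rule adm[OF T])
    show "bolza_cost \<Lambda> h U T x = ereal (U M)" by (rule bx[OF T])
    show "ereal (U M) = (INF y\<in>admissible_curves T M. bolza_cost \<Lambda> h U T y)"
    proof (rule antisym)
      show "ereal (U M) \<le> (INF y\<in>admissible_curves T M. bolza_cost \<Lambda> h U T y)"
        by (rule INF_greatest) (rule by_ge[OF T])
      show "(INF y\<in>admissible_curves T M. bolza_cost \<Lambda> h U T y) \<le> ereal (U M)"
        using INF_lower[OF adm[OF T], of "bolza_cost \<Lambda> h U T"] bx[OF T] by simp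
    qed
  qed
  have uniq: "y t = x t" if y: "calibrated_trajectory \<Lambda> h U M y" and t: "t \<ge> 0" for y t
  proof (cases "t = 0")
    case True
    have yC: "y \<in> C1_half_line" using y by (simp add: calibrated_trajectory_def)
    then have "y differentiable (at 0 within {0..})" by (simp add: C1_half_line_def)
    then have "continuous (at 0 within {0..}) y" by (rule differentiable_imp_continuous_within)
    then have "(y \<longlongrightarrow> y 0) (at 0 within {0..})" by (simp add: continuous_within)
    then have "(y \<longlongrightarrow> y 0) (at_right 0)" by (rule tendsto_within_subset) auto
    moreover have "(y \<longlongrightarrow> M) (at_right 0)"
    proof -
      have "y \<in> admissible_curves 1 M"
        using y zero_less_one[where 'a = real] unfolding calibrated_trajectory_def by blast
      then show ?thesis by (simp add: admissible_curves_def)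
    qed
    ultimately have "y 0 = M" by (rule tendsto_unique[OF trivial_limit_at_right_real])
    then show ?thesis using True x0 by simp
  next
    case False
    define T where "T = t + 1"
    have T: "T > 0" "t < T" "t > 0" using t False by (auto simp: T_def)
    have ya: "y \<in> admissible_curves T M" and yb: "bolza_cost \<Lambda> h U T y = ereal (U M)"
      using y T(1) unfolding calibrated_trajectory_def by blast+
    show ?thesis
    proof (rule admissible_bolza[OF T(1) ya])
      fix v assume v: "L2_on T v" and yp: "\<forall>t. 0 < t \<longrightarrow> t < T \<longrightarrow> y t = M + primitive v t"
        and b: "bolza_cost \<Lambda> h U T y = ereal (action T M v + T * h + U (M + primitive v T))"
      have "action T M v + T * h + U (M + primitive v T) \<le> U M" using b yb by simp
      then have "primitive v t = primitive w t"
        using T by (intro minimizer_unique[OF P T(1) wL resT v]) auto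
      moreover have "y t = M + primitive v t" using yp T by blast
      moreover have "x t = M + primitive w t" using xp t by blast
      ultimately show "y t = x t" by simp
    qed
  qed
  have EL: "((\<lambda>s. q (x s) (velocity x s)) has_vector_derivative p (x s) (velocity x s)) (at s within {0..})" if s: "s \<ge> 0" for s
  proof -
    have "((\<lambda>s. q (x s) (w s)) has_vector_derivative p (x s) (w s)) (at s within {0..})" using dq s by blast
    then have "((\<lambda>s. q (x s) (velocity x s)) has_vector_derivative p (x s) (w s)) (at s within {0..})"
      by (rule has_vector_derivative_transform[rotated 2]) (use s vel in auto)
    then show ?thesis using vel[OF s] by simp
  qed
  have "velocity x 0 = \<Psi> M (- P)" using vel[of 0] w0 by simp
  then show ?thesis
    using cal uniq EL x0 by (intro exI[of _ x] conjI allI impI)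
qed

end

theorem theorem1p2:
  fixes L :: "'d::finite L2 \<Rightarrow> 'd L2 \<Rightarrow> real"
    and c :: "real ^ 'd"
    and \<epsilon> :: "nat \<Rightarrow> real"
    and U :: "'d L2 \<Rightarrow> real"
    and Hbar :: real
  assumes lagrangian: "admissible_lagrangian L"
    and eps_pos: "\<And>j. \<epsilon> j > 0"
    and eps_lim: "\<epsilon> \<longlonglongrightarrow> 0"
    and Hbar_lim: "uniform_limit UNIV
          (\<lambda>j M. \<epsilon> j * discounted_value (shifted_lagrangian L c) (\<epsilon> j) M) (\<lambda>M. - Hbar) sequentially"
    and U_lim: "uniform_limit UNIV
          (\<lambda>j M. discounted_value (shifted_lagrangian L c) (\<epsilon> j) M
               - (INF N. discounted_value (shifted_lagrangian L c) (\<epsilon> j) N)) U sequentially"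
    and U_lipschitz: "\<exists>K. K-lipschitz_on UNIV U"
  shows "viscosity_solution (\<lambda>M r \<zeta>. shifted_hamiltonian L c M \<zeta> - Hbar) U
    \<and> (\<forall>M. U differentiable (at M) \<longrightarrow>
        (\<exists>x. calibrated_trajectory (shifted_lagrangian L c) Hbar U M x
           \<and> (\<forall>y. calibrated_trajectory (shifted_lagrangian L c) Hbar U M y
                  \<longrightarrow> (\<forall>t\<ge>0. y t = x t))
           \<and> (\<forall>s\<ge>0. ((\<lambda>s. Dv (shifted_lagrangian L c) (x s) (velocity x s))
                 has_vector_derivative Dx (shifted_lagrangian L c) (x s) (velocity x s))
                 (at s within {0..}))
           \<and> x 0 = M
           \<and> velocity x 0 = - grad (shifted_hamiltonian L c M) (grad U M)))"
proof -
  let ?\<Lambda> = "shifted_lagrangian L c"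
  obtain K \<gamma> \<alpha> A B B0 where bar: "bounded_at_rest ?\<Lambda> (Dx ?\<Lambda>) (Dv ?\<Lambda>) K \<gamma> \<alpha> A B B0"
    using shifted_lagrangian_locale[OF lagrangian, of c] by (elim exE)
  interpret bounded_at_rest ?\<Lambda> "Dx ?\<Lambda>" "Dv ?\<Lambda>" K \<gamma> \<alpha> A B B0 by (rule bar)
  have dv: "discounted_value ?\<Lambda> e M = disc_value e M" for e M
    unfolding discounted_value_def disc_value_def ..
  obtain l where l: "l-lipschitz_on UNIV U" using U_lipschitz by blast
  have l0: "l \<ge> 0" using l by (rule lipschitz_on_nonneg)
  have lip: "\<bar>U x - U y\<bar> \<le> l * norm (x - y)" for x y
    using lipschitz_onD[OF l, of x y] by (simp add: dist_norm)
  have wk: "weak_KAM ?\<Lambda> (Dx ?\<Lambda>) (Dv ?\<Lambda>) K \<gamma> \<alpha> A B U Hbar l"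
    by (rule vanishing_discount[OF eps_pos eps_lim Hbar_lim[unfolded dv] U_lim[unfolded dv] l0 lip])
  interpret W: weak_KAM ?\<Lambda> "Dx ?\<Lambda>" "Dv ?\<Lambda>" K \<gamma> \<alpha> A B U Hbar l by (rule wk)
  have "continuous_on UNIV U" using l by (rule lipschitz_on_continuous_on)
  then have visc: "viscosity_solution (\<lambda>M r \<zeta>. shifted_hamiltonian L c M \<zeta> - Hbar) U"
    unfolding viscosity_solution_def shifted_hamiltonian_eq
    using W.viscosity_inequalities by simp
  have "\<exists>x. calibrated_trajectory ?\<Lambda> Hbar U M x
           \<and> (\<forall>y. calibrated_trajectory ?\<Lambda> Hbar U M y \<longrightarrow> (\<forall>t\<ge>0. y t = x t))
           \<and> (\<forall>s\<ge>0. ((\<lambda>s. Dv ?\<Lambda> (x s) (velocity x s)) has_vector_derivative Dx ?\<Lambda> (x s) (velocity x s)) (at s within {0..}))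
           \<and> x 0 = M
           \<and> velocity x 0 = - grad (shifted_hamiltonian L c M) (grad U M)" if "U differentiable (at M)" for M
  proof -
    have "shifted_hamiltonian L c M = (\<lambda>P. SUP N. - (P \<bullet> N) - ?\<Lambda> M N)"
      by (rule ext) (rule shifted_hamiltonian_eq)
    then have "- grad (shifted_hamiltonian L c M) (grad U M) = \<Psi> M (- grad U M)"
      by (simp add: grad_Legendre)
    then show ?thesis
      using calibrated_trajectory_exists[OF wk differentiable_imp_GDERIV[OF that]] by simp
  qed
  with visc show ?thesis by blast
qed

end
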